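(* Let $F$ be a self-dual QP-generated full vertex operator algebra, with a fixed non-degenerate invariant bilinear form $(-,-)$, and let $S:F^{\otimes 4}\to \mathrm{Cor}_4$ be the linear map determined by $$e_{1(2(3(4\star)))}\bigl(S(a_1,a_2,a_3,a_4)\bigr)=(\mathbf 1,Y(a_1,\underline z_1)Y(a_2,\underline z_2)Y(a_3,\underline z_3)Y(a_4,\underline z_4)\mathbf 1).$$ Then for all $a_1,a_2,a_3,a_4\in F$ and $\sigma\in S_4$, $$\sigma\cdot S(a_1,a_2,a_3,a_4)=S(a_{\sigma^{-1}1},a_{\sigma^{-1}2},a_{\sigma^{-1}3},a_{\sigma^{-1}4}).$$
   Context: **Conventions.** $z,\bar z$ are independent formal variables, $\underline z=(z,\bar z)$, and $|z|$ stands for $z\bar z$ in exponents, so $|z|^r=z^r\bar z^r$. For a vector space $V$, $V[[z,\bar z,|z|^{\mathbb R}]]$ is the set of formal sums $\sum_{r,s\in\mathbb R}a_{r,s}z^r\bar z^s$ with countable support and $a_{r,s}=0$ unless $r-s\in\mathbb Z$; $V((z,\bar z,|z|^{\mathbb R}))$ is the subspace of those for which there is $N$ with $a_{r,s}=0$ unless $r,s\ge N$. **Function spaces.** $F_{0,1,\infty}$ is the space of real analytic functions $f:\mathbb CP^1\setminus\{0,1,\infty\}\to\mathbb C$ with conformal singularities at $0,1,\infty$: for each $\alpha\in\{0,1,\infty\}$ and each holomorphic chart $\chi$ at $\alpha$ with $\chi(\alpha)=0$ there is a series in $\mathbb C((p,\bar p,|p|^{\mathbb R}))$ converging absolutely and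 compactly to $f\circ\chi^{-1}(p)$ in some punctured disc around $p=0$. For $\chi\in\{p,1-p,1/p,1-1/p\}$ ($p$ the standard coordinate) this uniquely determined series is denoted $j(\chi,f)$. $\mathrm{GCor}_2$ is the complex span of the functions on $Y_2=\{(z_1,z_2)\in\mathbb C^2: z_1\ne z_2, z_1\ne0,z_2\neq 0\}$ $$\mu=z_1^{\alpha_1}z_2^{\alpha_2}(z_1-z_2)^{\alpha_{12}}\bar z_1^{\beta_1}\bar z_2^{\beta_2}(\bar z_1-\bar z_2)^{\beta_{12}}f(z_2/z_1),$$ $f\in F_{0,1,\infty}$, $\alpha$'s, $\beta$'s real with $\alpha_1-\beta_1,\alpha_2-\beta_2,\alpha_{12}-\beta_{12}\in\mathbb Z$. Its expansions, extended linearly, are: $\mu|_{|z_1|>|z_2|}$: expand $(z_1-z_2)^{\alpha_{12}}(\bar z_1-\bar z_2)^{\beta_{12}}$ binomially in non-negative powers of $z_2/z_1,\bar z_2/\bar z_1$ and replace $f(z_2/z_1)$ by $j(p,f)$ at $p=z_2/z_1$; $\mu|_{|z_2|>|z_1|}$: expand in non-negative powers of $z_1/z_2,\bar z_1/\bar z_2$ (with sign $(-1)^{\alpha_{12}-\beta_{12}}$) and replace $f(z_2/z_1)$ by $j(p^{-1},f)$ at $p=z_1/z_2$; $\mu|_{|z_2|>|z_1-z_2|}$: put $z_1=z_2+z_0$, expand $(z_2+z_0)^{\alpha_1}(\bar z_2+\bar z_0)^{\beta_1}$ in non-negative powers of $z_0/z_2,\bar z_0/\bar z_2$ and replace $f(z_2/z_1)$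 by $j(1-p^{-1},f)$ at $p=-z_0/z_2$. **Full vertex algebra.** For $F=\bigoplus_{h,\bar h\in\mathbb R}F_{h,\bar h}$ put $F^\vee=\bigoplus F_{h,\bar h}^*$. A full vertex algebra is such an $F$ over $\mathbb C$ with $Y(-,\underline z):F\to\mathrm{End}(F)[[z,\bar z,|z|^{\mathbb R}]]$, $Y(a,\underline z)=\sum_{r,s\in\mathbb R}a(r,s)z^{-r-1}\bar z^{-s-1}$, and $\mathbf 1\in F_{0,0}$ such that: (FV1) for all $a,b$ there is $N$ with $a(r,s)b=0$ if $r\ge N$ or $s\ge N$; (FV2) $F_{h,\bar h}=0$ unless $h-\bar h\in\mathbb Z$; (FV3) $Y(a,\underline z)\mathbf 1\in F[[z,\bar z]]$ with constant term $a$; (FV4) $Y(\mathbf 1,\underline z)=\mathrm{id}$; (FV5) for all $a,b,c\in F$, $u\in F^\vee$ there is $\mu\in\mathrm{GCor}_2$ with $u(Y(a,\underline z_1)Y(b,\underline z_2)c)=\mu|_{|z_1|>|z_2|}$, $u(Y(Y(a,\underline z_0)b,\underline z_2)c)=\mu|_{|z_2|>|z_1-z_2|}$ ($z_0=z_1-z_2$), $u(Y(b,\underline z_2)Y(a,\underline z_1)c)=\mu|_{|z_2|>|z_1|}$; (FV6) $F_{h,\bar h}(r,s)F_{h',\bar h'}\subset F_{h+h'-r-1,\bar h+\bar h'-s-1}$. Define $D,\bar D\in\mathrm{End}F$ by $Y(a,\underline z)\mathbf 1=a+Da\,z+\bar Da\,\bar z+\cdots$. **Full vertex operator algebra.** A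 full vertex algebra $F$ with $\omega,\bar\omega\in F$, $\bar D\omega=0$, $D\bar\omega=0$, such that $L(n)=\omega(n+1,-1)$ and $\bar L(n)=\bar\omega(-1,n+1)$ satisfy: $[L(n),L(m)]=(n-m)L(n+m)+\frac{n^3-n}{12}\delta_{n+m,0}c$ and $[\bar L(n),\bar L(m)]=(n-m)\bar L(n+m)+\frac{n^3-n}{12}\delta_{n+m,0}\bar c$ for some $c,\bar c\in\mathbb C$; $D=L(-1)$, $\bar D=\bar L(-1)$; $L(0)=h$, $\bar L(0)=\bar h$ on $F_{h,\bar h}$; $\dim F_{h,\bar h}<\infty$; there is $N\in\mathbb R$ with $F_{h,\bar h}=0$ if $h\le N$ or $\bar h\le N$. An invariant bilinear form is a bilinear form with $(Y(a,\underline z)b,c)=(b,Y(S_za,\underline z^{-1})c)$, where $S_za=\exp(zL(1)+\bar z\bar L(1))(-1)^{h-\bar h}z^{-2h}\bar z^{-2\bar h}a$ for $a\in F_{h,\bar h}$. $F$ is self-dual if it has a non-degenerate invariant bilinear form. With $QF_{h,\bar h}=\{v\in F_{h,\bar h}:L(1)v=\bar L(1)v=0\}$ and $QF=\bigoplus QF_{h,\bar h}$, $F$ is QP-generated if $F=\mathbb C[L(-1),\bar L(-1)]QF$. **$\mathrm{Cor}_4$ and the $S_4$-action.** $\mathrm{Cor}_4$ is the complex span of the functions of pairwise distinct $z_1,\dots,z_4\in\mathbb C$ $$\prod_{1\le i<j\le4}(z_i-z_j)^{\alpha_{ij}}(\bar z_i-\bar z_j)^{\beta_{ij}}f(\xi),\quad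 \xi=\frac{(z_1-z_2)(z_3-z_4)}{(z_1-z_3)(z_2-z_4)},$$ $f\in F_{0,1,\infty}$, $\alpha_{ij},\beta_{ij}\in\mathbb R$, $\alpha_{ij}-\beta_{ij}\in\mathbb Z$. $S_4$ acts on points by $\sigma\cdot(z_1,\dots,z_4)=(z_{\sigma^{-1}1},\dots,z_{\sigma^{-1}4})$ and on $\mathrm{Cor}_4$ by $(\sigma\cdot\phi)(x)=\phi(\sigma^{-1}\cdot x)$. **The expansion $e_{1(2(3(4\star)))}$.** It sends the displayed function to the formal series in $z_1,\bar z_1,\dots,z_4,\bar z_4$ obtained by expanding each $(z_i-z_j)^{\alpha}(\bar z_i-\bar z_j)^{\beta}$ ($i<j$) binomially in non-negative powers of $z_j/z_i,\bar z_j/\bar z_i$, and replacing $f(\xi)$ by the series $j(p,f)=\sum a_{r,s}p^r\bar p^s$ in which $p^r\bar p^s$ is replaced by the expansion, in the same sense, of $\xi^r\bar\xi^s$; it is extended linearly, is well defined and injective, and $e_{1(2(3(4\star)))}(\phi)$ converges absolutely to $\phi$ for $|z_1|\gg|z_2|\gg|z_3|\gg|z_4|$. For $F$ as in the claim, the right hand side of the formula determining $S$ lies in the image of $e_{1(2(3(4\star)))}$. *)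

theory Defs
  imports "HOL-Analysis.Analysis"
begin

section \<open>Series in real powers of one variable and its conjugate\<close>

text \<open>
  The value of \<open>z\<^sup>r zbar\<^sup>s\<close> for \<open>z \<noteq> 0\<close> and \<open>r - s\<close> an integer, with the convention
  \<open>|z| = z zbar\<close> in exponents: \<open>z\<^sup>r zbar\<^sup>s = z\<^sup>r\<^sup>-\<^sup>s (z zbar)\<^sup>s\<close>.
  It is used only for integral \<open>r - s\<close>.
\<close>
definition cpow :: "complex \<Rightarrow> real \<Rightarrow> real \<Rightarrow> complex" where
  "cpow z r s = z powi \<lfloor>r - s\<rfloor> * of_real (cmod z powr (2 * s))"

text \<open>The space \<open>\<complex>((z, zbar, |z|\<^sup>\<real>))\<close>; \<open>A r s\<close> is the coefficient of \<open>z\<^sup>r zbar\<^sup>s\<close>.\<close>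
definition laurent_series :: "(real \<Rightarrow> real \<Rightarrow> complex) set" where
  "laurent_series = {A. countable {(r, s). A r s \<noteq> 0} \<and>
     (\<forall>r s. A r s \<noteq> 0 \<longrightarrow> r - s \<in> \<int>) \<and>
     (\<exists>N. \<forall>r s. A r s \<noteq> 0 \<longrightarrow> N \<le> r \<and> N \<le> s)}"

text \<open>
  \<open>A\<close> converges absolutely, and uniformly on compact sets, to \<open>g\<close> in some punctured disc
  around 0.  The disc may always be shrunk, so values of \<open>g\<close> away from 0 are irrelevant.
\<close>
definition converges_near_0 :: "(real \<Rightarrow> real \<Rightarrow> complex) \<Rightarrow> (complex \<Rightarrow> complex) \<Rightarrow> bool" where
  "converges_near_0 A g \<longleftrightarrow> (\<exists>\<epsilon>>0.
     (\<forall>p \<in> ball 0 \<epsilon> - {0}. (\<lambda>(r, s). norm (A r s * cpow p r s)) summable_on UNIV) \<and>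
     (\<forall>K. compact K \<and> K \<subseteq> ball 0 \<epsilon> - {0} \<longrightarrow>
        uniform_limit K (\<lambda>X p. \<Sum>(r, s)\<in>X. A r s * cpow p r s) g (finite_subsets_at_top UNIV)))"

section \<open>The function space with conformal singularities at 0, 1 and infinity\<close>

text \<open>Real analyticity in the two real coordinates of \<open>\<complex>\<close>.\<close>
definition real_analytic_on :: "(complex \<Rightarrow> complex) \<Rightarrow> complex set \<Rightarrow> bool" where
  "real_analytic_on f U \<longleftrightarrow> (\<forall>p\<in>U. \<exists>\<epsilon>>0. \<exists>c :: nat \<Rightarrow> nat \<Rightarrow> complex. \<forall>z\<in>ball p \<epsilon>.
     ((\<lambda>(m, n). c m n * of_real (Re (z - p)) ^ m * of_real (Im (z - p)) ^ n) has_sum f z) UNIV)"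

text \<open>
  The standard local coordinates of the projective line at 0, 1 and infinity have the inverses
  \<open>w \<mapsto> w\<close>, \<open>w \<mapsto> 1 + w\<close> and \<open>w \<mapsto> 1 / w\<close>.  A holomorphic chart \<open>\<chi>\<close> at one of these points,
  centred there, is the standard coordinate followed by an injective holomorphic \<open>\<kappa>\<close>, defined
  near 0, with \<open>\<kappa> 0 = 0\<close>; if \<open>\<psi>\<close> is the inverse of the standard coordinate, then the inverse of
  \<open>\<chi>\<close> is \<open>\<psi> \<circ> \<kappa>\<^sup>-\<^sup>1\<close>.
\<close>
definition conformal_singularity :: "(complex \<Rightarrow> complex) \<Rightarrow> (complex \<Rightarrow> complex) \<Rightarrow> bool" where
  "conformal_singularity \<psi> f \<longleftrightarrow>
     (\<forall>U \<kappa>. open U \<and> 0 \<in> U \<and> \<kappa> holomorphic_on U \<and> inj_on \<kappa> U \<and> \<kappa> 0 = 0 \<longrightarrow>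
        (\<exists>A\<in>laurent_series. converges_near_0 A (\<lambda>p. f (\<psi> (inv_into U \<kappa> p)))))"

text \<open>Values at 0 and 1 are junk: elements are functions on \<open>\<complex> - {0, 1}\<close>.\<close>
definition F01inf :: "(complex \<Rightarrow> complex) set" where
  "F01inf = {f. real_analytic_on f (- {0, 1}) \<and>
     conformal_singularity (\<lambda>w. w) f \<and>
     conformal_singularity (\<lambda>w. 1 + w) f \<and>
     conformal_singularity (\<lambda>w. 1 / w) f}"

text \<open>
  \<open>is_j \<psi> f A\<close> says \<open>A = j(\<chi>, f)\<close>, where \<open>\<psi>\<close> is the inverse of the chart \<open>\<chi>\<close>.
  The charts \<open>p\<close>, \<open>1/p\<close> and \<open>1 - 1/p\<close> have the inverses \<open>p\<close>, \<open>1/p\<close> and \<open>1/(1 - p)\<close>.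
\<close>
definition is_j :: "(complex \<Rightarrow> complex) \<Rightarrow> (complex \<Rightarrow> complex) \<Rightarrow> (real \<Rightarrow> real \<Rightarrow> complex) \<Rightarrow> bool" where
  "is_j \<psi> f A \<longleftrightarrow> A \<in> laurent_series \<and> converges_near_0 A (\<lambda>p. f (\<psi> p))"

section \<open>Formal series in several variables\<close>

text \<open>
  An exponent \<open>e\<close> stands for the monomial \<open>\<Prod>\<^sub>i z\<^sub>i\<^sup>r zbar\<^sub>i\<^sup>s\<close> with \<open>(r, s) = e i\<close>, where \<open>e i = (0, 0)\<close> for
  variables that do not occur.  A formal series assigns coefficients to exponents.
\<close>
type_synonym expo = "nat \<Rightarrow> real \<times> real"
type_synonym series = "expo \<Rightarrow> complex"

definition expo_add :: "expo \<Rightarrow> expo \<Rightarrow> expo" where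
  "expo_add d e = (\<lambda>i. d i + e i)"

definition pw :: "nat \<Rightarrow> real \<Rightarrow> real \<Rightarrow> expo" where
  "pw i r s = (\<lambda>k. if k = i then (r, s) else (0, 0))"

text \<open>
  The formal sum of \<open>c k\<close> times the monomial with exponent \<open>m k\<close>, over all \<open>k\<close>.  In every use
  below only finitely many nonzero terms contribute to a given monomial.
\<close>
definition formal_sum :: "('k \<Rightarrow> complex) \<Rightarrow> ('k \<Rightarrow> expo) \<Rightarrow> series" where
  "formal_sum c m = (\<lambda>e. \<Sum>k | m k = e \<and> c k \<noteq> 0. c k)"

definition monomial :: "expo \<Rightarrow> series" where
  "monomial d = (\<lambda>e. if e = d then 1 else 0)"

definition series_mult :: "series \<Rightarrow> series \<Rightarrow> series" (infixl \<open>\<odot>\<close> 70) where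
  "A \<odot> B = formal_sum (\<lambda>(d, e). A d * B e) (\<lambda>(d, e). expo_add d e)"

text \<open>
  \<open>(z\<^sub>i + \<epsilon> z\<^sub>j)\<^sup>\<alpha> (zbar\<^sub>i + \<epsilon> zbar\<^sub>j)\<^sup>\<beta>\<close> expanded in non-negative powers of \<open>z\<^sub>j / z\<^sub>i\<close> and its conjugate;
  \<open>\<epsilon>\<close> is 1 or -1.
\<close>
definition binom_series :: "nat \<Rightarrow> nat \<Rightarrow> complex \<Rightarrow> real \<Rightarrow> real \<Rightarrow> series" where
  "binom_series i j \<epsilon> \<alpha> \<beta> =
     formal_sum (\<lambda>(m, n). \<epsilon> ^ (m + n) * of_real (\<alpha> gchoose m) * of_real (\<beta> gchoose n))
       (\<lambda>(m, n). expo_add (pw i (\<alpha> - real m) (\<beta> - real n)) (pw j (real m) (real n)))"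

text \<open>\<open>A\<close> at \<open>p = z\<^sub>i / z\<^sub>j\<close>\<close>
definition subst_series :: "nat \<Rightarrow> nat \<Rightarrow> (real \<Rightarrow> real \<Rightarrow> complex) \<Rightarrow> series" where
  "subst_series i j A = formal_sum (\<lambda>(r, s). A r s) (\<lambda>(r, s). expo_add (pw i r s) (pw j (- r) (- s)))"

section \<open>Spans of functions and linear extensions\<close>

definition fun_span :: "('x \<Rightarrow> complex) set \<Rightarrow> ('x \<Rightarrow> complex) set" where
  "fun_span G = {\<phi>. \<exists>(n :: nat) c g. (\<forall>k<n. g k \<in> G) \<and> \<phi> = (\<lambda>x. \<Sum>k<n. c k * g k x)}"

text \<open>
  If \<open>R\<close> relates the generators of a space of functions to series, \<open>lin_ext R\<close> is the graph of the
  linear extension of \<open>R\<close> to the span.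
\<close>
definition lin_ext ::
  "(('x \<Rightarrow> complex) \<Rightarrow> series \<Rightarrow> bool) \<Rightarrow> ('x \<Rightarrow> complex) \<Rightarrow> series \<Rightarrow> bool" where
  "lin_ext R \<phi> A \<longleftrightarrow> (\<exists>(n :: nat) c g B. (\<forall>k<n. R (g k) (B k)) \<and>
     \<phi> = (\<lambda>x. \<Sum>k<n. c k * g k x) \<and> A = (\<lambda>e. \<Sum>k<n. c k * B k e))"

section \<open>Two-point functions and their expansions\<close>

text \<open>Functions on \<open>Y2\<close> are extended by 0, so that equality on \<open>Y2\<close> is equality.\<close>
definition Y2 :: "(complex \<times> complex) set" where
  "Y2 = {(z1, z2). z1 \<noteq> z2 \<and> z1 \<noteq> 0 \<and> z2 \<noteq> 0}"

definition gcor2_fun ::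
  "real \<Rightarrow> real \<Rightarrow> real \<Rightarrow> real \<Rightarrow> real \<Rightarrow> real \<Rightarrow> (complex \<Rightarrow> complex) \<Rightarrow> complex \<times> complex \<Rightarrow> complex" where
  "gcor2_fun \<alpha>1 \<beta>1 \<alpha>2 \<beta>2 \<alpha>12 \<beta>12 f = (\<lambda>(z1, z2). if (z1, z2) \<in> Y2
     then cpow z1 \<alpha>1 \<beta>1 * cpow z2 \<alpha>2 \<beta>2 * cpow (z1 - z2) \<alpha>12 \<beta>12 * f (z2 / z1) else 0)"

definition GCor2 :: "(complex \<times> complex \<Rightarrow> complex) set" where
  "GCor2 = fun_span {gcor2_fun \<alpha>1 \<beta>1 \<alpha>2 \<beta>2 \<alpha>12 \<beta>12 f | \<alpha>1 \<beta>1 \<alpha>2 \<beta>2 \<alpha>12 \<beta>12 f.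
     \<alpha>1 - \<beta>1 \<in> \<int> \<and> \<alpha>2 - \<beta>2 \<in> \<int> \<and> \<alpha>12 - \<beta>12 \<in> \<int> \<and> f \<in> F01inf}"

text \<open>Expansion in \<open>|z\<^sub>1| > |z\<^sub>2|\<close>, a series in \<open>z\<^sub>1\<close> and \<open>z\<^sub>2\<close>\<close>
definition expand_12 :: "(complex \<times> complex \<Rightarrow> complex) \<Rightarrow> series \<Rightarrow> bool" where
  "expand_12 = lin_ext (\<lambda>\<mu> A. \<exists>\<alpha>1 \<beta>1 \<alpha>2 \<beta>2 \<alpha>12 \<beta>12 f J.
     \<alpha>1 - \<beta>1 \<in> \<int> \<and> \<alpha>2 - \<beta>2 \<in> \<int> \<and> \<alpha>12 - \<beta>12 \<in> \<int> \<and> f \<in> F01inf \<and>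
     \<mu> = gcor2_fun \<alpha>1 \<beta>1 \<alpha>2 \<beta>2 \<alpha>12 \<beta>12 f \<and> is_j (\<lambda>p. p) f J \<and>
     A = monomial (expo_add (pw 1 \<alpha>1 \<beta>1) (pw 2 \<alpha>2 \<beta>2)) \<odot>
           (binom_series 1 2 (-1) \<alpha>12 \<beta>12 \<odot> subst_series 2 1 J))"

text \<open>Expansion in \<open>|z\<^sub>2| > |z\<^sub>1|\<close>, a series in \<open>z\<^sub>1\<close> and \<open>z\<^sub>2\<close>\<close>
definition expand_21 :: "(complex \<times> complex \<Rightarrow> complex) \<Rightarrow> series \<Rightarrow> bool" where
  "expand_21 = lin_ext (\<lambda>\<mu> A. \<exists>\<alpha>1 \<beta>1 \<alpha>2 \<beta>2 \<alpha>12 \<beta>12 f J.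
     \<alpha>1 - \<beta>1 \<in> \<int> \<and> \<alpha>2 - \<beta>2 \<in> \<int> \<and> \<alpha>12 - \<beta>12 \<in> \<int> \<and> f \<in> F01inf \<and>
     \<mu> = gcor2_fun \<alpha>1 \<beta>1 \<alpha>2 \<beta>2 \<alpha>12 \<beta>12 f \<and> is_j (\<lambda>p. 1 / p) f J \<and>
     A = (\<lambda>e. (-1) powi \<lfloor>\<alpha>12 - \<beta>12\<rfloor> *
          (monomial (expo_add (pw 1 \<alpha>1 \<beta>1) (pw 2 \<alpha>2 \<beta>2)) \<odot>
             (binom_series 2 1 (-1) \<alpha>12 \<beta>12 \<odot> subst_series 1 2 J)) e))"

text \<open>
  Expansion in \<open>|z\<^sub>2| > |z\<^sub>1 - z\<^sub>2|\<close>, a series in \<open>z\<^sub>0 = z\<^sub>1 - z\<^sub>2\<close> and \<open>z\<^sub>2\<close>.  Putting \<open>p = - z\<^sub>0 / z\<^sub>2\<close>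
  replaces \<open>p\<^sup>r pbar\<^sup>s\<close> by \<open>(-1)\<^sup>r\<^sup>-\<^sup>s\<close> times the power of \<open>z\<^sub>0 / z\<^sub>2\<close>.
\<close>
definition expand_02 :: "(complex \<times> complex \<Rightarrow> complex) \<Rightarrow> series \<Rightarrow> bool" where
  "expand_02 = lin_ext (\<lambda>\<mu> A. \<exists>\<alpha>1 \<beta>1 \<alpha>2 \<beta>2 \<alpha>12 \<beta>12 f J.
     \<alpha>1 - \<beta>1 \<in> \<int> \<and> \<alpha>2 - \<beta>2 \<in> \<int> \<and> \<alpha>12 - \<beta>12 \<in> \<int> \<and> f \<in> F01inf \<and>
     \<mu> = gcor2_fun \<alpha>1 \<beta>1 \<alpha>2 \<beta>2 \<alpha>12 \<beta>12 f \<and> is_j (\<lambda>p. 1 / (1 - p)) f J \<and>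
     A = monomial (expo_add (pw 0 \<alpha>12 \<beta>12) (pw 2 \<alpha>2 \<beta>2)) \<odot>
           (binom_series 2 0 1 \<alpha>1 \<beta>1 \<odot>
            subst_series 0 2 (\<lambda>r s. (-1) powi \<lfloor>r - s\<rfloor> * J r s)))"

section \<open>Full vertex algebras\<close>

text \<open>
  The underlying space \<open>F\<close> is the whole type \<open>'a\<close> with scalar multiplication \<open>scl\<close>, and
  \<open>V h k\<close> is the homogeneous subspace of bidegree \<open>(h, k)\<close>.  The graded dual, the direct sum of the
  duals of the \<open>V h k\<close>, consists of the linear functionals vanishing on almost all \<open>V h k\<close>.
\<close>
definition graded_dual ::
  "(complex \<Rightarrow> 'a::ab_group_add \<Rightarrow> 'a) \<Rightarrow> (real \<Rightarrow> real \<Rightarrow> 'a set) \<Rightarrow> ('a \<Rightarrow> complex) set" where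
  "graded_dual scl V =
     {u. Vector_Spaces.linear scl (*) u \<and> finite {(h, k). \<exists>v\<in>V h k. u v \<noteq> 0}}"

text \<open>
  \<open>Y a r s b\<close> is \<open>a(r, s) b\<close>, the coefficient of \<open>z\<^sup>-\<^sup>r\<^sup>-\<^sup>1 zbar\<^sup>-\<^sup>s\<^sup>-\<^sup>1\<close> in \<open>Y(a, z) b\<close>, and
  \<open>Ycoeff Y a (r, s) b\<close> is the coefficient of \<open>z\<^sup>r zbar\<^sup>s\<close>.
\<close>
type_synonym 'a vertex_op = "'a \<Rightarrow> real \<Rightarrow> real \<Rightarrow> 'a \<Rightarrow> 'a"

definition Ycoeff :: "'a vertex_op \<Rightarrow> 'a \<Rightarrow> real \<times> real \<Rightarrow> 'a \<Rightarrow> 'a" where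
  "Ycoeff Y a e b = Y a (- fst e - 1) (- snd e - 1) b"

text \<open>\<open>u(Y(a, z\<^sub>i) Y(b, z\<^sub>j) c)\<close> as a series in \<open>z\<^sub>i\<close> and \<open>z\<^sub>j\<close>\<close>
definition product_series ::
  "'a vertex_op \<Rightarrow> ('a \<Rightarrow> complex) \<Rightarrow> nat \<Rightarrow> 'a \<Rightarrow> nat \<Rightarrow> 'a \<Rightarrow> 'a \<Rightarrow> series" where
  "product_series Y u i a j b c = (\<lambda>e. if \<forall>k. k \<notin> {i, j} \<longrightarrow> e k = (0, 0)
     then u (Ycoeff Y a (e i) (Ycoeff Y b (e j) c)) else 0)"

text \<open>\<open>u(Y(Y(a, z\<^sub>0) b, z\<^sub>2) c)\<close> as a series in \<open>z\<^sub>0\<close> and \<open>z\<^sub>2\<close>\<close>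
definition iterate_series ::
  "'a vertex_op \<Rightarrow> ('a \<Rightarrow> complex) \<Rightarrow> 'a \<Rightarrow> 'a \<Rightarrow> 'a \<Rightarrow> series" where
  "iterate_series Y u a b c = (\<lambda>e. if \<forall>k. k \<notin> {0, 2} \<longrightarrow> e k = (0, 0)
     then u (Ycoeff Y (Ycoeff Y a (e 0) b) (e 2) c) else 0)"

text \<open>\<open>Y(a, z)\<one> = a + D a z + Dbar a zbar + \<dots>\<close>\<close>
definition Dop :: "'a vertex_op \<Rightarrow> 'a \<Rightarrow> 'a \<Rightarrow> 'a" where
  "Dop Y vac a = Ycoeff Y a (1, 0) vac"

definition Dbar :: "'a vertex_op \<Rightarrow> 'a \<Rightarrow> 'a \<Rightarrow> 'a" where
  "Dbar Y vac a = Ycoeff Y a (0, 1) vac"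

locale full_vertex_algebra = vector_space scl
  for scl :: "complex \<Rightarrow> 'a::ab_group_add \<Rightarrow> 'a" +
  fixes V :: "real \<Rightarrow> real \<Rightarrow> 'a set"
    and Y :: "'a vertex_op"
    and vac :: 'a
  assumes subspace_V: "subspace (V h k)"
    and direct_sum_V: "\<exists>!x :: real \<times> real \<Rightarrow> 'a. (\<forall>h k. x (h, k) \<in> V h k) \<and>
          finite {i. x i \<noteq> 0} \<and> v = (\<Sum>i | x i \<noteq> 0. x i)"
    and linear_Y_left: "Vector_Spaces.linear scl scl (\<lambda>a. Y a r s b)"
    and linear_Y_right: "Vector_Spaces.linear scl scl (\<lambda>b. Y a r s b)"
    and countable_Y: "countable {(r, s). \<exists>b. Y a r s b \<noteq> 0}"
    and integral_Y: "Y a r s b \<noteq> 0 \<Longrightarrow> r - s \<in> \<int>"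
    and vac_degree: "vac \<in> V 0 0"
    and FV1: "\<exists>N. \<forall>r s. r \<ge> N \<or> s \<ge> N \<longrightarrow> Y a r s b = 0"
    and FV2: "h - k \<notin> \<int> \<Longrightarrow> V h k = {0}"
    and FV3_power_series: "Ycoeff Y a (r, s) vac \<noteq> 0 \<Longrightarrow> r \<in> \<nat> \<and> s \<in> \<nat>"
    and FV3_constant_term: "Ycoeff Y a (0, 0) vac = a"
    and FV4: "Ycoeff Y vac (r, s) b = (if r = 0 \<and> s = 0 then b else 0)"
    and FV5: "u \<in> graded_dual scl V \<Longrightarrow> \<exists>\<mu>\<in>GCor2.
          expand_12 \<mu> (product_series Y u 1 a 2 b c) \<and>
          expand_02 \<mu> (iterate_series Y u a b c) \<and>
          expand_21 \<mu> (product_series Y u 2 b 1 a c)"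
    and FV6: "a \<in> V h k \<Longrightarrow> b \<in> V h' k' \<Longrightarrow> Y a r s b \<in> V (h + h' - r - 1) (k + k' - s - 1)"

section \<open>Full vertex operator algebras\<close>

definition Lop :: "'a vertex_op \<Rightarrow> 'a \<Rightarrow> int \<Rightarrow> 'a \<Rightarrow> 'a" where
  "Lop Y \<omega> n = Y \<omega> (of_int n + 1) (-1)"

definition Lbar :: "'a vertex_op \<Rightarrow> 'a \<Rightarrow> int \<Rightarrow> 'a \<Rightarrow> 'a" where
  "Lbar Y \<omega>b n = Y \<omega>b (-1) (of_int n + 1)"

definition virasoro :: "(complex \<Rightarrow> 'a::ab_group_add \<Rightarrow> 'a) \<Rightarrow> (int \<Rightarrow> 'a \<Rightarrow> 'a) \<Rightarrow> complex \<Rightarrow> bool" where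
  "virasoro scl L c \<longleftrightarrow> (\<forall>n m v. L n (L m v) - L m (L n v) =
     scl (of_int (n - m)) (L (n + m) v) +
     scl (if n + m = 0 then (of_int (n ^ 3 - n) / 12) * c else 0) v)"

locale full_vertex_operator_algebra = full_vertex_algebra scl V Y vac
  for scl :: "complex \<Rightarrow> 'a::ab_group_add \<Rightarrow> 'a"
    and V :: "real \<Rightarrow> real \<Rightarrow> 'a set" and Y :: "'a vertex_op" and vac :: 'a +
  fixes \<omega> \<omega>b :: 'a
  assumes Dbar_\<omega>: "Dbar Y vac \<omega> = 0"
    and D_\<omega>b: "Dop Y vac \<omega>b = 0"
    and virasoro_L: "\<exists>c. virasoro scl (Lop Y \<omega>) c"
    and virasoro_Lbar: "\<exists>c. virasoro scl (Lbar Y \<omega>b) c"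
    and D_eq: "Dop Y vac = Lop Y \<omega> (-1)"
    and Dbar_eq: "Dbar Y vac = Lbar Y \<omega>b (-1)"
    and L0_eq: "v \<in> V h k \<Longrightarrow> Lop Y \<omega> 0 v = scl (of_real h) v"
    and Lbar0_eq: "v \<in> V h k \<Longrightarrow> Lbar Y \<omega>b 0 v = scl (of_real k) v"
    and finite_dim_V: "\<exists>B. finite B \<and> V h k = span B"
    and bounded_below: "\<exists>N. \<forall>h k. h \<le> N \<or> k \<le> N \<longrightarrow> V h k = {0}"

text \<open>\<open>pow_coeff P Q m n\<close> is the coefficient of \<open>z\<^sup>m zbar\<^sup>n\<close> in \<open>(z P + zbar Q)\<^sup>m\<^sup>+\<^sup>n\<close>.\<close>
fun pow_coeff :: "('a \<Rightarrow> 'a) \<Rightarrow> ('a \<Rightarrow> 'a) \<Rightarrow> nat \<Rightarrow> nat \<Rightarrow> 'a \<Rightarrow> 'a::ab_group_add" where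
  "pow_coeff P Q 0 0 v = v"
| "pow_coeff P Q (Suc m) 0 v = P (pow_coeff P Q m 0 v)"
| "pow_coeff P Q 0 (Suc n) v = Q (pow_coeff P Q 0 n v)"
| "pow_coeff P Q (Suc m) (Suc n) v = P (pow_coeff P Q m (Suc n) v) + Q (pow_coeff P Q (Suc m) n v)"

text \<open>
  For \<open>a \<in> V h k\<close>, the coefficient of \<open>z\<^sup>m\<^sup>-\<^sup>2\<^sup>h zbar\<^sup>n\<^sup>-\<^sup>2\<^sup>k\<close> in
  \<open>S\<^sub>z a = exp(z L(1) + zbar Lbar(1)) (-1)\<^sup>h\<^sup>-\<^sup>k z\<^sup>-\<^sup>2\<^sup>h zbar\<^sup>-\<^sup>2\<^sup>k a\<close>.
\<close>
definition Scoeff ::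
  "(complex \<Rightarrow> 'a::ab_group_add \<Rightarrow> 'a) \<Rightarrow> 'a vertex_op \<Rightarrow> 'a \<Rightarrow> 'a \<Rightarrow> real \<Rightarrow> real \<Rightarrow> nat \<Rightarrow> nat \<Rightarrow> 'a \<Rightarrow> 'a" where
  "Scoeff scl Y \<omega> \<omega>b h k m n a =
     scl ((-1) powi \<lfloor>h - k\<rfloor> / fact (m + n)) (pow_coeff (Lop Y \<omega> 1) (Lbar Y \<omega>b 1) m n a)"

text \<open>
  \<open>(Y(a, z) b, c) = (b, Y(S\<^sub>z a, z\<^sup>-\<^sup>1) c)\<close>, compared at \<open>z\<^sup>p zbar\<^sup>q\<close>: on the right, the terms are
  \<open>z\<^sup>m\<^sup>-\<^sup>2\<^sup>h zbar\<^sup>n\<^sup>-\<^sup>2\<^sup>k\<close> from \<open>S\<^sub>z a\<close> times a monomial in \<open>z\<^sup>-\<^sup>1\<close> and its conjugate.  The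
  sum is finite, since the \<open>Scoeff\<close> have bidegree \<open>(h - m, k - n)\<close>.  Both sides
  are linear in \<open>a\<close>, so homogeneous \<open>a\<close> suffice.
\<close>
definition invariant_form ::
  "(complex \<Rightarrow> 'a::ab_group_add \<Rightarrow> 'a) \<Rightarrow> (real \<Rightarrow> real \<Rightarrow> 'a set) \<Rightarrow> 'a vertex_op \<Rightarrow> 'a \<Rightarrow> 'a \<Rightarrow>
   ('a \<Rightarrow> 'a \<Rightarrow> complex) \<Rightarrow> bool" where
  "invariant_form scl V Y \<omega> \<omega>b B \<longleftrightarrow>
     (\<forall>b. Vector_Spaces.linear scl (*) (\<lambda>a. B a b)) \<and>
     (\<forall>a. Vector_Spaces.linear scl (*) (\<lambda>b. B a b)) \<and>
     (\<forall>h k a b c p q. a \<in> V h k \<longrightarrow>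
        B (Ycoeff Y a (p, q) b) c =
        (\<Sum>(m, n)\<in>{(m, n). Scoeff scl Y \<omega> \<omega>b h k m n a \<noteq> 0}.
           B b (Ycoeff Y (Scoeff scl Y \<omega> \<omega>b h k m n a)
                  (real m - 2 * h - p, real n - 2 * k - q) c)))"

definition nondegenerate :: "('a::zero \<Rightarrow> 'a \<Rightarrow> complex) \<Rightarrow> bool" where
  "nondegenerate B \<longleftrightarrow> (\<forall>a. (\<forall>b. B a b = 0) \<longrightarrow> a = 0) \<and> (\<forall>b. (\<forall>a. B a b = 0) \<longrightarrow> b = 0)"

context full_vertex_operator_algebra
begin

definition QF_part :: "real \<Rightarrow> real \<Rightarrow> 'a set" where
  "QF_part h k = {v \<in> V h k. Lop Y \<omega> 1 v = 0 \<and> Lbar Y \<omega>b 1 v = 0}"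

definition QF :: "'a set" where
  "QF = span (\<Union>h k. QF_part h k)"

definition QP_generated :: bool where
  "QP_generated \<longleftrightarrow>
     span {(Lop Y \<omega> (-1) ^^ m) ((Lbar Y \<omega>b (-1) ^^ n) v) | m n v. v \<in> QF} = UNIV"

end

section \<open>Four-point functions\<close>

text \<open>
  Four points are \<open>z 1, \<dots>, z 4\<close>; other values of \<open>z\<close> are never used.  Functions on \<open>X4\<close> are
  extended by 0.
\<close>
definition X4 :: "(nat \<Rightarrow> complex) set" where
  "X4 = {z. inj_on z {1..4}}"

definition pairs4 :: "(nat \<times> nat) list" where
  "pairs4 = [(1, 2), (1, 3), (1, 4), (2, 3), (2, 4), (3, 4)]"

definition cross_ratio :: "(nat \<Rightarrow> complex) \<Rightarrow> complex" where
  "cross_ratio z = ((z 1 - z 2) * (z 3 - z 4)) / ((z 1 - z 3) * (z 2 - z 4))"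

definition cor4_fun ::
  "(nat \<Rightarrow> nat \<Rightarrow> real) \<Rightarrow> (nat \<Rightarrow> nat \<Rightarrow> real) \<Rightarrow> (complex \<Rightarrow> complex) \<Rightarrow> (nat \<Rightarrow> complex) \<Rightarrow> complex" where
  "cor4_fun \<alpha> \<beta> f = (\<lambda>z. if z \<in> X4
     then (\<Prod>(i, j)\<in>set pairs4. cpow (z i - z j) (\<alpha> i j) (\<beta> i j)) * f (cross_ratio z) else 0)"

definition Cor4 :: "((nat \<Rightarrow> complex) \<Rightarrow> complex) set" where
  "Cor4 = fun_span {cor4_fun \<alpha> \<beta> f | \<alpha> \<beta> f.
     (\<forall>(i, j)\<in>set pairs4. \<alpha> i j - \<beta> i j \<in> \<int>) \<and> f \<in> F01inf}"

text \<open>The expansion of \<open>\<Prod> (z\<^sub>i - z\<^sub>j)\<^sup>\<alpha> (zbar\<^sub>i - zbar\<^sub>j)\<^sup>\<beta>\<close> in non-negative powers of \<open>z\<^sub>j / z\<^sub>i\<close>, \<open>i < j\<close>\<close>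
definition pairs_series :: "(nat \<Rightarrow> nat \<Rightarrow> real) \<Rightarrow> (nat \<Rightarrow> nat \<Rightarrow> real) \<Rightarrow> series" where
  "pairs_series \<alpha> \<beta> =
     foldr (\<odot>) (map (\<lambda>(i, j). binom_series i j (-1) (\<alpha> i j) (\<beta> i j)) pairs4) (monomial (\<lambda>_. (0, 0)))"

text \<open>The exponent of \<open>z\<^sub>i - z\<^sub>j\<close> in the cross ratio\<close>
definition xi_exponent :: "nat \<Rightarrow> nat \<Rightarrow> real" where
  "xi_exponent i j = (if (i, j) \<in> {(1, 2), (3, 4)} then 1
                      else if (i, j) \<in> {(1, 3), (2, 4)} then -1 else 0)"

definition xi_pow_series :: "real \<Rightarrow> real \<Rightarrow> series" where
  "xi_pow_series r s = pairs_series (\<lambda>i j. r * xi_exponent i j) (\<lambda>i j. s * xi_exponent i j)"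

definition xi_subst_series :: "(real \<Rightarrow> real \<Rightarrow> complex) \<Rightarrow> series" where
  "xi_subst_series J = formal_sum (\<lambda>(r, s, e). J r s * xi_pow_series r s e) (\<lambda>(r, s, e). e)"

text \<open>The graph of the expansion map for \<open>1(2(3(4\<star>)))\<close>\<close>
definition expand_1234 :: "((nat \<Rightarrow> complex) \<Rightarrow> complex) \<Rightarrow> series \<Rightarrow> bool" where
  "expand_1234 = lin_ext (\<lambda>\<phi> A. \<exists>\<alpha> \<beta> f J.
     (\<forall>(i, j)\<in>set pairs4. \<alpha> i j - \<beta> i j \<in> \<int>) \<and> f \<in> F01inf \<and>
     \<phi> = cor4_fun \<alpha> \<beta> f \<and> is_j (\<lambda>p. p) f J \<and>
     A = pairs_series \<alpha> \<beta> \<odot> xi_subst_series J)"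

text \<open>\<open>(\<one>, Y(a\<^sub>1, z\<^sub>1) Y(a\<^sub>2, z\<^sub>2) Y(a\<^sub>3, z\<^sub>3) Y(a\<^sub>4, z\<^sub>4) \<one>)\<close>\<close>
definition vacuum_series ::
  "'a vertex_op \<Rightarrow> 'a \<Rightarrow> ('a \<Rightarrow> 'a \<Rightarrow> complex) \<Rightarrow> 'a \<Rightarrow> 'a \<Rightarrow> 'a \<Rightarrow> 'a \<Rightarrow> series" where
  "vacuum_series Y vac B a1 a2 a3 a4 = (\<lambda>e. if \<forall>k. k \<notin> {1..4} \<longrightarrow> e k = (0, 0)
     then B vac (Ycoeff Y a1 (e 1) (Ycoeff Y a2 (e 2) (Ycoeff Y a3 (e 3) (Ycoeff Y a4 (e 4) vac))))
     else 0)"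

definition multilinear4 ::
  "(complex \<Rightarrow> 'a::ab_group_add \<Rightarrow> 'a) \<Rightarrow> ('a \<Rightarrow> 'a \<Rightarrow> 'a \<Rightarrow> 'a \<Rightarrow> 'x \<Rightarrow> complex) \<Rightarrow> bool" where
  "multilinear4 scl S \<longleftrightarrow> (\<forall>a b c x.
     Vector_Spaces.linear scl (*) (\<lambda>v. S v a b c x) \<and>
     Vector_Spaces.linear scl (*) (\<lambda>v. S a v b c x) \<and>
     Vector_Spaces.linear scl (*) (\<lambda>v. S a b v c x) \<and>
     Vector_Spaces.linear scl (*) (\<lambda>v. S a b c v x))"

text \<open>\<open>\<sigma> \<cdot> (z\<^sub>1, \<dots>, z\<^sub>4)\<close> has \<open>i\<close>-th entry \<open>z (\<sigma>\<^sup>-\<^sup>1 i)\<close>, and \<open>(\<sigma> \<cdot> \<phi>) x = \<phi> (\<sigma>\<^sup>-\<^sup>1 \<cdot> x)\<close>.\<close>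
definition act_points :: "(nat \<Rightarrow> nat) \<Rightarrow> (nat \<Rightarrow> complex) \<Rightarrow> nat \<Rightarrow> complex" where
  "act_points \<sigma> z = (\<lambda>i. z (inv \<sigma> i))"

definition act_fun ::
  "(nat \<Rightarrow> nat) \<Rightarrow> ((nat \<Rightarrow> complex) \<Rightarrow> complex) \<Rightarrow> (nat \<Rightarrow> complex) \<Rightarrow> complex" where
  "act_fun \<sigma> \<phi> = (\<lambda>x. \<phi> (act_points (inv \<sigma>) x))"

end

theory Submission
  imports Defs "HOL-Complex_Analysis.Complex_Analysis"
begin

text \<open>
  It suffices to treat homogeneous vectors and transpositions of neighbouring points.  Fix one such
  transposition, of the points \<open>p\<close> and \<open>q\<close>, and expand both four-point functions in the other
  variables only, with \<open>z\<^sub>p\<close> and \<open>z\<^sub>q\<close> kept as genuine complex numbers: small \<open>z\<^sub>3\<close> and \<open>z\<^sub>4\<close> for the pair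
  \<open>(1, 2)\<close>, large \<open>z\<^sub>1\<close> and \<open>z\<^sub>2\<close> for \<open>(3, 4)\<close>, and large \<open>z\<^sub>1\<close> with \<open>z\<^sub>4 = 0\<close> for \<open>(2, 3)\<close>, which is no
  restriction because of translation invariance.  The coefficients are analytic wherever \<open>z\<^sub>p\<close>, \<open>z\<^sub>q\<close> and \<open>0\<close>
  are distinct.  By uniqueness of convergent expansions their own expansion in \<open>|z\<^sub>p| > |z\<^sub>q|\<close> is the
  corresponding part of the vacuum series, so (FV5) identifies each of them with a function in
  \<open>GCor2\<close>, and for the exchanged vectors with the same function read in the exchanged variables.  Hence the two
  four-point functions agree up to the transposition near one configuration, and everywhere
  by analytic continuation.  Functionals in the graded dual suffice, because the vacuum
  series has only finitely many total degrees.
\<close>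

text \<open>The formal expansions in |z_p| > |z_q| and in |z_q| > |z_p| have no common region, so
  the two vacuum series cannot be compared directly. Keeping z_p and z_q numerical supplies the
  bridge: a coefficient found in one region continues analytically to the other. The limits are
  dictated by the cross ratio. It tends to 0 both for small z3, z4 and for large z1, z2, so the
  series j(p, f) can be substituted, at the price of explicit constants because its disc of
  convergence is unknown. For large z1 and z4 = 0 it tends to z3 / z2, an arbitrary point other than
  0 and 1, and Taylor series of f must take over. Two features of the setting shape the tools. The
  functions are only real analytic, so continuation runs along real lines on which they extend
  holomorphically. The exponents are arbitrary real numbers, so coefficients are extracted by mean
  values over frequencies, as for almost periodic functions, and not by Cauchy's formula. Finiteness
  of all formal products is controlled by a real weight on exponents, adapted to each limit.\<close>

section \<open>Powers of a complex number and its conjugate with real exponents\<close>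

text \<open>In a logarithmic coordinate the integral power and the power of the modulus fuse into
  one exponential. Replacing w by w + 2 \<pi> \<i> multiplies it by exp (2 \<pi> \<i> (r - s)) = 1,
  which is where integrality of r - s enters. Several power laws then reduce to additivity of the
  exponent.\<close>

lemma cpow_exp:
  assumes "r - s \<in> \<int>"
  shows "cpow (exp w) r s = exp (of_real r * w + of_real s * cnj w)"
proof -
  obtain k where k: "r - s = of_int k" using assms by (auto elim: Ints_cases)
  have "cpow (exp w) r s = exp (of_int k * w) * of_real (exp (Re w) powr (2 * s))"
    by (simp add: cpow_def k exp_power_int)
  also have "exp (Re w) powr (2 * s) = exp (2 * s * Re w)" by (simp add: powr_def)
  also have "complex_of_real (exp (2 * s * Re w)) = exp (of_real s * (w + cnj w))"
    by (simp add: exp_of_real complex_add_cnj mult_ac flip: exp_of_real)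
  also have "exp (of_int k * w) * exp (of_real s * (w + cnj w)) =
      exp ((of_real (of_int k) + of_real s) * w + of_real s * cnj w)"
    by (simp add: algebra_simps flip: exp_add)
  also have "complex_of_real (of_int k) + of_real s = of_real r"
    using k by (metis add.commute diff_add_cancel of_real_add of_real_of_int_eq)
  finally show ?thesis .
qed

lemma cpow_add:
  assumes "z \<noteq> 0" "r - s \<in> \<int>" "r' - s' \<in> \<int>"
  shows "cpow z (r + r') (s + s') = cpow z r s * cpow z r' s'"
proof -
  obtain w where w: "z = exp w" using assms(1) by (metis exp_Ln)
  have "r + r' - (s + s') \<in> \<int>"
    using Ints_add[OF assms(2,3)] by (simp add: algebra_simps)
  then show ?thesis using assms by (simp add: w cpow_exp algebra_simps flip: exp_add)
qed

lemma cpow_nonzero: "z \<noteq> 0 \<Longrightarrow> cpow z r s \<noteq> 0"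
  by (simp add: cpow_def)

lemma cpow_0: "z \<noteq> 0 \<Longrightarrow> cpow z 0 0 = 1"
  by (simp add: cpow_def)

lemma cpow_minus:
  assumes "z \<noteq> 0" "r - s \<in> \<int>"
  shows "cpow z (- r) (- s) = inverse (cpow z r s)"
proof -
  have "- r - - s \<in> \<int>" using assms(2) by (metis Ints_minus minus_diff_eq minus_diff_minus)
  from cpow_add[OF assms this] have "cpow z r s * cpow z (- r) (- s) = 1"
    by (simp add: cpow_0 assms(1))
  then show ?thesis by (metis inverse_unique)
qed

lemma cpow_mult:
  assumes "z \<noteq> 0" "w \<noteq> 0" "r - s \<in> \<int>"
  shows "cpow (z * w) r s = cpow z r s * cpow w r s"
  by (simp add: cpow_def norm_mult powr_mult power_int_mult_distrib)

lemma cpow_inverse: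
  assumes "z \<noteq> 0" "r - s \<in> \<int>"
  shows "cpow (inverse z) r s = inverse (cpow z r s)"
proof -
  have "cpow (inverse z) r s * cpow z r s = cpow (inverse z * z) r s"
    using assms by (subst cpow_mult) auto
  also have "\<dots> = 1" using assms(1) by (simp add: cpow_def)
  finally show ?thesis by (metis inverse_unique mult.commute)
qed

lemma cpow_nat: "z \<noteq> 0 \<Longrightarrow> cpow z (real m) (real n) = z ^ m * cnj z ^ n"
proof -
  assume "z \<noteq> 0"
  then obtain w where w: "z = exp w" by (metis exp_Ln)
  have "real m - real n \<in> \<int>" by simp
  then show ?thesis by (simp add: w cpow_exp exp_add exp_of_nat_mult flip: exp_cnj)
qed

lemma norm_cpow:
  assumes "z \<noteq> 0" "r - s \<in> \<int>"
  shows "norm (cpow z r s) = norm z powr (r + s)"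
proof -
  obtain w where w: "z = exp w" using assms(1) by (metis exp_Ln)
  show ?thesis using assms(2) by (simp add: w cpow_exp powr_def algebra_simps)
qed

lemma cpow_uminus:
  assumes "r - s \<in> \<int>"
  shows "cpow (- z) r s = (-1) powi \<lfloor>r - s\<rfloor> * cpow z r s"
proof -
  have "(- z) powi k = (-1) powi k * z powi k" for k
    using power_int_mult_distrib[of "-1" z k] by simp
  then show ?thesis by (simp add: cpow_def)
qed

section \<open>Absolute convergence of binomial series\<close>

text \<open>Termwise |a - i| \<le> |a| + i, and the product of the |a| + i is, up to sign, the
  numerator of the binomial coefficient of -|a|. Hence the series of absolute values for the
  exponent a is dominated by the binomial series of
  \<open>(1 - x) powr (- \<bar>a\<bar>)\<close>.\<close>

lemma abs_gchoose_le: "\<bar>a gchoose m\<bar> \<le> (-1) ^ m * ((- \<bar>a\<bar>) gchoose m)" for a :: real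
proof -
  have e: "(-1) ^ m * ((- \<bar>a\<bar>) gchoose m) = (\<Prod>i<m. \<bar>a\<bar> + real i) / fact m"
  proof -
    have "(\<Prod>i<m. - \<bar>a\<bar> - real i) = (-1) ^ m * (\<Prod>i<m. \<bar>a\<bar> + real i)"
      by (induction m) (simp_all add: algebra_simps)
    then show ?thesis by (simp add: gbinomial_prod_rev atLeast0LessThan)
  qed
  have "\<bar>a gchoose m\<bar> = (\<Prod>i<m. \<bar>a - real i\<bar>) / fact m"
    by (simp add: gbinomial_prod_rev atLeast0LessThan abs_divide abs_prod)
  also have "\<dots> \<le> (\<Prod>i<m. \<bar>a\<bar> + real i) / fact m"
    by (intro divide_right_mono prod_mono) auto
  finally show ?thesis using e by simp
qed

text \<open>The explicit bound matters more than convergence: later the exponent runs over the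
  support of a whole series, and the cost of expanding has to be controlled for all exponents at
  once.\<close>

lemma binomial_norm_has_sum:
  fixes a x :: real
  assumes "0 \<le> x" "x < 1"
  shows "\<exists>M\<le>(1 - x) powr (- \<bar>a\<bar>). ((\<lambda>m. \<bar>a gchoose m\<bar> * x ^ m) has_sum M) UNIV"
proof -
  have s: "(\<lambda>m. ((- \<bar>a\<bar>) gchoose m) * (- x) ^ m) sums (1 + (- x)) powr (- \<bar>a\<bar>)"
    by (rule gen_binomial_real) (use assms in auto)
  have eq: "((- \<bar>a\<bar>) gchoose m) * (- x) ^ m = (-1) ^ m * ((- \<bar>a\<bar>) gchoose m) * x ^ m" for m
    by (simp add: power_minus[of x])
  have le: "\<bar>a gchoose m\<bar> * x ^ m \<le> ((- \<bar>a\<bar>) gchoose m) * (- x) ^ m" for m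
    unfolding eq using abs_gchoose_le[of a m] assms by (intro mult_right_mono) auto
  have sm: "summable (\<lambda>m. \<bar>a gchoose m\<bar> * x ^ m)"
    using le assms by (intro summable_comparison_test'[OF sums_summable[OF s]]) auto
  have hs: "((\<lambda>m. \<bar>a gchoose m\<bar> * x ^ m) has_sum (\<Sum>m. \<bar>a gchoose m\<bar> * x ^ m)) UNIV"
    using sm assms by (intro norm_summable_imp_has_sum summable_sums) auto
  moreover have "(\<Sum>m. \<bar>a gchoose m\<bar> * x ^ m) \<le> (1 - x) powr (- \<bar>a\<bar>)"
    using suminf_le[OF le sm sums_summable[OF s]] sums_unique[OF s] by simp
  ultimately show ?thesis by blast
qed

lemma has_sum_norm_summable:
  fixes f :: "'a \<Rightarrow> complex"
  assumes "(f has_sum a) A"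
  shows "(\<lambda>x. norm (f x)) summable_on A"
  using has_sum_imp_summable[OF assms] summable_on_iff_abs_summable_on_complex[of f A] by simp

lemma has_sum_product:
  fixes f :: "'a \<Rightarrow> complex" and g :: "'b \<Rightarrow> complex"
  assumes "(f has_sum a) A" "(g has_sum b) B"
  shows "((\<lambda>(x, y). f x * g y) has_sum (a * b)) (A \<times> B)"
proof -
  have f: "(\<lambda>x. norm (f x)) summable_on A" and g: "(\<lambda>x. norm (g x)) summable_on B"
    using assms by (auto intro: has_sum_norm_summable)
  have "(\<lambda>(x, y). norm (f x) * norm (g y)) summable_on A \<times> B"
    by (rule summable_on_SigmaI[where g = "\<lambda>x. norm (f x) * infsum (\<lambda>y. norm (g y)) B"])
       (use f g in \<open>auto intro!: has_sum_cmult_right summable_on_cmult_left\<close>)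
  then have "(\<lambda>z. norm (case z of (x, y) \<Rightarrow> f x * g y)) summable_on A \<times> B"
    by (simp add: case_prod_unfold norm_mult)
  then have "(\<lambda>(x, y). f x * g y) summable_on A \<times> B"
    by (rule abs_summable_summable)
  then show ?thesis
    by (rule has_sum_SigmaI[rotated 2])
       (use assms in \<open>auto intro!: has_sum_cmult_right has_sum_cmult_left\<close>)
qed


lemma norm_has_sum_product:
  fixes f :: "'a \<Rightarrow> real" and g :: "'b \<Rightarrow> real"
  assumes "(f has_sum a) A" "(g has_sum b) B" "\<And>x. 0 \<le> f x" "\<And>x. 0 \<le> g x"
  shows "((\<lambda>(x, y). f x * g y) has_sum (a * b)) (A \<times> B)"
proof (rule has_sum_SigmaI)
  show "(\<lambda>(x, y). f x * g y) summable_on A \<times> B"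
    by (rule summable_on_SigmaI[where g = "\<lambda>x. f x * b"])
       (use assms in \<open>auto intro!: has_sum_cmult_right summable_on_cmult_left dest: has_sum_imp_summable\<close>)
qed (use assms in \<open>auto intro!: has_sum_cmult_right has_sum_cmult_left\<close>)

lemma binomial_has_sum:
  assumes "norm x < 1" "a - b \<in> \<int>"
  shows "((\<lambda>(m, n). of_real (a gchoose m) * of_real (b gchoose n) * x ^ m * cnj x ^ n)
            has_sum cpow (1 + x) a b) UNIV"
    and "\<exists>M\<le>(1 - norm x) powr (- \<bar>a\<bar> - \<bar>b\<bar>).
         ((\<lambda>(m, n). norm (of_real (a gchoose m) * of_real (b gchoose n) * x ^ m * cnj x ^ n))
            has_sum M) UNIV"
proof -
  have one: "((\<lambda>m. of_real (c gchoose m) * y ^ m) has_sum (1 + y) powr of_real c) UNIV"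
    if y1: "norm y < 1" for c :: real and y :: complex
  proof (rule norm_summable_imp_has_sum)
    obtain M where "((\<lambda>m. \<bar>c gchoose m\<bar> * norm y ^ m) has_sum M) UNIV"
      using binomial_norm_has_sum[OF norm_ge_zero y1] by blast
    from has_sum_imp_sums[OF this] show "summable (\<lambda>m. norm (complex_of_real (c gchoose m) * y ^ m))"
      by (auto simp: norm_mult norm_power sums_iff)
    show "(\<lambda>m. complex_of_real (c gchoose m) * y ^ m) sums (1 + y) powr of_real c"
      using gen_binomial_complex[OF y1, of "of_real c"] by (simp add: gbinomial_prod_rev)
  qed
  have nx: "1 + x \<noteq> 0"
    using assms(1) by (metis add_eq_0_iff norm_minus_cancel norm_one order_less_irrefl)
  \<comment> \<open>The right half plane avoids the branch cut, so \<open>Ln\<close> commutes with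
    conjugation and the two principal powers combine into one \<open>cpow\<close>.\<close>
  have "\<bar>Re x\<bar> < 1" using abs_Re_le_cmod[of x] assms(1) by linarith
  then have re: "Re (1 + x) > 0" by simp
  have ln: "Ln (1 + cnj x) = cnj (Ln (1 + x))"
    using re cnj_Ln[of "1 + x"] by (force simp: complex_nonpos_Reals_iff)
  have "cnj x \<noteq> - 1" using nx by (metis add.right_inverse complex_cnj_cnj complex_cnj_minus complex_cnj_one)
  then have nx': "1 + cnj x \<noteq> 0" by (metis add_eq_0_iff)
  have "(1 + x) powr of_real a * (1 + cnj x) powr of_real b = cpow (exp (Ln (1 + x))) a b"
    using nx nx' assms(2) by (simp add: powr_def ln cpow_exp exp_add del: exp_Ln)
  also have "\<dots> = cpow (1 + x) a b" using nx by simp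
  finally show "((\<lambda>(m, n). of_real (a gchoose m) * of_real (b gchoose n) * x ^ m * cnj x ^ n)
            has_sum cpow (1 + x) a b) UNIV"
    using has_sum_product[OF one[of x a] one[of "cnj x" b]] assms(1) by (simp add: mult_ac UNIV_Times_UNIV)
  obtain M M' where M: "M \<le> (1 - norm x) powr (- \<bar>a\<bar>)" "((\<lambda>m. \<bar>a gchoose m\<bar> * norm x ^ m) has_sum M) UNIV"
    and M': "M' \<le> (1 - norm x) powr (- \<bar>b\<bar>)" "((\<lambda>m. \<bar>b gchoose m\<bar> * norm x ^ m) has_sum M') UNIV"
    using binomial_norm_has_sum[OF norm_ge_zero assms(1), of a]
      binomial_norm_has_sum[OF norm_ge_zero assms(1), of b] by blast
  have "M' \<ge> 0" using M'(2) by (rule has_sum_nonneg) auto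
  then have "M * M' \<le> (1 - norm x) powr (- \<bar>a\<bar>) * (1 - norm x) powr (- \<bar>b\<bar>)"
    using M(1) M'(1) by (intro mult_mono) auto
  also have "\<dots> = (1 - norm x) powr (- \<bar>a\<bar> - \<bar>b\<bar>)" by (simp flip: powr_add)
  finally show "\<exists>M\<le>(1 - norm x) powr (- \<bar>a\<bar> - \<bar>b\<bar>).
         ((\<lambda>(m, n). norm (of_real (a gchoose m) * of_real (b gchoose n) * x ^ m * cnj x ^ n))
            has_sum M) UNIV"
    using norm_has_sum_product[OF M(2) M'(2)]
    by (auto simp: norm_mult norm_power mult_ac UNIV_Times_UNIV)
qed

section \<open>Evaluation of monomials\<close>

text \<open>Vanishing coordinates are skipped because \<open>cpow 0 0 0\<close> is 0 and not 1,
  owing to \<open>0 powr 0 = 0\<close>. With this convention a point with z4 = 0 can be inserted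
  into a series that does not involve z4, and no monomial ever evaluates to 0, so coefficients can
  be recovered from values.\<close>

definition mon :: "(nat \<Rightarrow> complex) \<Rightarrow> expo \<Rightarrow> complex" where
  "mon z e = (\<Prod>i | i \<in> {1..4} \<and> z i \<noteq> 0. cpow (z i) (fst (e i)) (snd (e i)))"

definition expos :: "nat set \<Rightarrow> expo set" where
  "expos K = {e. (\<forall>i. i \<notin> K \<longrightarrow> e i = 0) \<and> (\<forall>i. fst (e i) - snd (e i) \<in> \<int>)}"

lemma mon_add:
  assumes "d \<in> expos K" "e \<in> expos L"
  shows "mon z (expo_add d e) = mon z d * mon z e"
  using assms unfolding mon_def expo_add_def expos_def
  by (simp add: cpow_add flip: prod.distrib)

lemma mon_cong: "(\<And>i. i \<in> {1..4} \<Longrightarrow> e i \<noteq> 0 \<Longrightarrow> z i = z' i) \<Longrightarrow>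
  (\<And>i. i \<in> {1..4} \<Longrightarrow> e i \<noteq> 0 \<Longrightarrow> z i \<noteq> 0) \<Longrightarrow> mon z e = mon z' e"
proof -
  assume a: "\<And>i. i \<in> {1..4} \<Longrightarrow> e i \<noteq> 0 \<Longrightarrow> z i = z' i"
    "\<And>i. i \<in> {1..4} \<Longrightarrow> e i \<noteq> 0 \<Longrightarrow> z i \<noteq> 0"
  have *: "mon y e = (\<Prod>i | i \<in> {1..4} \<and> e i \<noteq> 0. cpow (y i) (fst (e i)) (snd (e i)))"
    if "\<And>i. i \<in> {1..4} \<Longrightarrow> e i \<noteq> 0 \<Longrightarrow> y i \<noteq> 0" for y
    unfolding mon_def by (rule prod.mono_neutral_right) (use that in \<open>auto simp: cpow_0 zero_prod_def\<close>)
  show ?thesis using a by (subst (1 2) *) (auto intro!: prod.cong)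
qed

lemma mon_nonzero: "mon z e \<noteq> 0"
  by (auto simp: mon_def cpow_nonzero)

lemma expos_mono: "K \<subseteq> L \<Longrightarrow> expos K \<subseteq> expos L"
  by (auto simp: expos_def)

lemma expos_zero: "(\<lambda>_. 0) \<in> expos K" "(\<lambda>_. (0, 0)) \<in> expos K"
  by (auto simp: expos_def zero_prod_def)

lemma expos_add:
  assumes "d \<in> expos K" "e \<in> expos K" shows "expo_add d e \<in> expos K"
proof -
  have "fst (d i) + fst (e i) - (snd (d i) + snd (e i)) \<in> \<int>" for i
    using Ints_add[of "fst (d i) - snd (d i)" "fst (e i) - snd (e i)"] assms
    by (simp add: expos_def algebra_simps)
  then show ?thesis using assms by (auto simp: expos_def expo_add_def)
qed

lemma pw_expos: "i \<in> K \<Longrightarrow> r - s \<in> \<int> \<Longrightarrow> pw i r s \<in> expos K"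
  by (auto simp: pw_def expos_def zero_prod_def)

lemma mon_pw:
  assumes "i \<in> {1..4}" "z i \<noteq> 0 \<or> r = 0 \<and> s = 0"
  shows "mon z (pw i r s) = (if r = 0 \<and> s = 0 then 1 else cpow (z i) r s)"
proof -
  have "mon z (pw i r s) = (\<Prod>k\<in>{k. k = i \<and> z i \<noteq> 0}. cpow (z k) r s)"
    unfolding mon_def pw_def
    by (rule prod.mono_neutral_cong_right) (use assms in \<open>auto simp: cpow_0\<close>)
  also have "\<dots> = (if z i \<noteq> 0 then cpow (z i) r s else 1)"
    by auto
  finally show ?thesis using assms(2) by (auto simp: cpow_0)
qed

section \<open>Absolutely convergent evaluation of formal series\<close>

text \<open>A bound M on the sum of absolute values travels together with the value. It is needed to
  sum infinitely many expansions, one for each power of the cross ratio; an inequality is used since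
  only upper bounds are computed explicitly.\<close>

definition conv :: "(nat \<Rightarrow> complex) \<Rightarrow> series \<Rightarrow> complex \<Rightarrow> real \<Rightarrow> bool" where
  "conv z A a M \<longleftrightarrow> ((\<lambda>e. A e * mon z e) has_sum a) UNIV \<and>
     (\<exists>M'\<le>M. ((\<lambda>e. norm (A e * mon z e)) has_sum M') UNIV)"

lemma conv_mono: "conv z A a M \<Longrightarrow> M \<le> M' \<Longrightarrow> conv z A a M'"
  unfolding conv_def by (meson order_trans)

lemma conv_monomial: "conv z (monomial d) (mon z d) (norm (mon z d))"
proof -
  have "((\<lambda>e. monomial d e * mon z e) has_sum mon z d) UNIV"
    by (rule has_sum_finite_neutralI[of "{d}"]) (auto simp: monomial_def)
  moreover have "((\<lambda>e. norm (monomial d e * mon z e)) has_sum norm (mon z d)) UNIV"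
    by (rule has_sum_finite_neutralI[of "{d}"]) (auto simp: monomial_def)
  ultimately show ?thesis unfolding conv_def by blast
qed

text \<open>Fubini for the double family over i and e. Summing over e first gives the values
  \<open>a i\<close>; summing over i first is a finite sum for each e and gives the coefficients of
  F. The weighted bounds make the double family absolutely summable.\<close>

lemma family_conv:
  fixes A :: "'i \<Rightarrow> series"
  assumes cv: "\<And>i. c i \<noteq> 0 \<Longrightarrow> conv z (A i) (a i) (M i)"
    and sm: "(\<lambda>i. norm (c i) * M i) summable_on UNIV"
    and fin: "\<And>e. finite {i. c i * A i e \<noteq> 0}"
    and F: "\<And>e. F e = (\<Sum>i | c i * A i e \<noteq> 0. c i * A i e)"
    and s: "((\<lambda>i. c i * a i) has_sum s) UNIV"
  shows "conv z F s (infsum (\<lambda>i. norm (c i) * M i) UNIV)"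
proof -
  define g where "g = (\<lambda>(i, e). c i * (A i e * mon z e))"
  have inner: "((\<lambda>e. g (i, e)) has_sum c i * a i) UNIV" for i
    using cv[of i] by (cases "c i = 0") (auto simp: g_def conv_def intro: has_sum_cmult_right)
  define m where "m = (\<lambda>i. infsum (\<lambda>e. norm (g (i, e))) UNIV)"
  have innern: "((\<lambda>e. norm (g (i, e))) has_sum m i) UNIV \<and> m i \<le> norm (c i) * M i" for i
  proof (cases "c i = 0")
    case False
    then obtain M' where M': "M' \<le> M i" "((\<lambda>e. norm (A i e * mon z e)) has_sum M') UNIV"
      using cv by (auto simp: conv_def)
    have "((\<lambda>e. norm (g (i, e))) has_sum norm (c i) * M') UNIV"
      using has_sum_cmult_right[OF M'(2), of "norm (c i)"] by (simp add: g_def norm_mult mult_ac)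
    then show ?thesis using M'(1) by (simp add: m_def infsumI mult_left_mono)
  qed (simp add: g_def m_def)
  have m0: "0 \<le> m i" for i using has_sum_nonneg[of "\<lambda>e. norm (g (i, e))" UNIV "m i"] innern by auto
  have msum: "m summable_on UNIV"
    by (rule summable_on_comparison_test[OF sm]) (use innern m0 in auto)
  have gn: "(\<lambda>x. norm (g x)) summable_on UNIV \<times> UNIV"
    by (rule summable_on_SigmaI[where g = m]) (use innern msum in auto)
  have gs: "g summable_on UNIV \<times> UNIV" using gn by (rule abs_summable_summable)
  have hs: "(g has_sum s) (UNIV \<times> UNIV)"
    by (rule has_sum_SigmaI[OF _ s]) (use inner gs in auto)
  have hn: "((\<lambda>x. norm (g x)) has_sum infsum m UNIV) (UNIV \<times> UNIV)"
    by (rule has_sum_SigmaI[where g = m]) (use innern msum gn in auto)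
  have swap: "bij_betw prod.swap (UNIV \<times> UNIV) (UNIV \<times> UNIV)"
    by (auto intro!: bij_betwI[where g = prod.swap])
  have hs': "((\<lambda>x. g (prod.swap x)) has_sum s) (UNIV \<times> UNIV)"
    using hs has_sum_reindex_bij_betw[OF swap, of g s] by simp
  have hn': "((\<lambda>x. norm (g (prod.swap x))) has_sum infsum m UNIV) (UNIV \<times> UNIV)"
    using hn has_sum_reindex_bij_betw[OF swap, of "\<lambda>x. norm (g x)"] by simp
  have Fe: "((\<lambda>i. g (prod.swap (e, i))) has_sum F e * mon z e) UNIV" for e
    unfolding F sum_distrib_right
    by (rule has_sum_finite_neutralI[OF fin[of e]]) (auto simp: g_def mult_ac)
  have Fn: "((\<lambda>i. norm (g (prod.swap (e, i)))) has_sum (\<Sum>i | c i * A i e \<noteq> 0. norm (c i * A i e * mon z e))) UNIV" for e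
    by (rule has_sum_finite_neutralI[OF fin[of e]]) (auto simp: g_def mult_ac)
  have 1: "((\<lambda>e. F e * mon z e) has_sum s) UNIV"
    using has_sum_SigmaD[OF hs'] Fe by simp
  have 2: "((\<lambda>e. \<Sum>i | c i * A i e \<noteq> 0. norm (c i * A i e * mon z e)) has_sum infsum m UNIV) UNIV"
    using has_sum_SigmaD[OF hn'] Fn by simp
  have le: "norm (F e * mon z e) \<le> (\<Sum>i | c i * A i e \<noteq> 0. norm (c i * A i e * mon z e))" for e
    unfolding F sum_distrib_right by (rule norm_sum)
  have 3: "(\<lambda>e. norm (F e * mon z e)) summable_on UNIV"
    by (rule summable_on_comparison_test[OF has_sum_imp_summable[OF 2]]) (use le in auto)
  have "infsum (\<lambda>e. norm (F e * mon z e)) UNIV \<le> infsum m UNIV"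
    using infsum_mono[OF 3 has_sum_imp_summable[OF 2] le] infsumI[OF 2] by simp
  also have "\<dots> \<le> infsum (\<lambda>i. norm (c i) * M i) UNIV"
    using infsum_mono[OF msum sm] innern by blast
  finally show ?thesis unfolding conv_def using 1 has_sum_infsum[OF 3] by blast
qed

lemma formal_sum_conv:
  assumes fin: "\<And>e. finite {k. m k = e \<and> c k \<noteq> 0}"
    and s: "((\<lambda>k. c k * mon z (m k)) has_sum s) UNIV"
  shows "conv z (formal_sum c m) s (infsum (\<lambda>k. norm (c k * mon z (m k))) UNIV)"
proof -
  have eq: "{k. c k * monomial (m k) e \<noteq> 0} = {k. m k = e \<and> c k \<noteq> 0}" for e
    by (auto simp: monomial_def)
  have "(\<lambda>k. norm (c k * mon z (m k))) summable_on UNIV"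
    using s by (rule has_sum_norm_summable)
  then have "conv z (formal_sum c m) s (infsum (\<lambda>k. norm (c k) * norm (mon z (m k))) UNIV)"
    by (intro family_conv[where A = "\<lambda>k. monomial (m k)", OF conv_monomial])
       (use fin s in \<open>simp_all only: eq, auto simp: formal_sum_def norm_mult monomial_def intro!: sum.cong\<close>)
  then show ?thesis by (simp add: norm_mult)
qed

section \<open>Weights and finiteness of formal products\<close>

text \<open>A weight on the variables under which every extra factor z_j / z_i of an expansion
  raises the grade. Supports with only finitely many exponents below each level are closed under
  addition, as for a valuation, and their products have finite coefficient sums.\<close>

definition grade :: "(nat \<Rightarrow> real) \<Rightarrow> expo \<Rightarrow> real" where
  "grade w e = (\<Sum>i\<in>{1..4}. w i * (fst (e i) + snd (e i)))"

definition locfin :: "(nat \<Rightarrow> real) \<Rightarrow> expo set \<Rightarrow> bool" where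
  "locfin w S \<longleftrightarrow> (\<forall>c. finite {e \<in> S. grade w e \<le> c})"

definition bdd_from :: "(nat \<Rightarrow> real) \<Rightarrow> real \<Rightarrow> expo set \<Rightarrow> bool" where
  "bdd_from w c S \<longleftrightarrow> (\<forall>e\<in>S. c \<le> grade w e)"

definition expo_plus :: "expo set \<Rightarrow> expo set \<Rightarrow> expo set" where
  "expo_plus S T = {expo_add d e | d e. d \<in> S \<and> e \<in> T}"

definition supp :: "series \<Rightarrow> expo set" where
  "supp A = {e. A e \<noteq> 0}"

lemma grade_add: "grade w (expo_add d e) = grade w d + grade w e"
  by (simp add: grade_def expo_add_def algebra_simps sum.distrib)

lemma grade_pw: "i \<in> {1..4} \<Longrightarrow> grade w (pw i r s) = w i * (r + s)"
proof -
  assume i: "i \<in> {1..4}"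
  have "grade w (pw i r s) = (\<Sum>k\<in>{1..4}. if k = i then w i * (r + s) else 0)"
    unfolding grade_def pw_def by (rule sum.cong) auto
  also have "\<dots> = w i * (r + s)" using i by (simp only: sum.delta finite_atLeastAtMost if_True)
  finally show ?thesis .
qed

lemma grade_0: "grade w (\<lambda>_. 0) = 0" "grade w (\<lambda>_. (0, 0)) = 0"
  by (simp_all add: grade_def)

lemma locfin_bdd: assumes "locfin w S" obtains c where "bdd_from w c S"
proof -
  have fin: "finite {e \<in> S. grade w e \<le> 0}" using assms by (auto simp: locfin_def)
  \<comment> \<open>Inserting 0 covers the case that no exponent has non-positive grade, and bounds
    the exponents of positive grade as well.\<close>
  define c where "c = Min (insert 0 (grade w ` {e \<in> S. grade w e \<le> 0}))"
  have "bdd_from w c S"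
    unfolding bdd_from_def
  proof
    fix e assume e: "e \<in> S"
    show "c \<le> grade w e"
    proof (cases "grade w e \<le> 0")
      case True
      then show ?thesis unfolding c_def using fin e by (intro Min_le) auto
    next
      case False
      have "c \<le> 0" unfolding c_def using fin by (intro Min_le) auto
      then show ?thesis using False by linarith
    qed
  qed
  then show ?thesis by (rule that)
qed

text \<open>The grade of d is at most that of e minus the lower bound c, which leaves finitely many
  d; and d' is determined by d and e.\<close>

lemma finite_fibre:
  assumes "locfin w S" "bdd_from w c T"
  shows "finite {(d, d'). d \<in> S \<and> d' \<in> T \<and> expo_add d d' = e}"
proof (rule finite_imageD[of fst])
  have "fst ` {(d, d'). d \<in> S \<and> d' \<in> T \<and> expo_add d d' = e} \<subseteq> {d \<in> S. grade w d \<le> grade w e - c}"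
    using assms(2) by (force simp: bdd_from_def grade_add)
  then show "finite (fst ` {(d, d'). d \<in> S \<and> d' \<in> T \<and> expo_add d d' = e})"
    using assms(1) by (auto simp: locfin_def intro: finite_subset)
  show "inj_on fst {(d, d'). d \<in> S \<and> d' \<in> T \<and> expo_add d d' = e}"
    by (auto simp: inj_on_def expo_add_def fun_eq_iff) (metis add_left_cancel)
qed

lemma locfin_plus:
  assumes "locfin w S" "locfin w T"
  shows "locfin w (expo_plus S T)"
  unfolding locfin_def
proof
  fix c
  obtain a where a: "bdd_from w a S" using assms(1) by (rule locfin_bdd)
  obtain b where b: "bdd_from w b T" using assms(2) by (rule locfin_bdd)
  have "{e \<in> expo_plus S T. grade w e \<le> c} \<subseteq>
     (\<lambda>(d, e). expo_add d e) ` ({e \<in> S. grade w e \<le> c - b} \<times> {e \<in> T. grade w e \<le> c - a})"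
    using a b by (force simp: expo_plus_def bdd_from_def grade_add)
  then show "finite {e \<in> expo_plus S T. grade w e \<le> c}"
    by (rule finite_subset) (use assms in \<open>auto simp: locfin_def\<close>)
qed

lemma bdd_plus: "bdd_from w a S \<Longrightarrow> bdd_from w b T \<Longrightarrow> bdd_from w (a + b) (expo_plus S T)"
  by (force simp: bdd_from_def expo_plus_def grade_add)

lemma expo_plus_expos: "S \<subseteq> expos K \<Longrightarrow> T \<subseteq> expos K \<Longrightarrow> expo_plus S T \<subseteq> expos K"
  by (auto simp: expo_plus_def intro!: expos_add)

lemma supp_mult: "supp A \<subseteq> S \<Longrightarrow> supp B \<subseteq> T \<Longrightarrow> supp (A \<odot> B) \<subseteq> expo_plus S T"
proof
  fix e assume st: "supp A \<subseteq> S" "supp B \<subseteq> T" and "e \<in> supp (A \<odot> B)"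
  then have "(\<Sum>k | (case k of (d, e) \<Rightarrow> expo_add d e) = e \<and> (case k of (d, e) \<Rightarrow> A d * B e) \<noteq> 0. case k of (d, e) \<Rightarrow> A d * B e) \<noteq> 0"
    by (simp add: supp_def series_mult_def formal_sum_def)
  then obtain d d' where "expo_add d d' = e" "A d * B d' \<noteq> 0"
    by (auto elim!: sum.not_neutral_contains_not_neutral)
  then show "e \<in> expo_plus S T" using st by (auto simp: expo_plus_def supp_def)
qed

text \<open>The index set of the sum depends only on the bounding sets S and T, not on the
  coefficients. When A and B vary with a point z, the index set stays fixed, and analyticity in z
  passes to the coefficients of the product.\<close>

lemma mult_eq:
  assumes "locfin w S" "bdd_from w c T" "supp A \<subseteq> S" "supp B \<subseteq> T"
  shows "(A \<odot> B) e = (\<Sum>(d, d') \<in> {(d, d'). d \<in> S \<and> d' \<in> T \<and> expo_add d d' = e}. A d * B d')"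
  unfolding series_mult_def formal_sum_def
  by (rule sum.mono_neutral_cong_left[OF finite_fibre[OF assms(1,2)]])
     (use assms(3,4) in \<open>auto simp: supp_def\<close>)

lemma mult_conv:
  assumes "locfin w S" "bdd_from w c T" "supp A \<subseteq> S" "supp B \<subseteq> T"
    and "S \<subseteq> expos K" "T \<subseteq> expos K"
    and A: "conv z A a M" and B: "conv z B b N"
  shows "conv z (A \<odot> B) (a * b) (M * N)"
proof -
  obtain M' where M': "M' \<le> M" "((\<lambda>e. norm (A e * mon z e)) has_sum M') UNIV"
    using A by (auto simp: conv_def)
  obtain N' where N': "N' \<le> N" "((\<lambda>e. norm (B e * mon z e)) has_sum N') UNIV"
    using B by (auto simp: conv_def)
  let ?c = "\<lambda>(d, e). A d * B e" and ?m = "\<lambda>(d, e). expo_add d e"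
  have eq: "?c k * mon z (?m k) = (case k of (d, e) \<Rightarrow> (A d * mon z d) * (B e * mon z e))" for k
  proof (cases k)
    case (Pair d e)
    have "A d * B e \<noteq> 0 \<Longrightarrow> mon z (expo_add d e) = mon z d * mon z e"
      by (rule mon_add[of _ K _ K]) (use assms(3-6) in \<open>auto simp: supp_def\<close>)
    then show ?thesis using Pair by auto
  qed
  have 1: "((\<lambda>k. ?c k * mon z (?m k)) has_sum a * b) UNIV"
    unfolding eq using has_sum_product[of "\<lambda>e. A e * mon z e" UNIV a "\<lambda>e. B e * mon z e" UNIV b] A B
    by (simp add: conv_def UNIV_Times_UNIV)
  have 2: "((\<lambda>k. norm (?c k * mon z (?m k))) has_sum M' * N') UNIV"
    unfolding eq using norm_has_sum_product[OF M'(2) N'(2)]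
    by (simp add: UNIV_Times_UNIV case_prod_unfold norm_mult)
  have fin: "finite {k. ?m k = e \<and> ?c k \<noteq> 0}" for e
    by (rule finite_subset[OF _ finite_fibre[OF assms(1,2), of e]]) (use assms(3,4) in \<open>auto simp: supp_def\<close>)
  have "conv z (A \<odot> B) (a * b) (M' * N')"
    using formal_sum_conv[OF fin 1] infsumI[OF 2] by (simp add: series_mult_def)
  moreover have "0 \<le> M'" "0 \<le> N'"
    using has_sum_nonneg[OF M'(2)] has_sum_nonneg[OF N'(2)] by auto
  ultimately show ?thesis
    using M'(1) N'(1) by (elim conv_mono) (intro mult_mono, auto)
qed

lemma holomorphic_infsum:
  fixes f :: "'i \<Rightarrow> complex \<Rightarrow> complex"
  assumes S: "open S" and hol: "\<And>i. i \<in> I \<Longrightarrow> f i holomorphic_on S"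
    and le: "\<And>i x. i \<in> I \<Longrightarrow> x \<in> S \<Longrightarrow> norm (f i x) \<le> M i"
    and M: "M summable_on I"
  shows "(\<lambda>x. infsum (\<lambda>i. f i x) I) holomorphic_on S"
proof -
  have "(\<lambda>x. infsum (\<lambda>i. f i x) I) field_differentiable at x within S" if x: "x \<in> S" for x
  proof -
    obtain r where r: "r > 0" "cball x r \<subseteq> S" using S x by (meson open_contains_cball)
    have ul: "uniform_limit (cball x r) (\<lambda>X y. \<Sum>i\<in>X. f i y) (\<lambda>y. infsum (\<lambda>i. f i y) I) (finite_subsets_at_top I)"
      by (rule Weierstrass_m_test_general[OF _ M]) (use le r in auto)
    have ev: "eventually (\<lambda>X. continuous_on (cball x r) (\<lambda>y. \<Sum>i\<in>X. f i y) \<and>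
        (\<lambda>y. \<Sum>i\<in>X. f i y) holomorphic_on ball x r) (finite_subsets_at_top I)"
    proof (rule eventually_finite_subsets_at_top_weakI, intro conjI)
      fix X assume "finite X" "X \<subseteq> I"
      then have h: "(\<lambda>y. \<Sum>i\<in>X. f i y) holomorphic_on S" using hol by (auto intro!: holomorphic_on_sum)
      show "continuous_on (cball x r) (\<lambda>y. \<Sum>i\<in>X. f i y)"
        using holomorphic_on_imp_continuous_on[OF h] r(2) by (rule continuous_on_subset)
      show "(\<lambda>y. \<Sum>i\<in>X. f i y) holomorphic_on ball x r"
        using h by (rule holomorphic_on_subset) (use r(2) ball_subset_cball in blast)
    qed
    have "(\<lambda>y. infsum (\<lambda>i. f i y) I) holomorphic_on ball x r"
      by (rule holomorphic_uniform_limit[OF ev ul]) auto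
    then show ?thesis using r(1)
      by (meson centre_in_ball field_differentiable_at_within holomorphic_on_imp_differentiable_at open_ball)
  qed
  then show ?thesis by (simp add: holomorphic_on_def)
qed

section \<open>Functions that are analytic along real lines\<close>

text \<open>The functions depend on z and on its conjugate, so holomorphy fails; but on a real line
  they are restrictions of holomorphic functions of the line parameter. This one-parameter form of
  real analyticity suffices for continuation and survives all operations used, conjugation
  included.\<close>

definition la :: "((nat \<Rightarrow> complex) \<Rightarrow> complex) \<Rightarrow> (nat \<Rightarrow> complex) \<Rightarrow> bool" where
  "la g z \<longleftrightarrow> (\<forall>d. \<exists>\<epsilon>>0. \<exists>H. H holomorphic_on ball 0 \<epsilon> \<and>
     (\<forall>t. \<bar>t\<bar> < \<epsilon> \<longrightarrow> g (\<lambda>i. z i + of_real t * d i) = H (of_real t)))"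

lemma la_const: "la (\<lambda>_. c) z"
  unfolding la_def by (auto intro!: exI[of _ 1] exI[of _ "\<lambda>_. c"] holomorphic_intros)

lemma la_coord: "la (\<lambda>z. z i) z"
  unfolding la_def
proof
  fix d
  have "(\<lambda>t. z i + t * d i) holomorphic_on ball 0 1" by (intro holomorphic_intros)
  then show "\<exists>\<epsilon>>0. \<exists>H. H holomorphic_on ball 0 \<epsilon> \<and>
     (\<forall>t. \<bar>t\<bar> < \<epsilon> \<longrightarrow> z i + of_real t * d i = H (of_real t))"
    by (intro exI[of _ 1] conjI exI[of _ "\<lambda>t. z i + t * d i"]) auto
qed

lemma la_binop:
  assumes "la f z" "la g z"
    and "\<And>\<epsilon> F G. F holomorphic_on ball 0 \<epsilon> \<Longrightarrow> G holomorphic_on ball 0 \<epsilon> \<Longrightarrow>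
           (\<lambda>t. b (F t) (G t)) holomorphic_on ball 0 \<epsilon>"
  shows "la (\<lambda>z. b (f z) (g z)) z"
  unfolding la_def
proof
  fix d
  obtain \<epsilon> F where F: "\<epsilon> > 0" "F holomorphic_on ball 0 \<epsilon>"
    "\<And>t. \<bar>t\<bar> < \<epsilon> \<Longrightarrow> f (\<lambda>i. z i + of_real t * d i) = F (of_real t)"
    using assms(1) unfolding la_def by metis
  obtain \<delta> G where G: "\<delta> > 0" "G holomorphic_on ball 0 \<delta>"
    "\<And>t. \<bar>t\<bar> < \<delta> \<Longrightarrow> g (\<lambda>i. z i + of_real t * d i) = G (of_real t)"
    using assms(2) unfolding la_def by metis
  have "F holomorphic_on ball 0 (min \<epsilon> \<delta>)" "G holomorphic_on ball 0 (min \<epsilon> \<delta>)"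
    using F(2) G(2) by (auto elim!: holomorphic_on_subset)
  then show "\<exists>\<epsilon>>0. \<exists>H. H holomorphic_on ball 0 \<epsilon> \<and>
     (\<forall>t. \<bar>t\<bar> < \<epsilon> \<longrightarrow> b (f (\<lambda>i. z i + of_real t * d i)) (g (\<lambda>i. z i + of_real t * d i)) = H (of_real t))"
    by (intro exI[of _ "min \<epsilon> \<delta>"] conjI exI[of _ "\<lambda>t. b (F t) (G t)"] assms(3))
       (use F G in auto)
qed

lemma la_add: "la f z \<Longrightarrow> la g z \<Longrightarrow> la (\<lambda>z. f z + g z) z"
  by (rule la_binop) (auto intro!: holomorphic_intros)

lemma la_diff: "la f z \<Longrightarrow> la g z \<Longrightarrow> la (\<lambda>z. f z - g z) z"
  by (rule la_binop) (auto intro!: holomorphic_intros)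

lemma la_mult: "la f z \<Longrightarrow> la g z \<Longrightarrow> la (\<lambda>z. f z * g z) z"
  by (rule la_binop) (auto intro!: holomorphic_intros)

lemma la_power: "la f z \<Longrightarrow> la (\<lambda>z. f z ^ n) z"
  by (rule la_binop[of f z f "\<lambda>x _. x ^ n"]) (auto intro!: holomorphic_intros)

lemma la_sum: "(\<And>i. i \<in> I \<Longrightarrow> la (f i) z) \<Longrightarrow> la (\<lambda>z. \<Sum>i\<in>I. f i z) z"
  by (induction I rule: infinite_finite_induct) (auto intro: la_const la_add)

lemma la_prod: "(\<And>i. i \<in> I \<Longrightarrow> la (f i) z) \<Longrightarrow> la (\<lambda>z. \<Prod>i\<in>I. f i z) z"
  by (induction I rule: infinite_finite_induct) (auto intro: la_const la_mult)

lemma la_transfer: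
  assumes "la f z" "\<And>d. \<exists>\<epsilon>>0. \<forall>t::real. \<bar>t\<bar> < \<epsilon> \<longrightarrow>
      g (\<lambda>i. z i + of_real t * d i) = f (\<lambda>i. z i + of_real t * d i)"
  shows "la g z"
  unfolding la_def
proof
  fix d
  obtain \<epsilon> F where F: "\<epsilon> > 0" "F holomorphic_on ball 0 \<epsilon>"
    "\<And>t. \<bar>t\<bar> < \<epsilon> \<Longrightarrow> f (\<lambda>i. z i + of_real t * d i) = F (of_real t)"
    using assms(1) unfolding la_def by metis
  obtain \<delta> where G: "\<delta> > 0"
    "\<And>t::real. \<bar>t\<bar> < \<delta> \<Longrightarrow> g (\<lambda>i. z i + of_real t * d i) = f (\<lambda>i. z i + of_real t * d i)"
    using assms(2) by metis
  have "F holomorphic_on ball 0 (min \<epsilon> \<delta>)"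
    using F(2) by (auto elim!: holomorphic_on_subset)
  then show "\<exists>\<epsilon>>0. \<exists>H. H holomorphic_on ball 0 \<epsilon> \<and>
     (\<forall>t. \<bar>t\<bar> < \<epsilon> \<longrightarrow> g (\<lambda>i. z i + of_real t * d i) = H (of_real t))"
    by (intro exI[of _ "min \<epsilon> \<delta>"] conjI exI[of _ F]) (use F G in auto)
qed

lemma la_linear:
  assumes "la g (T z)" "\<And>d t. T (\<lambda>i. z i + of_real t * d i) = (\<lambda>i. T z i + of_real t * L d i)"
  shows "la (\<lambda>z. g (T z)) z"
  using assms(1) unfolding la_def assms(2) by blast

text \<open>Along a line, \<open>cnj \<circ> f\<close> extends holomorphically by Schwarz reflection.\<close>
lemma reflected_holomorphic:
  assumes "F holomorphic_on ball 0 \<epsilon>"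
  shows "(\<lambda>t. cnj (F (cnj t))) holomorphic_on ball 0 \<epsilon>"
proof -
  have "cnj ` ball 0 \<epsilon> = ball 0 \<epsilon>"
    by (auto simp: image_iff intro!: bexI[of _ "cnj _"])
  then have "(cnj \<circ> F \<circ> cnj) holomorphic_on ball 0 \<epsilon>"
    using holomorphic_on_compose_cnj_cnj[of F "ball 0 \<epsilon>"] assms by simp
  then show ?thesis by (simp add: o_def)
qed

lemma la_cnj: assumes "la f z" shows "la (\<lambda>z. cnj (f z)) z"
  unfolding la_def
proof
  fix d
  obtain \<epsilon> F where F: "\<epsilon> > 0" "F holomorphic_on ball 0 \<epsilon>"
    "\<And>t. \<bar>t\<bar> < \<epsilon> \<Longrightarrow> f (\<lambda>i. z i + of_real t * d i) = F (of_real t)"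
    using assms unfolding la_def by metis
  show "\<exists>\<epsilon>>0. \<exists>H. H holomorphic_on ball 0 \<epsilon> \<and>
     (\<forall>t. \<bar>t\<bar> < \<epsilon> \<longrightarrow> cnj (f (\<lambda>i. z i + of_real t * d i)) = H (of_real t))"
    by (intro exI[of _ \<epsilon>] conjI exI[of _ "\<lambda>t. cnj (F (cnj t))"] reflected_holomorphic)
       (use F in auto)
qed

text \<open>G is the polarization of g: x and its conjugate become independent variables. Along a
  line f extends holomorphically, and so does its conjugate by reflection; substituting both
  extensions into G gives the required function on a smaller disc.\<close>

lemma la_compose2:
  assumes "la f z" and S: "open S" "(f z, cnj (f z)) \<in> S"
    and G: "\<And>\<epsilon> X Y. X holomorphic_on ball 0 \<epsilon> \<Longrightarrow> Y holomorphic_on ball 0 \<epsilon> \<Longrightarrow>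
      (\<And>t. t \<in> ball 0 \<epsilon> \<Longrightarrow> (X t, Y t) \<in> S) \<Longrightarrow> (\<lambda>t. G (X t) (Y t)) holomorphic_on ball 0 \<epsilon>"
    and g: "\<And>x. (x, cnj x) \<in> S \<Longrightarrow> g x = G x (cnj x)"
  shows "la (\<lambda>z. g (f z)) z"
  unfolding la_def
proof
  fix d
  obtain \<epsilon> F where F: "\<epsilon> > 0" "F holomorphic_on ball 0 \<epsilon>"
    "\<And>t. \<bar>t\<bar> < \<epsilon> \<Longrightarrow> f (\<lambda>i. z i + of_real t * d i) = F (of_real t)"
    using assms(1) unfolding la_def by metis
  let ?Y = "\<lambda>t. cnj (F (cnj t))"
  have Y: "?Y holomorphic_on ball 0 \<epsilon>" by (rule reflected_holomorphic[OF F(2)])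
  have F0: "F 0 = f z" using F(3)[of 0] F(1) by simp
  have "continuous_on (ball 0 \<epsilon>) (\<lambda>t. (F t, ?Y t))"
    using F(2) Y by (intro continuous_on_Pair holomorphic_on_imp_continuous_on)
  then have op: "open ((\<lambda>t. (F t, ?Y t)) -` S \<inter> ball 0 \<epsilon>)"
    using S(1) by (metis continuous_on_open_vimage open_ball)
  moreover have "0 \<in> (\<lambda>t. (F t, ?Y t)) -` S \<inter> ball 0 \<epsilon>" using F0 S(2) F(1) by simp
  ultimately obtain \<delta> where \<delta>: "\<delta> > 0" "ball 0 \<delta> \<subseteq> (\<lambda>t. (F t, ?Y t)) -` S \<inter> ball 0 \<epsilon>"
    by (metis open_contains_ball_eq)
  have "(\<lambda>t. G (F t) (?Y t)) holomorphic_on ball 0 \<delta>"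
    by (rule G) (use \<delta> in \<open>auto intro: holomorphic_on_subset[OF F(2)] holomorphic_on_subset[OF Y]\<close>)
  moreover have "g (f (\<lambda>i. z i + of_real t * d i)) = G (F (of_real t)) (?Y (of_real t))" if "\<bar>t\<bar> < \<delta>" for t
  proof -
    have t: "of_real t \<in> ball (0 :: complex) \<delta>" using that by simp
    then have "of_real t \<in> ball (0 :: complex) \<epsilon>" "(F (of_real t), ?Y (of_real t)) \<in> S" using \<delta> by blast+
    then show ?thesis using F(3)[of t] g by simp
  qed
  ultimately show "\<exists>\<epsilon>>0. \<exists>H. H holomorphic_on ball 0 \<epsilon> \<and>
     (\<forall>t. \<bar>t\<bar> < \<epsilon> \<longrightarrow> g (f (\<lambda>i. z i + of_real t * d i)) = H (of_real t))"
    using \<delta>(1) by blast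
qed

lemma la_inverse: assumes "la f z" "f z \<noteq> 0" shows "la (\<lambda>z. inverse (f z)) z"
proof (rule la_compose2[OF assms(1), of "(- {0}) \<times> UNIV" "\<lambda>x y. inverse x"])
  show "open ((- {0 :: complex}) \<times> (UNIV :: complex set))" by (intro open_Times) auto
  show "(\<lambda>t. inverse (X t)) holomorphic_on ball 0 \<epsilon>"
    if "X holomorphic_on ball 0 \<epsilon>" "\<And>t. t \<in> ball 0 \<epsilon> \<Longrightarrow> (X t, Y t) \<in> (- {0}) \<times> UNIV" for X Y \<epsilon>
    using that by (auto intro!: holomorphic_intros)
qed (use assms in auto)

lemma la_divide: "la f z \<Longrightarrow> la g z \<Longrightarrow> g z \<noteq> 0 \<Longrightarrow> la (\<lambda>z. f z / g z) z"
  unfolding divide_inverse by (intro la_mult la_inverse)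

text \<open>The power of the modulus has the polarization exp (s Ln (x y)), which is |x| to the
  power 2 s when y is the conjugate of x. There x y is positive, and the open condition Re (x y) > 0
  keeps \<open>Ln\<close> off its cut.\<close>

lemma la_cpow: assumes "la f z" "f z \<noteq> 0" shows "la (\<lambda>z. cpow (f z) r s) z"
proof (rule la_compose2[OF assms(1), where g = "\<lambda>x. cpow x r s" and S = "{(x, y). x \<noteq> 0 \<and> Re (x * y) > 0}"
      and G = "\<lambda>x y. x powi \<lfloor>r - s\<rfloor> * exp (of_real s * Ln (x * y))"])
  have "{(x, y). x \<noteq> 0 \<and> Re (x * y) > 0} = {p :: complex \<times> complex. fst p \<noteq> 0} \<inter> {p. Re (fst p * snd p) > 0}"
    by auto
  moreover have "open {p :: complex \<times> complex. fst p \<noteq> 0}"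
    by (intro open_Collect_neq continuous_intros)
  moreover have "open {p :: complex \<times> complex. Re (fst p * snd p) > 0}"
    by (intro open_Collect_less continuous_intros)
  ultimately show "open {(x, y). (x :: complex) \<noteq> 0 \<and> Re (x * y) > 0}" by auto
  have re: "x * cnj x = of_real ((norm x)\<^sup>2)" for x by (simp add: complex_norm_square[symmetric])
  have re': "Re (x * cnj x) > 0" if "x \<noteq> 0" for x :: complex
    using that unfolding re by simp
  show "(f z, cnj (f z)) \<in> {(x, y). x \<noteq> 0 \<and> Re (x * y) > 0}" using assms(2) re'[OF assms(2)] by blast
  show "cpow x r s = x powi \<lfloor>r - s\<rfloor> * exp (of_real s * Ln (x * cnj x))"
    if "(x, cnj x) \<in> {(x, y). x \<noteq> 0 \<and> Re (x * y) > 0}" for x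
  proof -
    have "x \<noteq> 0" using that by simp
    then have "Ln (x * cnj x) = of_real (ln ((norm x)\<^sup>2))"
      unfolding re by (subst Ln_of_real) auto
    also have "\<dots> = of_real (2 * ln (norm x))" using \<open>x \<noteq> 0\<close> by (simp add: ln_realpow)
    finally have "exp (of_real s * Ln (x * cnj x)) = of_real (exp (s * (2 * ln (norm x))))"
      by (simp flip: exp_of_real)
    then show ?thesis using \<open>x \<noteq> 0\<close> by (simp add: cpow_def powr_def mult_ac)
  qed
  show "(\<lambda>t. X t powi \<lfloor>r - s\<rfloor> * exp (of_real s * Ln (X t * Y t))) holomorphic_on ball 0 \<epsilon>"
    if "X holomorphic_on ball 0 \<epsilon>" "Y holomorphic_on ball 0 \<epsilon>"
      "\<And>t. t \<in> ball 0 \<epsilon> \<Longrightarrow> (X t, Y t) \<in> {(x, y). x \<noteq> 0 \<and> Re (x * y) > 0}" for X Y \<epsilon>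
  proof -
    have "X t * Y t \<notin> \<real>\<^sub>\<le>\<^sub>0" "X t \<noteq> 0" if "t \<in> ball 0 \<epsilon>" for t
      using \<open>\<And>t. t \<in> ball 0 \<epsilon> \<Longrightarrow> (X t, Y t) \<in> {(x, y). x \<noteq> 0 \<and> Re (x * y) > 0}\<close>[OF that]
      by (auto simp: complex_nonpos_Reals_iff)
    then show ?thesis using that(1,2) by (intro holomorphic_intros) auto
  qed
qed

section \<open>The identity theorem\<close>

text \<open>At the supremum \<open>s0\<close> of the initial interval of zeros the local holomorphic
  extension vanishes on points accumulating at its centre, hence identically, so the zeros continue
  past \<open>s0\<close>.\<close>

lemma real_line_identity:
  fixes k :: "real \<Rightarrow> complex"
  assumes loc: "\<And>t. t \<in> {0..1} \<Longrightarrow> \<exists>\<epsilon>>0. \<exists>H. H holomorphic_on ball 0 \<epsilon> \<and>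
      (\<forall>s. \<bar>s\<bar> < \<epsilon> \<longrightarrow> k (t + s) = H (of_real s))"
    and "\<eta> > 0" and zero: "\<And>t. 0 \<le> t \<Longrightarrow> t < \<eta> \<Longrightarrow> k t = 0"
  shows "k 1 = 0"
proof -
  define S where "S = {t \<in> {0..1}. \<forall>s\<in>{0..t}. k s = 0}"
  define s0 where "s0 = Sup S"
  have "k s = 0" if "s \<in> {0..min (\<eta> / 2) 1}" for s
    by (rule zero) (use that \<open>\<eta> > 0\<close> in auto)
  moreover have "min (\<eta> / 2) 1 \<in> {0..1}" using \<open>\<eta> > 0\<close> by auto
  ultimately have m: "min (\<eta> / 2) 1 \<in> S" unfolding S_def by blast
  have bdd: "bdd_above S" by (rule bdd_aboveI[of _ 1]) (auto simp: S_def)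
  have "min (\<eta> / 2) 1 \<le> s0" unfolding s0_def by (rule cSup_upper[OF m bdd])
  then have s0_pos: "s0 > 0" using \<open>\<eta> > 0\<close> by linarith
  have s0_le: "s0 \<le> 1" unfolding s0_def
  proof (rule cSup_least)
    show "S \<noteq> {}" using m by blast
  qed (simp add: S_def)
  have below: "k s = 0" if s: "0 \<le> s" "s < s0" for s
  proof -
    obtain t where "t \<in> S" "s < t" using s(2) m less_cSup_iff[OF _ bdd, of s] unfolding s0_def by blast
    then show ?thesis using s(1) by (auto simp: S_def)
  qed
  obtain \<epsilon> H where H: "\<epsilon> > 0" "H holomorphic_on ball 0 \<epsilon>" "\<And>s. \<bar>s\<bar> < \<epsilon> \<Longrightarrow> k (s0 + s) = H (of_real s)"
    using loc[of s0] s0_pos s0_le by auto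
  \<comment> \<open>Only parameters to the left of \<open>s0\<close> are known to be zeros, hence
    the minus sign.\<close>
  define U where "U = (\<lambda>s. complex_of_real (- s)) ` {0<..<min \<epsilon> s0}"
  have U0: "0 islimpt U"
    unfolding islimpt_approachable
  proof (intro allI impI)
    fix e :: real assume "e > 0"
    define s where "s = min e (min \<epsilon> s0) / 2"
    have "s > 0" "s < e" "s < min \<epsilon> s0" using \<open>e > 0\<close> H(1) s0_pos by (auto simp: s_def)
    then show "\<exists>x'\<in>U. x' \<noteq> 0 \<and> dist x' 0 < e"
      by (intro bexI[of _ "of_real (- s)"]) (auto simp: U_def)
  qed
  have Hz: "H w = 0" if "w \<in> ball 0 \<epsilon>" for w
  proof (rule analytic_continuation[OF H(2) open_ball connected_ball _ _ U0 _ that])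
    show "U \<subseteq> ball 0 \<epsilon>" by (auto simp: U_def)
    show "(0::complex) \<in> ball 0 \<epsilon>" using H(1) by simp
    fix z assume "z \<in> U"
    then obtain s where "0 < s" "s < \<epsilon>" "s < s0" "z = of_real (- s)" by (auto simp: U_def)
    then show "H z = 0" using H(3)[of "- s"] below[of "s0 - s"] by simp
  qed
  have near: "k t = 0" if "\<bar>t - s0\<bar> < \<epsilon>" for t
    using H(3)[of "t - s0"] Hz[of "of_real (t - s0)"] that by (simp flip: of_real_diff)
  have "s0 = 1"
  proof (rule ccontr)
    assume "s0 \<noteq> 1"
    then have "s0 < 1" using s0_le by simp
    define t where "t = min 1 (s0 + \<epsilon> / 2)"
    have t: "s0 < t" "t \<le> 1" "t < s0 + \<epsilon>" using \<open>s0 < 1\<close> H(1) by (auto simp: t_def)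
    have "k s = 0" if "0 \<le> s" "s \<le> t" for s
      using below[of s] near[of s] that t by (cases "s < s0") auto
    then have "t \<in> S" using t s0_pos by (auto simp: S_def)
    then have "t \<le> s0" unfolding s0_def using bdd by (rule cSup_upper)
    then show False using t by simp
  qed
  then show ?thesis using near[of 1] H(1) by simp
qed

text \<open>The interior of the zero set is also closed in U: if a ball inside U meets it, each
  point of the ball is the end of a segment starting in an open set of zeros, and
  \<open>real_line_identity\<close> applies along that segment. Connectedness of U then finishes the
  argument.\<close>

lemma plane_identity:
  fixes h :: "complex \<Rightarrow> complex"
  assumes U: "open U" "connected U" and W: "open W" "W \<subseteq> U" "W \<noteq> {}" "\<And>x. x \<in> W \<Longrightarrow> h x = 0"
    and loc: "\<And>x c. x \<in> U \<Longrightarrow> \<exists>\<epsilon>>0. \<exists>H. H holomorphic_on ball 0 \<epsilon> \<and>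
      (\<forall>t. \<bar>t\<bar> < \<epsilon> \<longrightarrow> h (x + of_real t * c) = H (of_real t))"
    and x: "x \<in> U"
  shows "h x = 0"
proof -
  define Z where "Z = interior {x \<in> U. h x = 0}"
  have ballZ: "ball p r \<subseteq> Z" if b: "ball p r \<subseteq> U" and q: "q \<in> Z" "q \<in> ball p r" for p q r
  proof -
    have "h y = 0" if y: "y \<in> ball p r" for y
    proof -
      have seg: "q + of_real t * (y - q) \<in> ball p r" if "t \<in> {0..1}" for t :: real
      proof -
        have "q + of_real t * (y - q) = (1 - t) *\<^sub>R q + t *\<^sub>R y" by (simp add: scaleR_conv_of_real algebra_simps)
        then show ?thesis using convexD[OF convex_ball q(2) y, of "1 - t" t] that by simp
      qed
      obtain e where e: "e > 0" "ball q e \<subseteq> Z" using q(1) unfolding Z_def by (meson open_contains_ball open_interior)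
      \<comment> \<open>The length of the initial stretch on which h is already known to vanish; the
        summand 1 avoids a zero denominator for y = q.\<close>
      define \<eta> where "\<eta> = e / (1 + norm (y - q))"
      have \<eta>: "\<eta> > 0" using e(1) by (simp add: \<eta>_def add_pos_nonneg)
      have "h (q + of_real 1 * (y - q)) = 0"
      proof (rule real_line_identity[where k = "\<lambda>t. h (q + of_real t * (y - q))", OF _ \<eta>])
        fix t :: real assume t: "0 \<le> t" "t < \<eta>"
        have "t * (1 + norm (y - q)) < e" using t(2) by (simp add: \<eta>_def pos_less_divide_eq add_pos_nonneg)
        then have "t * norm (y - q) < e" using t(1) by (simp add: algebra_simps)
        then have "q + of_real t * (y - q) \<in> ball q e" using t(1) by (simp add: dist_norm norm_mult)
        then show "h (q + of_real t * (y - q)) = 0" using e(2) unfolding Z_def using interior_subset by blast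
      next
        fix t :: real assume "t \<in> {0..1}"
        then have "q + of_real t * (y - q) \<in> U" using seg b by blast
        from loc[OF this, of "y - q"]
        show "\<exists>\<epsilon>>0. \<exists>H. H holomorphic_on ball 0 \<epsilon> \<and>
            (\<forall>s. \<bar>s\<bar> < \<epsilon> \<longrightarrow> h (q + of_real (t + s) * (y - q)) = H (of_real s))"
          by (simp add: algebra_simps)
      qed
      then show ?thesis by simp
    qed
    then show ?thesis unfolding Z_def using b by (intro interior_maximal) auto
  qed
  have "open (U - Z)"
    unfolding open_contains_ball
  proof
    fix p assume p: "p \<in> U - Z"
    then obtain r where r: "r > 0" "ball p r \<subseteq> U" using U(1) by (meson DiffD1 open_contains_ball)
    then have "ball p r \<inter> Z = {}" using ballZ[OF r(2)] p by (metis DiffD2 IntE centre_in_ball equals0I subsetD)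
    then show "\<exists>r>0. ball p r \<subseteq> U - Z" using r by blast
  qed
  moreover have "open Z" by (simp add: Z_def)
  moreover have "W \<subseteq> Z" unfolding Z_def by (rule interior_maximal) (use W in auto)
  moreover have "Z \<subseteq> U" unfolding Z_def using interior_subset by blast
  ultimately have "U - Z = {}"
    using connectedD[OF U(2), of Z "U - Z"] W(2,3) by blast
  then show ?thesis using x interior_subset unfolding Z_def by blast
qed

text \<open>The complex line through \<open>x0\<close> and y is used rather than the real segment:
  deleting finitely many parameters leaves a plane connected but may cut a segment.\<close>

lemma identity_theorem:
  assumes thin: "\<And>x y. x \<in> D \<Longrightarrow> y \<in> D \<Longrightarrow> finite {l. (\<lambda>i. x i + l * (y i - x i)) \<notin> D}"
    and la: "\<And>z. z \<in> D \<Longrightarrow> la g z"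
    and x0: "x0 \<in> D" and y: "y \<in> D"
    and near: "\<And>d. \<exists>\<epsilon>>0. \<forall>l. norm l < \<epsilon> \<longrightarrow> g (\<lambda>i. x0 i + l * d i) = 0"
  shows "g y = 0"
proof -
  let ?p = "\<lambda>l i. x0 i + l * (y i - x0 i)"
  define U where "U = - {l. ?p l \<notin> D}"
  have fin: "finite {l. ?p l \<notin> D}" by (rule thin[OF x0 y])
  have U: "open U" "connected U"
    unfolding U_def using fin
    by (auto intro!: open_Compl finite_imp_closed path_connected_imp_connected
        path_connected_complement_countable intro: countable_finite)
  obtain \<epsilon> where e: "\<epsilon> > 0" "\<And>l. norm l < \<epsilon> \<Longrightarrow> g (?p l) = 0" using near[of "\<lambda>i. y i - x0 i"] by blast
  have 0: "0 \<in> U" "1 \<in> U" using x0 y by (auto simp: U_def)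
  have "g (?p 1) = 0"
  proof (rule plane_identity[OF U, of "U \<inter> ball 0 \<epsilon>" "\<lambda>l. g (?p l)"])
    show "U \<inter> ball 0 \<epsilon> \<noteq> {}" using 0 e(1) by auto
    fix l c assume "l \<in> U"
    then have "la g (?p l)" using la by (auto simp: U_def)
    moreover have "?p (l + of_real t * c) = (\<lambda>i. ?p l i + of_real t * (c * (y i - x0 i)))" for t
      by (simp add: algebra_simps)
    ultimately show "\<exists>\<epsilon>>0. \<exists>H. H holomorphic_on ball 0 \<epsilon> \<and>
      (\<forall>t. \<bar>t\<bar> < \<epsilon> \<longrightarrow> g (?p (l + of_real t * c)) = H (of_real t))"
      unfolding la_def by simp
  qed (use U 0 e in auto)
  then show ?thesis by simp
qed

section \<open>Uniqueness of absolutely convergent expansions\<close>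

text \<open>Averaging over the sample times t = n h turns each exponential into the mean of a
  geometric progression, which tends to 0 unless its ratio is 1. This is the Bohr mean of a
  trigonometric polynomial in sampled form.\<close>

lemma trig_poly_mean:
  fixes c :: "'i \<Rightarrow> complex" and l :: "'i \<Rightarrow> real"
  assumes F: "finite F" and le: "\<And>t. norm (\<Sum>i\<in>F. c i * cis (l i * t)) \<le> \<epsilon>"
  shows "norm (\<Sum>i | i \<in> F \<and> l i = 0. c i) \<le> \<epsilon>"
proof -
  \<comment> \<open>The step is so small that |l i h| \<le> 1 < 2 \<pi>, so no nonzero frequency is
    aliased to 0.\<close>
  define h where "h = 1 / (1 + (\<Sum>i\<in>F. \<bar>l i\<bar>))"
  have pos: "1 + (\<Sum>i\<in>F. \<bar>l i\<bar>) > 0" by (intro add_pos_nonneg sum_nonneg) auto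
  define q where "q = (\<lambda>i. cis (l i * h))"
  have q1: "q i \<noteq> 1" if i: "i \<in> F" "l i \<noteq> 0" for i
  proof
    assume "q i = 1"
    then have "cos (l i * h) = 1" by (simp add: q_def complex_eq_iff)
    then obtain n :: int where n: "l i * h = n * 2 * pi" by (auto simp: cos_one_2pi_int)
    have "\<bar>l i\<bar> \<le> (\<Sum>i\<in>F. \<bar>l i\<bar>)" using F i(1) by (intro member_le_sum) auto
    then have "\<bar>l i * h\<bar> \<le> 1" using pos by (simp add: h_def abs_mult divide_simps)
    then have "\<bar>real_of_int n\<bar> * (2 * pi) \<le> 1" by (simp add: n abs_mult)
    moreover have "2 * pi > 1" using pi_gt3 by simp
    ultimately have "\<bar>real_of_int n\<bar> < 1"
    proof -
      have "\<bar>real_of_int n\<bar> \<le> \<bar>real_of_int n\<bar> / (2 * pi) * (2 * pi)" by simp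
      also have "\<dots> \<le> 1 / (2 * pi)"
        using \<open>\<bar>real_of_int n\<bar> * (2 * pi) \<le> 1\<close> \<open>2 * pi > 1\<close> by (simp add: pos_le_divide_eq)
      also have "\<dots> < 1" using \<open>2 * pi > 1\<close> by simp
      finally show ?thesis .
    qed
    then have "n = 0" by linarith
    then have "l i * h = 0" using n by simp
    then show False using i(2) pos by (simp add: h_def)
  qed
  define m where "m = (\<lambda>N::nat. \<Sum>i\<in>F. c i * ((\<Sum>n<N. q i ^ n) / of_nat N))"
  have mle: "norm (m N) \<le> \<epsilon>" if "N > 0" for N
  proof -
    have "m N = (\<Sum>n<N. \<Sum>i\<in>F. c i * cis (l i * (real n * h))) / of_nat N"
      unfolding m_def q_def
      by (subst sum.swap) (simp add: sum_divide_distrib sum_distrib_left Complex.DeMoivre mult_ac)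
    also have "norm \<dots> = norm (\<Sum>n<N. \<Sum>i\<in>F. c i * cis (l i * (real n * h))) / real N"
      by (simp add: norm_divide)
    also have "\<dots> \<le> (\<Sum>n<N. \<epsilon>) / real N"
      by (intro divide_right_mono order_trans[OF norm_sum] sum_mono le) auto
    finally show ?thesis using that by simp
  qed
  have lim: "(\<lambda>N. (\<Sum>n<N. q i ^ n) / of_nat N) \<longlonglongrightarrow> (if l i = 0 then 1 else 0)" if i: "i \<in> F" for i
  proof (cases "l i = 0")
    case True
    have "eventually (\<lambda>N. (\<Sum>n<N. q i ^ n) / of_nat N = 1) sequentially"
      using eventually_gt_at_top[of 0] by eventually_elim (simp add: q_def True)
    then show ?thesis using True by (simp add: tendsto_eventually)
  next
    case False
    have nq: "q i \<noteq> 1" using q1 i False by blast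
    have b: "norm ((\<Sum>n<N. q i ^ n) / of_nat N) \<le> (2 / norm (1 - q i)) * (1 / real N)" for N
    proof -
      have "norm (1 - q i ^ N) \<le> 2"
        using norm_triangle_ineq4[of 1 "q i ^ N"] by (simp add: q_def norm_power)
      then have "norm (1 - q i ^ N) / norm (1 - q i) / real N \<le> 2 / norm (1 - q i) / real N"
        by (intro divide_right_mono) auto
      then show ?thesis using nq by (simp add: sum_gp_strict norm_divide norm_mult)
    qed
    have "(\<lambda>N. (2 / norm (1 - q i)) * (1 / real N)) \<longlonglongrightarrow> 0"
      by (intro tendsto_mult_right_zero lim_1_over_n)
    then have "(\<lambda>N. (\<Sum>n<N. q i ^ n) / of_nat N) \<longlonglongrightarrow> 0"
      by (rule Lim_null_comparison[rotated]) (use b in simp)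
    then show ?thesis using False by simp
  qed
  have "m \<longlonglongrightarrow> (\<Sum>i\<in>F. c i * (if l i = 0 then 1 else 0))"
    unfolding m_def by (intro tendsto_sum tendsto_mult tendsto_const lim)
  moreover have "eventually (\<lambda>N. norm (m N) \<le> \<epsilon>) sequentially"
    using eventually_gt_at_top[of 0] by eventually_elim (rule mle)
  ultimately have "norm (\<Sum>i\<in>F. c i * (if l i = 0 then 1 else 0)) \<le> \<epsilon>"
    by (rule Lim_norm_ubound[OF sequentially_bot])
  also have "(\<Sum>i\<in>F. c i * (if l i = 0 then 1 else 0)) = (\<Sum>i | i \<in> F \<and> l i = 0. c i)"
    using F by (simp add: sum.inter_filter if_distrib cong: if_cong)
  finally show ?thesis .
qed

text \<open>A finite part F carries all but \<epsilon> of the absolute sum. The polynomial over F is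
  then bounded by \<epsilon> for every t, \<open>trig_poly_mean\<close> bounds its part of frequency
  zero, and the neglected terms of frequency zero cost another \<epsilon>.\<close>

lemma trig_series_mean:
  fixes c :: "'i \<Rightarrow> complex" and l :: "'i \<Rightarrow> real"
  assumes z: "\<And>t. ((\<lambda>i. c i * cis (l i * t)) has_sum 0) I"
  shows "(c has_sum 0) {i \<in> I. l i = 0}"
proof -
  have c: "(c has_sum 0) I" using z[of 0] by simp
  note cn = has_sum_norm_summable[OF c]
  have sub: "c summable_on J" if "J \<subseteq> I" for J
    using summable_on_subset_banach[OF has_sum_imp_summable[OF c] that] .
  let ?J = "{i \<in> I. l i = 0}"
  have small: "norm (infsum c ?J) \<le> 2 * \<epsilon>" if "\<epsilon> > 0" for \<epsilon>
  proof -
    define T where "T = infsum (\<lambda>i. norm (c i)) I"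
    obtain F where F: "finite F" "F \<subseteq> I" "dist (\<Sum>i\<in>F. norm (c i)) T \<le> \<epsilon>"
      using has_sum_finite_approximation[OF has_sum_infsum[OF cn] \<open>\<epsilon> > 0\<close>] unfolding T_def by blast
    have tail: "((\<lambda>i. norm (c i)) has_sum (T - (\<Sum>i\<in>F. norm (c i)))) (I - F)"
      unfolding T_def using F by (intro has_sum_Diff has_sum_infsum cn has_sum_finite) auto
    have bound: "norm x \<le> \<epsilon>" if "(g has_sum x) J" "J \<subseteq> I - F" "\<And>i. norm (g i) = norm (c i)" for g :: "'i \<Rightarrow> complex" and x J
    proof -
      have s: "(\<lambda>i. norm (c i)) summable_on J"
        using summable_on_subset_banach[OF has_sum_imp_summable[OF tail] that(2)] .
      have "norm x \<le> infsum (\<lambda>i. norm (c i)) J"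
        using norm_infsum_bound[of g J] s infsumI[OF that(1)] that(3) by simp
      also have "\<dots> \<le> T - (\<Sum>i\<in>F. norm (c i))"
        using infsum_mono2[OF s has_sum_imp_summable[OF tail] that(2)] infsumI[OF tail] by simp
      also have "\<dots> \<le> \<epsilon>" using F(3) by (simp add: dist_real_def)
      finally show ?thesis .
    qed
    have "norm (\<Sum>i\<in>F. c i * cis (l i * t)) \<le> \<epsilon>" for t
    proof -
      have "((\<lambda>i. c i * cis (l i * t)) has_sum (0 - (\<Sum>i\<in>F. c i * cis (l i * t)))) (I - F)"
        using F by (intro has_sum_Diff z has_sum_finite) auto
      then have "norm (0 - (\<Sum>i\<in>F. c i * cis (l i * t))) \<le> \<epsilon>"
        by (rule bound) (auto simp: norm_mult)
      then show ?thesis by simp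
    qed
    from trig_poly_mean[OF F(1) this] have 1: "norm (\<Sum>i | i \<in> F \<and> l i = 0. c i) \<le> \<epsilon>" .
    have "(c has_sum (infsum c ?J - (\<Sum>i | i \<in> F \<and> l i = 0. c i))) (?J - {i. i \<in> F \<and> l i = 0})"
      using F by (intro has_sum_Diff has_sum_infsum sub has_sum_finite) auto
    then have "norm (infsum c ?J - (\<Sum>i | i \<in> F \<and> l i = 0. c i)) \<le> \<epsilon>"
      by (rule bound) auto
    then show ?thesis using 1 norm_triangle_sub[of "infsum c ?J" "\<Sum>i | i \<in> F \<and> l i = 0. c i"] by linarith
  qed
  have "norm (infsum c ?J) \<le> 0"
    by (rule field_le_epsilon) (use small[of "_ / 2"] in auto)
  then show ?thesis using has_sum_infsum[OF sub[of ?J]] by auto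
qed

text \<open>One coordinate at a time: multiplication by \<open>cis (- v k * t)\<close> moves the
  frequency \<open>v k\<close> to 0, and \<open>trig_series_mean\<close> then restricts the index
  set to the terms with that frequency.\<close>

lemma trig_series_coefficients:
  fixes c :: "'i \<Rightarrow> complex" and l :: "'i \<Rightarrow> 'k \<Rightarrow> real"
  assumes "finite K" "\<And>u. ((\<lambda>i. c i * cis (\<Sum>k\<in>K. u k * l i k)) has_sum 0) I"
  shows "(c has_sum 0) {i \<in> I. \<forall>k\<in>K. l i k = v k}"
  using assms
proof (induction K arbitrary: c I rule: finite_induct)
  case empty
  then show ?case by simp
next
  case (insert k K)
  have "((\<lambda>i. c i * cis (\<Sum>j\<in>K. u j * l i j)) has_sum 0) {i \<in> I. l i k - v k = 0}" for u
  proof (rule trig_series_mean)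
    fix t
    have "((\<lambda>i. cis (- v k * t) * (c i * cis (\<Sum>j\<in>insert k K. (u(k := t)) j * l i j))) has_sum cis (- v k * t) * 0) I"
      by (intro has_sum_cmult_right insert.prems)
    moreover have "(\<Sum>j\<in>insert k K. (u(k := t)) j * l i j) = t * l i k + (\<Sum>j\<in>K. u j * l i j)" for i
    proof -
      have "(\<Sum>j\<in>K. (u(k := t)) j * l i j) = (\<Sum>j\<in>K. u j * l i j)"
        by (rule sum.cong) (use insert.hyps(2) in auto)
      then show ?thesis using insert.hyps by simp
    qed
    ultimately show "((\<lambda>i. c i * cis (\<Sum>j\<in>K. u j * l i j) * cis ((l i k - v k) * t)) has_sum 0) I"
      by (simp add: cis_mult algebra_simps)
  qed
  from insert.IH[OF this] have "(c has_sum 0) {i \<in> {i \<in> I. l i k - v k = 0}. \<forall>k\<in>K. l i k = v k}" .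
  also have "{i \<in> {i \<in> I. l i k - v k = 0}. \<forall>k\<in>K. l i k = v k} = {i \<in> I. \<forall>j\<in>insert k K. l i j = v j}"
    by auto
  finally show ?case .
qed

text \<open>The angles \<theta> make the differences of the exponents of z and its conjugate
  oscillate, while the moduli only produce real exponentials in their sums. Continuing the parameter
  of the moduli holomorphically to an imaginary value turns these into oscillations too. Sums and
  differences, which together determine the exponent, are then separated as frequencies.\<close>

lemma expansion_unique:
  assumes C: "supp C \<subseteq> expos W" and W: "W \<subseteq> {1..4}" and z: "\<And>i. i \<in> W \<Longrightarrow> z i \<noteq> 0" and "\<eta> > 0"
    and hs: "\<And>t \<theta>. (\<And>i. i \<in> W \<Longrightarrow> \<bar>t i\<bar> < \<eta>) \<Longrightarrow>
       ((\<lambda>e. C e * mon (\<lambda>i. if i \<in> W then z i * exp (of_real (t i) + \<i> * of_real (\<theta> i)) else z i) e) has_sum 0) UNIV"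
  shows "C = (\<lambda>_. 0)"
proof -
  define sg where "sg = (\<lambda>(e :: expo) i. fst (e i) + snd (e i))"
  define df where "df = (\<lambda>(e :: expo) i. fst (e i) - snd (e i))"
  have finW: "finite W" using W finite_subset by blast
  have m: "mon (\<lambda>i. if i \<in> W then z i * exp (of_real (t i) + \<i> * of_real (\<theta> i)) else z i) e =
      mon z e * exp (of_real (\<Sum>i\<in>W. t i * sg e i)) * cis (\<Sum>i\<in>W. \<theta> i * df e i)"
    if e: "e \<in> expos W" for t \<theta> e
  proof -
    have red: "mon y e = (\<Prod>i\<in>W. cpow (y i) (fst (e i)) (snd (e i)))" if "\<And>i. i \<in> W \<Longrightarrow> y i \<noteq> 0" for y
      unfolding mon_def by (rule prod.mono_neutral_right) (use e W that in \<open>auto simp: expos_def cpow_0\<close>)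
    have "cpow (z i * exp (of_real (t i) + \<i> * of_real (\<theta> i))) (fst (e i)) (snd (e i)) =
       cpow (z i) (fst (e i)) (snd (e i)) * (exp (of_real (t i * sg e i)) * cis (\<theta> i * df e i))"
      if "i \<in> W" for i
    proof -
      have int: "fst (e i) - snd (e i) \<in> \<int>" using e by (auto simp: expos_def)
      have "of_real (fst (e i)) * (of_real (t i) + \<i> * of_real (\<theta> i)) +
         of_real (snd (e i)) * cnj (of_real (t i) + \<i> * of_real (\<theta> i)) =
         of_real (t i * sg e i) + \<i> * of_real (\<theta> i * df e i)"
        by (simp add: sg_def df_def algebra_simps)
      then show ?thesis
        by (subst cpow_mult[OF z[OF that] exp_not_eq_zero int], subst cpow_exp[OF int])
           (simp only: exp_add cis_conv_exp)
    qed
    then have "mon (\<lambda>i. if i \<in> W then z i * exp (of_real (t i) + \<i> * of_real (\<theta> i)) else z i) e =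
       (\<Prod>i\<in>W. cpow (z i) (fst (e i)) (snd (e i)) * (exp (of_real (t i * sg e i)) * cis (\<theta> i * df e i)))"
      by (subst red) (use z in \<open>auto intro!: prod.cong\<close>)
    also have "\<dots> = mon z e * (exp (\<Sum>i\<in>W. of_real (t i * sg e i)) * exp (\<Sum>i\<in>W. \<i> * of_real (\<theta> i * df e i)))"
      by (simp only: prod.distrib red[OF z] exp_sum[OF finW] cis_conv_exp)
    also have "(\<Sum>i\<in>W. \<i> * of_real (\<theta> i * df e i)) = \<i> * complex_of_real (\<Sum>i\<in>W. \<theta> i * df e i)"
      by (simp add: sum_distrib_left)
    finally show ?thesis by (simp only: of_real_sum cis_conv_exp mult.assoc)
  qed
  have m': "C e * mon (\<lambda>i. if i \<in> W then z i * exp (of_real (t i) + \<i> * of_real (\<theta> i)) else z i) e =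
      C e * mon z e * exp (of_real (\<Sum>i\<in>W. t i * sg e i)) * cis (\<Sum>i\<in>W. \<theta> i * df e i)" for t \<theta> e
    using m[of e t \<theta>] C by (cases "C e = 0") (auto simp: supp_def)
  have main: "((\<lambda>e. C e * mon z e * cis (\<Sum>i\<in>W. u i * sg e i) * cis (\<Sum>i\<in>W. \<theta> i * df e i)) has_sum 0) UNIV" for u \<theta>
  proof -
    \<comment> \<open>B exceeds every |u i|, so the vector x u stays in the admissible box as long
      as |x| < \<eta> / B.\<close>
    define B where "B = 1 + (\<Sum>i\<in>W. \<bar>u i\<bar>)"
    have B: "B > 0" "\<bar>u i\<bar> < B" if "i \<in> W" for i
      using member_le_sum[of i W "\<lambda>i. \<bar>u i\<bar>"] finW that by (simp_all add: B_def)
    have Bp: "B > 0" by (simp add: B_def sum_nonneg add_pos_nonneg)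
    define \<rho> where "\<rho> = \<eta> / B"
    have \<rho>: "\<rho> > 0" using Bp \<open>\<eta> > 0\<close> by (simp add: \<rho>_def)
    define c where "c = (\<lambda>e. C e * mon z e * cis (\<Sum>i\<in>W. \<theta> i * df e i))"
    define s where "s = (\<lambda>e. \<Sum>i\<in>W. u i * sg e i)"
    have realz: "((\<lambda>e. c e * exp (of_real (x * s e))) has_sum 0) UNIV" if "\<bar>x\<bar> < \<rho>" for x
    proof -
      have "\<bar>x * u i\<bar> < \<eta>" if "i \<in> W" for i
      proof -
        have "\<bar>x\<bar> * \<bar>u i\<bar> \<le> \<bar>x\<bar> * B" using B(2)[OF that] by (intro mult_left_mono) auto
        also have "\<dots> < \<rho> * B" using \<open>\<bar>x\<bar> < \<rho>\<close> Bp by simp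
        also have "\<dots> = \<eta>" using Bp by (simp add: \<rho>_def)
        finally show ?thesis by (simp add: abs_mult)
      qed
      from hs[of "\<lambda>i. x * u i" \<theta>, OF this]
      show ?thesis unfolding m' by (simp add: c_def s_def sum_distrib_left mult_ac)
    qed
    \<comment> \<open>In the strip each exponential is dominated by the sum of its values at the two
      real points \<rho> / 2 and -\<rho> / 2, where absolute convergence is known.\<close>
    define M where "M = (\<lambda>e. norm (c e * exp (of_real ((\<rho> / 2) * s e))) + norm (c e * exp (of_real ((- \<rho> / 2) * s e))))"
    have M: "M summable_on UNIV"
      unfolding M_def using \<rho> by (intro summable_on_add has_sum_norm_summable[OF realz]) auto
    define S where "S = {x :: complex. \<bar>Re x\<bar> < \<rho> / 2}"
    have S_eq: "S = {x. Re x < \<rho> / 2} \<inter> {x. - (\<rho> / 2) < Re x}" by (auto simp: S_def)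
    have "open S" unfolding S_eq by (intro open_Int open_Collect_less continuous_intros)
    have "convex S" unfolding S_eq
      using convex_halfspace_Re_lt[of "\<rho> / 2"] convex_halfspace_Re_gt[of "- (\<rho> / 2)"] by (intro convex_Int) auto
    have le: "norm (c e * exp (x * of_real (s e))) \<le> M e" if "x \<in> S" for x e
    proof -
      have "Re x * s e \<le> \<bar>Re x\<bar> * \<bar>s e\<bar>" using abs_ge_self[of "Re x * s e"] by (simp only: abs_mult)
      also have "\<dots> \<le> (\<rho> / 2) * \<bar>s e\<bar>" using that by (intro mult_right_mono) (auto simp: S_def)
      finally have "exp (Re x * s e) \<le> exp ((\<rho> / 2) * \<bar>s e\<bar>)" by simp
      also have "\<dots> \<le> exp ((\<rho> / 2) * s e) + exp ((- \<rho> / 2) * s e)"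
        by (cases "s e \<ge> 0") simp_all
      finally have "norm (c e) * exp (Re x * s e) \<le> norm (c e) * (exp ((\<rho> / 2) * s e) + exp ((- \<rho> / 2) * s e))"
        by (rule mult_left_mono) auto
      then show ?thesis by (simp add: M_def norm_mult algebra_simps)
    qed
    define F where "F = (\<lambda>x. infsum (\<lambda>e. c e * exp (x * of_real (s e))) UNIV)"
    have F: "F holomorphic_on S"
      unfolding F_def by (rule holomorphic_infsum[OF \<open>open S\<close> _ le M]) (auto intro!: holomorphic_intros)
    define U where "U = complex_of_real ` {0 <..< \<rho> / 2}"
    have U0: "0 islimpt U"
      unfolding islimpt_approachable
    proof (intro allI impI)
      fix e :: real assume "e > 0"
      define x where "x = min e (\<rho> / 2) / 2"
      have "x > 0" "x < e" "x < \<rho> / 2" using \<open>e > 0\<close> \<rho> by (auto simp: x_def)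
      then show "\<exists>x'\<in>U. x' \<noteq> 0 \<and> dist x' 0 < e"
        by (intro bexI[of _ "of_real x"]) (auto simp: U_def)
    qed
    \<comment> \<open>The vertical strip S contains both the real interval on which F is known to
      vanish and the point \<i>, where the exponentials become \<open>cis\<close>.\<close>
    have "F \<i> = 0"
    proof (rule analytic_continuation[OF F \<open>open S\<close> convex_connected[OF \<open>convex S\<close>] _ _ U0])
      show "U \<subseteq> S" "0 \<in> S" "\<i> \<in> S" using \<rho> by (auto simp: U_def S_def)
      fix w assume "w \<in> U"
      then obtain x where "0 < x" "x < \<rho> / 2" "w = of_real x" by (auto simp: U_def)
      then show "F w = 0" using infsumI[OF realz[of x]] by (simp add: F_def)
    qed
    moreover have sm: "(\<lambda>e. c e * exp (\<i> * of_real (s e))) summable_on UNIV"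
      by (rule abs_summable_summable, rule Infinite_Sum.abs_summable_on_comparison_test'[OF M])
         (rule le, use \<rho> in \<open>simp add: S_def\<close>)
    ultimately have "((\<lambda>e. c e * exp (\<i> * of_real (s e))) has_sum 0) UNIV"
      using has_sum_infsum[OF sm] by (simp only: F_def)
    then show ?thesis by (simp add: c_def s_def cis_conv_exp mult_ac)
  qed
  show ?thesis
  proof
    fix e0
    show "C e0 = 0"
    proof (cases "e0 \<in> expos W")
      case True
      let ?l = "\<lambda>e (i, b). if b then sg e i else df e i"
      have "((\<lambda>e. C e * mon z e) has_sum 0) {e \<in> UNIV. \<forall>k\<in>W \<times> UNIV. ?l e k = ?l e0 k}"
      proof (rule trig_series_coefficients)
        show "finite (W \<times> (UNIV :: bool set))" using finW by simp
        fix u :: "nat \<times> bool \<Rightarrow> real"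
        have "(\<Sum>k\<in>W \<times> UNIV. u k * ?l e k) = (\<Sum>i\<in>W. u (i, True) * sg e i) + (\<Sum>i\<in>W. u (i, False) * df e i)" for e
        proof -
          have "(\<Sum>k\<in>W \<times> UNIV. u k * ?l e k) = (\<Sum>i\<in>W. \<Sum>b\<in>UNIV. u (i, b) * ?l e (i, b))"
            by (subst sum.cartesian_product) (rule sum.cong, auto)
          then show ?thesis by (simp add: UNIV_bool sum.distrib add.commute)
        qed
        then show "((\<lambda>e. C e * mon z e * cis (\<Sum>k\<in>W \<times> UNIV. u k * ?l e k)) has_sum 0) UNIV"
          using main[of "\<lambda>i. u (i, True)" "\<lambda>i. u (i, False)"] by (simp add: cis_mult mult.assoc)
      qed
      then have "((\<lambda>e. C e * mon z e) has_sum 0) {e0}"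
      proof (rule has_sum_cong_neutral[THEN iffD1, rotated -1])
        fix e assume e: "e \<in> {e \<in> UNIV. \<forall>k\<in>W \<times> UNIV. ?l e k = ?l e0 k} - {e0}"
        show "C e * mon z e = 0"
        proof (rule ccontr)
          assume "C e * mon z e \<noteq> 0"
          then have "e \<in> expos W" using C by (auto simp: supp_def)
          have "e i = e0 i" for i
          proof (cases "i \<in> W")
            case True
            have k: "\<forall>k\<in>W \<times> UNIV. ?l e k = ?l e0 k" using e by blast
            have "sg e i = sg e0 i" "df e i = df e0 i"
              using bspec[OF k, of "(i, True)"] bspec[OF k, of "(i, False)"] True by simp_all
            then show ?thesis by (simp add: sg_def df_def prod_eq_iff)
          qed (use \<open>e \<in> expos W\<close> \<open>e0 \<in> expos W\<close> in \<open>auto simp: expos_def\<close>)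
          then show False using e by auto
        qed
      qed auto
      then have "C e0 * mon z e0 = 0"
        using has_sum_finite[of "{e0}" "\<lambda>e. C e * mon z e"] has_sum_unique by fastforce
      then show ?thesis using mon_nonzero by simp
    qed (use C in \<open>auto simp: supp_def\<close>)
  qed
qed

section \<open>Taylor expansion in a complex variable and its conjugate\<close>

text \<open>Wirtinger form of a real power series. It matches monomials in z and its conjugate, and
  it is polarized by making h and its conjugate independent.\<close>

definition wps :: "(complex \<Rightarrow> complex) \<Rightarrow> complex \<Rightarrow> (nat \<Rightarrow> nat \<Rightarrow> complex) \<Rightarrow> real \<Rightarrow> bool" where
  "wps f p c \<epsilon> \<longleftrightarrow> 0 < \<epsilon> \<and> (\<forall>h. norm h < \<epsilon> \<longrightarrow>
     ((\<lambda>(m, n). c m n * h ^ m * cnj h ^ n) has_sum f (p + h)) UNIV)"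

lemma has_sum_diff:
  fixes f g :: "'a \<Rightarrow> complex"
  assumes "(f has_sum a) A" "(g has_sum b) A"
  shows "((\<lambda>x. f x - g x) has_sum (a - b)) A"
  using has_sum_add[OF assms(1) has_sum_cmult_right[OF assms(2), of "- 1"]] by simp

lemma wpsD:
  "wps f p c \<epsilon> \<Longrightarrow> norm h < \<epsilon> \<Longrightarrow> ((\<lambda>(m, n). c m n * h ^ m * cnj h ^ n) has_sum f (p + h)) UNIV"
  by (simp only: wps_def)

lemma wps_summable:
  assumes "wps f p c \<epsilon>" "0 \<le> R" "R < \<epsilon>"
  shows "(\<lambda>(m, n). norm (c m n) * R ^ (m + n)) summable_on UNIV"
proof -
  have "((\<lambda>(m, n). c m n * of_real R ^ m * cnj (of_real R) ^ n) has_sum f (p + of_real R)) UNIV"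
    by (rule wpsD[OF assms(1)]) (use assms in simp)
  from has_sum_norm_summable[OF this] show ?thesis
    using assms(2) by (simp add: case_prod_unfold norm_mult norm_power power_add mult_ac)
qed

lemma la_wps:
  assumes f: "la f z" and w: "wps g (f z) c \<epsilon>"
  shows "la (\<lambda>z. g (f z)) z"
proof -
  define q where "q = f z"
  have e: "\<epsilon> > 0" using w by (simp add: wps_def)
  define S where "S = {(x, y). norm (x - q) < \<epsilon> / 2 \<and> norm (y - cnj q) < \<epsilon> / 2}"
  have S_eq: "S = ball q (\<epsilon> / 2) \<times> ball (cnj q) (\<epsilon> / 2)"
    by (auto simp: S_def dist_norm norm_minus_commute)
  define G where "G = (\<lambda>x y. infsum (\<lambda>k. case k of (m, n) \<Rightarrow> c m n * (x - q) ^ m * (y - cnj q) ^ n) UNIV)"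
  have M: "(\<lambda>(m, n). norm (c m n) * (\<epsilon> / 2) ^ (m + n)) summable_on UNIV"
    using wps_summable[OF w, of "\<epsilon> / 2"] e by simp
  show ?thesis
  proof (rule la_compose2[OF f, of S G])
    show "open S" unfolding S_eq by (intro open_Times open_ball)
    show "(f z, cnj (f z)) \<in> S" using e by (simp add: S_def q_def)
    show "(\<lambda>t. G (X t) (Y t)) holomorphic_on ball 0 \<delta>"
      if "X holomorphic_on ball 0 \<delta>" "Y holomorphic_on ball 0 \<delta>"
        "\<And>t. t \<in> ball 0 \<delta> \<Longrightarrow> (X t, Y t) \<in> S" for X Y \<delta>
      unfolding G_def
    proof (rule holomorphic_infsum[OF open_ball _ _ M])
      fix k :: "nat \<times> nat"
      show "(\<lambda>x. case k of (m, n) \<Rightarrow> c m n * (X x - q) ^ m * (Y x - cnj q) ^ n) holomorphic_on ball 0 \<delta>"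
        using that(1,2) by (cases k) (auto intro!: holomorphic_intros)
    next
      fix k :: "nat \<times> nat" and t assume "t \<in> ball (0 :: complex) \<delta>"
      then have "norm (X t - q) \<le> \<epsilon> / 2" "norm (Y t - cnj q) \<le> \<epsilon> / 2"
        using that(3) by (fastforce simp: S_def)+
      then have "norm (X t - q) ^ m * norm (Y t - cnj q) ^ n \<le> (\<epsilon> / 2) ^ m * (\<epsilon> / 2) ^ n" for m n
        using e by (intro mult_mono power_mono) auto
      then show "norm (case k of (m, n) \<Rightarrow> c m n * (X t - q) ^ m * (Y t - cnj q) ^ n) \<le>
          (case k of (m, n) \<Rightarrow> norm (c m n) * (\<epsilon> / 2) ^ (m + n))"
        by (cases k) (simp add: norm_mult norm_power power_add mult.assoc mult_left_mono)
    qed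
    show "g x = G x (cnj x)" if "(x, cnj x) \<in> S" for x
    proof -
      have "norm (x - q) < \<epsilon>" using that e by (simp add: S_def)
      then have "((\<lambda>(m, n). c m n * (x - q) ^ m * cnj (x - q) ^ n) has_sum g (q + (x - q))) UNIV"
        unfolding q_def by (rule wpsD[OF w])
      from infsumI[OF this] show ?thesis by (simp add: G_def)
    qed
  qed
qed

text \<open>The bounds by R keep the family absolutely summable after both binomials are multiplied
  out, which permits rearrangement. It serves twice: to pass from real and imaginary part to h and
  its conjugate, and to move the centre of an expansion.\<close>

lemma double_binomial_has_sum:
  fixes c :: "nat \<Rightarrow> nat \<Rightarrow> complex"
  assumes c: "(\<lambda>(m, n). norm (c m n) * R ^ (m + n)) summable_on UNIV"
    and a: "norm a1 + norm a2 \<le> R" and b: "norm b1 + norm b2 \<le> R"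
    and s: "((\<lambda>(m, n). c m n * (a1 + a2) ^ m * (b1 + b2) ^ n) has_sum s) UNIV"
  shows "((\<lambda>((i, i'), (j, j')). c (i + i') (j + j') * of_nat ((i + i') choose i) * of_nat ((j + j') choose j) *
     a1 ^ i * a2 ^ i' * b1 ^ j * b2 ^ j') has_sum s) UNIV"
proof -
  define T where "T = Sigma (UNIV :: (nat \<times> nat) set) (\<lambda>(m, n). {..m} \<times> {..n})"
  define g where "g = (\<lambda>((m, n), (i, j)). c m n * of_nat (m choose i) * of_nat (n choose j) *
     a1 ^ i * a2 ^ (m - i) * b1 ^ j * b2 ^ (n - j))"
  have fin: "(\<Sum>(i, j)\<in>{..m} \<times> {..n}. g ((m, n), (i, j))) = c m n * (a1 + a2) ^ m * (b1 + b2) ^ n" for m n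
  proof -
    have "(\<Sum>(i, j)\<in>{..m} \<times> {..n}. g ((m, n), (i, j))) = (\<Sum>i\<le>m. \<Sum>j\<le>n. g ((m, n), (i, j)))"
      by (rule sum.cartesian_product[symmetric])
    also have "\<dots> =
        c m n * ((\<Sum>i\<le>m. of_nat (m choose i) * a1 ^ i * a2 ^ (m - i)) * (\<Sum>j\<le>n. of_nat (n choose j) * b1 ^ j * b2 ^ (n - j)))"
      unfolding sum_product by (simp add: g_def sum_distrib_left mult_ac)
    finally show ?thesis by (simp add: binomial_ring)
  qed
  have finn: "(\<Sum>(i, j)\<in>{..m} \<times> {..n}. norm (g ((m, n), (i, j)))) =
      norm (c m n) * (norm a1 + norm a2) ^ m * (norm b1 + norm b2) ^ n" for m n
  proof -
    have "(\<Sum>(i, j)\<in>{..m} \<times> {..n}. norm (g ((m, n), (i, j)))) = (\<Sum>i\<le>m. \<Sum>j\<le>n. norm (g ((m, n), (i, j))))"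
      by (rule sum.cartesian_product[symmetric])
    also have "\<dots> =
        norm (c m n) * ((\<Sum>i\<le>m. of_nat (m choose i) * norm a1 ^ i * norm a2 ^ (m - i)) *
          (\<Sum>j\<le>n. of_nat (n choose j) * norm b1 ^ j * norm b2 ^ (n - j)))"
      unfolding sum_product by (simp add: g_def sum_distrib_left mult_ac norm_mult norm_power)
    finally show ?thesis by (simp add: binomial_ring)
  qed
  have "(\<lambda>x. norm (g x)) summable_on T"
    unfolding T_def
  proof (rule summable_on_SigmaI[where g = "\<lambda>(m, n). norm (c m n) * (norm a1 + norm a2) ^ m * (norm b1 + norm b2) ^ n"])
    fix x :: "nat \<times> nat"
    obtain m n where x: "x = (m, n)" by force
    show "((\<lambda>y. norm (g (x, y))) has_sum (case x of (m, n) \<Rightarrow> norm (c m n) * (norm a1 + norm a2) ^ m * (norm b1 + norm b2) ^ n))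
       (case x of (m, n) \<Rightarrow> {..m} \<times> {..n})"
      unfolding x using finn[of m n] by (simp add: has_sum_finiteI case_prod_unfold)
  next
    have "0 \<le> R" using a norm_ge_zero[of a1] norm_ge_zero[of a2] by linarith
    then have "norm (c m n) * (norm a1 + norm a2) ^ m * (norm b1 + norm b2) ^ n \<le> norm (c m n) * R ^ (m + n)" for m n
      unfolding power_add mult.assoc
      by (intro mult_left_mono mult_mono power_mono a b) auto
    then show "(\<lambda>(m, n). norm (c m n) * (norm a1 + norm a2) ^ m * (norm b1 + norm b2) ^ n) summable_on UNIV"
      by (intro summable_on_comparison_test[OF c]) auto
  qed auto
  then have "g summable_on T" by (rule abs_summable_summable)
  then have "(g has_sum s) T"
    unfolding T_def
    by (rule has_sum_SigmaI[OF _ s, rotated]) (auto simp: fin[symmetric] case_prod_unfold intro!: has_sum_finiteI)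
  also have "(g has_sum s) T \<longleftrightarrow> ?thesis"
    by (rule has_sum_reindex_bij_witness[where i = "\<lambda>((i, i'), (j, j')). ((i + i', j + j'), (i, j))"
          and j = "\<lambda>((m, n), (i, j)). ((i, m - i), (j, n - j))"])
       (auto simp: T_def g_def)
  finally show ?thesis .
qed

lemma real_analytic_imp_wps:
  assumes "real_analytic_on f U" "p \<in> U"
  shows "\<exists>c \<epsilon>. wps f p c \<epsilon>"
proof -
  obtain \<epsilon> c where e: "\<epsilon> > 0" and c: "\<And>z. z \<in> ball p \<epsilon> \<Longrightarrow>
     ((\<lambda>(m, n). c m n * of_real (Re (z - p)) ^ m * of_real (Im (z - p)) ^ n) has_sum f z) UNIV"
    using assms unfolding real_analytic_on_def by meson
  define R where "R = \<epsilon> / 2"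
  \<comment> \<open>Both real coordinates of this point relative to p equal R, so convergence there
    yields summability of \<open>norm (c m n) * R ^ (m + n)\<close>. The point lies in the ball
    because sqrt 2 < 2.\<close>
  have "p + Complex R R \<in> ball p \<epsilon>"
  proof -
    have "norm (Complex R R) = sqrt 2 * R" using e by (simp add: R_def complex_norm real_sqrt_mult[symmetric] real_sqrt_mult)
    also have "\<dots> < 2 * R" using e sqrt2_less_2 by (simp add: R_def)
    finally show ?thesis by (simp add: R_def dist_norm)
  qed
  from has_sum_norm_summable[OF c[OF this]]
  have sm: "(\<lambda>(m, n). norm (c m n) * R ^ (m + n)) summable_on UNIV"
    using e by (simp add: case_prod_unfold norm_mult norm_power power_add mult_ac R_def)
  \<comment> \<open>Collects the terms in which h has total exponent M and its conjugate N; i and i'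
    are the shares coming from the real coordinate, M - i and N - i' those from the imaginary
    one.\<close>
  define C where "C = (\<lambda>M N. \<Sum>(i, i')\<in>{..M} \<times> {..N}. c (i + i') ((M - i) + (N - i')) *
     of_nat ((i + i') choose i) * of_nat (((M - i) + (N - i')) choose (M - i)) *
     (1 / 2) ^ i * (1 / 2) ^ i' * (1 / (2 * \<i>)) ^ (M - i) * (- 1 / (2 * \<i>)) ^ (N - i'))"
  have "((\<lambda>(M, N). C M N * h ^ M * cnj h ^ N) has_sum f (p + h)) UNIV" if h: "norm h < R" for h
  proof -
    have "p + h \<in> ball p \<epsilon>" using h e by (simp add: R_def dist_norm)
    from c[OF this] have "((\<lambda>(m, n). c m n * (h / 2 + cnj h / 2) ^ m * (h / (2 * \<i>) + - cnj h / (2 * \<i>)) ^ n) has_sum f (p + h)) UNIV"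
    proof (rule has_sum_cong[THEN iffD1, rotated])
      fix k :: "nat \<times> nat"
      have "complex_of_real (Re h) = h / 2 + cnj h / 2" "complex_of_real (Im h) = h / (2 * \<i>) + - cnj h / (2 * \<i>)"
        by (auto simp: complex_eq_iff Re_divide Im_divide)
      then show "(case k of (m, n) \<Rightarrow> c m n * of_real (Re (p + h - p)) ^ m * of_real (Im (p + h - p)) ^ n) =
         (case k of (m, n) \<Rightarrow> c m n * (h / 2 + cnj h / 2) ^ m * (h / (2 * \<i>) + - cnj h / (2 * \<i>)) ^ n)"
        by simp
    qed
    then have "((\<lambda>((i, i'), (j, j')). c (i + i') (j + j') * of_nat ((i + i') choose i) * of_nat ((j + j') choose j) *
     (h / 2) ^ i * (cnj h / 2) ^ i' * (h / (2 * \<i>)) ^ j * (- cnj h / (2 * \<i>)) ^ j') has_sum f (p + h)) UNIV"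
      by (rule double_binomial_has_sum[OF sm, rotated 2]) (use h in \<open>auto simp: norm_divide norm_mult\<close>)
    moreover define G where "G = (\<lambda>((M, N), (i, i')). c (i + i') ((M - i) + (N - i')) *
     of_nat ((i + i') choose i) * of_nat (((M - i) + (N - i')) choose (M - i)) *
     (h / 2) ^ i * (cnj h / 2) ^ i' * (h / (2 * \<i>)) ^ (M - i) * (- cnj h / (2 * \<i>)) ^ (N - i'))"
    ultimately have G: "(G has_sum f (p + h)) (Sigma UNIV (\<lambda>(M, N). {..M} \<times> {..N}))"
      by (subst has_sum_reindex_bij_witness[where j = "\<lambda>((M, N), (i, i')). ((i, i'), (M - i, N - i'))"
          and i = "\<lambda>((i, i'), (j, j')). ((i + j, i' + j'), (i, i'))" and T = UNIV
          and h = "\<lambda>((i, i'), (j, j')). c (i + i') (j + j') * of_nat ((i + i') choose i) * of_nat ((j + j') choose j) *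
     (h / 2) ^ i * (cnj h / 2) ^ i' * (h / (2 * \<i>)) ^ j * (- cnj h / (2 * \<i>)) ^ j'"]) (auto simp: G_def)
    show ?thesis
    proof (rule has_sum_SigmaD[OF G])
      fix k :: "nat \<times> nat"
      obtain M N where k: "k = (M, N)" by force
      have "(\<Sum>y\<in>{..M} \<times> {..N}. G ((M, N), y)) = C M N * h ^ M * cnj h ^ N"
        unfolding C_def sum_distrib_right G_def
      proof (rule sum.cong, goal_cases)
        case (2 y)
        obtain i i' where y: "y = (i, i')" by force
        have "h ^ M = h ^ i * h ^ (M - i)" "cnj h ^ N = cnj h ^ i' * cnj h ^ (N - i')"
          using 2 y by (auto simp flip: power_add)
        moreover have "(h / 2) ^ i = h ^ i * (1 / 2) ^ i" "(cnj h / 2) ^ i' = cnj h ^ i' * (1 / 2) ^ i'"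
          "(h / (2 * \<i>)) ^ (M - i) = h ^ (M - i) * (1 / (2 * \<i>)) ^ (M - i)"
          "(- cnj h / (2 * \<i>)) ^ (N - i') = cnj h ^ (N - i') * (- 1 / (2 * \<i>)) ^ (N - i')"
          by (simp_all only: power_mult_distrib[symmetric] times_divide_eq_right mult_1_right mult_minus_right)
        ultimately show ?case by (simp only: y prod.case mult_ac)
      qed auto
      then show "((\<lambda>y. G (k, y)) has_sum (case k of (M, N) \<Rightarrow> C M N * h ^ M * cnj h ^ N)) (case k of (M, N) \<Rightarrow> {..M} \<times> {..N})"
        unfolding k by (simp add: has_sum_finiteI)
    qed
  qed
  then have "wps f p C R" using e by (simp add: wps_def R_def)
  then show ?thesis by blast
qed

definition reexp_coeff :: "(nat \<Rightarrow> nat \<Rightarrow> complex) \<Rightarrow> nat \<Rightarrow> nat \<Rightarrow> nat \<Rightarrow> nat \<Rightarrow> complex" where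
  "reexp_coeff c i j = (\<lambda>i' j'. c (i + i') (j + j') * of_nat ((i + i') choose i) * of_nat ((j + j') choose j))"

definition reexp :: "(nat \<Rightarrow> nat \<Rightarrow> complex) \<Rightarrow> complex \<Rightarrow> nat \<Rightarrow> nat \<Rightarrow> complex" where
  "reexp c k i j = infsum (\<lambda>(i', j'). reexp_coeff c i j i' j' * k ^ i' * cnj k ^ j') UNIV"

text \<open>Half the radius leaves room for h and k together. The first claim exhibits the new
  coefficients as convergent power series in the displacement k, so they depend real analytically on
  the centre.\<close>

lemma wps_reexpand:
  assumes w: "wps f p c \<epsilon>" and k: "norm k < \<epsilon> / 2"
  shows "((\<lambda>(i', j'). reexp_coeff c i j i' j' * k ^ i' * cnj k ^ j') has_sum reexp c k i j) UNIV"
    and "wps f (p + k) (reexp c k) (\<epsilon> / 2)"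
proof -
  have e: "\<epsilon> > 0" using w by (simp add: wps_def)
  have big: "((\<lambda>((i, j), (i', j')). (h ^ i * cnj h ^ j) * (reexp_coeff c i j i' j' * k ^ i' * cnj k ^ j'))
      has_sum f (p + k + h)) (UNIV \<times> UNIV)" if h: "norm h < \<epsilon> / 2" for h
  proof -
    have "norm (h + k) < \<epsilon>" using h k norm_triangle_ineq[of h k] by linarith
    then have "((\<lambda>(m, n). c m n * (h + k) ^ m * (cnj h + cnj k) ^ n) has_sum f (p + (h + k))) UNIV"
      using wpsD[OF w] by (simp only: complex_cnj_add[symmetric])
    from double_binomial_has_sum[OF wps_summable[OF w, of "norm h + norm k"] _ _ this] h k
    have "((\<lambda>((i, i'), (j, j')). c (i + i') (j + j') * of_nat ((i + i') choose i) * of_nat ((j + j') choose j) *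
     h ^ i * k ^ i' * cnj h ^ j * cnj k ^ j') has_sum f (p + (h + k))) UNIV" by simp
    also have "?this \<longleftrightarrow> ((\<lambda>((i, j), (i', j')). (h ^ i * cnj h ^ j) * (reexp_coeff c i j i' j' * k ^ i' * cnj k ^ j'))
      has_sum f (p + (h + k))) (UNIV \<times> UNIV)"
      by (rule has_sum_reindex_bij_witness[where i = "\<lambda>((i, j), (i', j')). ((i, i'), (j, j'))"
          and j = "\<lambda>((i, i'), (j, j')). ((i, j), (i', j'))"]) (auto simp: reexp_coeff_def)
    finally show ?thesis by (simp add: add_ac)
  qed
  have slice: "((\<lambda>(i', j'). reexp_coeff c i j i' j' * k ^ i' * cnj k ^ j') has_sum reexp c k i j) UNIV" for i j
  proof -
    \<comment> \<open>Any nonzero admissible h serves: its monomial is a common factor of the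
      summable slice and is cancelled.\<close>
    define h where "h = complex_of_real (\<epsilon> / 4)"
    have h: "norm h < \<epsilon> / 2" "h \<noteq> 0" using e by (auto simp: h_def)
    have "(\<lambda>y. (h ^ i * cnj h ^ j) * (case y of (i', j') \<Rightarrow> reexp_coeff c i j i' j' * k ^ i' * cnj k ^ j')) summable_on UNIV"
      using summable_on_SigmaD1[OF has_sum_imp_summable[OF big[OF h(1)]], of "(i, j)"]
      by (simp add: case_prod_unfold)
    then have "(\<lambda>(i', j'). reexp_coeff c i j i' j' * k ^ i' * cnj k ^ j') summable_on UNIV"
      by (subst (asm) summable_on_cmult_right') (use h(2) in auto)
    then show ?thesis unfolding reexp_def by (rule has_sum_infsum)
  qed
  then show "((\<lambda>(i', j'). reexp_coeff c i j i' j' * k ^ i' * cnj k ^ j') has_sum reexp c k i j) UNIV" .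
  have "((\<lambda>(i, j). reexp c k i j * h ^ i * cnj h ^ j) has_sum f (p + k + h)) UNIV" if h: "norm h < \<epsilon> / 2" for h
  proof (rule has_sum_SigmaD[OF big[OF h]])
    fix x :: "nat \<times> nat"
    obtain i j where x: "x = (i, j)" by force
    show "((\<lambda>y. (\<lambda>((i, j), (i', j')). (h ^ i * cnj h ^ j) * (reexp_coeff c i j i' j' * k ^ i' * cnj k ^ j')) (x, y))
       has_sum (case x of (i, j) \<Rightarrow> reexp c k i j * h ^ i * cnj h ^ j)) UNIV"
      using has_sum_cmult_right[OF slice[of i j], of "h ^ i * cnj h ^ j"] by (simp add: x case_prod_unfold mult_ac)
  qed
  then show "wps f (p + k) (reexp c k) (\<epsilon> / 2)" using e by (simp add: wps_def)
qed

lemma wps_unique: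
  assumes "wps f p c \<epsilon>" "wps f p c' \<epsilon>'"
  shows "c = c'"
proof -
  define C where "C = formal_sum (\<lambda>(m, n). c m n - c' m n) (\<lambda>(m, n). pw 1 (real m) (real n))"
  have inj: "pw 1 (real m) (real n) = pw 1 (real m') (real n') \<longleftrightarrow> m = m' \<and> n = n'" for m n m' n'
    by (auto simp: pw_def fun_eq_iff)
  have fin: "finite {k. (case k of (m, n) \<Rightarrow> pw 1 (real m) (real n)) = e \<and> P k}" for e P
    by (rule finite_subset[of _ "{(THE k. (case k of (m, n) \<Rightarrow> pw 1 (real m) (real n)) = e)}"])
       (auto simp: inj simp del: One_nat_def intro!: the_equality[symmetric])
  have sC: "supp C \<subseteq> expos {1}"
  proof
    fix e assume "e \<in> supp C"
    then obtain m n where "e = pw 1 (real m) (real n)"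
      by (auto simp: supp_def C_def formal_sum_def elim!: sum.not_neutral_contains_not_neutral)
    then show "e \<in> expos {1}" by (auto intro!: pw_expos)
  qed
  \<comment> \<open>With \<eta> = 1 below, the modulus grows at most by the factor exp 1 \<le> 3, so
    3 \<delta> has to stay below both radii.\<close>
  define \<delta> where "\<delta> = min \<epsilon> \<epsilon>' / 4"
  have d: "\<delta> > 0" "\<delta> * 3 < \<epsilon>" "\<delta> * 3 < \<epsilon>'" using assms by (auto simp: \<delta>_def wps_def)
  have "C = (\<lambda>_. 0)"
  proof (rule expansion_unique[OF sC, where z = "\<lambda>_. of_real \<delta>" and \<eta> = 1])
    fix t \<theta> :: "nat \<Rightarrow> real" assume t: "\<And>i. i \<in> {1} \<Longrightarrow> \<bar>t i\<bar> < 1"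
    let ?z = "\<lambda>i. if i \<in> {1} then complex_of_real \<delta> * exp (of_real (t i) + \<i> * of_real (\<theta> i)) else of_real \<delta>"
    define h where "h = ?z 1"
    have h0: "h \<noteq> 0" using d(1) by (simp add: h_def)
    have "exp (t 1) \<le> exp 1" using t[of 1] by simp
    also have "exp (1 :: real) \<le> 3" by (rule exp_le)
    finally have "\<delta> * exp (t 1) \<le> \<delta> * 3" using d(1) by (intro mult_left_mono) auto
    moreover have "norm h = \<delta> * exp (t 1)" using d(1) by (simp add: h_def norm_mult)
    ultimately have hn: "norm h < \<epsilon>" "norm h < \<epsilon>'" using d by linarith+
    have "((\<lambda>k. (case k of (m, n) \<Rightarrow> c m n * h ^ m * cnj h ^ n) - (case k of (m, n) \<Rightarrow> c' m n * h ^ m * cnj h ^ n))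
       has_sum (f (p + h) - f (p + h))) UNIV"
      by (intro has_sum_diff wpsD[OF assms(1)] wpsD[OF assms(2)] hn)
    moreover have "mon ?z (pw 1 (real m) (real n)) = h ^ m * cnj h ^ n" for m n
      using mon_pw[of 1 ?z "real m" "real n"] d(1) h0 cpow_nat[OF h0, of m n] by (simp add: h_def cpow_0)
    ultimately have "((\<lambda>k. (case k of (m, n) \<Rightarrow> c m n - c' m n) * mon ?z (case k of (m, n) \<Rightarrow> pw 1 (real m) (real n))) has_sum 0) UNIV"
      by (simp add: case_prod_unfold algebra_simps)
    from formal_sum_conv[OF fin this] show "((\<lambda>e. C e * mon ?z e) has_sum 0) UNIV"
      by (simp add: conv_def C_def)
  qed (use d in auto)
  then have "C (pw 1 (real m) (real n)) = 0" for m n by simp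
  moreover have "C (pw 1 (real m) (real n)) = c m n - c' m n" for m n
  proof -
    have "{k. (case k of (m, n) \<Rightarrow> pw 1 (real m) (real n)) = pw 1 (real m) (real n) \<and> (case k of (m, n) \<Rightarrow> c m n - c' m n) \<noteq> 0}
        = (if c m n - c' m n = 0 then {} else {(m, n)})"
      by (auto simp: inj simp del: One_nat_def)
    then show ?thesis unfolding C_def formal_sum_def by auto
  qed
  ultimately show ?thesis by (auto simp: fun_eq_iff)
qed

definition taylor :: "(complex \<Rightarrow> complex) \<Rightarrow> complex \<Rightarrow> nat \<Rightarrow> nat \<Rightarrow> complex" where
  "taylor f p = (SOME c. \<exists>\<epsilon>. wps f p c \<epsilon>)"

lemma taylor_eq: "wps f p c \<epsilon> \<Longrightarrow> taylor f p = c"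
  unfolding taylor_def by (rule some_equality) (auto dest: wps_unique)

text \<open>For four-point functions the centre of the Taylor expansion moves with the retained
  points. One radius for all nearby centres gives locally uniform convergence, and analytic
  coefficient functions give analytic formal coefficients.\<close>

lemma taylor_locally:
  assumes "real_analytic_on f U" "p \<in> U"
  obtains \<rho> where "\<rho> > 0" "\<And>k. norm k < \<rho> \<Longrightarrow> wps f (p + k) (taylor f (p + k)) \<rho>"
    "\<And>m n. \<exists>c. wps (\<lambda>x. taylor f x m n) p c \<rho>"
proof -
  obtain c \<epsilon> where w: "wps f p c \<epsilon>" using real_analytic_imp_wps[OF assms] by blast
  have eq: "taylor f (p + k) = reexp c k" if "norm k < \<epsilon> / 2" for k
    by (rule taylor_eq[OF wps_reexpand(2)[OF w that]])
  have "\<epsilon> / 2 > 0" using w by (simp add: wps_def)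
  moreover have "wps f (p + k) (taylor f (p + k)) (\<epsilon> / 2)" if "norm k < \<epsilon> / 2" for k
    using wps_reexpand(2)[OF w that] eq[OF that] by simp
  moreover have "wps (\<lambda>x. taylor f x m n) p (reexp_coeff c m n) (\<epsilon> / 2)" for m n
    using wps_reexpand(1)[OF w] eq \<open>\<epsilon> / 2 > 0\<close> by (simp add: wps_def)
  ultimately show ?thesis by (intro that) blast+
qed

section \<open>Expanding products of powers of differences\<close>

text \<open>
  In \<open>pf X z i j \<alpha> \<beta>\<close> the variables with index in \<open>X\<close> are replaced by the numbers \<open>z i\<close>, and the
  others are formal.  For \<open>X = {}\<close> this is \<open>binom_series i j (-1) \<alpha> \<beta>\<close>.
\<close>

definition pf_expo :: "nat set \<Rightarrow> nat \<Rightarrow> nat \<Rightarrow> real \<Rightarrow> real \<Rightarrow> nat \<times> nat \<Rightarrow> expo" where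
  "pf_expo X i j \<alpha> \<beta> = (\<lambda>(m, n). expo_add
     (if i \<in> X then (\<lambda>_. 0) else pw i (\<alpha> - real m) (\<beta> - real n))
     (if j \<in> X then (\<lambda>_. 0) else pw j (real m) (real n)))"

definition pf_coeff ::
  "nat set \<Rightarrow> (nat \<Rightarrow> complex) \<Rightarrow> nat \<Rightarrow> nat \<Rightarrow> real \<Rightarrow> real \<Rightarrow> nat \<times> nat \<Rightarrow> complex" where
  "pf_coeff X z i j \<alpha> \<beta> = (\<lambda>(m, n). (-1) ^ (m + n) * of_real (\<alpha> gchoose m) * of_real (\<beta> gchoose n) *
     (if i \<in> X then cpow (z i) (\<alpha> - real m) (\<beta> - real n) else 1) *
     (if j \<in> X then z j ^ m * cnj (z j) ^ n else 1))"

definition pf ::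
  "nat set \<Rightarrow> (nat \<Rightarrow> complex) \<Rightarrow> nat \<Rightarrow> nat \<Rightarrow> real \<Rightarrow> real \<Rightarrow> series" where
  "pf X z i j \<alpha> \<beta> = (if i \<in> X \<and> j \<in> X then (\<lambda>e. if e = (\<lambda>_. 0) then cpow (z i - z j) \<alpha> \<beta> else 0)
     else formal_sum (pf_coeff X z i j \<alpha> \<beta>) (pf_expo X i j \<alpha> \<beta>))"

text \<open>Bounds the support independently of the point z, so that sums over it keep a fixed index
  set while z varies.\<close>

definition pf_set :: "nat set \<Rightarrow> nat \<Rightarrow> nat \<Rightarrow> real \<Rightarrow> real \<Rightarrow> expo set" where
  "pf_set X i j \<alpha> \<beta> = (if i \<in> X \<and> j \<in> X then {\<lambda>_. 0} else range (pf_expo X i j \<alpha> \<beta>))"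

lemma pf_empty: "pf {} z i j \<alpha> \<beta> = binom_series i j (-1) \<alpha> \<beta>"
  by (simp add: pf_def binom_series_def pf_coeff_def pf_expo_def)

lemma pf_cong: "(\<And>i. i \<in> X \<Longrightarrow> z i = z' i) \<Longrightarrow> pf X z i j \<alpha> \<beta> = pf X z' i j \<alpha> \<beta>"
  by (auto simp: pf_def pf_coeff_def intro!: arg_cong2[where f = formal_sum])

text \<open>As soon as one of the two variables is formal, its exponents remember m and n.\<close>

lemma pf_expo_inj:
  assumes "\<not> (i \<in> X \<and> j \<in> X)" "i \<noteq> j" shows "inj (pf_expo X i j \<alpha> \<beta>)"
proof (rule injI)
  fix k k' assume eq: "pf_expo X i j \<alpha> \<beta> k = pf_expo X i j \<alpha> \<beta> k'"
  obtain m n m' n' where k: "k = (m, n)" "k' = (m', n')" by (metis surj_pair)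
  show "k = k'"
    using fun_cong[OF eq, of i] fun_cong[OF eq, of j] assms
    by (cases "i \<in> X"; cases "j \<in> X") (auto simp: k pf_expo_def expo_add_def pw_def)
qed

lemma formal_sum_inj: "inj m \<Longrightarrow> formal_sum c m (m k) = c k"
proof -
  assume "inj m"
  then have "{k'. m k' = m k \<and> c k' \<noteq> 0} = (if c k = 0 then {} else {k})" by (auto dest: injD)
  then show ?thesis unfolding formal_sum_def by auto
qed

lemma formal_sum_supp: "supp (formal_sum c m) \<subseteq> range m"
  by (auto simp: supp_def formal_sum_def elim!: sum.not_neutral_contains_not_neutral)

lemma finite_inj_fibre: assumes "inj m" shows "finite {k. m k = e \<and> P k}"
proof (cases "e \<in> range m")
  case True
  then obtain k where "e = m k" by blast
  then have "{k. m k = e \<and> P k} \<subseteq> {k}" using assms by (auto dest: injD)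
  then show ?thesis using finite_subset by blast
next
  case False
  then have "{k. m k = e \<and> P k} = {}" by auto
  then show ?thesis by (simp only: finite.emptyI)
qed

lemma pf_supp: "supp (pf X z i j \<alpha> \<beta>) \<subseteq> pf_set X i j \<alpha> \<beta>"
  using formal_sum_supp by (auto simp: pf_def pf_set_def supp_def)

lemma pf_set_expos:
  assumes "\<alpha> - \<beta> \<in> \<int>" "i \<in> K" "j \<in> K"
  shows "pf_set X i j \<alpha> \<beta> \<subseteq> expos (K - X)"
proof -
  have "\<alpha> - real m - (\<beta> - real n) \<in> \<int>" for m n
    using Ints_diff[OF assms(1), of "of_int (int m - int n)"] by (simp add: algebra_simps)
  then show ?thesis
    using assms by (auto simp: pf_set_def pf_expo_def intro!: expos_add pw_expos expos_zero)
qed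

definition base_grade :: "nat set \<Rightarrow> (nat \<Rightarrow> real) \<Rightarrow> nat \<Rightarrow> nat \<Rightarrow> real \<Rightarrow> real" where
  "base_grade X w i j t = (if i \<in> X then 0 else w i * t)"

definition good_pair :: "nat set \<Rightarrow> (nat \<Rightarrow> real) \<Rightarrow> nat \<Rightarrow> nat \<Rightarrow> bool" where
  "good_pair X w i j \<longleftrightarrow> i \<in> {1..4} \<and> j \<in> {1..4} \<and> i \<noteq> j \<and>
     (i \<in> X \<and> j \<in> X \<or> (if i \<in> X then 0 else w i) < (if j \<in> X then 0 else w j))"

lemma grade_pf_expo:
  assumes "good_pair X w i j"
  shows "grade w (pf_expo X i j \<alpha> \<beta> (m, n)) = base_grade X w i j (\<alpha> + \<beta>) +
     ((if j \<in> X then 0 else w j) - (if i \<in> X then 0 else w i)) * (real m + real n)"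
  using assms by (simp add: pf_expo_def grade_add grade_pw grade_0 base_grade_def good_pair_def algebra_simps)

lemma pf_locfin:
  assumes "good_pair X w i j"
  shows "locfin w (pf_set X i j \<alpha> \<beta>)"
proof (cases "i \<in> X \<and> j \<in> X")
  case False
  define k where "k = (if j \<in> X then 0 else w j) - (if i \<in> X then 0 else w i)"
  have k: "k > 0" using False assms by (auto simp: good_pair_def k_def)
  show ?thesis
    unfolding locfin_def
  proof
    fix c
    define N where "N = nat \<lceil>(c - base_grade X w i j (\<alpha> + \<beta>)) / k\<rceil>"
    have "{e \<in> pf_set X i j \<alpha> \<beta>. grade w e \<le> c} \<subseteq> pf_expo X i j \<alpha> \<beta> ` ({..N} \<times> {..N})"
    proof
      fix e assume "e \<in> {e \<in> pf_set X i j \<alpha> \<beta>. grade w e \<le> c}"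
      then obtain m n where e: "e = pf_expo X i j \<alpha> \<beta> (m, n)" "grade w e \<le> c"
        using False by (auto simp: pf_set_def)
      have "k * (real m + real n) \<le> c - base_grade X w i j (\<alpha> + \<beta>)"
        using e(2) unfolding e(1) grade_pf_expo[OF assms] k_def by linarith
      then have "real m + real n \<le> (c - base_grade X w i j (\<alpha> + \<beta>)) / k"
        using k by (simp add: pos_le_divide_eq mult.commute)
      then have "m \<le> N" "n \<le> N" unfolding N_def by linarith+
      then show "e \<in> pf_expo X i j \<alpha> \<beta> ` ({..N} \<times> {..N})" using e(1) by auto
    qed
    then show "finite {e \<in> pf_set X i j \<alpha> \<beta>. grade w e \<le> c}" by (rule finite_subset) auto
  qed
qed (auto simp: pf_set_def locfin_def)

lemma pf_bdd:
  assumes "good_pair X w i j"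
  shows "bdd_from w (base_grade X w i j (\<alpha> + \<beta>)) (pf_set X i j \<alpha> \<beta>)"
proof (cases "i \<in> X \<and> j \<in> X")
  case False
  then have "(if j \<in> X then 0 else w j) - (if i \<in> X then 0 else w i) > 0"
    using assms by (auto simp: good_pair_def)
  then have "base_grade X w i j (\<alpha> + \<beta>) \<le> grade w (pf_expo X i j \<alpha> \<beta> (m, n))" for m n
    unfolding grade_pf_expo[OF assms] by (simp add: mult_nonneg_nonneg less_imp_le)
  then show ?thesis using False by (auto simp: bdd_from_def pf_set_def)
qed (auto simp: pf_set_def bdd_from_def base_grade_def grade_0)

text \<open>Records the exponents of one variable modulo integers. Together with a bound on the
  grade this leaves finitely many powers of the cross ratio that can contribute to a given
  monomial.\<close>

definition coset :: "nat \<Rightarrow> real \<Rightarrow> real \<Rightarrow> expo set" where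
  "coset l r s = {e. fst (e l) - r \<in> \<int> \<and> snd (e l) - s \<in> \<int>}"

lemma coset_plus: "S \<subseteq> coset l r s \<Longrightarrow> T \<subseteq> coset l r' s' \<Longrightarrow> expo_plus S T \<subseteq> coset l (r + r') (s + s')"
proof
  fix e assume st: "S \<subseteq> coset l r s" "T \<subseteq> coset l r' s'" and "e \<in> expo_plus S T"
  then obtain d d' where e: "e = expo_add d d'" "d \<in> coset l r s" "d' \<in> coset l r' s'"
    by (auto simp: expo_plus_def)
  show "e \<in> coset l (r + r') (s + s')"
    using Ints_add[of "fst (d l) - r" "fst (d' l) - r'"] Ints_add[of "snd (d l) - s" "snd (d' l) - s'"] e(2,3)
    by (simp add: e(1) coset_def expo_add_def algebra_simps)
qed

lemma pf_coset:
  "pf_set X i j \<alpha> \<beta> \<subseteq> coset l (if l = i \<and> i \<notin> X then \<alpha> else 0) (if l = i \<and> i \<notin> X then \<beta> else 0)"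
proof -
  have "- real m \<in> \<int>" "real m - real n \<in> \<int>" for m n by auto
  then show ?thesis
    by (auto simp: pf_set_def coset_def pf_expo_def expo_add_def pw_def)
qed

text \<open>The factor 2 keeps z_j / z_i at modulus at most 1/2, so that each expansion costs no
  more than a power of 2. A formal z_j has to be nonzero because \<open>mon\<close> skips vanishing
  coordinates.\<close>

definition reg_pair :: "nat set \<Rightarrow> (nat \<Rightarrow> complex) \<Rightarrow> nat \<Rightarrow> nat \<Rightarrow> bool" where
  "reg_pair X z i j \<longleftrightarrow> (if i \<in> X \<and> j \<in> X then z i \<noteq> z j
     else z i \<noteq> 0 \<and> 2 * norm (z j) \<le> norm (z i) \<and> (j \<in> X \<or> z j \<noteq> 0))"

definition lead :: "nat set \<Rightarrow> (nat \<Rightarrow> complex) \<Rightarrow> nat \<Rightarrow> nat \<Rightarrow> real" where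
  "lead X z i j = (if i \<in> X \<and> j \<in> X then norm (z i - z j) else norm (z i))"

lemma lead_pos: "reg_pair X z i j \<Longrightarrow> lead X z i j > 0"
  by (auto simp: reg_pair_def lead_def split: if_splits)

lemma pf_conv:
  assumes ij: "i \<in> {1..4}" "j \<in> {1..4}" "i \<noteq> j" and int: "\<alpha> - \<beta> \<in> \<int>" and reg: "reg_pair X z i j"
  shows "conv z (pf X z i j \<alpha> \<beta>) (cpow (z i - z j) \<alpha> \<beta>)
           (lead X z i j powr (\<alpha> + \<beta>) * 2 powr (\<bar>\<alpha>\<bar> + \<bar>\<beta>\<bar>))"
proof (cases "i \<in> X \<and> j \<in> X")
  case True
  have z: "z i - z j \<noteq> 0" using reg True by (simp add: reg_pair_def)
  have m0: "mon z (\<lambda>_. 0) = 1" by (simp add: mon_def cpow_0 zero_prod_def)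
  have "((\<lambda>e. pf X z i j \<alpha> \<beta> e * mon z e) has_sum cpow (z i - z j) \<alpha> \<beta>) UNIV"
    by (rule has_sum_finite_neutralI[of "{\<lambda>_. 0}"]) (use True in \<open>auto simp: pf_def m0\<close>)
  moreover have "((\<lambda>e. norm (pf X z i j \<alpha> \<beta> e * mon z e)) has_sum norm (cpow (z i - z j) \<alpha> \<beta>)) UNIV"
    by (rule has_sum_finite_neutralI[of "{\<lambda>_. 0}"]) (use True in \<open>auto simp: pf_def m0\<close>)
  moreover have "norm (cpow (z i - z j) \<alpha> \<beta>) \<le> lead X z i j powr (\<alpha> + \<beta>) * 2 powr (\<bar>\<alpha>\<bar> + \<bar>\<beta>\<bar>)"
    using mult_left_mono[of 1 "2 powr (\<bar>\<alpha>\<bar> + \<bar>\<beta>\<bar>)" "norm (z i - z j) powr (\<alpha> + \<beta>)"] True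
    by (simp add: norm_cpow[OF z int] lead_def ge_one_powr_ge_zero)
  ultimately show ?thesis unfolding conv_def by blast
next
  case False
  then have z: "z i \<noteq> 0" "2 * norm (z j) \<le> norm (z i)" "j \<in> X \<or> z j \<noteq> 0"
    using reg by (auto simp: reg_pair_def split: if_splits)
  \<comment> \<open>Factoring out z_i leaves powers of 1 + x with |x| \<le> 1/2.\<close>
  define x where "x = - z j / z i"
  have nx: "norm x \<le> 1 / 2" using z by (simp add: x_def norm_divide divide_simps)
  let ?t = "\<lambda>(m, n). of_real (\<alpha> gchoose m) * of_real (\<beta> gchoose n) * x ^ m * cnj x ^ n"
  have int': "\<alpha> - real m - (\<beta> - real n) \<in> \<int>" for m n
    using Ints_diff[OF int, of "of_int (int m - int n)"] by (simp add: algebra_simps)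
  have trm: "pf_coeff X z i j \<alpha> \<beta> k * mon z (pf_expo X i j \<alpha> \<beta> k) = cpow (z i) \<alpha> \<beta> * ?t k" for k
  proof -
    obtain m n where k: "k = (m, n)" by force
    define A where "A = (if i \<in> X then (\<lambda>_. 0) else pw i (\<alpha> - real m) (\<beta> - real n))"
    define B where "B = (if j \<in> X then (\<lambda>_. 0) else pw j (real m) (real n))"
    have m0: "mon z (\<lambda>_. 0) = 1" by (simp add: mon_def cpow_0 zero_prod_def)
    have ex: "A \<in> expos {1..4}" "B \<in> expos {1..4}"
      using ij int' by (auto simp: A_def B_def intro!: pw_expos expos_zero)
    have 1: "(if i \<in> X then cpow (z i) (\<alpha> - real m) (\<beta> - real n) else 1) * mon z A = cpow (z i) (\<alpha> - real m) (\<beta> - real n)"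
      using z(1) ij by (auto simp: A_def m0 mon_pw cpow_0)
    have 2: "(if j \<in> X then z j ^ m * cnj (z j) ^ n else 1) * mon z B = z j ^ m * cnj (z j) ^ n"
      using z(3) ij by (auto simp: B_def m0 mon_pw cpow_nat)
    have "pf_coeff X z i j \<alpha> \<beta> k * mon z (pf_expo X i j \<alpha> \<beta> k) =
       (-1) ^ (m + n) * of_real (\<alpha> gchoose m) * of_real (\<beta> gchoose n) *
       ((if i \<in> X then cpow (z i) (\<alpha> - real m) (\<beta> - real n) else 1) * mon z A) *
       ((if j \<in> X then z j ^ m * cnj (z j) ^ n else 1) * mon z B)"
      unfolding k pf_coeff_def pf_expo_def prod.case A_def[symmetric] B_def[symmetric] mon_add[OF ex]
      by (simp only: mult_ac)
    also have "\<dots> = (-1) ^ (m + n) * of_real (\<alpha> gchoose m) * of_real (\<beta> gchoose n) *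
       cpow (z i) (\<alpha> - real m) (\<beta> - real n) * (z j ^ m * cnj (z j) ^ n)"
      by (simp only: 1 2)
    also have "cpow (z i) (\<alpha> - real m) (\<beta> - real n) = cpow (z i) \<alpha> \<beta> / (z i ^ m * cnj (z i) ^ n)"
      using cpow_add[OF z(1) int', of "real m" "real n" m n] z(1)
      by (simp add: cpow_nat divide_simps)
    also have "(-1) ^ (m + n) * of_real (\<alpha> gchoose m) * of_real (\<beta> gchoose n) *
       (cpow (z i) \<alpha> \<beta> / (z i ^ m * cnj (z i) ^ n)) * (z j ^ m * cnj (z j) ^ n) = cpow (z i) \<alpha> \<beta> * ?t k"
    proof -
      have "x ^ m = (-1) ^ m * z j ^ m / z i ^ m"
        unfolding x_def power_divide by (subst power_minus) simp
      moreover have "cnj x ^ n = (-1) ^ n * cnj (z j) ^ n / cnj (z i) ^ n"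
        unfolding x_def complex_cnj_divide complex_cnj_minus power_divide by (subst power_minus) simp
      ultimately show ?thesis by (simp add: k power_add mult_ac)
    qed
    finally show ?thesis .
  qed
  have nx1: "norm x < 1" using nx by linarith
  have "1 + x \<noteq> 0" using nx by (metis add_eq_0_iff norm_minus_cancel norm_one not_less nx1 order_refl)
  have 1: "((\<lambda>k. pf_coeff X z i j \<alpha> \<beta> k * mon z (pf_expo X i j \<alpha> \<beta> k)) has_sum cpow (z i) \<alpha> \<beta> * cpow (1 + x) \<alpha> \<beta>) UNIV"
    unfolding trm by (rule has_sum_cmult_right[OF binomial_has_sum(1)[OF nx1 int]])
  obtain M where M: "M \<le> (1 - norm x) powr (- \<bar>\<alpha>\<bar> - \<bar>\<beta>\<bar>)" "((\<lambda>k. norm (?t k)) has_sum M) UNIV"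
    using binomial_has_sum(2)[OF nx1 int] by (auto simp: case_prod_unfold)
  have "((\<lambda>k. norm (cpow (z i) \<alpha> \<beta> * ?t k)) has_sum norm (cpow (z i) \<alpha> \<beta>) * M) UNIV"
    unfolding norm_mult[of "cpow (z i) \<alpha> \<beta>"] by (rule has_sum_cmult_right[OF M(2)])
  then have 2: "infsum (\<lambda>k. norm (pf_coeff X z i j \<alpha> \<beta> k * mon z (pf_expo X i j \<alpha> \<beta> k))) UNIV = norm (cpow (z i) \<alpha> \<beta>) * M"
    unfolding trm by (rule infsumI)
  have "M \<le> (1 - norm x) powr (- \<bar>\<alpha>\<bar> - \<bar>\<beta>\<bar>)" by (rule M(1))
  also have "\<dots> \<le> (1 / 2) powr (- \<bar>\<alpha>\<bar> - \<bar>\<beta>\<bar>)"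
    using nx by (intro powr_mono2') auto
  also have "\<dots> = 2 powr (\<bar>\<alpha>\<bar> + \<bar>\<beta>\<bar>)"
    by (simp add: powr_divide powr_minus_divide[symmetric] powr_minus field_simps flip: powr_add)
  finally have Mle: "M \<le> 2 powr (\<bar>\<alpha>\<bar> + \<bar>\<beta>\<bar>)" .
  have "lead X z i j = norm (z i)" using False by (auto simp: lead_def)
  then have "norm (cpow (z i) \<alpha> \<beta>) * M \<le> lead X z i j powr (\<alpha> + \<beta>) * 2 powr (\<bar>\<alpha>\<bar> + \<bar>\<beta>\<bar>)"
    using Mle by (simp add: norm_cpow[OF z(1) int] mult_left_mono)
  moreover have "cpow (z i) \<alpha> \<beta> * cpow (1 + x) \<alpha> \<beta> = cpow (z i - z j) \<alpha> \<beta>"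
    using z(1) by (subst cpow_mult[OF z(1) \<open>1 + x \<noteq> 0\<close> int, symmetric]) (simp add: x_def algebra_simps)
  moreover have "conv z (pf X z i j \<alpha> \<beta>) (cpow (z i) \<alpha> \<beta> * cpow (1 + x) \<alpha> \<beta>) (norm (cpow (z i) \<alpha> \<beta>) * M)"
    using formal_sum_conv[OF finite_inj_fibre[OF pf_expo_inj[OF False ij(3)]] 1]
    unfolding 2 by (simp only: pf_def False if_False)
  ultimately show ?thesis using conv_mono by simp
qed

lemma pf_la:
  assumes "i \<noteq> j" "i \<in> X \<Longrightarrow> j \<in> X \<Longrightarrow> z i \<noteq> z j" "i \<in> X \<Longrightarrow> j \<notin> X \<Longrightarrow> z i \<noteq> 0"
  shows "la (\<lambda>z. pf X z i j \<alpha> \<beta> e) z"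
proof (cases "i \<in> X \<and> j \<in> X")
  case True
  have "la (\<lambda>z. cpow (z i - z j) \<alpha> \<beta>) z"
    using True assms by (intro la_cpow la_diff la_coord) auto
  then show ?thesis using True by (cases "e = (\<lambda>_. 0)") (auto simp: pf_def la_const)
next
  case False
  show ?thesis
  proof (cases "e \<in> range (pf_expo X i j \<alpha> \<beta>)")
    case True
    then obtain m n where e: "e = pf_expo X i j \<alpha> \<beta> (m, n)" by auto
    have "la (\<lambda>z. pf_coeff X z i j \<alpha> \<beta> (m, n)) z"
      unfolding pf_coeff_def prod.case
      using assms False
      by (cases "i \<in> X"; cases "j \<in> X")
         (auto intro!: la_mult la_const la_cpow la_coord la_power la_cnj)
    then show ?thesis
      using False by (simp only: pf_def e formal_sum_inj[OF pf_expo_inj[OF False assms(1)]] if_False)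
  next
    case 2: False
    then have "pf X z i j \<alpha> \<beta> e = 0" for z
      using pf_supp[of X z i j \<alpha> \<beta>] False by (auto simp: supp_def pf_set_def)
    then show ?thesis by (simp add: la_const)
  qed
qed

section \<open>Products over several pairs\<close>

definition pfs ::
  "nat set \<Rightarrow> (nat \<Rightarrow> complex) \<Rightarrow> (nat \<times> nat) list \<Rightarrow> (nat \<Rightarrow> nat \<Rightarrow> real) \<Rightarrow> (nat \<Rightarrow> nat \<Rightarrow> real) \<Rightarrow> series" where
  "pfs X z L \<alpha> \<beta> = foldr (\<odot>) (map (\<lambda>(i, j). pf X z i j (\<alpha> i j) (\<beta> i j)) L) (monomial (\<lambda>_. (0, 0)))"

definition pfs_set ::
  "nat set \<Rightarrow> (nat \<times> nat) list \<Rightarrow> (nat \<Rightarrow> nat \<Rightarrow> real) \<Rightarrow> (nat \<Rightarrow> nat \<Rightarrow> real) \<Rightarrow> expo set" where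
  "pfs_set X L \<alpha> \<beta> = foldr expo_plus (map (\<lambda>(i, j). pf_set X i j (\<alpha> i j) (\<beta> i j)) L) {\<lambda>_. 0}"

lemma pfs_Cons: "pfs X z ((i, j) # L) \<alpha> \<beta> = pf X z i j (\<alpha> i j) (\<beta> i j) \<odot> pfs X z L \<alpha> \<beta>"
  by (simp add: pfs_def)

lemma pfs_set_Cons: "pfs_set X ((i, j) # L) \<alpha> \<beta> = expo_plus (pf_set X i j (\<alpha> i j) (\<beta> i j)) (pfs_set X L \<alpha> \<beta>)"
  by (simp add: pfs_set_def)

lemma pfs_pairs4: "pfs {} z pairs4 \<alpha> \<beta> = pairs_series \<alpha> \<beta>"
  by (simp add: pfs_def pairs_series_def pf_empty)

lemma pfs_cong: "(\<And>i. i \<in> X \<Longrightarrow> z i = z' i) \<Longrightarrow> pfs X z L \<alpha> \<beta> = pfs X z' L \<alpha> \<beta>"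
  unfolding pfs_def by (simp only: pf_cong[of X z z'])

lemma pfs_supp: "supp (pfs X z L \<alpha> \<beta>) \<subseteq> pfs_set X L \<alpha> \<beta>"
proof (induction L)
  case Nil
  show ?case by (auto simp: pfs_def pfs_set_def supp_def monomial_def zero_prod_def)
next
  case (Cons p L)
  then show ?case by (cases p) (simp add: pfs_Cons pfs_set_Cons supp_mult pf_supp)
qed

lemma pfs_set_expos:
  assumes "\<And>i j. (i, j) \<in> set L \<Longrightarrow> i \<in> K \<and> j \<in> K \<and> \<alpha> i j - \<beta> i j \<in> \<int>"
  shows "pfs_set X L \<alpha> \<beta> \<subseteq> expos (K - X)"
  using assms
proof (induction L)
  case Nil
  show ?case by (simp add: pfs_set_def expos_zero)
next
  case (Cons p L)
  obtain i j where p: "p = (i, j)" by force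
  have "pfs_set X L \<alpha> \<beta> \<subseteq> expos (K - X)" by (rule Cons.IH) (use Cons.prems in auto)
  then show ?case using Cons.prems[of i j] by (simp add: p pfs_set_Cons expo_plus_expos pf_set_expos)
qed

lemma pfs_locfin:
  assumes "\<And>i j. (i, j) \<in> set L \<Longrightarrow> good_pair X w i j"
  shows "locfin w (pfs_set X L \<alpha> \<beta>)"
  using assms
proof (induction L)
  case Nil
  show ?case by (simp add: pfs_set_def locfin_def)
next
  case (Cons p L)
  then show ?case by (cases p) (simp add: pfs_set_Cons locfin_plus pf_locfin)
qed

lemma pfs_bdd:
  assumes "\<And>i j. (i, j) \<in> set L \<Longrightarrow> good_pair X w i j"
  shows "bdd_from w (\<Sum>(i, j)\<leftarrow>L. base_grade X w i j (\<alpha> i j + \<beta> i j)) (pfs_set X L \<alpha> \<beta>)"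
  using assms
proof (induction L)
  case Nil
  show ?case by (simp add: pfs_set_def bdd_from_def grade_0)
next
  case (Cons p L)
  then show ?case by (cases p) (simp add: pfs_set_Cons bdd_plus pf_bdd)
qed

lemma pfs_coset:
  "pfs_set X L \<alpha> \<beta> \<subseteq> coset l (\<Sum>(i, j)\<leftarrow>L. if l = i \<and> i \<notin> X then \<alpha> i j else 0)
     (\<Sum>(i, j)\<leftarrow>L. if l = i \<and> i \<notin> X then \<beta> i j else 0)"
proof (induction L)
  case Nil
  show ?case by (simp add: pfs_set_def coset_def)
next
  case (Cons p L)
  obtain i j where p: "p = (i, j)" by force
  show ?case
    using coset_plus[OF pf_coset[of X i j "\<alpha> i j" "\<beta> i j" l] Cons.IH] by (simp add: p pfs_set_Cons)
qed

lemma pfs_conv: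
  assumes "\<And>i j. (i, j) \<in> set L \<Longrightarrow> good_pair X w i j \<and> \<alpha> i j - \<beta> i j \<in> \<int> \<and> reg_pair X z i j"
  shows "conv z (pfs X z L \<alpha> \<beta>) (\<Prod>(i, j)\<leftarrow>L. cpow (z i - z j) (\<alpha> i j) (\<beta> i j))
     (\<Prod>(i, j)\<leftarrow>L. lead X z i j powr (\<alpha> i j + \<beta> i j) * 2 powr (\<bar>\<alpha> i j\<bar> + \<bar>\<beta> i j\<bar>))"
  using assms
proof (induction L)
  case Nil
  have "mon z (\<lambda>_. (0, 0)) = 1" by (simp add: mon_def cpow_0)
  then show ?case using conv_monomial[of z "\<lambda>_. (0, 0)"] by (simp add: pfs_def)
next
  case (Cons p L)
  obtain i j where p: "p = (i, j)" by force
  have ij: "good_pair X w i j" "\<alpha> i j - \<beta> i j \<in> \<int>" "reg_pair X z i j" using Cons.prems by (auto simp: p)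
  have L: "\<And>i j. (i, j) \<in> set L \<Longrightarrow> good_pair X w i j" using Cons.prems by auto
  have "conv z (pf X z i j (\<alpha> i j) (\<beta> i j) \<odot> pfs X z L \<alpha> \<beta>)
     (cpow (z i - z j) (\<alpha> i j) (\<beta> i j) * (\<Prod>(i, j)\<leftarrow>L. cpow (z i - z j) (\<alpha> i j) (\<beta> i j)))
     ((lead X z i j powr (\<alpha> i j + \<beta> i j) * 2 powr (\<bar>\<alpha> i j\<bar> + \<bar>\<beta> i j\<bar>)) *
      (\<Prod>(i, j)\<leftarrow>L. lead X z i j powr (\<alpha> i j + \<beta> i j) * 2 powr (\<bar>\<alpha> i j\<bar> + \<bar>\<beta> i j\<bar>)))"
  proof (rule mult_conv[OF pf_locfin[OF ij(1)] pfs_bdd[OF L] pf_supp pfs_supp])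
    show "pf_set X i j (\<alpha> i j) (\<beta> i j) \<subseteq> expos ({1..4} - X)"
      by (rule pf_set_expos) (use ij in \<open>auto simp: good_pair_def\<close>)
    show "pfs_set X L \<alpha> \<beta> \<subseteq> expos ({1..4} - X)"
      by (rule pfs_set_expos) (use Cons.prems in \<open>auto simp: good_pair_def\<close>)
    show "conv z (pf X z i j (\<alpha> i j) (\<beta> i j)) (cpow (z i - z j) (\<alpha> i j) (\<beta> i j))
       (lead X z i j powr (\<alpha> i j + \<beta> i j) * 2 powr (\<bar>\<alpha> i j\<bar> + \<bar>\<beta> i j\<bar>))"
      by (rule pf_conv) (use ij in \<open>auto simp: good_pair_def\<close>)
  qed (use Cons in auto)
  then show ?case by (simp add: p pfs_Cons)
qed

lemma mult_la:
  assumes "locfin w S" "bdd_from w c T" "\<And>z. supp (A z) \<subseteq> S" "\<And>z. supp (B z) \<subseteq> T"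
    and "\<And>e. la (\<lambda>z. A z e) z" "\<And>e. la (\<lambda>z. B z e) z"
  shows "la (\<lambda>z. (A z \<odot> B z) e) z"
  unfolding mult_eq[OF assms(1-4)] case_prod_unfold by (intro la_sum la_mult assms)

lemma pfs_la:
  assumes "\<And>i j. (i, j) \<in> set L \<Longrightarrow> good_pair X w i j"
    and "\<And>i j. (i, j) \<in> set L \<Longrightarrow> i \<in> X \<Longrightarrow> (if j \<in> X then z i \<noteq> z j else z i \<noteq> 0)"
  shows "la (\<lambda>z. pfs X z L \<alpha> \<beta> e) z"
  using assms
proof (induction L arbitrary: e)
  case Nil
  show ?case by (simp add: pfs_def la_const)
next
  case (Cons p L)
  obtain i j where p: "p = (i, j)" by force
  have L: "\<And>i j. (i, j) \<in> set L \<Longrightarrow> good_pair X w i j" using Cons.prems by auto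
  have ij: "good_pair X w i j" using Cons.prems by (auto simp: p)
  have "la (\<lambda>z. pf X z i j (\<alpha> i j) (\<beta> i j) e) z" for e
    by (rule pf_la) (use Cons.prems(2)[of i j] ij in \<open>auto simp: p good_pair_def\<close>)
  moreover have "la (\<lambda>z. pfs X z L \<alpha> \<beta> e) z" for e
    by (rule Cons.IH, rule Cons.prems(1), simp, rule Cons.prems(2), simp_all)
  ultimately show ?case unfolding p pfs_Cons
    by (intro mult_la[OF pf_locfin[OF ij] pfs_bdd[OF L] pf_supp pfs_supp])
qed

section \<open>Powers of the cross ratio\<close>

abbreviation xi_pfs :: "nat set \<Rightarrow> (nat \<Rightarrow> complex) \<Rightarrow> real \<Rightarrow> real \<Rightarrow> series" where
  "xi_pfs X z r s \<equiv> pfs X z pairs4 (\<lambda>i j. r * xi_exponent i j) (\<lambda>i j. s * xi_exponent i j)"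

abbreviation xi_set :: "nat set \<Rightarrow> real \<Rightarrow> real \<Rightarrow> expo set" where
  "xi_set X r s \<equiv> pfs_set X pairs4 (\<lambda>i j. r * xi_exponent i j) (\<lambda>i j. s * xi_exponent i j)"

definition xis :: "nat set \<Rightarrow> (nat \<Rightarrow> complex) \<Rightarrow> (real \<Rightarrow> real \<Rightarrow> complex) \<Rightarrow> series" where
  "xis X z J = (\<lambda>e. \<Sum>(r, s) | J r s * xi_pfs X z r s e \<noteq> 0. J r s * xi_pfs X z r s e)"

definition xis_set :: "nat set \<Rightarrow> (real \<Rightarrow> real \<Rightarrow> complex) \<Rightarrow> expo set" where
  "xis_set X J = (\<Union>(r, s)\<in>{(r, s). J r s \<noteq> 0}. xi_set X r s)"

lemma xis_empty: "xis {} z J = xi_subst_series J"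
proof
  fix e
  show "xis {} z J e = xi_subst_series J e"
    unfolding xis_def xi_subst_series_def formal_sum_def xi_pow_series_def pfs_pairs4
    by (rule sum.reindex_bij_witness[where i = "\<lambda>(r, s, e). (r, s)" and j = "\<lambda>(r, s). (r, s, e)"]) auto
qed

text \<open>The clauses ask for a weight compatible with the order of expansion, for a grade of the
  t-th power of the cross ratio that starts at \<kappa> t with \<kappa> > 0, and for a formal
  variable whose exponent in that power is t or -t modulo integers. The last two confine the powers
  contributing to a given monomial to a finite set.\<close>

definition xi_ok :: "nat set \<Rightarrow> (nat \<Rightarrow> real) \<Rightarrow> bool" where
  "xi_ok X w \<longleftrightarrow> (\<forall>(i, j)\<in>set pairs4. good_pair X w i j) \<and>
     (\<exists>\<kappa>>0. \<forall>t. (\<Sum>(i, j)\<leftarrow>pairs4. base_grade X w i j (t * xi_exponent i j)) = \<kappa> * t) \<and>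
     (\<exists>l. \<exists>\<sigma>\<in>{1, -1}. \<forall>t. (\<Sum>(i, j)\<leftarrow>pairs4. if l = i \<and> i \<notin> X then t * xi_exponent i j else 0) = \<sigma> * t)"

lemma xi_ok_empty: "xi_ok {} real"
  unfolding xi_ok_def
proof (intro conjI)
  show "\<exists>\<kappa>>0. \<forall>t. (\<Sum>(i, j)\<leftarrow>pairs4. base_grade {} real i j (t * xi_exponent i j)) = \<kappa> * t"
    by (rule exI[of _ 1]) (simp add: pairs4_def base_grade_def xi_exponent_def)
  show "\<exists>l. \<exists>\<sigma>\<in>{1, -1}. \<forall>t. (\<Sum>(i, j)\<leftarrow>pairs4. if l = i \<and> i \<notin> {} then t * xi_exponent i j else 0) = \<sigma> * t"
    by (rule exI[of _ 3], rule bexI[of _ 1]) (simp_all add: pairs4_def xi_exponent_def)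
qed (auto simp: pairs4_def good_pair_def)

lemma xi_ok_12: "xi_ok {1, 2} real"
  unfolding xi_ok_def
proof (intro conjI)
  show "\<exists>\<kappa>>0. \<forall>t. (\<Sum>(i, j)\<leftarrow>pairs4. base_grade {1, 2} real i j (t * xi_exponent i j)) = \<kappa> * t"
    by (rule exI[of _ 3]) (simp add: pairs4_def base_grade_def xi_exponent_def)
  show "\<exists>l. \<exists>\<sigma>\<in>{1, -1}. \<forall>t. (\<Sum>(i, j)\<leftarrow>pairs4. if l = i \<and> i \<notin> {1, 2} then t * xi_exponent i j else 0) = \<sigma> * t"
    by (rule exI[of _ 3], rule bexI[of _ 1]) (simp_all add: pairs4_def xi_exponent_def)
qed (auto simp: pairs4_def good_pair_def)

text \<open>Here z1 and z2 are large, so their weights -4 and -3 lie below the weight 0 of the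
  retained numbers. The starting grade of the cross ratio is -4 + 4 + 3, whence \<kappa> =
  3.\<close>

lemma xi_ok_34: "xi_ok {3, 4} (\<lambda>i. real i - 5)"
  unfolding xi_ok_def
proof (intro conjI)
  show "\<exists>\<kappa>>0. \<forall>t. (\<Sum>(i, j)\<leftarrow>pairs4. base_grade {3, 4} (\<lambda>i. real i - 5) i j (t * xi_exponent i j)) = \<kappa> * t"
    by (rule exI[of _ 3]) (simp add: pairs4_def base_grade_def xi_exponent_def)
  show "\<exists>l. \<exists>\<sigma>\<in>{1, -1}. \<forall>t. (\<Sum>(i, j)\<leftarrow>pairs4. if l = i \<and> i \<notin> {3, 4} then t * xi_exponent i j else 0) = \<sigma> * t"
    by (rule exI[of _ 2], rule bexI[of _ "- 1"]) (simp_all add: pairs4_def xi_exponent_def)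
qed (auto simp: pairs4_def good_pair_def)

lemma good_234: "(i, j) \<in> set pairs4 \<Longrightarrow> good_pair {2, 3, 4} (\<lambda>i. real i - 5) i j"
  by (auto simp: pairs4_def good_pair_def)

lemma xi_exponent_Ints: "r - s \<in> \<int> \<Longrightarrow> r * xi_exponent i j - s * xi_exponent i j \<in> \<int>"
proof -
  assume "r - s \<in> \<int>"
  then have "(r - s) * xi_exponent i j \<in> \<int>" by (intro Ints_mult) (auto simp: xi_exponent_def)
  then show ?thesis by (simp add: algebra_simps)
qed

lemma finite_shifted_ints: "finite {r :: real. a \<le> r \<and> r \<le> b \<and> r - x \<in> \<int>}"
proof (rule finite_subset)
  show "{r. a \<le> r \<and> r \<le> b \<and> r - x \<in> \<int>} \<subseteq> (\<lambda>k. of_int k + x) ` {\<lfloor>a - x\<rfloor>..\<lceil>b - x\<rceil>}"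
  proof
    fix r assume r: "r \<in> {r. a \<le> r \<and> r \<le> b \<and> r - x \<in> \<int>}"
    then obtain k where k: "r - x = of_int k" by (auto elim: Ints_cases)
    have "a - x \<le> of_int k" "of_int k \<le> b - x" using r k by auto
    then have "\<lfloor>a - x\<rfloor> \<le> k" "k \<le> \<lceil>b - x\<rceil>" by linarith+
    then show "r \<in> (\<lambda>k. of_int k + x) ` {\<lfloor>a - x\<rfloor>..\<lceil>b - x\<rceil>}"
      using k by (auto simp: image_iff intro!: bexI[of _ k])
  qed
qed auto

text \<open>With r, s \<ge> N on the support of J, the inequality that \<kappa> (r + s) is at most
  the grade of e bounds r and s from above, and the exponent of the variable l in e fixes them
  modulo integers. So only finitely many powers reach e, and the sum can be taken over an index set
  that does not depend on z.\<close>

lemma xis_props: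
  assumes ok: "xi_ok X w" and J: "J \<in> laurent_series"
  shows "finite {(r, s). J r s \<noteq> 0 \<and> e \<in> xi_set X r s}"
    and "\<exists>c. bdd_from w c (xis_set X J)"
    and "xis_set X J \<subseteq> expos ({1..4} - X)"
    and "supp (xis X z J) \<subseteq> xis_set X J"
    and "xis X z J e = (\<Sum>(r, s) | J r s \<noteq> 0 \<and> e \<in> xi_set X r s. J r s * xi_pfs X z r s e)"
proof -
  have good: "\<And>i j. (i, j) \<in> set pairs4 \<Longrightarrow> good_pair X w i j" using ok by (auto simp: xi_ok_def)
  obtain \<kappa> where \<kappa>: "\<kappa> > 0" "\<And>t. (\<Sum>(i, j)\<leftarrow>pairs4. base_grade X w i j (t * xi_exponent i j)) = \<kappa> * t"
    using ok by (auto simp: xi_ok_def)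
  obtain l \<sigma> where l: "\<sigma> \<in> {1, -1 :: real}"
    "\<And>t. (\<Sum>(i, j)\<leftarrow>pairs4. if l = i \<and> i \<notin> X then t * xi_exponent i j else 0) = \<sigma> * t"
    using ok unfolding xi_ok_def by blast
  obtain N where N: "\<And>r s. J r s \<noteq> 0 \<Longrightarrow> N \<le> r \<and> N \<le> s" and int: "\<And>r s. J r s \<noteq> 0 \<Longrightarrow> r - s \<in> \<int>"
    using J by (auto simp: laurent_series_def)
  have bdd: "bdd_from w (\<kappa> * (r + s)) (xi_set X r s)" for r s
    using pfs_bdd[OF good, of pairs4 "\<lambda>i j. r * xi_exponent i j" "\<lambda>i j. s * xi_exponent i j"]
    by (simp add: \<kappa>(2) flip: distrib_right)
  have cos: "xi_set X r s \<subseteq> coset l (\<sigma> * r) (\<sigma> * s)" for r s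
    using pfs_coset[of X pairs4 "\<lambda>i j. r * xi_exponent i j" "\<lambda>i j. s * xi_exponent i j" l] by (simp only: l(2))
  let ?F = "{(r, s). J r s \<noteq> 0 \<and> e \<in> xi_set X r s}"
  have "?F \<subseteq> {r. N \<le> r \<and> r \<le> grade w e / \<kappa> - N \<and> r - \<sigma> * fst (e l) \<in> \<int>} \<times>
      {s. N \<le> s \<and> s \<le> grade w e / \<kappa> - N \<and> s - \<sigma> * snd (e l) \<in> \<int>}"
  proof
    fix k assume "k \<in> ?F"
    then obtain r s where k: "k = (r, s)" "J r s \<noteq> 0" "e \<in> xi_set X r s" by auto
    have "\<kappa> * (r + s) \<le> grade w e" using bdd[of r s] k(3) by (auto simp: bdd_from_def)
    then have le: "r + s \<le> grade w e / \<kappa>" using \<kappa>(1) by (simp add: pos_le_divide_eq mult.commute)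
    have "e \<in> coset l (\<sigma> * r) (\<sigma> * s)" using cos[of r s] k(3) by blast
    then have "fst (e l) - \<sigma> * r \<in> \<int>" "snd (e l) - \<sigma> * s \<in> \<int>" by (auto simp: coset_def)
    then have "r - \<sigma> * fst (e l) \<in> \<int>" "s - \<sigma> * snd (e l) \<in> \<int>"
      using l(1) Ints_minus[of "fst (e l) - \<sigma> * r"] Ints_minus[of "snd (e l) - \<sigma> * s"]
      by (auto simp: add.commute)
    then show "k \<in> {r. N \<le> r \<and> r \<le> grade w e / \<kappa> - N \<and> r - \<sigma> * fst (e l) \<in> \<int>} \<times>
      {s. N \<le> s \<and> s \<le> grade w e / \<kappa> - N \<and> s - \<sigma> * snd (e l) \<in> \<int>}"
      using le N[OF k(2)] by (auto simp: k(1))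
  qed
  then show fin: "finite ?F"
    by (rule finite_subset) (intro finite_cartesian_product finite_shifted_ints)
  show "\<exists>c. bdd_from w c (xis_set X J)"
  proof (rule exI[of _ "\<kappa> * (N + N)"], unfold bdd_from_def, rule ballI)
    fix d assume "d \<in> xis_set X J"
    then obtain r s where d: "J r s \<noteq> 0" "d \<in> xi_set X r s" by (auto simp: xis_set_def)
    have "\<kappa> * (N + N) \<le> \<kappa> * (r + s)" using N[OF d(1)] \<kappa>(1) by (intro mult_left_mono) auto
    also have "\<dots> \<le> grade w d" using bdd[of r s] d(2) by (auto simp: bdd_from_def)
    finally show "\<kappa> * (N + N) \<le> grade w d" .
  qed
  show "xis_set X J \<subseteq> expos ({1..4} - X)"
    unfolding xis_set_def
  proof (intro UN_least, clarify)
    fix r s d assume "J r s \<noteq> 0" "d \<in> xi_set X r s"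
    moreover from this(1) have "xi_set X r s \<subseteq> expos ({1..4} - X)"
      by (intro pfs_set_expos) (use xi_exponent_Ints[OF int] in \<open>auto simp: pairs4_def\<close>)
    ultimately show "d \<in> expos ({1..4} - X)" by blast
  qed
  have sub: "{(r, s). J r s * xi_pfs X z r s e \<noteq> 0} \<subseteq> {(r, s). J r s \<noteq> 0 \<and> e \<in> xi_set X r s}" for e
    using pfs_supp[of X z pairs4] by (auto simp: supp_def subset_iff)
  show "supp (xis X z J) \<subseteq> xis_set X J"
  proof
    fix d assume "d \<in> supp (xis X z J)"
    then have "xis X z J d \<noteq> 0" by (simp add: supp_def)
    then have "{(r, s). J r s * xi_pfs X z r s d \<noteq> 0} \<noteq> {}"
      unfolding xis_def by (rule contrapos_nn) (simp only: sum.empty)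
    then show "d \<in> xis_set X J" using sub[of d] unfolding xis_set_def by blast
  qed
  show "xis X z J e = (\<Sum>(r, s) | J r s \<noteq> 0 \<and> e \<in> xi_set X r s. J r s * xi_pfs X z r s e)"
    unfolding xis_def by (rule sum.mono_neutral_left[OF fin sub]) auto
qed

lemma xis_cong: "(\<And>i. i \<in> X \<Longrightarrow> z i = z' i) \<Longrightarrow> xis X z J = xis X z' J"
  unfolding xis_def by (simp only: pfs_cong[of X z z'])

lemma la_scale: "la f z \<Longrightarrow> la (\<lambda>z. c * f z) z"
  by (intro la_mult la_const)

lemma xis_la:
  assumes ok: "xi_ok X w" and J: "J \<in> laurent_series"
    and "\<And>i j. (i, j) \<in> set pairs4 \<Longrightarrow> i \<in> X \<Longrightarrow> (if j \<in> X then z i \<noteq> z j else z i \<noteq> 0)"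
  shows "la (\<lambda>z. xis X z J e) z"
proof -
  have good: "\<And>i j. (i, j) \<in> set pairs4 \<Longrightarrow> good_pair X w i j" using ok by (auto simp: xi_ok_def)
  show ?thesis
    unfolding xis_props(5)[OF ok J] case_prod_unfold
    by (intro la_sum la_scale pfs_la[OF good]) (use assms(3) in auto)
qed

definition leadL :: "nat set \<Rightarrow> (nat \<Rightarrow> complex) \<Rightarrow> real" where
  "leadL X z = lead X z 1 2 * lead X z 3 4 / (lead X z 1 3 * lead X z 2 4)"

definition reg4 :: "nat set \<Rightarrow> (nat \<Rightarrow> complex) \<Rightarrow> bool" where
  "reg4 X z \<longleftrightarrow> (\<forall>(i, j)\<in>set pairs4. reg_pair X z i j)"

lemma reg4_distinct: assumes "reg4 X z" "(i, j) \<in> set pairs4" shows "z i \<noteq> z j"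
proof -
  have "reg_pair X z i j" using assms by (auto simp: reg4_def)
  then show ?thesis by (auto simp: reg_pair_def split: if_splits)
qed

lemma reg4_X4: assumes "reg4 X z" shows "z \<in> X4"
proof -
  have "{1..4 :: nat} = {1, 2, 3, 4}" by auto
  moreover have "z 1 \<noteq> z 2" "z 1 \<noteq> z 3" "z 1 \<noteq> z 4" "z 2 \<noteq> z 3" "z 2 \<noteq> z 4" "z 3 \<noteq> z 4"
    using reg4_distinct[OF assms] by (auto simp: pairs4_def)
  ultimately show ?thesis by (auto simp: X4_def inj_on_def)
qed

text \<open>Each of the four differences in the cross ratio costs 2 to the power |r| + |s|, which
  makes 16 to that power.\<close>

lemma xi_conv:
  assumes good: "\<And>i j. (i, j) \<in> set pairs4 \<Longrightarrow> good_pair X w i j"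
    and reg: "reg4 X z" and int: "r - s \<in> \<int>"
  shows "conv z (xi_pfs X z r s) (cpow (cross_ratio z) r s)
     (leadL X z powr (r + s) * 16 powr (\<bar>r\<bar> + \<bar>s\<bar>))"
proof -
  have d: "z 1 - z 2 \<noteq> 0" "z 1 - z 3 \<noteq> 0" "z 1 - z 4 \<noteq> 0" "z 2 - z 3 \<noteq> 0" "z 2 - z 4 \<noteq> 0" "z 3 - z 4 \<noteq> 0"
    using reg4_distinct[OF reg] by (auto simp: pairs4_def)
  have lp: "lead X z 1 2 > 0" "lead X z 1 3 > 0" "lead X z 2 4 > 0" "lead X z 3 4 > 0"
      "lead X z 1 4 > 0" "lead X z 2 3 > 0"
    using reg by (auto intro!: lead_pos simp: reg4_def pairs4_def)
  have "conv z (xi_pfs X z r s) (\<Prod>(i, j)\<leftarrow>pairs4. cpow (z i - z j) (r * xi_exponent i j) (s * xi_exponent i j))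
     (\<Prod>(i, j)\<leftarrow>pairs4. lead X z i j powr (r * xi_exponent i j + s * xi_exponent i j) *
        2 powr (\<bar>r * xi_exponent i j\<bar> + \<bar>s * xi_exponent i j\<bar>))"
    by (rule pfs_conv) (use good reg xi_exponent_Ints[OF int] in \<open>auto simp: reg4_def\<close>)
  moreover have "(\<Prod>(i, j)\<leftarrow>pairs4. cpow (z i - z j) (r * xi_exponent i j) (s * xi_exponent i j)) = cpow (cross_ratio z) r s"
  proof -
    have "cpow (cross_ratio z) r s = cpow ((z 1 - z 2) * (z 3 - z 4) * inverse ((z 1 - z 3) * (z 2 - z 4))) r s"
      by (simp add: cross_ratio_def divide_inverse)
    also have "\<dots> = cpow (z 1 - z 2) r s * cpow (z 3 - z 4) r s * inverse (cpow (z 1 - z 3) r s * cpow (z 2 - z 4) r s)"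
      using d int by (simp add: cpow_mult cpow_inverse del: inverse_mult_distrib)
    finally show ?thesis
      using d int by (simp add: pairs4_def xi_exponent_def cpow_0 cpow_minus)
  qed
  moreover have "(\<Prod>(i, j)\<leftarrow>pairs4. lead X z i j powr (r * xi_exponent i j + s * xi_exponent i j) *
        2 powr (\<bar>r * xi_exponent i j\<bar> + \<bar>s * xi_exponent i j\<bar>)) = leadL X z powr (r + s) * 16 powr (\<bar>r\<bar> + \<bar>s\<bar>)"
  proof -
    define t where "t = r + s"
    have "leadL X z powr t = lead X z 1 2 powr t * lead X z 3 4 powr t *
        (lead X z 1 3 powr (- t) * lead X z 2 4 powr (- t))"
      unfolding leadL_def using lp
      by (simp only: powr_divide powr_mult powr_minus divide_inverse[of _ "_ powr _ * _"] inverse_mult_distrib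
          less_imp_le mult_nonneg_nonneg)
    moreover have "(16 :: real) powr (\<bar>r\<bar> + \<bar>s\<bar>) = 2 powr (\<bar>r\<bar> + \<bar>s\<bar>) * 2 powr (\<bar>r\<bar> + \<bar>s\<bar>) * 2 powr (\<bar>r\<bar> + \<bar>s\<bar>) * 2 powr (\<bar>r\<bar> + \<bar>s\<bar>)"
      by (simp flip: powr_mult)
    moreover have "- r - s = - t" by (simp add: t_def)
    ultimately show ?thesis using lp by (simp add: pairs4_def xi_exponent_def mult_ac flip: t_def)
  qed
  ultimately show ?thesis by simp
qed

text \<open>At a regular point every difference agrees with its leading size up to a factor 2. Four
  such factors give 16 again, so the smallness condition that makes the expansion converge also puts
  the cross ratio into the disc where J converges to f.\<close>

lemma norm_cross_ratio_le: assumes "reg4 X z" shows "norm (cross_ratio z) \<le> 16 * leadL X z"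
proof -
  have b: "norm (z i - z j) \<le> 2 * lead X z i j" "lead X z i j \<le> 2 * norm (z i - z j)" if "(i, j) \<in> set pairs4" for i j
  proof -
    have "reg_pair X z i j" using assms that by (auto simp: reg4_def)
    then show "norm (z i - z j) \<le> 2 * lead X z i j" "lead X z i j \<le> 2 * norm (z i - z j)"
      using norm_triangle_ineq4[of "z i" "z j"] norm_triangle_ineq2[of "z i" "z j"] norm_ge_zero[of "z i"]
      by (auto simp: reg_pair_def lead_def split: if_splits)
  qed
  have lp: "lead X z 1 3 > 0" "lead X z 2 4 > 0" "lead X z 1 2 > 0" "lead X z 3 4 > 0"
    using assms by (auto intro!: lead_pos simp: reg4_def pairs4_def)
  have p: "(1, 2) \<in> set pairs4" "(3, 4) \<in> set pairs4" "(1, 3) \<in> set pairs4" "(2, 4) \<in> set pairs4"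
    by (auto simp: pairs4_def)
  have "norm (cross_ratio z) = (norm (z 1 - z 2) * norm (z 3 - z 4)) / (norm (z 1 - z 3) * norm (z 2 - z 4))"
    by (simp add: cross_ratio_def norm_divide norm_mult)
  also have "\<dots> \<le> ((2 * lead X z 1 2) * (2 * lead X z 3 4)) / ((lead X z 1 3 / 2) * (lead X z 2 4 / 2))"
    using b(1)[OF p(1)] b(1)[OF p(2)] b(2)[OF p(3)] b(2)[OF p(4)] lp
    by (intro frac_le mult_mono mult_nonneg_nonneg mult_pos_pos) auto
  also have "\<dots> = 16 * leadL X z" by (simp add: leadL_def)
  finally show ?thesis .
qed

text \<open>
  The series \<open>J\<close> is only known to converge in some small punctured disc; the factor 16 makes up for
  the fact that expanding \<open>\<xi>\<^sup>r\<close> costs a factor \<open>16\<^bsup>|r|\<^esup>\<close> in absolute values.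
\<close>
lemma xis_conv:
  assumes ok: "xi_ok X w" and J: "J \<in> laurent_series" and reg: "reg4 X z"
    and abs: "\<And>p. p \<in> ball 0 \<epsilon> - {0} \<Longrightarrow> (\<lambda>(r, s). norm (J r s * cpow p r s)) summable_on UNIV"
    and val: "\<And>p. p \<in> ball 0 \<epsilon> - {0} \<Longrightarrow> ((\<lambda>(r, s). J r s * cpow p r s) has_sum f p) UNIV"
    and small: "16 * leadL X z < \<epsilon>"
  shows "\<exists>M. conv z (xis X z J) (f (cross_ratio z)) M"
proof -
  have good: "\<And>i j. (i, j) \<in> set pairs4 \<Longrightarrow> good_pair X w i j" using ok by (auto simp: xi_ok_def)
  obtain N where N: "\<And>r s. J r s \<noteq> 0 \<Longrightarrow> N \<le> r \<and> N \<le> s" and int: "\<And>r s. J r s \<noteq> 0 \<Longrightarrow> r - s \<in> \<int>"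
    using J by (auto simp: laurent_series_def)
  \<comment> \<open>All exponents are at least -P, so |r| \<le> r + 2 P. The cost 16 to the power
    |r| + |s| thus becomes a constant times 16 to the power r + s, and this is absorbed by
    evaluating J at \<open>16 * leadL X z\<close>.\<close>
  define P where "P = max 0 (- N)"
  have lp: "lead X z 1 3 > 0" "lead X z 2 4 > 0" "lead X z 1 2 > 0" "lead X z 3 4 > 0"
    using reg by (auto intro!: lead_pos simp: reg4_def pairs4_def)
  then have L: "leadL X z > 0" by (simp add: leadL_def)
  have xi0: "cross_ratio z \<noteq> 0"
    using reg4_distinct[OF reg] by (auto simp: cross_ratio_def pairs4_def)
  define M where "M = (\<lambda>k :: real \<times> real. case k of (r, s) \<Rightarrow> leadL X z powr (r + s) * 16 powr (\<bar>r\<bar> + \<bar>s\<bar>))"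
  let ?A = "\<lambda>k :: real \<times> real. case k of (r, s) \<Rightarrow> xi_pfs X z r s"
  let ?c = "\<lambda>k :: real \<times> real. case k of (r, s) \<Rightarrow> J r s"
  let ?a = "\<lambda>k :: real \<times> real. case k of (r, s) \<Rightarrow> cpow (cross_ratio z) r s"
  have "conv z (xis X z J) (f (cross_ratio z)) (infsum (\<lambda>k. norm (?c k) * M k) UNIV)"
  proof (rule family_conv[where A = ?A and c = ?c and a = ?a])
    fix k assume k: "?c k \<noteq> 0"
    obtain r s where rs: "k = (r, s)" by force
    have "r - s \<in> \<int>" using k int by (simp add: rs)
    from xi_conv[OF good reg this] show "conv z (?A k) (?a k) (M k)" by (simp add: rs M_def)
  next
    let ?p = "complex_of_real (16 * leadL X z)"
    have "?p \<in> ball 0 \<epsilon> - {0}" using small L by simp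
    from abs[OF this] have s: "(\<lambda>k. 16 powr (4 * P) * (case k of (r, s) \<Rightarrow> norm (J r s * cpow ?p r s))) summable_on UNIV"
      by (rule summable_on_cmult_right)
    show "(\<lambda>k. norm (?c k) * M k) summable_on UNIV"
    proof (rule summable_on_comparison_test[OF s])
      fix k :: "real \<times> real"
      obtain r s where rs: "k = (r, s)" by force
      show "norm (?c k) * M k \<le> 16 powr (4 * P) * (case k of (r, s) \<Rightarrow> norm (J r s * cpow ?p r s))"
      proof (cases "J r s = 0")
        case False
        have "\<bar>r\<bar> + \<bar>s\<bar> \<le> 4 * P + (r + s)" using N[OF False] by (auto simp: P_def)
        then have "16 powr (\<bar>r\<bar> + \<bar>s\<bar>) \<le> (16 :: real) powr (4 * P + (r + s))" by (intro powr_mono) auto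
        then have "M k \<le> leadL X z powr (r + s) * 16 powr (4 * P + (r + s))"
          by (simp add: M_def rs mult_left_mono)
        also have "\<dots> = 16 powr (4 * P) * norm (cpow ?p r s)"
          using L by (subst norm_cpow[OF _ int[OF False]]) (auto simp: powr_add powr_mult norm_mult)
        finally show ?thesis
          by (simp add: rs norm_mult mult_left_mono mult.left_commute)
      qed (simp add: rs)
    qed (auto simp: M_def case_prod_unfold)
  next
    fix e
    have "{k. ?c k * ?A k e \<noteq> 0} \<subseteq> {(r, s). J r s \<noteq> 0 \<and> e \<in> xi_set X r s}"
      using pfs_supp[of X z pairs4] by (auto simp: supp_def subset_iff)
    then show "finite {k. ?c k * ?A k e \<noteq> 0}" using xis_props(1)[OF ok J] by (rule finite_subset)
    have eq: "{k. ?c k * ?A k e \<noteq> 0} = {(r, s). J r s * xi_pfs X z r s e \<noteq> 0}" by auto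
    show "xis X z J e = (\<Sum>k | ?c k * ?A k e \<noteq> 0. ?c k * ?A k e)"
      unfolding eq xis_def by (rule sum.cong) auto
  next
    have "cross_ratio z \<in> ball 0 \<epsilon> - {0}" using norm_cross_ratio_le[OF reg] small xi0 by simp
    from val[OF this] show "((\<lambda>k. ?c k * ?a k) has_sum f (cross_ratio z)) UNIV"
      by (simp add: case_prod_unfold)
  qed
  then show ?thesis by blast
qed

lemma converges_near_0D:
  assumes "converges_near_0 A g"
  obtains \<epsilon> where "\<epsilon> > 0"
    "\<And>p. p \<in> ball 0 \<epsilon> - {0} \<Longrightarrow> (\<lambda>(r, s). norm (A r s * cpow p r s)) summable_on UNIV"
    "\<And>p. p \<in> ball 0 \<epsilon> - {0} \<Longrightarrow> ((\<lambda>(r, s). A r s * cpow p r s) has_sum g p) UNIV"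
proof -
  obtain \<epsilon> where e: "\<epsilon> > 0"
    "\<forall>p \<in> ball 0 \<epsilon> - {0}. (\<lambda>(r, s). norm (A r s * cpow p r s)) summable_on UNIV"
    "\<forall>K. compact K \<and> K \<subseteq> ball 0 \<epsilon> - {0} \<longrightarrow>
        uniform_limit K (\<lambda>X p. \<Sum>(r, s)\<in>X. A r s * cpow p r s) g (finite_subsets_at_top UNIV)"
    using assms unfolding converges_near_0_def by (elim exE conjE)
  show ?thesis
  proof (rule that[OF e(1) bspec[OF e(2)]])
    fix p :: complex assume p: "p \<in> ball 0 \<epsilon> - {0}"
    have "compact {p} \<and> {p} \<subseteq> ball 0 \<epsilon> - {0}" using p by simp
    then have "uniform_limit {p} (\<lambda>X p. \<Sum>(r, s)\<in>X. A r s * cpow p r s) g (finite_subsets_at_top UNIV)"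
      using e(3) by (elim allE impE) 
    then show "((\<lambda>(r, s). A r s * cpow p r s) has_sum g p) UNIV"
      unfolding has_sum_def by (rule tendsto_uniform_limitI) simp
  qed
qed

lemma pairs4_range: "(i, j) \<in> set pairs4 \<Longrightarrow> i \<in> {1..4} \<and> j \<in> {1..4}"
  by (auto simp: pairs4_def)

definition G4 :: "nat set \<Rightarrow> (nat \<Rightarrow> complex) \<Rightarrow> (nat \<Rightarrow> nat \<Rightarrow> real) \<Rightarrow> (nat \<Rightarrow> nat \<Rightarrow> real) \<Rightarrow>
    (real \<Rightarrow> real \<Rightarrow> complex) \<Rightarrow> series" where
  "G4 X z \<alpha> \<beta> J = pfs X z pairs4 \<alpha> \<beta> \<odot> xis X z J"

lemma G4_props:
  assumes ok: "xi_ok X w" and J: "is_j (\<lambda>p. p) f J"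
    and int: "\<And>i j. (i, j) \<in> set pairs4 \<Longrightarrow> \<alpha> i j - \<beta> i j \<in> \<int>"
  shows "supp (G4 X z \<alpha> \<beta> J) \<subseteq> expos ({1..4} - X)"
    and "(\<And>i. i \<in> X \<Longrightarrow> z i = z' i) \<Longrightarrow> G4 X z \<alpha> \<beta> J = G4 X z' \<alpha> \<beta> J"
    and "(\<And>i j. (i, j) \<in> set pairs4 \<Longrightarrow> i \<in> X \<Longrightarrow> (if j \<in> X then z i \<noteq> z j else z i \<noteq> 0)) \<Longrightarrow>
       la (\<lambda>z. G4 X z \<alpha> \<beta> J e) z"
    and "\<exists>\<epsilon>>0. \<forall>z. reg4 X z \<longrightarrow> 16 * leadL X z < \<epsilon> \<longrightarrow>
       ((\<lambda>e. G4 X z \<alpha> \<beta> J e * mon z e) has_sum cor4_fun \<alpha> \<beta> f z) UNIV"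
proof -
  have good: "\<And>i j. (i, j) \<in> set pairs4 \<Longrightarrow> good_pair X w i j" using ok by (auto simp: xi_ok_def)
  have L: "J \<in> laurent_series" and cv: "converges_near_0 J f" using J by (auto simp: is_j_def)
  obtain c where c: "bdd_from w c (xis_set X J)" using xis_props(2)[OF ok L] by (elim exE)
  have ex: "pfs_set X pairs4 \<alpha> \<beta> \<subseteq> expos ({1..4} - X)"
    by (rule pfs_set_expos, intro conjI int) (blast dest: pairs4_range)+
  show "supp (G4 X z \<alpha> \<beta> J) \<subseteq> expos ({1..4} - X)"
    unfolding G4_def
    by (rule order_trans[OF supp_mult[OF pfs_supp xis_props(4)[OF ok L]] expo_plus_expos[OF ex xis_props(3)[OF ok L]]])
  show "G4 X z \<alpha> \<beta> J = G4 X z' \<alpha> \<beta> J" if "\<And>i. i \<in> X \<Longrightarrow> z i = z' i"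
    unfolding G4_def by (simp only: pfs_cong[OF that] xis_cong[OF that])
  show "la (\<lambda>z. G4 X z \<alpha> \<beta> J e) z"
    if "\<And>i j. (i, j) \<in> set pairs4 \<Longrightarrow> i \<in> X \<Longrightarrow> (if j \<in> X then z i \<noteq> z j else z i \<noteq> 0)"
    unfolding G4_def
  proof (rule mult_la[OF pfs_locfin[OF good] c pfs_supp xis_props(4)[OF ok L]])
    show "la (\<lambda>z. pfs X z pairs4 \<alpha> \<beta> e) z" for e by (rule pfs_la[OF good that])
    show "la (\<lambda>z. xis X z J e) z" for e by (rule xis_la[OF ok L that])
  qed
  obtain \<epsilon> where e: "\<epsilon> > 0"
    "\<And>p. p \<in> ball 0 \<epsilon> - {0} \<Longrightarrow> (\<lambda>(r, s). norm (J r s * cpow p r s)) summable_on UNIV"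
    "\<And>p. p \<in> ball 0 \<epsilon> - {0} \<Longrightarrow> ((\<lambda>(r, s). J r s * cpow p r s) has_sum f p) UNIV"
    by (rule converges_near_0D[OF cv]) (rule that; assumption)
  have "((\<lambda>e. G4 X z \<alpha> \<beta> J e * mon z e) has_sum cor4_fun \<alpha> \<beta> f z) UNIV"
    if reg: "reg4 X z" and small: "16 * leadL X z < \<epsilon>" for z
  proof -
    obtain M where M: "conv z (xis X z J) (f (cross_ratio z)) M"
      using xis_conv[OF ok L reg e(2,3) small] by blast
    have P: "conv z (pfs X z pairs4 \<alpha> \<beta>) (\<Prod>(i, j)\<leftarrow>pairs4. cpow (z i - z j) (\<alpha> i j) (\<beta> i j))
       (\<Prod>(i, j)\<leftarrow>pairs4. lead X z i j powr (\<alpha> i j + \<beta> i j) * 2 powr (\<bar>\<alpha> i j\<bar> + \<bar>\<beta> i j\<bar>))"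
      by (rule pfs_conv[where w = w], intro conjI good int) (use reg in \<open>auto simp: reg4_def\<close>)
    have "(\<Prod>(i, j)\<leftarrow>pairs4. cpow (z i - z j) (\<alpha> i j) (\<beta> i j)) * f (cross_ratio z) = cor4_fun \<alpha> \<beta> f z"
      using reg4_X4[OF reg] by (simp add: cor4_fun_def pairs4_def mult_ac)
    with mult_conv[OF pfs_locfin[OF good] c pfs_supp xis_props(4)[OF ok L] ex xis_props(3)[OF ok L] P M]
    show ?thesis by (simp add: conv_def G4_def)
  qed
  then show "\<exists>\<epsilon>>0. \<forall>z. reg4 X z \<longrightarrow> 16 * leadL X z < \<epsilon> \<longrightarrow>
       ((\<lambda>e. G4 X z \<alpha> \<beta> J e * mon z e) has_sum cor4_fun \<alpha> \<beta> f z) UNIV" using e(1) by blast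
qed

section \<open>Expansion at large \<open>z\<^sub>1\<close>\<close>

text \<open>
  For \<open>z\<^sub>4 = 0\<close> the cross ratio is \<open>z\<^sub>3 / z\<^sub>2 + q / (z\<^sub>1 - z\<^sub>3)\<close> with \<open>q = - (z\<^sub>2 - z\<^sub>3) z\<^sub>3 / z\<^sub>2\<close>, and
  \<open>f\<close> is Taylor-expanded at \<open>z\<^sub>3 / z\<^sub>2\<close>.
\<close>

definition qq :: "(nat \<Rightarrow> complex) \<Rightarrow> complex" where
  "qq z = - (z 2 - z 3) * z 3 / z 2"

abbreviation (input) pf13 :: "(nat \<Rightarrow> complex) \<Rightarrow> nat \<Rightarrow> nat \<Rightarrow> series" where
  "pf13 z m n \<equiv> pf {2, 3, 4} z 1 3 (- real m) (- real n)"

abbreviation (input) pf13_set :: "nat \<Rightarrow> nat \<Rightarrow> expo set" where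
  "pf13_set m n \<equiv> pf_set {2, 3, 4} 1 3 (- real m) (- real n)"

definition tay :: "(complex \<Rightarrow> complex) \<Rightarrow> (nat \<Rightarrow> complex) \<Rightarrow> series" where
  "tay f z = (\<lambda>e. \<Sum>(m, n) | e \<in> pf13_set m n.
     taylor f (z 3 / z 2) m n * qq z ^ m * cnj (qq z) ^ n * pf13 z m n e)"

lemma good13: "good_pair {2, 3, 4} (\<lambda>i. real i - 5) 1 3"
  by (rule good_234) (simp add: pairs4_def)

text \<open>The variable z1 has weight -4 and enters the term (m, n) with exponents of total at most
  -(m + n). Higher Taylor terms therefore start at higher grade, and each monomial receives only
  finitely many of them.\<close>

lemma pf13_bdd: "e \<in> pf13_set m n \<Longrightarrow> 4 * (real m + real n) \<le> grade (\<lambda>i. real i - 5) e"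
  using pf_bdd[OF good13, of "- real m" "- real n"] by (auto simp: bdd_from_def base_grade_def)

lemma finite_pf13: "finite {(m, n). e \<in> pf13_set m n}"
proof (rule finite_subset)
  let ?N = "nat \<lceil>grade (\<lambda>i. real i - 5) e\<rceil>"
  show "{(m, n). e \<in> pf13_set m n} \<subseteq> {..?N} \<times> {..?N}"
  proof
    fix k assume "k \<in> {(m, n). e \<in> pf13_set m n}"
    then obtain m n where k: "k = (m, n)" "e \<in> pf13_set m n" by auto
    note b = pf13_bdd[OF k(2)]
    have "real m \<le> grade (\<lambda>i. real i - 5) e" by (rule order_trans[OF _ b]) simp
    moreover have "real n \<le> grade (\<lambda>i. real i - 5) e" by (rule order_trans[OF _ b]) simp
    ultimately have "m \<le> ?N" "n \<le> ?N"
      using real_nat_ceiling_ge order_trans of_nat_le_iff by blast+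
    then show "k \<in> {..?N} \<times> {..?N}" by (simp add: k(1))
  qed
qed simp

definition tay_set :: "expo set" where
  "tay_set = (\<Union>(m, n). pf13_set m n)"

lemma tay_bdd: "bdd_from (\<lambda>i. real i - 5) 0 tay_set"
  unfolding bdd_from_def tay_set_def using pf13_bdd by fastforce

lemma tay_expos: "tay_set \<subseteq> expos {1}"
proof -
  have "pf13_set m n \<subseteq> expos ({1, 2, 3, 4} - {2, 3, 4})" for m n
    by (rule pf_set_expos) auto
  moreover have "{1, 2, 3, 4} - {2, 3, 4} = {1 :: nat}" by auto
  ultimately show ?thesis by (auto simp: tay_set_def)
qed

lemma tay_supp: "supp (tay f z) \<subseteq> tay_set"
proof
  fix e assume "e \<in> supp (tay f z)"
  then have "tay f z e \<noteq> 0" by (simp add: supp_def)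
  then have "{(m, n). e \<in> pf13_set m n} \<noteq> {}"
    unfolding tay_def by (rule contrapos_nn) (simp only: sum.empty)
  then show "e \<in> tay_set" by (auto simp: tay_set_def)
qed

text \<open>The centre z3 / z2 moves with the point, so the Taylor coefficients have to be analytic
  as functions of the centre.\<close>

lemma tay_la:
  assumes f: "real_analytic_on f (- {0, 1})" and z: "z 2 \<noteq> 0" "z 3 \<noteq> 0" "z 2 \<noteq> z 3"
  shows "la (\<lambda>z. tay f z e) z"
proof -
  have "z 3 / z 2 \<in> - {0, 1}" using z by (simp add: divide_eq_1_iff)
  then obtain \<rho> where "\<And>m n. \<exists>c. wps (\<lambda>x. taylor f x m n) (z 3 / z 2) c \<rho>"
    by (rule taylor_locally[OF f]) (rule that; assumption)
  moreover have "la (\<lambda>z. z 3 / z 2) z" by (rule la_divide[OF la_coord la_coord]) (rule z(1))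
  ultimately have t: "la (\<lambda>z. taylor f (z 3 / z 2) m n) z" for m n
    using la_wps[where f = "\<lambda>z. z 3 / z 2" and z = z] by blast
  have q: "la qq z"
    unfolding qq_def using z
    by (intro la_divide la_mult la_coord la_diff) (auto intro!: la_scale[of _ _ "- 1", simplified] la_diff la_coord)
  have "la (\<lambda>z. pf13 z m n e) z" for m n
    by (rule pf_la) auto
  then show ?thesis
    unfolding tay_def case_prod_unfold by (intro la_sum la_mult t la_power la_cnj q)
qed

text \<open>The displacement from z3 / z2 to the cross ratio is h = q / (z1 - z3). Since |z1 - z3|
  \<ge> |z1| / 2, both h and the number R = 2 |q| / |z1|, which dominates the expanded powers, stay
  inside the radius \<rho>.\<close>

lemma tay_conv:
  assumes w: "wps f (z 3 / z 2) (taylor f (z 3 / z 2)) \<rho>" and z2: "z 2 \<noteq> 0" and z4: "z 4 = 0"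
    and reg: "reg_pair {2, 3, 4} z 1 3" and small: "2 * norm (qq z) / norm (z 1) < \<rho>"
  shows "\<exists>M. conv z (tay f z) (f (cross_ratio z)) M"
proof -
  have z1: "z 1 \<noteq> 0" "2 * norm (z 3) \<le> norm (z 1)" using reg by (auto simp: reg_pair_def)
  have l: "lead {2, 3, 4} z 1 3 = norm (z 1)" by (simp add: lead_def)
  have "norm (z 1) - norm (z 3) \<le> norm (z 1 - z 3)" by (rule norm_triangle_ineq2)
  then have n13: "norm (z 1) / 2 \<le> norm (z 1 - z 3)" using z1(2) by simp
  have "norm (z 1) > 0" using z1(1) by simp
  then have p13: "norm (z 1 - z 3) > 0" using n13 by linarith
  then have d13: "z 1 - z 3 \<noteq> 0" by auto
  define R where "R = 2 * norm (qq z) / norm (z 1)"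
  define h where "h = qq z / (z 1 - z 3)"
  have "norm h \<le> norm (qq z) / (norm (z 1) / 2)"
    unfolding h_def norm_divide using n13 z1(1) by (intro divide_left_mono mult_pos_pos p13) auto
  also have "\<dots> = 2 * norm (qq z) / norm (z 1)" by simp
  finally have h: "norm h < \<rho>" using small by (rule le_less_trans)
  have ph: "z 3 / z 2 + h = cross_ratio z"
    using z2 d13 by (simp add: h_def qq_def cross_ratio_def z4 field_simps)
  let ?c = "\<lambda>k. case k of (m, n) \<Rightarrow> taylor f (z 3 / z 2) m n * qq z ^ m * cnj (qq z) ^ n"
  let ?A = "\<lambda>k. case k of (m, n) \<Rightarrow> pf13 z m n"
  let ?a = "\<lambda>k. case k of (m, n) \<Rightarrow> cpow (z 1 - z 3) (- real m) (- real n)"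
  let ?M = "\<lambda>k. case k of (m, n) \<Rightarrow> (2 / norm (z 1)) ^ (m + n)"
  have "conv z (tay f z) (f (cross_ratio z)) (infsum (\<lambda>k. norm (?c k) * ?M k) UNIV)"
  proof (rule family_conv[where A = ?A and c = ?c and a = ?a])
    fix k :: "nat \<times> nat"
    obtain m n where k: "k = (m, n)" by force
    have "lead {2, 3, 4} z 1 3 powr (- real m + - real n) * 2 powr (\<bar>- real m\<bar> + \<bar>- real n\<bar>) = (2 / norm (z 1)) ^ (m + n)"
    proof -
      have "norm (z 1) powr (- real (m + n)) * 2 powr real (m + n) = (2 / norm (z 1)) ^ (m + n)"
      proof -
        have "norm (z 1) > 0" using z1(1) by simp
        then have "norm (z 1) powr (- real (m + n)) = inverse (norm (z 1) ^ (m + n))"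
          by (simp only: powr_minus powr_realpow)
        moreover have "2 powr real (m + n) = (2 :: real) ^ (m + n)" by (rule powr_realpow) simp
        ultimately show ?thesis by (simp only:) (simp add: power_divide divide_inverse power_inverse)
      qed
      then show ?thesis unfolding l by simp
    qed
    then show "conv z (?A k) (?a k) (?M k)"
      using pf_conv[of 1 3 "- real m" "- real n" "{2, 3, 4}" z] reg by (simp add: k)
  next
    have "(\<lambda>(m, n). norm (taylor f (z 3 / z 2) m n) * R ^ (m + n)) summable_on UNIV"
      by (rule wps_summable[OF w]) (use small in \<open>auto simp: R_def\<close>)
    also have "(\<lambda>(m, n). norm (taylor f (z 3 / z 2) m n) * R ^ (m + n)) = (\<lambda>k. norm (?c k) * ?M k)"
      by (auto simp: fun_eq_iff R_def norm_mult norm_power power_divide power_mult_distrib power_add)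
    finally show "(\<lambda>k. norm (?c k) * ?M k) summable_on UNIV" .
  next
    fix e
    have sub: "{k. ?c k * ?A k e \<noteq> 0} \<subseteq> {(m, n). e \<in> pf13_set m n}"
      using pf_supp[of "{2, 3, 4}" z 1 3] by (auto simp: supp_def subset_iff)
    then show "finite {k. ?c k * ?A k e \<noteq> 0}" using finite_pf13 by (rule finite_subset)
    show "tay f z e = (\<Sum>k | ?c k * ?A k e \<noteq> 0. ?c k * ?A k e)"
      unfolding tay_def by (rule sum.mono_neutral_cong_right[OF finite_pf13 sub]) auto
  next
    have "cpow (z 1 - z 3) (- real m) (- real n) = inverse ((z 1 - z 3) ^ m * cnj (z 1 - z 3) ^ n)" for m n
      using cpow_minus[OF d13, of "real m" "real n"] cpow_nat[OF d13, of m n] by simp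
    then have "?c k * ?a k = (case k of (m, n) \<Rightarrow> taylor f (z 3 / z 2) m n * h ^ m * cnj h ^ n)" for k
      by (cases k) (simp add: h_def power_divide divide_inverse power_mult_distrib power_inverse mult_ac)
    then show "((\<lambda>k. ?c k * ?a k) has_sum f (cross_ratio z)) UNIV"
      using wpsD[OF w h] by (simp only: ph)
  qed
  then show ?thesis by blast
qed

lemma tay_cong: "(\<And>i. i \<in> {2, 3, 4} \<Longrightarrow> z i = z' i) \<Longrightarrow> tay f z = tay f z'"
proof -
  assume a: "\<And>i. i \<in> {2, 3, 4} \<Longrightarrow> z i = z' i"
  have "z 2 = z' 2" "z 3 = z' 3" using a by auto
  then show ?thesis unfolding tay_def qq_def by (simp only: pf_cong[OF a])
qed

definition G3 :: "(nat \<Rightarrow> complex) \<Rightarrow> (nat \<Rightarrow> nat \<Rightarrow> real) \<Rightarrow> (nat \<Rightarrow> nat \<Rightarrow> real) \<Rightarrow> (complex \<Rightarrow> complex) \<Rightarrow> series" where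
  "G3 z \<alpha> \<beta> f = pfs {2, 3, 4} z pairs4 \<alpha> \<beta> \<odot> tay f z"

lemma G3_props:
  assumes f: "real_analytic_on f (- {0, 1})"
    and int: "\<And>i j. (i, j) \<in> set pairs4 \<Longrightarrow> \<alpha> i j - \<beta> i j \<in> \<int>"
  shows "supp (G3 z \<alpha> \<beta> f) \<subseteq> expos {1}"
    and "(\<And>i. i \<in> {2, 3, 4} \<Longrightarrow> z i = z' i) \<Longrightarrow> G3 z \<alpha> \<beta> f = G3 z' \<alpha> \<beta> f"
    and "z 2 \<noteq> 0 \<Longrightarrow> z 3 \<noteq> 0 \<Longrightarrow> z 2 \<noteq> z 3 \<Longrightarrow> z 4 = 0 \<Longrightarrow> la (\<lambda>z. G3 z \<alpha> \<beta> f e) z"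
    and "x \<noteq> 0 \<Longrightarrow> y \<noteq> 0 \<Longrightarrow> x \<noteq> y \<Longrightarrow> \<exists>\<epsilon>>0. \<forall>z. norm (z 2 - x) < \<epsilon> \<longrightarrow> norm (z 3 - y) < \<epsilon> \<longrightarrow> z 4 = 0 \<longrightarrow>
       1 / \<epsilon> < norm (z 1) \<longrightarrow> ((\<lambda>e. G3 z \<alpha> \<beta> f e * mon z e) has_sum cor4_fun \<alpha> \<beta> f z) UNIV"
proof -
  let ?X = "{2, 3, 4} :: nat set"
  have ex: "pfs_set ?X pairs4 \<alpha> \<beta> \<subseteq> expos {1}"
  proof -
    have "pfs_set ?X pairs4 \<alpha> \<beta> \<subseteq> expos ({1, 2, 3, 4} - ?X)"
      by (rule pfs_set_expos, intro conjI int) (auto simp: pairs4_def)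
    moreover have "{1, 2, 3, 4} - ?X = {1}" by auto
    ultimately show ?thesis by simp
  qed
  show "supp (G3 z \<alpha> \<beta> f) \<subseteq> expos {1}"
    unfolding G3_def
    by (rule order_trans[OF supp_mult[OF pfs_supp tay_supp] expo_plus_expos[OF ex tay_expos]])
  show "G3 z \<alpha> \<beta> f = G3 z' \<alpha> \<beta> f" if "\<And>i. i \<in> ?X \<Longrightarrow> z i = z' i"
    unfolding G3_def by (simp only: pfs_cong[OF that] tay_cong[OF that])
  show "la (\<lambda>z. G3 z \<alpha> \<beta> f e) z" if "z 2 \<noteq> 0" "z 3 \<noteq> 0" "z 2 \<noteq> z 3" "z 4 = 0"
    unfolding G3_def
  proof (rule mult_la[OF pfs_locfin[OF good_234] tay_bdd pfs_supp tay_supp])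
    show "la (\<lambda>z. pfs ?X z pairs4 \<alpha> \<beta> e) z" for e
      by (rule pfs_la[OF good_234]) (use that in \<open>auto simp: pairs4_def\<close>)
    show "la (\<lambda>z. tay f z e) z" for e by (rule tay_la[OF f that(1-3)])
  qed
  show "\<exists>\<epsilon>>0. \<forall>z. norm (z 2 - x) < \<epsilon> \<longrightarrow> norm (z 3 - y) < \<epsilon> \<longrightarrow> z 4 = 0 \<longrightarrow>
       1 / \<epsilon> < norm (z 1) \<longrightarrow> ((\<lambda>e. G3 z \<alpha> \<beta> f e * mon z e) has_sum cor4_fun \<alpha> \<beta> f z) UNIV"
    if xy: "x \<noteq> 0" "y \<noteq> 0" "x \<noteq> y"
  proof -
    have "y / x \<in> - {0, 1}" using xy by (simp add: divide_eq_1_iff)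
    then obtain \<rho> where \<rho>: "\<rho> > 0" "\<And>k. norm k < \<rho> \<Longrightarrow> wps f (y / x + k) (taylor f (y / x + k)) \<rho>"
      by (rule taylor_locally[OF f]) (rule that; assumption)
    define B where "B = norm (- (x - y) * y / x) + 1"
    \<comment> \<open>Open conditions that hold at (x, y); they make the Taylor radius \<rho> and
      the bound B on |q| uniform nearby.\<close>
    have "eventually (\<lambda>p. fst p \<noteq> 0 \<and> snd p \<noteq> 0 \<and> fst p - snd p \<noteq> 0 \<and> norm (snd p / fst p - y / x) < \<rho> \<and>
        norm (- (fst p - snd p) * snd p / fst p) < B \<and> norm (fst p) < norm x + 1 \<and> norm (snd p) < norm y + 1) (nhds (x, y))"
    proof (intro eventually_conj)
      note t = tendsto_fst[OF filterlim_ident[of "nhds (x, y)"]] tendsto_snd[OF filterlim_ident[of "nhds (x, y)"]]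
      show "\<forall>\<^sub>F p in nhds (x, y). fst p \<noteq> 0" using tendsto_imp_eventually_ne[OF t(1)] xy by simp
      show "\<forall>\<^sub>F p in nhds (x, y). snd p \<noteq> 0" using tendsto_imp_eventually_ne[OF t(2)] xy by simp
      show "\<forall>\<^sub>F p in nhds (x, y). fst p - snd p \<noteq> 0"
        by (rule tendsto_imp_eventually_ne[OF tendsto_diff[OF t]]) (use xy in simp)
      have "((\<lambda>p. norm (snd p / fst p - y / x)) \<longlongrightarrow> norm (y / x - y / x)) (nhds (x, y))"
        by (intro tendsto_intros t[simplified]) (use xy in auto)
      then show "\<forall>\<^sub>F p in nhds (x, y). norm (snd p / fst p - y / x) < \<rho>"
        using order_tendstoD(2) \<rho>(1) by fastforce
      have "((\<lambda>p. norm (- (fst p - snd p) * snd p / fst p)) \<longlongrightarrow> norm (- (x - y) * y / x)) (nhds (x, y))"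
        by (intro tendsto_intros t[simplified]) (use xy in auto)
      then show "\<forall>\<^sub>F p in nhds (x, y). norm (- (fst p - snd p) * snd p / fst p) < B"
        by (rule order_tendstoD(2)) (simp add: B_def)
      show "\<forall>\<^sub>F p in nhds (x, y). norm (fst p) < norm x + 1"
        by (rule order_tendstoD(2)[OF tendsto_norm[OF t(1)]]) simp
      show "\<forall>\<^sub>F p in nhds (x, y). norm (snd p) < norm y + 1"
        by (rule order_tendstoD(2)[OF tendsto_norm[OF t(2)]]) simp
    qed
    then obtain \<delta> where \<delta>: "\<delta> > 0" "\<And>a b. dist (a, b) (x, y) < \<delta> \<Longrightarrow>
        a \<noteq> 0 \<and> b \<noteq> 0 \<and> a - b \<noteq> 0 \<and> norm (b / a - y / x) < \<rho> \<and>
        norm (- (a - b) * b / a) < B \<and> norm a < norm x + 1 \<and> norm b < norm y + 1"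
      unfolding eventually_nhds_metric by force
    \<comment> \<open>|z1| > K forces 2 |q| / |z1| < \<rho>, and the other two terms of C make |z1|
      dominate 2 |z2| and 2 |z3|.\<close>
    define K where "K = 2 * B / \<rho>"
    define C where "C = 2 * (norm x + 1) + 2 * (norm y + 1) + K"
    have Bp: "B > 0" by (simp add: B_def add_nonneg_pos)
    have Cge: "2 * (norm x + 1) \<le> C" "2 * (norm y + 1) \<le> C" "K \<le> C" "C > 0"
    proof -
      have "0 \<le> norm x" "0 \<le> norm y" "0 < K" using Bp \<rho>(1) by (simp_all add: K_def)
      note nn = this
      show "2 * (norm x + 1) \<le> C" unfolding C_def distrib_left using nn by linarith
      show "2 * (norm y + 1) \<le> C" unfolding C_def distrib_left using nn by linarith
      show "K \<le> C" unfolding C_def distrib_left using nn by linarith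
      show "C > 0" unfolding C_def distrib_left using nn by linarith
    qed
    define \<epsilon> where "\<epsilon> = min (\<delta> / 2) (1 / C)"
    have e: "\<epsilon> > 0" "2 * \<epsilon> \<le> \<delta>" "C \<le> 1 / \<epsilon>"
    proof -
      show pos: "\<epsilon> > 0" using \<delta>(1) Cge(4) by (simp add: \<epsilon>_def)
      show "2 * \<epsilon> \<le> \<delta>" by (simp add: \<epsilon>_def min_def)
      have "\<epsilon> \<le> 1 / C" by (simp add: \<epsilon>_def)
      then show "C \<le> 1 / \<epsilon>" using pos Cge(4) by (simp add: field_simps)
    qed
    have "((\<lambda>e. G3 z \<alpha> \<beta> f e * mon z e) has_sum cor4_fun \<alpha> \<beta> f z) UNIV"
      if z: "norm (z 2 - x) < \<epsilon>" "norm (z 3 - y) < \<epsilon>" "z 4 = 0" "1 / \<epsilon> < norm (z 1)" for z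
    proof -
      have "dist (z 2, z 3) (x, y) \<le> norm (z 2 - x) + norm (z 3 - y)"
        using sqrt_sum_squares_le_sum[of "norm (z 2 - x)" "norm (z 3 - y)"] by (simp add: dist_prod_def dist_norm)
      then have "dist (z 2, z 3) (x, y) < \<delta>" using z e by linarith
      note D = \<delta>(2)[OF this]
      have z1: "C < norm (z 1)" using z(4) e(3) by linarith
      then have z1': "norm (z 1) > 0" "z 1 \<noteq> 0" using Cge(4) by (auto intro: less_trans)
      have reg: "reg4 ?X z"
        using D z1 z1' Cge z(3) by (auto simp: reg4_def pairs4_def reg_pair_def)
      have w: "wps f (z 3 / z 2) (taylor f (z 3 / z 2)) \<rho>"
        using \<rho>(2)[of "z 3 / z 2 - y / x"] D by simp
      have "2 * norm (qq z) < 2 * B" using D by (simp only: qq_def) simp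
      moreover have "2 * B < \<rho> * norm (z 1)"
      proof -
        have "K < norm (z 1)" using Cge(3) z1 by (rule le_less_trans)
        then show ?thesis using \<rho>(1) by (simp add: K_def pos_divide_less_eq mult.commute)
      qed
      ultimately have small: "2 * norm (qq z) / norm (z 1) < \<rho>"
        using z1' by (simp add: pos_divide_less_eq)
      obtain M where M: "conv z (tay f z) (f (cross_ratio z)) M"
        using tay_conv[of f z, OF w _ z(3) _ small] reg D by (auto simp: reg4_def pairs4_def)
      have P: "conv z (pfs ?X z pairs4 \<alpha> \<beta>) (\<Prod>(i, j)\<leftarrow>pairs4. cpow (z i - z j) (\<alpha> i j) (\<beta> i j))
         (\<Prod>(i, j)\<leftarrow>pairs4. lead ?X z i j powr (\<alpha> i j + \<beta> i j) * 2 powr (\<bar>\<alpha> i j\<bar> + \<bar>\<beta> i j\<bar>))"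
        by (rule pfs_conv[where w = "\<lambda>i. real i - 5"], intro conjI good_234 int) (use reg in \<open>auto simp: reg4_def\<close>)
      have "(\<Prod>(i, j)\<leftarrow>pairs4. cpow (z i - z j) (\<alpha> i j) (\<beta> i j)) * f (cross_ratio z) = cor4_fun \<alpha> \<beta> f z"
        using reg4_X4[OF reg] by (simp add: cor4_fun_def pairs4_def mult_ac)
      with mult_conv[OF pfs_locfin[OF good_234] tay_bdd pfs_supp tay_supp ex tay_expos P M]
      show ?thesis by (simp add: conv_def G3_def)
    qed
    then show ?thesis using e(1) by blast
  qed
qed

section \<open>Evaluating the expansions of two-point functions\<close>

lemma two_point_conv:
  assumes ij: "i \<in> {1, 2}" "j \<in> {1, 2}" "i \<noteq> j"
    and int: "\<alpha>1 - \<beta>1 \<in> \<int>" "\<alpha>2 - \<beta>2 \<in> \<int>" "\<alpha> - \<beta> \<in> \<int>"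
    and J: "J \<in> laurent_series"
    and val: "\<And>p. p \<in> ball 0 \<epsilon> - {0} \<Longrightarrow> ((\<lambda>(r, s). J r s * cpow p r s) has_sum g p) UNIV"
  defines "A \<equiv> monomial (expo_add (pw 1 \<alpha>1 \<beta>1) (pw 2 \<alpha>2 \<beta>2)) \<odot> (binom_series i j (-1) \<alpha> \<beta> \<odot> subst_series j i J)"
  shows "supp A \<subseteq> expos {1, 2}"
    and "z 1 \<noteq> 0 \<Longrightarrow> z 2 \<noteq> 0 \<Longrightarrow> 2 * norm (z j) \<le> norm (z i) \<Longrightarrow> norm (z j / z i) < \<epsilon> \<Longrightarrow>
      ((\<lambda>e. A e * mon z e) has_sum
        (cpow (z 1) \<alpha>1 \<beta>1 * cpow (z 2) \<alpha>2 \<beta>2 * (cpow (z i - z j) \<alpha> \<beta> * g (z j / z i)))) UNIV"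
proof -
  \<comment> \<open>The expansion proceeds in powers of z_j / z_i, and its order is counted by the
    exponents of z_j alone.\<close>
  define w where "w = (\<lambda>k. if k = j then 1 else 0 :: real)"
  let ?d = "expo_add (pw 1 \<alpha>1 \<beta>1) (pw 2 \<alpha>2 \<beta>2)"
  define m where "m = (\<lambda>(r, s). expo_add (pw j r s) (pw i (- r) (- s)))"
  define T where "T = m ` {(r, s). J r s \<noteq> 0}"
  have ij4: "i \<in> {1..4}" "j \<in> {1..4}" using ij by auto
  obtain N where N: "\<And>r s. J r s \<noteq> 0 \<Longrightarrow> N \<le> r \<and> N \<le> s" and intJ: "\<And>r s. J r s \<noteq> 0 \<Longrightarrow> r - s \<in> \<int>"
    using J by (auto simp: laurent_series_def)
  have gp: "good_pair {} w i j" using ij ij4 by (simp add: good_pair_def w_def)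
  have b: "binom_series i j (-1) \<alpha> \<beta> = pf {} z i j \<alpha> \<beta>" for z by (simp add: pf_empty)
  have injm: "inj m"
  proof (rule injI)
    fix k k' assume eq: "m k = m k'"
    show "k = k'" using fun_cong[OF eq, of j] ij(3)
      by (cases k; cases k') (auto simp: m_def expo_add_def pw_def)
  qed
  have sT: "supp (subst_series j i J) \<subseteq> T"
    by (auto simp: supp_def subst_series_def formal_sum_def T_def m_def elim!: sum.not_neutral_contains_not_neutral)
  have Tb: "bdd_from w (N + N) T"
    unfolding bdd_from_def
  proof
    fix e assume "e \<in> T"
    then obtain r s where e: "J r s \<noteq> 0" "e = expo_add (pw j r s) (pw i (- r) (- s))" by (auto simp: T_def m_def)
    have "grade w e = r + s" using ij ij4 by (simp add: e(2) grade_add grade_pw w_def)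
    then show "N + N \<le> grade w e" using N[OF e(1)] by simp
  qed
  have mr: "- r - - s \<in> \<int>" if "J r s \<noteq> 0" for r s
    using Ints_minus[OF intJ[OF that]] by simp
  have Te: "T \<subseteq> expos {1, 2}"
    using ij by (auto simp: T_def m_def intro!: expos_add pw_expos intJ mr)
  have Pe: "pf_set {} i j \<alpha> \<beta> \<subseteq> expos {1, 2}"
    using pf_set_expos[OF int(3) ij(1,2), of "{}"] by simp
  have de: "{?d} \<subseteq> expos {1, 2}" using int by (auto intro!: expos_add pw_expos)
  have lfd: "locfin w {?d}" by (simp add: locfin_def)
  have sd: "supp (monomial ?d) \<subseteq> {?d}" by (auto simp: supp_def monomial_def)
  have sP: "supp (binom_series i j (-1) \<alpha> \<beta>) \<subseteq> pf_set {} i j \<alpha> \<beta>" unfolding b[of z] by (rule pf_supp)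
  have s1: "supp (binom_series i j (-1) \<alpha> \<beta> \<odot> subst_series j i J) \<subseteq> expo_plus (pf_set {} i j \<alpha> \<beta>) T"
    by (rule supp_mult[OF sP sT])
  note bd = bdd_plus[OF pf_bdd[OF gp] Tb]
  show "supp A \<subseteq> expos {1, 2}"
    unfolding A_def
    by (rule order_trans[OF supp_mult[OF sd s1] expo_plus_expos[OF de expo_plus_expos[OF Pe Te]]])
  assume z: "z 1 \<noteq> 0" "z 2 \<noteq> 0" "2 * norm (z j) \<le> norm (z i)" "norm (z j / z i) < \<epsilon>"
  have zij: "z i \<noteq> 0" "z j \<noteq> 0" using z(1,2) ij by auto
  have md: "mon z ?d = cpow (z 1) \<alpha>1 \<beta>1 * cpow (z 2) \<alpha>2 \<beta>2"
    using mon_add[of "pw 1 \<alpha>1 \<beta>1" "{1, 2}" "pw 2 \<alpha>2 \<beta>2" "{1, 2}" z] z(1,2) int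
    by (simp add: pw_expos mon_pw cpow_0)
  have cP: "conv z (binom_series i j (-1) \<alpha> \<beta>) (cpow (z i - z j) \<alpha> \<beta>)
       (lead {} z i j powr (\<alpha> + \<beta>) * 2 powr (\<bar>\<alpha>\<bar> + \<bar>\<beta>\<bar>))"
    unfolding b[of z] by (rule pf_conv[OF ij4 ij(3) int(3)]) (use z zij in \<open>simp add: reg_pair_def\<close>)
  have "mon z (m (r, s)) = cpow (z j / z i) r s" if "J r s \<noteq> 0" for r s
  proof -
    have "mon z (m (r, s)) = cpow (z j) r s * cpow (z i) (- r) (- s)"
      using mon_add[of "pw j r s" "{1, 2}" "pw i (- r) (- s)" "{1, 2}" z] ij ij4 zij intJ[OF that] mr[OF that]
      by (simp add: m_def pw_expos mon_pw cpow_0)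
    also have "\<dots> = cpow (z j / z i) r s"
      using zij intJ[OF that] by (simp add: divide_inverse cpow_mult cpow_minus cpow_inverse)
    finally show ?thesis .
  qed
  then have eq: "(case k of (r, s) \<Rightarrow> J r s) * mon z (m k) = (case k of (r, s) \<Rightarrow> J r s * cpow (z j / z i) r s)" for k
    by (cases k) force
  have "z j / z i \<in> ball 0 \<epsilon> - {0}" using z(4) zij by simp
  then have "((\<lambda>k. (case k of (r, s) \<Rightarrow> J r s) * mon z (m k)) has_sum g (z j / z i)) UNIV"
    unfolding eq by (rule val)
  from formal_sum_conv[OF finite_inj_fibre[OF injm] this]
  have cT: "conv z (subst_series j i J) (g (z j / z i))
      (infsum (\<lambda>k. norm ((case k of (r, s) \<Rightarrow> J r s) * mon z (m k))) UNIV)"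
    by (simp add: subst_series_def m_def)
  show "((\<lambda>e. A e * mon z e) has_sum
        (cpow (z 1) \<alpha>1 \<beta>1 * cpow (z 2) \<alpha>2 \<beta>2 * (cpow (z i - z j) \<alpha> \<beta> * g (z j / z i)))) UNIV"
    using mult_conv[OF lfd bd sd s1 de expo_plus_expos[OF Pe Te] conv_monomial
        mult_conv[OF pf_locfin[OF gp] Tb sP sT Pe Te cP cT]]
    unfolding A_def conv_def md by blast
qed

lemma has_sum_lincomb:
  fixes F :: "nat \<Rightarrow> 'a \<Rightarrow> complex"
  assumes "\<And>k. k < n \<Longrightarrow> (F k has_sum s k) A"
  shows "((\<lambda>x. \<Sum>k<n. c k * F k x) has_sum (\<Sum>k<n. c k * s k)) A"
  using assms by (induction n) (auto intro!: has_sum_add has_sum_cmult_right)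

lemma common_small:
  fixes P :: "nat \<Rightarrow> real \<Rightarrow> bool"
  assumes "\<And>k. k < n \<Longrightarrow> \<exists>\<epsilon>>0. P k \<epsilon>" and anti: "\<And>k \<epsilon> \<epsilon>'. P k \<epsilon> \<Longrightarrow> 0 < \<epsilon>' \<Longrightarrow> \<epsilon>' \<le> \<epsilon> \<Longrightarrow> P k \<epsilon>'"
  shows "\<exists>\<epsilon>>0. \<forall>k<n. P k \<epsilon>"
  using assms(1)
proof (induction n)
  case 0
  show ?case by (auto intro: exI[of _ 1])
next
  case (Suc n)
  obtain \<epsilon> where e: "\<epsilon> > 0" "\<forall>k<n. P k \<epsilon>" using Suc by auto
  obtain \<epsilon>' where e': "\<epsilon>' > 0" "P n \<epsilon>'" using Suc.prems[of n] by auto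
  have "P k (min \<epsilon> \<epsilon>')" if "k < Suc n" for k
    using that e e' anti[of k \<epsilon> "min \<epsilon> \<epsilon>'"] anti[of n \<epsilon>' "min \<epsilon> \<epsilon>'"] by (cases "k = n") auto
  then show ?case using e(1) e'(1) by (intro exI[of _ "min \<epsilon> \<epsilon>'"]) auto
qed

text \<open>The graph of a linear extension only provides some finite representation by generators.
  Supports and values pass to linear combinations, and monotonicity of Q yields one threshold for
  the finitely many generators involved.\<close>

lemma lin_ext_eval:
  fixes Q :: "real \<Rightarrow> (nat \<Rightarrow> complex) \<Rightarrow> bool"
  assumes "lin_ext R \<mu> A"
    and R: "\<And>g B. R g B \<Longrightarrow> supp B \<subseteq> expos K \<and> (\<exists>\<epsilon>>0. \<forall>z. Q \<epsilon> z \<longrightarrow> ((\<lambda>e. B e * mon z e) has_sum g (t z)) UNIV)"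
    and anti: "\<And>\<epsilon> \<epsilon>' z. Q \<epsilon>' z \<Longrightarrow> 0 < \<epsilon>' \<Longrightarrow> \<epsilon>' \<le> \<epsilon> \<Longrightarrow> Q \<epsilon> z"
  shows "supp A \<subseteq> expos K \<and> (\<exists>\<epsilon>>0. \<forall>z. Q \<epsilon> z \<longrightarrow> ((\<lambda>e. A e * mon z e) has_sum \<mu> (t z)) UNIV)"
proof -
  obtain n :: nat and c g B where nc: "\<forall>k<n. R (g k) (B k)" "\<mu> = (\<lambda>x. \<Sum>k<n. c k * g k x)" "A = (\<lambda>e. \<Sum>k<n. c k * B k e)"
    using assms(1) unfolding lin_ext_def by (elim exE conjE) (rule that; assumption)
  have "supp A \<subseteq> expos K"
  proof
    fix e assume "e \<in> supp A"
    then have "(\<Sum>k<n. c k * B k e) \<noteq> 0" by (simp add: supp_def nc(3))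
    then obtain k where "k < n" "c k * B k e \<noteq> 0" by (auto elim!: sum.not_neutral_contains_not_neutral)
    then show "e \<in> expos K" using R nc(1) by (auto simp: supp_def subset_iff)
  qed
  moreover have "\<exists>\<epsilon>>0. \<forall>k<n. \<forall>z. Q \<epsilon> z \<longrightarrow> ((\<lambda>e. B k e * mon z e) has_sum g k (t z)) UNIV"
  proof (rule common_small[where P = "\<lambda>k \<epsilon>. \<forall>z. Q \<epsilon> z \<longrightarrow> ((\<lambda>e. B k e * mon z e) has_sum g k (t z)) UNIV"])
    fix k assume "k < n"
    then show "\<exists>\<epsilon>>0. \<forall>z. Q \<epsilon> z \<longrightarrow> ((\<lambda>e. B k e * mon z e) has_sum g k (t z)) UNIV"
      using R nc(1) by simp
  qed (use anti in blast)
  then obtain \<epsilon> where e: "\<epsilon> > 0" "\<And>k z. k < n \<Longrightarrow> Q \<epsilon> z \<Longrightarrow> ((\<lambda>e. B k e * mon z e) has_sum g k (t z)) UNIV"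
    by blast
  have "((\<lambda>e. A e * mon z e) has_sum \<mu> (t z)) UNIV" if "Q \<epsilon> z" for z
    using has_sum_lincomb[where n = n and c = c, OF e(2)[OF _ that]]
    by (simp add: nc sum_distrib_right mult.assoc)
  ultimately show ?thesis using e(1) by blast
qed

lemma expand_12_eval:
  assumes "expand_12 \<mu> A"
  shows "supp A \<subseteq> expos {1, 2} \<and> (\<exists>\<delta>>0. \<forall>v. v 1 \<noteq> 0 \<and> v 2 \<noteq> 0 \<and> norm (v 2) < \<delta> * norm (v 1) \<longrightarrow>
     ((\<lambda>e. A e * mon v e) has_sum \<mu> (v 1, v 2)) UNIV)"
  using assms unfolding expand_12_def
proof (rule lin_ext_eval, goal_cases)
  case (1 g B)
  then obtain \<alpha>1 \<beta>1 \<alpha>2 \<beta>2 \<alpha> \<beta> f J where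
     int: "\<alpha>1 - \<beta>1 \<in> \<int>" "\<alpha>2 - \<beta>2 \<in> \<int>" "\<alpha> - \<beta> \<in> \<int>" and g: "g = gcor2_fun \<alpha>1 \<beta>1 \<alpha>2 \<beta>2 \<alpha> \<beta> f"
     and J: "is_j (\<lambda>p. p) f J"
     and B: "B = monomial (expo_add (pw 1 \<alpha>1 \<beta>1) (pw 2 \<alpha>2 \<beta>2)) \<odot> (binom_series 1 2 (-1) \<alpha> \<beta> \<odot> subst_series 2 1 J)"
    by (elim exE conjE) (rule that; assumption)
  have L: "J \<in> laurent_series" and cv: "converges_near_0 J f" using J by (auto simp: is_j_def)
  obtain \<epsilon> where e: "\<epsilon> > 0" "\<And>p. p \<in> ball 0 \<epsilon> - {0} \<Longrightarrow> ((\<lambda>(r, s). J r s * cpow p r s) has_sum f p) UNIV"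
    by (rule converges_near_0D[OF cv]) (rule that; assumption)
  have sB: "supp B \<subseteq> expos {1, 2}"
    unfolding B by (rule two_point_conv(1)[OF _ _ _ int L e(2)]) simp_all
  have "((\<lambda>e. B e * mon v e) has_sum g (v 1, v 2)) UNIV"
    if v: "v 1 \<noteq> 0 \<and> v 2 \<noteq> 0 \<and> norm (v 2) < min \<epsilon> (1 / 2) * norm (v 1)" for v
  proof -
    have "min \<epsilon> (1 / 2) * norm (v 1) \<le> (1 / 2) * norm (v 1)" "min \<epsilon> (1 / 2) * norm (v 1) \<le> \<epsilon> * norm (v 1)"
      by (rule mult_right_mono; simp)+
    then have b: "2 * norm (v 2) < norm (v 1)" "norm (v 2) < \<epsilon> * norm (v 1)" using v by linarith+
    then have "(v 1, v 2) \<in> Y2" using v by (auto simp: Y2_def)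
    moreover have "norm (v 2 / v 1) < \<epsilon>" using b(2) v by (simp add: norm_divide pos_divide_less_eq)
    moreover from this have "((\<lambda>e. B e * mon v e) has_sum
        (cpow (v 1) \<alpha>1 \<beta>1 * cpow (v 2) \<alpha>2 \<beta>2 * (cpow (v 1 - v 2) \<alpha> \<beta> * f (v 2 / v 1)))) UNIV"
      unfolding B by (intro two_point_conv(2)[OF _ _ _ int L e(2)]) (use v b(1) in auto)
    ultimately show ?thesis by (simp add: g gcor2_fun_def mult.assoc)
  qed
  then show ?case using sB e(1) by (intro conjI exI[of _ "min \<epsilon> (1 / 2)"]) auto
next
  case (2 \<epsilon> \<epsilon>' z)
  have "\<epsilon>' * norm (z 1) \<le> \<epsilon> * norm (z 1)" by (rule mult_right_mono[OF 2(3)]) simp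
  then show ?case using 2(1) less_le_trans by blast
qed

lemma expand_21_eval:
  assumes "expand_21 \<mu> A"
  shows "supp A \<subseteq> expos {1, 2} \<and> (\<exists>\<delta>>0. \<forall>v. v 1 \<noteq> 0 \<and> v 2 \<noteq> 0 \<and> norm (v 1) < \<delta> * norm (v 2) \<longrightarrow>
     ((\<lambda>e. A e * mon v e) has_sum \<mu> (v 1, v 2)) UNIV)"
  using assms unfolding expand_21_def
proof (rule lin_ext_eval, goal_cases)
  case (1 g B)
  then obtain \<alpha>1 \<beta>1 \<alpha>2 \<beta>2 \<alpha> \<beta> f J where
     int: "\<alpha>1 - \<beta>1 \<in> \<int>" "\<alpha>2 - \<beta>2 \<in> \<int>" "\<alpha> - \<beta> \<in> \<int>" and g: "g = gcor2_fun \<alpha>1 \<beta>1 \<alpha>2 \<beta>2 \<alpha> \<beta> f"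
     and J: "is_j (\<lambda>p. 1 / p) f J"
     and B: "B = (\<lambda>e. (-1) powi \<lfloor>\<alpha> - \<beta>\<rfloor> * (monomial (expo_add (pw 1 \<alpha>1 \<beta>1) (pw 2 \<alpha>2 \<beta>2)) \<odot>
        (binom_series 2 1 (-1) \<alpha> \<beta> \<odot> subst_series 1 2 J)) e)"
    by (elim exE conjE) (rule that; assumption)
  have L: "J \<in> laurent_series" and cv: "converges_near_0 J (\<lambda>p. f (1 / p))" using J by (auto simp: is_j_def)
  obtain \<epsilon> where e: "\<epsilon> > 0" "\<And>p. p \<in> ball 0 \<epsilon> - {0} \<Longrightarrow> ((\<lambda>(r, s). J r s * cpow p r s) has_sum f (1 / p)) UNIV"
    by (rule converges_near_0D[OF cv]) (rule that; assumption)
  have "supp (monomial (expo_add (pw 1 \<alpha>1 \<beta>1) (pw 2 \<alpha>2 \<beta>2)) \<odot>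
        (binom_series 2 1 (-1) \<alpha> \<beta> \<odot> subst_series 1 2 J)) \<subseteq> expos {1, 2}"
    by (rule two_point_conv(1)[OF _ _ _ int L e(2)]) simp_all
  then have sB: "supp B \<subseteq> expos {1, 2}" by (auto simp: B supp_def)
  have "((\<lambda>e. B e * mon v e) has_sum g (v 1, v 2)) UNIV"
    if v: "v 1 \<noteq> 0 \<and> v 2 \<noteq> 0 \<and> norm (v 1) < min \<epsilon> (1 / 2) * norm (v 2)" for v
  proof -
    have "min \<epsilon> (1 / 2) * norm (v 2) \<le> (1 / 2) * norm (v 2)" "min \<epsilon> (1 / 2) * norm (v 2) \<le> \<epsilon> * norm (v 2)"
      by (rule mult_right_mono; simp)+
    then have b: "2 * norm (v 1) < norm (v 2)" "norm (v 1) < \<epsilon> * norm (v 2)" using v by linarith+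
    then have Y: "(v 1, v 2) \<in> Y2" using v by (auto simp: Y2_def)
    have "norm (v 1 / v 2) < \<epsilon>" using b(2) v by (simp add: norm_divide pos_divide_less_eq)
    then have "((\<lambda>e. (-1) powi \<lfloor>\<alpha> - \<beta>\<rfloor> * ((monomial (expo_add (pw 1 \<alpha>1 \<beta>1) (pw 2 \<alpha>2 \<beta>2)) \<odot>
        (binom_series 2 1 (-1) \<alpha> \<beta> \<odot> subst_series 1 2 J)) e * mon v e)) has_sum
        (-1) powi \<lfloor>\<alpha> - \<beta>\<rfloor> * (cpow (v 1) \<alpha>1 \<beta>1 * cpow (v 2) \<alpha>2 \<beta>2 * (cpow (v 2 - v 1) \<alpha> \<beta> * f (1 / (v 1 / v 2))))) UNIV"
      by (intro has_sum_cmult_right two_point_conv(2)[OF _ _ _ int L e(2)]) (use v b(1) in auto)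
    \<comment> \<open>The sign prescribed for this expansion turns the power of v2 - v1 into that of
      v1 - v2.\<close>
    also have "(-1) powi \<lfloor>\<alpha> - \<beta>\<rfloor> * (cpow (v 1) \<alpha>1 \<beta>1 * cpow (v 2) \<alpha>2 \<beta>2 * (cpow (v 2 - v 1) \<alpha> \<beta> * f (1 / (v 1 / v 2))))
       = g (v 1, v 2)"
      using cpow_uminus[OF int(3), of "v 2 - v 1"] Y by (simp add: g gcor2_fun_def mult_ac)
    finally show ?thesis by (simp add: B mult.assoc)
  qed
  then show ?case using sB e(1) by (intro conjI exI[of _ "min \<epsilon> (1 / 2)"]) auto
next
  case (2 \<epsilon> \<epsilon>' z)
  have "\<epsilon>' * norm (z 2) \<le> \<epsilon> * norm (z 2)" by (rule mult_right_mono[OF 2(3)]) simp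
  then show ?case using 2(1) less_le_trans by blast
qed

section \<open>Analyticity of two-point functions\<close>

definition Y2f :: "(nat \<Rightarrow> complex) set" where
  "Y2f = {v. v 1 \<noteq> 0 \<and> v 2 \<noteq> 0 \<and> v 1 \<noteq> v 2}"

lemma eventually_line_ne:
  fixes a b :: complex
  assumes "a \<noteq> 0"
  shows "\<exists>\<epsilon>>0. \<forall>t::real. \<bar>t\<bar> < \<epsilon> \<longrightarrow> a + of_real t * b \<noteq> 0"
proof -
  have "((\<lambda>t. a + of_real t * b) \<longlongrightarrow> a + of_real 0 * b) (nhds (0 :: real))"
    by (intro tendsto_intros filterlim_ident)
  then have "eventually (\<lambda>t. a + of_real t * b \<noteq> 0) (nhds (0 :: real))"
    by (rule tendsto_imp_eventually_ne) (use assms in simp)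
  then show ?thesis by (auto simp: eventually_nhds_metric)
qed

lemma la_GCor2:
  assumes "\<mu> \<in> GCor2" "v \<in> Y2f"
  shows "la (\<lambda>v. \<mu> (v 1, v 2)) v"
proof -
  have gen: "la (\<lambda>v. gcor2_fun \<alpha>1 \<beta>1 \<alpha>2 \<beta>2 \<alpha> \<beta> f (v 1, v 2)) v" if f: "f \<in> F01inf" for \<alpha>1 \<beta>1 \<alpha>2 \<beta>2 \<alpha> \<beta> f
  proof (rule la_transfer[where f = "\<lambda>v. cpow (v 1) \<alpha>1 \<beta>1 * cpow (v 2) \<alpha>2 \<beta>2 * cpow (v 1 - v 2) \<alpha> \<beta> * f (v 2 / v 1)"])
    have "real_analytic_on f (- {0, 1})" using f by (simp add: F01inf_def)
    moreover have "v 2 / v 1 \<in> - {0, 1}" using assms(2) by (auto simp: Y2f_def)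
    ultimately obtain c \<epsilon> where w: "wps f (v 2 / v 1) c \<epsilon>" using real_analytic_imp_wps by blast
    have d: "la (\<lambda>v. v 2 / v 1) v" by (rule la_divide[OF la_coord la_coord]) (use assms(2) in \<open>simp add: Y2f_def\<close>)
    show "la (\<lambda>v. cpow (v 1) \<alpha>1 \<beta>1 * cpow (v 2) \<alpha>2 \<beta>2 * cpow (v 1 - v 2) \<alpha> \<beta> * f (v 2 / v 1)) v"
      by (intro la_mult la_cpow la_diff la_coord la_wps[OF d w]) (use assms(2) in \<open>auto simp: Y2f_def\<close>)
  next
    \<comment> \<open>Close to v a line stays inside the domain, so the extension by 0 outside it is
      not seen.\<close>
    fix d :: "nat \<Rightarrow> complex"
    obtain e1 where e1: "e1 > 0" "\<And>t::real. \<bar>t\<bar> < e1 \<Longrightarrow> v 1 + of_real t * d 1 \<noteq> 0"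
      using eventually_line_ne[of "v 1" "d 1"] assms(2) by (auto simp: Y2f_def)
    obtain e2 where e2: "e2 > 0" "\<And>t::real. \<bar>t\<bar> < e2 \<Longrightarrow> v 2 + of_real t * d 2 \<noteq> 0"
      using eventually_line_ne[of "v 2" "d 2"] assms(2) by (auto simp: Y2f_def)
    obtain e3 where e3: "e3 > 0" "\<And>t::real. \<bar>t\<bar> < e3 \<Longrightarrow> v 1 - v 2 + of_real t * (d 1 - d 2) \<noteq> 0"
      using eventually_line_ne[of "v 1 - v 2" "d 1 - d 2"] assms(2) by (auto simp: Y2f_def)
    have "v 1 + of_real t * d 1 \<noteq> v 2 + of_real t * d 2" if "\<bar>t\<bar> < e3" for t :: real
      using e3(2)[OF that] by (auto simp: algebra_simps)
    then show "\<exists>\<epsilon>>0. \<forall>t::real. \<bar>t\<bar> < \<epsilon> \<longrightarrow>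
        gcor2_fun \<alpha>1 \<beta>1 \<alpha>2 \<beta>2 \<alpha> \<beta> f (v 1 + of_real t * d 1, v 2 + of_real t * d 2) =
        cpow (v 1 + of_real t * d 1) \<alpha>1 \<beta>1 * cpow (v 2 + of_real t * d 2) \<alpha>2 \<beta>2 *
        cpow (v 1 + of_real t * d 1 - (v 2 + of_real t * d 2)) \<alpha> \<beta> *
        f ((v 2 + of_real t * d 2) / (v 1 + of_real t * d 1))"
      using e1 e2 e3(1) by (intro exI[of _ "min e1 (min e2 e3)"]) (auto simp: gcor2_fun_def Y2_def)
  qed
  obtain n :: nat and c g where mu: "\<mu> = (\<lambda>x. \<Sum>k<n. c k * g k x)" and g: "\<forall>k<n. \<exists>\<alpha>1 \<beta>1 \<alpha>2 \<beta>2 \<alpha>12 \<beta>12 f. g k = gcor2_fun \<alpha>1 \<beta>1 \<alpha>2 \<beta>2 \<alpha>12 \<beta>12 f \<and>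
     \<alpha>1 - \<beta>1 \<in> \<int> \<and> \<alpha>2 - \<beta>2 \<in> \<int> \<and> \<alpha>12 - \<beta>12 \<in> \<int> \<and> f \<in> F01inf"
    using assms(1) unfolding GCor2_def fun_span_def mem_Collect_eq
    by (elim exE conjE) (rule that; assumption)
  have "la (\<lambda>v. g k (v 1, v 2)) v" if "k < n" for k
  proof -
    from mp[OF spec[OF g] that] obtain \<alpha>1 \<beta>1 \<alpha>2 \<beta>2 \<alpha> \<beta> f where "g k = gcor2_fun \<alpha>1 \<beta>1 \<alpha>2 \<beta>2 \<alpha> \<beta> f" "f \<in> F01inf"
      by (elim exE conjE) (rule that; assumption)
    then show ?thesis using gen by simp
  qed
  then show ?thesis unfolding mu by (intro la_sum la_scale) auto
qed

section \<open>Expansions of four-point functions\<close>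

lemma expand_1234E:
  assumes "expand_1234 \<phi> A"
  obtains n :: nat and c \<alpha> \<beta> f J where
    "\<And>k i j. k < n \<Longrightarrow> (i, j) \<in> set pairs4 \<Longrightarrow> \<alpha> k i j - \<beta> k i j \<in> \<int>"
    "\<And>k. k < n \<Longrightarrow> f k \<in> F01inf" "\<And>k. k < n \<Longrightarrow> is_j (\<lambda>p. p) (f k) (J k)"
    "\<phi> = (\<lambda>z. \<Sum>k<n. c k * cor4_fun (\<alpha> k) (\<beta> k) (f k) z)"
    "A = (\<lambda>e. \<Sum>k<n. c k * (pairs_series (\<alpha> k) (\<beta> k) \<odot> xi_subst_series (J k)) e)"
proof -
  define P where "P = (\<lambda>g B (\<alpha>, \<beta>, f, J). (\<forall>(i, j)\<in>set pairs4. \<alpha> i j - \<beta> i j \<in> \<int>) \<and> f \<in> F01inf \<and>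
     g = cor4_fun \<alpha> \<beta> f \<and> is_j (\<lambda>p. p) f J \<and> B = pairs_series \<alpha> \<beta> \<odot> xi_subst_series J)"
  have "\<exists>(n :: nat) c g B. (\<forall>k<n. \<exists>\<alpha> \<beta> f J. P (g k) (B k) (\<alpha>, \<beta>, f, J)) \<and>
     \<phi> = (\<lambda>x. \<Sum>k<n. c k * g k x) \<and> A = (\<lambda>e. \<Sum>k<n. c k * B k e)"
    using assms unfolding expand_1234_def lin_ext_def P_def prod.case .
  then obtain n :: nat and c g B where nc: "\<forall>k<n. \<exists>\<alpha> \<beta> f J. P (g k) (B k) (\<alpha>, \<beta>, f, J)"
     "\<phi> = (\<lambda>x. \<Sum>k<n. c k * g k x)" "A = (\<lambda>e. \<Sum>k<n. c k * B k e)"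
    by (elim exE conjE) (rule that; assumption)
  have "\<forall>k. \<exists>x. k < n \<longrightarrow> P (g k) (B k) x"
  proof
    fix k
    show "\<exists>x. k < n \<longrightarrow> P (g k) (B k) x"
    proof (cases "k < n")
      case True
      with nc(1) obtain \<alpha> \<beta> f J where "P (g k) (B k) (\<alpha>, \<beta>, f, J)" by blast
      then show ?thesis by (intro exI impI)
    qed simp
  qed
  from choice[OF this] obtain X where X: "\<forall>k. k < n \<longrightarrow> P (g k) (B k) (X k)" ..
  define \<alpha> where "\<alpha> = (\<lambda>k. fst (X k))"
  define \<beta> where "\<beta> = (\<lambda>k. fst (snd (X k)))"
  define f where "f = (\<lambda>k. fst (snd (snd (X k))))"
  define J where "J = (\<lambda>k. snd (snd (snd (X k))))"
  have Xk: "X k = (\<alpha> k, \<beta> k, f k, J k)" for k by (simp add: \<alpha>_def \<beta>_def f_def J_def)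
  have p: "(\<forall>(i, j)\<in>set pairs4. \<alpha> k i j - \<beta> k i j \<in> \<int>) \<and> f k \<in> F01inf \<and>
     g k = cor4_fun (\<alpha> k) (\<beta> k) (f k) \<and> is_j (\<lambda>p. p) (f k) (J k) \<and>
     B k = pairs_series (\<alpha> k) (\<beta> k) \<odot> xi_subst_series (J k)" if "k < n" for k
    using mp[OF spec[OF X] that] unfolding Xk P_def prod.case .
  show ?thesis
  proof (rule that)
    show "\<alpha> k i j - \<beta> k i j \<in> \<int>" if "k < n" "(i, j) \<in> set pairs4" for k i j
      using p[OF that(1)] that(2) by blast
    show "\<phi> = (\<lambda>z. \<Sum>k<n. c k * cor4_fun (\<alpha> k) (\<beta> k) (f k) z)"
      unfolding nc(2) using p by (intro ext sum.cong) auto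
    show "A = (\<lambda>e. \<Sum>k<n. c k * (pairs_series (\<alpha> k) (\<beta> k) \<odot> xi_subst_series (J k)) e)"
      unfolding nc(3) using p by (intro ext sum.cong) auto
  qed (use p in blast)+
qed

text \<open>One representation of \<phi> by generators serves for every X, and for X = {} it
  reproduces the given series A. The partial expansions with numerical points and the complete
  formal series are thereby expansions of the same function.\<close>

lemma phi_expansion:
  assumes ok: "xi_ok X w" and ex: "expand_1234 \<phi> A"
  shows "\<exists>N. (\<forall>z. supp (N z) \<subseteq> expos ({1..4} - X)) \<and>
     (\<forall>z z'. (\<forall>i\<in>X. z i = z' i) \<longrightarrow> N z = N z') \<and>
     (\<forall>z e. (\<forall>i j. (i, j) \<in> set pairs4 \<longrightarrow> i \<in> X \<longrightarrow> (if j \<in> X then z i \<noteq> z j else z i \<noteq> 0)) \<longrightarrow> la (\<lambda>z. N z e) z) \<and>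
     (\<exists>\<epsilon>>0. \<forall>z. reg4 X z \<longrightarrow> 16 * leadL X z < \<epsilon> \<longrightarrow> ((\<lambda>e. N z e * mon z e) has_sum \<phi> z) UNIV) \<and>
     (X = {} \<longrightarrow> (\<forall>z. N z = A))"
proof -
  obtain n :: nat and c \<alpha> \<beta> f J where d:
    "\<And>k i j. k < n \<Longrightarrow> (i, j) \<in> set pairs4 \<Longrightarrow> \<alpha> k i j - \<beta> k i j \<in> \<int>"
    "\<And>k. k < n \<Longrightarrow> is_j (\<lambda>p. p) (f k) (J k)"
    "\<phi> = (\<lambda>z. \<Sum>k<n. c k * cor4_fun (\<alpha> k) (\<beta> k) (f k) z)"
    "A = (\<lambda>e. \<Sum>k<n. c k * (pairs_series (\<alpha> k) (\<beta> k) \<odot> xi_subst_series (J k)) e)"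
    by (rule expand_1234E[OF ex]) (rule that; assumption)
  define N where "N = (\<lambda>z e. \<Sum>k<n. c k * G4 X z (\<alpha> k) (\<beta> k) (J k) e)"
  have "supp (N z) \<subseteq> expos ({1..4} - X)" for z
  proof
    fix e assume "e \<in> supp (N z)"
    then have "(\<Sum>k<n. c k * G4 X z (\<alpha> k) (\<beta> k) (J k) e) \<noteq> 0" by (simp add: supp_def N_def)
    then obtain k where k: "k < n" "G4 X z (\<alpha> k) (\<beta> k) (J k) e \<noteq> 0"
      by (auto elim!: sum.not_neutral_contains_not_neutral)
    have "supp (G4 X z (\<alpha> k) (\<beta> k) (J k)) \<subseteq> expos ({1..4} - X)"
      by (rule G4_props(1)[OF ok d(2)[OF k(1)] d(1)[OF k(1)]])
    then show "e \<in> expos ({1..4} - X)" using k(2) unfolding supp_def by blast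
  qed
  moreover have "N z = N z'" if a: "\<forall>i\<in>X. z i = z' i" for z z'
  proof -
    have "G4 X z (\<alpha> k) (\<beta> k) (J k) = G4 X z' (\<alpha> k) (\<beta> k) (J k)" if "k < n" for k
      by (rule G4_props(2)[OF ok d(2)[OF that] d(1)[OF that]]) (use a in blast)+
    then show ?thesis unfolding N_def by (intro ext sum.cong) auto
  qed
  moreover have "la (\<lambda>z. N z e) z"
    if a: "\<forall>i j. (i, j) \<in> set pairs4 \<longrightarrow> i \<in> X \<longrightarrow> (if j \<in> X then z i \<noteq> z j else z i \<noteq> 0)" for z e
  proof -
    have "la (\<lambda>z. G4 X z (\<alpha> k) (\<beta> k) (J k) e) z" if "k < n" for k
      by (rule G4_props(3)[OF ok d(2)[OF that] d(1)[OF that]]) (use a in blast)+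
    then show ?thesis unfolding N_def by (intro la_sum la_scale) auto
  qed
  moreover have "\<exists>\<epsilon>>0. \<forall>z. reg4 X z \<longrightarrow> 16 * leadL X z < \<epsilon> \<longrightarrow> ((\<lambda>e. N z e * mon z e) has_sum \<phi> z) UNIV"
  proof -
    have "\<exists>\<epsilon>>0. \<forall>k<n. \<forall>z. reg4 X z \<longrightarrow> 16 * leadL X z < \<epsilon> \<longrightarrow>
        ((\<lambda>e. G4 X z (\<alpha> k) (\<beta> k) (J k) e * mon z e) has_sum cor4_fun (\<alpha> k) (\<beta> k) (f k) z) UNIV"
    proof (rule common_small[where P = "\<lambda>k \<epsilon>. \<forall>z. reg4 X z \<longrightarrow> 16 * leadL X z < \<epsilon> \<longrightarrow>
        ((\<lambda>e. G4 X z (\<alpha> k) (\<beta> k) (J k) e * mon z e) has_sum cor4_fun (\<alpha> k) (\<beta> k) (f k) z) UNIV"])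
      show "\<exists>\<epsilon>>0. \<forall>z. reg4 X z \<longrightarrow> 16 * leadL X z < \<epsilon> \<longrightarrow>
        ((\<lambda>e. G4 X z (\<alpha> k) (\<beta> k) (J k) e * mon z e) has_sum cor4_fun (\<alpha> k) (\<beta> k) (f k) z) UNIV" if "k < n" for k
        by (rule G4_props(4)[OF ok d(2)[OF that] d(1)[OF that]])
    qed (use less_le_trans in blast)
    then obtain \<epsilon> where e: "\<epsilon> > 0" "\<And>k z. k < n \<Longrightarrow> reg4 X z \<Longrightarrow> 16 * leadL X z < \<epsilon> \<Longrightarrow>
        ((\<lambda>e. G4 X z (\<alpha> k) (\<beta> k) (J k) e * mon z e) has_sum cor4_fun (\<alpha> k) (\<beta> k) (f k) z) UNIV"
      by blast
    have "((\<lambda>e. N z e * mon z e) has_sum \<phi> z) UNIV" if "reg4 X z" "16 * leadL X z < \<epsilon>" for z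
      using has_sum_lincomb[where n = n and c = c, OF e(2)[OF _ that]]
      by (simp add: N_def d(3) sum_distrib_right mult.assoc)
    then show ?thesis using e(1) by blast
  qed
  moreover have "X = {} \<longrightarrow> (\<forall>z. N z = A)"
    by (auto simp: N_def d(4) G4_def pfs_pairs4 xis_empty)
  ultimately show ?thesis by blast
qed

text \<open>With z4 = 0 and z1 large the cross ratio stays near z3 / z2 instead of near 0. Taylor
  series take the place of j(p, f), and \<epsilon> depends on the base point (x, y).\<close>

lemma phi_expansion_23:
  assumes ex: "expand_1234 \<phi> A"
  shows "\<exists>N. (\<forall>z. supp (N z) \<subseteq> expos {1}) \<and>
     (\<forall>z z'. (\<forall>i\<in>{2, 3, 4}. z i = z' i) \<longrightarrow> N z = N z') \<and>
     (\<forall>z e. z 2 \<noteq> 0 \<and> z 3 \<noteq> 0 \<and> z 2 \<noteq> z 3 \<and> z 4 = 0 \<longrightarrow> la (\<lambda>z. N z e) z) \<and>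
     (\<forall>x y. x \<noteq> 0 \<and> y \<noteq> 0 \<and> x \<noteq> y \<longrightarrow> (\<exists>\<epsilon>>0. \<forall>z. norm (z 2 - x) < \<epsilon> \<longrightarrow> norm (z 3 - y) < \<epsilon> \<longrightarrow> z 4 = 0 \<longrightarrow>
       1 / \<epsilon> < norm (z 1) \<longrightarrow> ((\<lambda>e. N z e * mon z e) has_sum \<phi> z) UNIV))"
proof -
  obtain n :: nat and c \<alpha> \<beta> f where d:
    "\<And>k i j. k < n \<Longrightarrow> (i, j) \<in> set pairs4 \<Longrightarrow> \<alpha> k i j - \<beta> k i j \<in> \<int>"
    "\<And>k. k < n \<Longrightarrow> f k \<in> F01inf"
    "\<phi> = (\<lambda>z. \<Sum>k<n. c k * cor4_fun (\<alpha> k) (\<beta> k) (f k) z)"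
    by (rule expand_1234E[OF ex]) (rule that; assumption)
  have ra: "real_analytic_on (f k) (- {0, 1})" if "k < n" for k using d(2)[OF that] by (simp add: F01inf_def)
  define N where "N = (\<lambda>z e. \<Sum>k<n. c k * G3 z (\<alpha> k) (\<beta> k) (f k) e)"
  have "supp (N z) \<subseteq> expos {1}" for z
  proof
    fix e assume "e \<in> supp (N z)"
    then have "(\<Sum>k<n. c k * G3 z (\<alpha> k) (\<beta> k) (f k) e) \<noteq> 0" by (simp add: supp_def N_def)
    then obtain k where k: "k < n" "G3 z (\<alpha> k) (\<beta> k) (f k) e \<noteq> 0"
      by (auto elim!: sum.not_neutral_contains_not_neutral)
    have "supp (G3 z (\<alpha> k) (\<beta> k) (f k)) \<subseteq> expos {1}"
      by (rule G3_props(1)[OF ra[OF k(1)] d(1)[OF k(1)]])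
    then show "e \<in> expos {1}" using k(2) unfolding supp_def by blast
  qed
  moreover have "N z = N z'" if a: "\<forall>i\<in>{2, 3, 4}. z i = z' i" for z z'
  proof -
    have "G3 z (\<alpha> k) (\<beta> k) (f k) = G3 z' (\<alpha> k) (\<beta> k) (f k)" if "k < n" for k
      by (rule G3_props(2)[OF ra[OF that] d(1)[OF that]]) (use a in blast)+
    then show ?thesis unfolding N_def by (intro ext sum.cong) auto
  qed
  moreover have "la (\<lambda>z. N z e) z" if a: "z 2 \<noteq> 0 \<and> z 3 \<noteq> 0 \<and> z 2 \<noteq> z 3 \<and> z 4 = 0" for z e
  proof -
    have "la (\<lambda>z. G3 z (\<alpha> k) (\<beta> k) (f k) e) z" if "k < n" for k
      by (rule G3_props(3)[OF ra[OF that] d(1)[OF that]]) (use a in blast)+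
    then show ?thesis unfolding N_def by (intro la_sum la_scale) auto
  qed
  moreover have "\<exists>\<epsilon>>0. \<forall>z. norm (z 2 - x) < \<epsilon> \<longrightarrow> norm (z 3 - y) < \<epsilon> \<longrightarrow> z 4 = 0 \<longrightarrow>
       1 / \<epsilon> < norm (z 1) \<longrightarrow> ((\<lambda>e. N z e * mon z e) has_sum \<phi> z) UNIV"
    if xy: "x \<noteq> 0 \<and> y \<noteq> 0 \<and> x \<noteq> y" for x y
  proof -
    let ?P = "\<lambda>k \<epsilon>. \<forall>z. norm (z 2 - x) < \<epsilon> \<longrightarrow> norm (z 3 - y) < \<epsilon> \<longrightarrow> z 4 = 0 \<longrightarrow>
       1 / \<epsilon> < norm (z 1) \<longrightarrow> ((\<lambda>e. G3 z (\<alpha> k) (\<beta> k) (f k) e * mon z e) has_sum cor4_fun (\<alpha> k) (\<beta> k) (f k) z) UNIV"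
    have "\<exists>\<epsilon>>0. \<forall>k<n. ?P k \<epsilon>"
    proof (rule common_small[where P = ?P])
      show "\<exists>\<epsilon>>0. ?P k \<epsilon>" if "k < n" for k
        by (rule G3_props(4)[OF ra[OF that] d(1)[OF that]]) (use xy in blast)+
    next
      fix k and \<epsilon> \<epsilon>' :: real assume P: "?P k \<epsilon>" and e: "0 < \<epsilon>'" "\<epsilon>' \<le> \<epsilon>"
      show "?P k \<epsilon>'"
      proof (intro allI impI)
        fix z :: "nat \<Rightarrow> complex" assume z: "norm (z 2 - x) < \<epsilon>'" "norm (z 3 - y) < \<epsilon>'" "z 4 = 0" "1 / \<epsilon>' < norm (z 1)"
        have "1 / \<epsilon> \<le> 1 / \<epsilon>'" using e by (simp add: frac_le)
        then have "1 / \<epsilon> < norm (z 1)" using z(4) by linarith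
        then show "((\<lambda>e. G3 z (\<alpha> k) (\<beta> k) (f k) e * mon z e) has_sum cor4_fun (\<alpha> k) (\<beta> k) (f k) z) UNIV"
          using P z e by (simp add: less_le_trans)
      qed
    qed
    then obtain \<epsilon> where e: "\<epsilon> > 0" "\<forall>k<n. ?P k \<epsilon>" by blast
    have "((\<lambda>e. N z e * mon z e) has_sum \<phi> z) UNIV"
      if z: "norm (z 2 - x) < \<epsilon>" "norm (z 3 - y) < \<epsilon>" "z 4 = 0" "1 / \<epsilon> < norm (z 1)" for z :: "nat \<Rightarrow> complex"
    proof -
      have "((\<lambda>e. G3 z (\<alpha> k) (\<beta> k) (f k) e * mon z e) has_sum cor4_fun (\<alpha> k) (\<beta> k) (f k) z) UNIV" if "k < n" for k
        using e(2) that z by simp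
      from has_sum_lincomb[where n = n and c = c, OF this]
      show ?thesis by (simp add: N_def d(3) sum_distrib_right mult.assoc)
    qed
    then show ?thesis using e(1) by blast
  qed
  ultimately show ?thesis by blast
qed

section \<open>Global properties of four-point functions\<close>

lemma X4_iff: "z \<in> X4 \<longleftrightarrow> (\<forall>(i, j)\<in>set pairs4. z i \<noteq> z j)"
proof -
  have "{1..4 :: nat} = {1, 2, 3, 4}" by auto
  then show ?thesis by (auto simp: X4_def inj_on_def pairs4_def)
qed

lemma X4_line:
  assumes "z \<in> X4"
  shows "\<exists>\<epsilon>>0. \<forall>t::real. \<bar>t\<bar> < \<epsilon> \<longrightarrow> (\<lambda>i. z i + of_real t * d i) \<in> X4"
proof -
  have "eventually (\<lambda>t. z i - z j + of_real t * (d i - d j) \<noteq> 0) (nhds (0 :: real))"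
    if "(i, j) \<in> set pairs4" for i j
  proof -
    have "((\<lambda>t. z i - z j + of_real t * (d i - d j)) \<longlongrightarrow> z i - z j + of_real 0 * (d i - d j)) (nhds (0 :: real))"
      by (intro tendsto_intros filterlim_ident)
    then show ?thesis
      by (rule tendsto_imp_eventually_ne) (use assms that in \<open>auto simp: X4_iff\<close>)
  qed
  then have "eventually (\<lambda>t::real. \<forall>p\<in>set pairs4. z (fst p) - z (snd p) + of_real t * (d (fst p) - d (snd p)) \<noteq> 0) (nhds 0)"
    by (intro eventually_ball_finite) auto
  then obtain \<epsilon> where e: "\<epsilon> > 0"
    "\<And>t::real. dist t 0 < \<epsilon> \<Longrightarrow> \<forall>p\<in>set pairs4. z (fst p) - z (snd p) + of_real t * (d (fst p) - d (snd p)) \<noteq> 0"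
    unfolding eventually_nhds_metric by blast
  have "(\<lambda>i. z i + of_real t * d i) \<in> X4" if "\<bar>t\<bar> < \<epsilon>" for t :: real
    unfolding X4_iff
  proof clarify
    fix i j assume "(i, j) \<in> set pairs4" and eq: "z i + of_real t * d i = z j + of_real t * d j"
    then have "z i - z j + of_real t * (d i - d j) \<noteq> 0" using e(2)[of t] that by force
    moreover have "z i - z j + of_real t * (d i - d j) = (z i + of_real t * d i) - (z j + of_real t * d j)"
      by (simp add: algebra_simps)
    ultimately show False using eq by simp
  qed
  then show ?thesis using e(1) by blast
qed

lemma cross_ratio_ne:
  assumes "z \<in> X4"
  shows "cross_ratio z \<noteq> 0" "cross_ratio z \<noteq> 1"
proof -
  have d: "z 1 \<noteq> z 2" "z 1 \<noteq> z 3" "z 1 \<noteq> z 4" "z 2 \<noteq> z 3" "z 2 \<noteq> z 4" "z 3 \<noteq> z 4"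
    using assms by (auto simp: X4_iff pairs4_def)
  then show "cross_ratio z \<noteq> 0" by (simp add: cross_ratio_def)
  \<comment> \<open>Numerator minus denominator of the cross ratio; it vanishes only if z1 = z4 or
    z2 = z3.\<close>
  have "(z 1 - z 2) * (z 3 - z 4) - (z 1 - z 3) * (z 2 - z 4) = - (z 1 - z 4) * (z 2 - z 3)"
    by (simp add: algebra_simps)
  moreover have "- (z 1 - z 4) * (z 2 - z 3) \<noteq> 0" using d by simp
  ultimately have "(z 1 - z 2) * (z 3 - z 4) \<noteq> (z 1 - z 3) * (z 2 - z 4)" by (metis diff_self)
  then show "cross_ratio z \<noteq> 1" using d by (simp add: cross_ratio_def)
qed

lemma Cor4E:
  assumes "\<phi> \<in> Cor4"
  obtains n :: nat and c g where "\<phi> = (\<lambda>x. \<Sum>k<n. c k * g k x)"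
    "\<And>k. k < n \<Longrightarrow> \<exists>\<alpha> \<beta> f. g k = cor4_fun \<alpha> \<beta> f \<and> f \<in> F01inf"
proof -
  obtain n :: nat and c g where mu: "\<phi> = (\<lambda>x. \<Sum>k<n. c k * g k x)"
    and g: "\<forall>k<n. \<exists>\<alpha> \<beta> f. g k = cor4_fun \<alpha> \<beta> f \<and> (\<forall>(i, j)\<in>set pairs4. \<alpha> i j - \<beta> i j \<in> \<int>) \<and> f \<in> F01inf"
    using assms unfolding Cor4_def fun_span_def mem_Collect_eq
    by (elim exE conjE) (rule that; assumption)
  then show ?thesis by (intro that[of c g n]) blast+
qed

lemma Cor4_la:
  assumes phi: "\<phi> \<in> Cor4" and z4: "z \<in> X4"
  shows "la \<phi> z"
proof -
  have gen: "la (cor4_fun \<alpha> \<beta> f) z" if f: "f \<in> F01inf" for \<alpha> \<beta> f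
  proof (rule la_transfer[where f = "\<lambda>z. (\<Prod>(i, j)\<in>set pairs4. cpow (z i - z j) (\<alpha> i j) (\<beta> i j)) * f (cross_ratio z)"])
    have "real_analytic_on f (- {0, 1})" using f by (simp add: F01inf_def)
    moreover have "cross_ratio z \<in> - {0, 1}" using cross_ratio_ne[OF z4] by simp
    ultimately obtain c \<epsilon> where w: "wps f (cross_ratio z) c \<epsilon>" using real_analytic_imp_wps by blast
    have d: "la cross_ratio z"
      unfolding cross_ratio_def
      by (intro la_divide la_mult la_diff la_coord) (use z4 in \<open>auto simp: X4_iff pairs4_def\<close>)
    have "la (\<lambda>z. \<Prod>(i, j)\<in>set pairs4. cpow (z i - z j) (\<alpha> i j) (\<beta> i j)) z"
      unfolding case_prod_unfold
      by (intro la_prod la_cpow la_diff la_coord) (use z4 in \<open>auto simp: X4_iff\<close>)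
    then show "la (\<lambda>z. (\<Prod>(i, j)\<in>set pairs4. cpow (z i - z j) (\<alpha> i j) (\<beta> i j)) * f (cross_ratio z)) z"
      by (intro la_mult la_wps[OF d w])
  next
    fix d :: "nat \<Rightarrow> complex"
    obtain e where "e > 0" "\<And>t::real. \<bar>t\<bar> < e \<Longrightarrow> (\<lambda>i. z i + of_real t * d i) \<in> X4"
      using X4_line[OF z4] by blast
    then show "\<exists>\<epsilon>>0. \<forall>t::real. \<bar>t\<bar> < \<epsilon> \<longrightarrow> cor4_fun \<alpha> \<beta> f (\<lambda>i. z i + of_real t * d i) =
       (\<Prod>(ia, j)\<in>set pairs4. cpow ((\<lambda>i. z i + of_real t * d i) ia - (\<lambda>i. z i + of_real t * d i) j) (\<alpha> ia j) (\<beta> ia j)) *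
       f (cross_ratio (\<lambda>i. z i + of_real t * d i))"
      unfolding cor4_fun_def by (intro exI[of _ e]) simp
  qed
  obtain n :: nat and c g where g: "\<phi> = (\<lambda>x. \<Sum>k<n. c k * g k x)"
    "\<And>k. k < n \<Longrightarrow> \<exists>\<alpha> \<beta> f. g k = cor4_fun \<alpha> \<beta> f \<and> f \<in> F01inf"
    by (rule Cor4E[OF phi]) (rule that; assumption)
  have "la (g k) z" if "k < n" for k using g(2)[OF that] gen by auto
  then show ?thesis unfolding g(1) by (intro la_sum la_scale) auto
qed

lemma Cor4_outside: "\<phi> \<in> Cor4 \<Longrightarrow> z \<notin> X4 \<Longrightarrow> \<phi> z = 0"
proof -
  assume phi: "\<phi> \<in> Cor4" and z: "z \<notin> X4"
  obtain n :: nat and c g where g: "\<phi> = (\<lambda>x. \<Sum>k<n. c k * g k x)"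
    "\<And>k. k < n \<Longrightarrow> \<exists>\<alpha> \<beta> f. g k = cor4_fun \<alpha> \<beta> f \<and> f \<in> F01inf"
    by (rule Cor4E[OF phi]) (rule that; assumption)
  have "g k z = 0" if "k < n" for k using g(2)[OF that] z by (auto simp: cor4_fun_def)
  then show ?thesis unfolding g(1) by simp
qed

lemma Cor4_translate:
  assumes "\<phi> \<in> Cor4"
  shows "\<phi> (\<lambda>i. z i + t) = \<phi> z"
proof -
  obtain n :: nat and c g where g: "\<phi> = (\<lambda>x. \<Sum>k<n. c k * g k x)"
    "\<And>k. k < n \<Longrightarrow> \<exists>\<alpha> \<beta> f. g k = cor4_fun \<alpha> \<beta> f \<and> f \<in> F01inf"
    by (rule Cor4E[OF assms]) (rule that; assumption)
  have "g k (\<lambda>i. z i + t) = g k z" if "k < n" for k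
    using g(2)[OF that] by (auto simp: cor4_fun_def X4_iff cross_ratio_def)
  then show ?thesis unfolding g(1) by simp
qed

text \<open>Two moving points of a line collide for at most one parameter, because they are distinct
  at parameter 0. So a line through a point of \<open>X4\<close> leaves \<open>X4\<close> for at
  most six parameters, one for each pair.\<close>

lemma Cor4_identity:
  assumes la: "\<And>z. z \<in> X4 \<Longrightarrow> la g z" and "x0 \<in> X4" "y \<in> X4"
    and near: "\<And>d. \<exists>\<epsilon>>0. \<forall>l. norm l < \<epsilon> \<longrightarrow> g (\<lambda>i. x0 i + l * d i) = 0"
  shows "g y = 0"
proof (rule identity_theorem[where D = X4 and g = g and ?x0.0 = x0])
  fix x y assume x: "x \<in> X4"
  have "{l. (\<lambda>i. x i + l * (y i - x i)) \<notin> X4} \<subseteq> (\<lambda>(i, j). (x j - x i) / ((y i - x i) - (y j - x j))) ` set pairs4"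
  proof
    fix l assume "l \<in> {l. (\<lambda>i. x i + l * (y i - x i)) \<notin> X4}"
    then obtain i j where ij: "(i, j) \<in> set pairs4" "x i + l * (y i - x i) = x j + l * (y j - x j)"
      by (auto simp: X4_iff)
    have "x i \<noteq> x j" using x ij(1) by (auto simp: X4_iff)
    moreover have "l * ((y i - x i) - (y j - x j)) = x j - x i" using ij(2) by (simp add: algebra_simps)
    ultimately have "l = (x j - x i) / ((y i - x i) - (y j - x j))"
      by (metis eq_divide_imp mult_zero_right right_minus_eq)
    then show "l \<in> (\<lambda>(i, j). (x j - x i) / ((y i - x i) - (y j - x j))) ` set pairs4"
      using ij(1) by (auto intro: rev_image_eqI)
  qed
  then show "finite {l. (\<lambda>i. x i + l * (y i - x i)) \<notin> X4}" by (rule finite_subset) simp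
qed (use assms in auto)

lemma Y2f_identity:
  assumes la: "\<And>v. v \<in> Y2f \<Longrightarrow> la g v" and "x0 \<in> Y2f" "y \<in> Y2f"
    and near: "\<And>d. \<exists>\<epsilon>>0. \<forall>l. norm l < \<epsilon> \<longrightarrow> g (\<lambda>i. x0 i + l * d i) = 0"
  shows "g y = 0"
proof (rule identity_theorem[where D = Y2f and g = g and ?x0.0 = x0])
  fix x y assume x: "x \<in> Y2f"
  have fin: "finite {l :: complex. a + l * b = 0}" if "a \<noteq> 0" for a b
  proof (rule finite_subset)
    show "{l. a + l * b = 0} \<subseteq> {- a / b}"
    proof
      fix l assume "l \<in> {l. a + l * b = 0}"
      then have l: "l * b = - a" by (simp add: add_eq_0_iff)
      then have "b \<noteq> 0" using that by auto
      then show "l \<in> {- a / b}" unfolding l[symmetric] by simp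
    qed
  qed simp
  have "{l. (\<lambda>i. x i + l * (y i - x i)) \<notin> Y2f} \<subseteq> {l. x 1 + l * (y 1 - x 1) = 0} \<union> {l. x 2 + l * (y 2 - x 2) = 0} \<union>
      {l. (x 1 - x 2) + l * ((y 1 - x 1) - (y 2 - x 2)) = 0}"
    by (auto simp: Y2f_def algebra_simps)
  then show "finite {l. (\<lambda>i. x i + l * (y i - x i)) \<notin> Y2f}"
    by (rule finite_subset) (use x in \<open>auto simp: Y2f_def intro!: fin\<close>)
qed (use assms in auto)

lemma mon_scale:
  assumes e: "e \<in> expos K" and u: "\<And>i. u i > 0"
  shows "mon (\<lambda>i. of_real (u i) * y i) e = mon y e * of_real (\<Prod>i | i \<in> {1..4} \<and> y i \<noteq> 0. u i powr (fst (e i) + snd (e i)))"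
proof -
  have un: "u i \<noteq> 0" for i using u[of i] by simp
  have set: "{i. i \<in> {1..4} \<and> of_real (u i) * y i \<noteq> 0} = {i. i \<in> {1..4} \<and> y i \<noteq> 0}"
    using un by auto
  have "cpow (of_real (u i) * y i) (fst (e i)) (snd (e i)) =
     cpow (y i) (fst (e i)) (snd (e i)) * of_real (u i powr (fst (e i) + snd (e i)))" if "y i \<noteq> 0" for i
  proof -
    have int: "fst (e i) - snd (e i) \<in> \<int>" using e by (simp add: expos_def)
    obtain w where w: "u i = exp w" using u[of i] by (metis exp_ln)
    have "cpow (of_real (u i)) (fst (e i)) (snd (e i)) = of_real (u i powr (fst (e i) + snd (e i)))"
      unfolding w using cpow_exp[OF int, of "of_real w"]
      by (simp add: powr_def distrib_right flip: exp_of_real)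
    then show ?thesis using cpow_mult[of "of_real (u i)" "y i"] un that int by (simp add: mult.commute)
  qed
  then show ?thesis unfolding mon_def set by (simp add: prod.distrib)
qed

text \<open>Passing to \<open>z\<^sub>4 = 0\<close> in an expansion in non-negative integral powers of \<open>z\<^sub>4\<close>\<close>
lemma has_sum_limit_0:
  fixes f :: "'i \<Rightarrow> complex" and k :: "'i \<Rightarrow> real"
  assumes hs: "\<And>t. 0 < t \<Longrightarrow> t \<le> 1 \<Longrightarrow> ((\<lambda>i. f i * of_real (t powr k i)) has_sum F t) UNIV"
    and k: "\<And>i. f i \<noteq> 0 \<Longrightarrow> k i = 0 \<or> 1 \<le> k i"
    and lim: "(F \<longlongrightarrow> L) (at_right 0)"
  shows "((\<lambda>i. if k i = 0 then f i else 0) has_sum L) UNIV"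
proof -
  have f: "(f has_sum F 1) UNIV" using hs[of 1] by simp
  note fn = has_sum_norm_summable[OF f]
  define M where "M = infsum (\<lambda>i. norm (f i)) UNIV"
  define g where "g = (\<lambda>i. if k i = 0 then f i else 0)"
  have gn: "(\<lambda>i. norm (g i)) summable_on UNIV"
    by (rule summable_on_comparison_test[OF fn]) (auto simp: g_def)
  have g: "(g has_sum infsum g UNIV) UNIV" by (rule has_sum_infsum[OF abs_summable_summable[OF gn]])
  \<comment> \<open>The terms with \<open>k i = 0\<close> cancel, and for t \<le> 1 those with
    \<open>k i \<ge> 1\<close> contribute at most t |f i|, so the difference is O(t).\<close>
  have "norm (F t - infsum g UNIV) \<le> t * M" if t: "0 < t" "t \<le> 1" for t
  proof -
    have d: "((\<lambda>i. f i * of_real (t powr k i) - g i) has_sum (F t - infsum g UNIV)) UNIV"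
      by (rule has_sum_diff[OF hs[OF t] g])
    have le: "norm (f i * of_real (t powr k i) - g i) \<le> t * norm (f i)" for i
    proof (cases "f i = 0 \<or> k i = 0")
      case True
      then show ?thesis using t by (auto simp: g_def)
    next
      case False
      then have "1 \<le> k i" using k by blast
      then have "t powr k i \<le> t powr 1" using t by (intro powr_mono') auto
      then have "t powr k i \<le> t" using t by simp
      then show ?thesis using False t by (simp add: g_def norm_mult mult.commute mult_left_mono)
    qed
    have s: "(\<lambda>i. t * norm (f i)) summable_on UNIV" by (rule summable_on_cmult_right[OF fn])
    have "norm (F t - infsum g UNIV) \<le> infsum (\<lambda>i. t * norm (f i)) UNIV"
      using norm_infsum_le[OF d has_sum_infsum[OF s] le] .
    also have "\<dots> = t * M" unfolding M_def using fn by (intro infsum_cmult_right)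
    finally show ?thesis .
  qed
  then have "\<exists>b>0. \<forall>t>0. t < b \<longrightarrow> norm (F t - infsum g UNIV) \<le> t * M"
    by (intro exI[of _ 1]) (simp add: less_imp_le)
  then have "eventually (\<lambda>t. norm (F t - infsum g UNIV) \<le> t * M) (at_right 0)"
    unfolding eventually_at_right_field .
  moreover have "((\<lambda>t. t * M) \<longlongrightarrow> 0) (at_right 0)"
    by (rule tendsto_mult_left_zero[OF tendsto_ident_at])
  ultimately have "((\<lambda>t. F t - infsum g UNIV) \<longlongrightarrow> 0) (at_right 0)"
    by (rule Lim_null_comparison)
  then have F: "(F \<longlongrightarrow> infsum g UNIV) (at_right 0)" by (rule LIM_zero_cancel)
  have "L = infsum g UNIV" by (rule tendsto_unique[OF trivial_limit_at_right_real lim F])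
  then show ?thesis using g by (simp add: g_def)
qed

section \<open>Comparing four-point functions through their two-point coefficients\<close>

text \<open>(FV5) is written in the variables 1 and 2, and \<open>emb p q\<close> transports these
  to the positions p and q. It is polymorphic since exponents and points are both transported;
  \<open>emb 2 1\<close> doubles as the exchange of the two variables.\<close>

definition emb :: "nat \<Rightarrow> nat \<Rightarrow> (nat \<Rightarrow> 'a::zero) \<Rightarrow> nat \<Rightarrow> 'a" where
  "emb p q x = (\<lambda>i. if i = p then x 1 else if i = q then x 2 else 0)"

definition prj :: "nat \<Rightarrow> nat \<Rightarrow> (nat \<Rightarrow> 'a::zero) \<Rightarrow> nat \<Rightarrow> 'a" where
  "prj p q z = (\<lambda>i. if i = 1 then z p else if i = 2 then z q else 0)"

text \<open>
  \<open>\<phi>\<close> is expanded in the variables with index in \<open>W\<close>, in the region described by \<open>sm\<close>; the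
  coefficients \<open>h v\<close> are functions of the other two variables \<open>(z\<^sub>p, z\<^sub>q) = (v\<^sub>1, v\<^sub>2)\<close>, analytic
  wherever these are distinct and nonzero.
\<close>
definition partial_expansion ::
  "nat \<Rightarrow> nat \<Rightarrow> nat set \<Rightarrow> (real \<Rightarrow> (nat \<Rightarrow> complex) \<Rightarrow> bool) \<Rightarrow> ((nat \<Rightarrow> complex) \<Rightarrow> complex) \<Rightarrow>
   ((nat \<Rightarrow> complex) \<Rightarrow> series) \<Rightarrow> bool" where
  "partial_expansion p q W sm \<phi> h \<longleftrightarrow> (\<forall>v. supp (h v) \<subseteq> expos W) \<and>
     (\<forall>v v'. v 1 = v' 1 \<and> v 2 = v' 2 \<longrightarrow> h v = h v') \<and>
     (\<forall>v\<in>Y2f. \<forall>e. la (\<lambda>v. h v e) v) \<and>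
     (\<forall>v\<in>Y2f. \<exists>\<epsilon>>0. \<forall>z. norm (z p - v 1) < \<epsilon> \<and> norm (z q - v 2) < \<epsilon> \<and> sm \<epsilon> z \<longrightarrow>
        ((\<lambda>e. h (prj p q z) e * mon z e) has_sum \<phi> z) UNIV)"

lemma partial_expansionD:
  assumes "partial_expansion p q W sm \<phi> h"
  shows "supp (h v) \<subseteq> expos W" and "v 1 = v' 1 \<Longrightarrow> v 2 = v' 2 \<Longrightarrow> h v = h v'"
    and "v \<in> Y2f \<Longrightarrow> la (\<lambda>v. h v e) v"
    and "v \<in> Y2f \<Longrightarrow> \<exists>\<epsilon>>0. \<forall>z. norm (z p - v 1) < \<epsilon> \<and> norm (z q - v 2) < \<epsilon> \<and> sm \<epsilon> z \<longrightarrow>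
        ((\<lambda>e. h (prj p q z) e * mon z e) has_sum \<phi> z) UNIV"
proof -
  note a = assms[unfolded partial_expansion_def]
  note a1 = conjunct1[OF a] and a2 = conjunct1[OF conjunct2[OF a]]
    and a3 = conjunct1[OF conjunct2[OF conjunct2[OF a]]] and a4 = conjunct2[OF conjunct2[OF conjunct2[OF a]]]
  show "supp (h v) \<subseteq> expos W" by (rule spec[OF a1])
  show "h v = h v'" if "v 1 = v' 1" "v 2 = v' 2"
    by (rule mp[OF spec[OF spec[OF a2]]], intro conjI that)
  show "la (\<lambda>v. h v e) v" if "v \<in> Y2f" by (rule spec[OF bspec[OF a3 that]])
  show "\<exists>\<epsilon>>0. \<forall>z. norm (z p - v 1) < \<epsilon> \<and> norm (z q - v 2) < \<epsilon> \<and> sm \<epsilon> z \<longrightarrow>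
        ((\<lambda>e. h (prj p q z) e * mon z e) has_sum \<phi> z) UNIV" if "v \<in> Y2f"
    by (rule bspec[OF a4 that])
qed

text \<open>The smallness \<rho> of the remaining variables may depend on v, because the region of
  convergence of the complete series is nested in the moduli, those of z_p and z_q included.\<close>

definition total_expansion ::
  "nat \<Rightarrow> nat \<Rightarrow> (real \<Rightarrow> (nat \<Rightarrow> complex) \<Rightarrow> bool) \<Rightarrow> ((nat \<Rightarrow> complex) \<Rightarrow> complex) \<Rightarrow> series \<Rightarrow> bool" where
  "total_expansion p q sm \<phi> A \<longleftrightarrow> (\<exists>\<delta>>0. \<forall>v :: nat \<Rightarrow> complex. v 1 \<noteq> 0 \<and> v 2 \<noteq> 0 \<and> norm (v 2) < \<delta> * norm (v 1) \<longrightarrow>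
     (\<exists>\<rho>>0. \<forall>z. z p = v 1 \<and> z q = v 2 \<and> sm \<rho> z \<longrightarrow> ((\<lambda>e. A e * mon z e) has_sum \<phi> z) UNIV))"

text \<open>\<open>sm_box\<close> provides a product of annuli in the variables of W with all angles
  allowed, the kind of domain on which \<open>expansion_unique\<close> separates coefficients.
  \<open>sm_cong\<close> makes the region ignore z_p and z_q, so that it is invariant under their
  exchange.\<close>

locale extreme_region =
  fixes p q :: nat and W :: "nat set" and sm :: "real \<Rightarrow> (nat \<Rightarrow> complex) \<Rightarrow> bool"
  assumes pq: "p \<in> {1..4}" "q \<in> {1..4}" "p \<noteq> q" "p \<notin> W" "q \<notin> W" and W: "W \<subseteq> {1..4}"
    and sm_mono: "\<And>\<rho> \<rho>' z. 0 < \<rho> \<Longrightarrow> \<rho> \<le> \<rho>' \<Longrightarrow> sm \<rho> z \<Longrightarrow> sm \<rho>' z"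
    and sm_cong: "\<And>\<rho> z z'. sm \<rho> z \<Longrightarrow> (\<And>i. i \<noteq> p \<Longrightarrow> i \<noteq> q \<Longrightarrow> z i = z' i) \<Longrightarrow> sm \<rho> z'"
    and sm_box: "\<And>\<rho>. 0 < \<rho> \<Longrightarrow> \<exists>\<zeta> \<eta>. 0 < \<eta> \<and> (\<forall>i\<in>W. \<zeta> i \<noteq> 0) \<and>
       (\<forall>z. (\<forall>i\<in>W. \<exists>t \<theta>. \<bar>t\<bar> < \<eta> \<and> z i = \<zeta> i * exp (complex_of_real t + \<i> * complex_of_real \<theta>)) \<and>
         (\<forall>i. i \<notin> W \<and> i \<noteq> p \<and> i \<noteq> q \<longrightarrow> z i = 0) \<longrightarrow> sm \<rho> z)"

lemma mon_emb:
  assumes "p \<in> {1..4}" "q \<in> {1..4}" "p \<noteq> q" "z p \<noteq> 0" "z q \<noteq> 0"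
  shows "mon z (emb p q e) = cpow (z p) (fst (e 1)) (snd (e 1)) * cpow (z q) (fst (e 2)) (snd (e 2))"
proof -
  have "mon z (emb p q e) = (\<Prod>i\<in>{p, q}. cpow (z i) (fst (emb p q e i)) (snd (emb p q e i)))"
    unfolding mon_def
    by (rule prod.mono_neutral_right) (use assms in \<open>auto simp: emb_def cpow_0\<close>)
  then show ?thesis using assms(3) by (auto simp: emb_def)
qed

lemma emb_12: "e \<in> expos {1, 2} \<Longrightarrow> emb 1 2 e = e"
  by (auto simp: emb_def expos_def fun_eq_iff)

lemma emb_expos: "e \<in> expos {1, 2} \<Longrightarrow> emb p q e \<in> expos {p, q}"
  by (auto simp: emb_def expos_def)

lemma mon_restrict:
  assumes "d \<in> expos W" "W \<subseteq> {1..4}"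
  shows "mon z d = (\<Prod>i | i \<in> W \<and> z i \<noteq> 0. cpow (z i) (fst (d i)) (snd (d i)))"
proof -
  have "finite {i. i \<in> {1..4} \<and> z i \<noteq> 0}" by simp
  then show ?thesis unfolding mon_def
    by (rule prod.mono_neutral_right) (use assms in \<open>auto simp: expos_def cpow_0\<close>)
qed

lemma near_region:
  fixes x0 d :: "nat \<Rightarrow> complex"
  assumes "x0 1 \<noteq> 0" "x0 2 \<noteq> 0" "norm (x0 2) < \<delta> * norm (x0 1)"
  shows "\<exists>\<epsilon>>0. \<forall>l. norm l < \<epsilon> \<longrightarrow> x0 1 + l * d 1 \<noteq> 0 \<and> x0 2 + l * d 2 \<noteq> 0 \<and>
     norm (x0 2 + l * d 2) < \<delta> * norm (x0 1 + l * d 1)"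
proof -
  have t: "((\<lambda>l. x0 i + l * d i) \<longlongrightarrow> x0 i + 0 * d i) (nhds (0 :: complex))" for i
    by (intro tendsto_intros filterlim_ident)
  have "((\<lambda>l. \<delta> * norm (x0 1 + l * d 1) - norm (x0 2 + l * d 2)) \<longlongrightarrow>
      \<delta> * norm (x0 1 + 0 * d 1) - norm (x0 2 + 0 * d 2)) (nhds (0 :: complex))"
    by (intro tendsto_diff tendsto_mult tendsto_const tendsto_norm t)
  then have "eventually (\<lambda>l. 0 < \<delta> * norm (x0 1 + l * d 1) - norm (x0 2 + l * d 2)) (nhds 0)"
    by (rule order_tendstoD(1)) (use assms in simp)
  moreover have "eventually (\<lambda>l. x0 1 + l * d 1 \<noteq> 0) (nhds 0)"
    using tendsto_imp_eventually_ne[OF t[of 1]] assms by simp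
  moreover have "eventually (\<lambda>l. x0 2 + l * d 2 \<noteq> 0) (nhds 0)"
    using tendsto_imp_eventually_ne[OF t[of 2]] assms by simp
  ultimately have "eventually (\<lambda>l. x0 1 + l * d 1 \<noteq> 0 \<and> x0 2 + l * d 2 \<noteq> 0 \<and>
     norm (x0 2 + l * d 2) < \<delta> * norm (x0 1 + l * d 1)) (nhds 0)"
    by eventually_elim simp
  then show ?thesis by (simp add: eventually_nhds_metric)
qed

context extreme_region
begin

text \<open>For fixed v the complete series and the partial expansion both sum to \<phi> on a
  product of annuli in the W-variables. Regrouped by its W-exponent d, the complete series has as
  coefficients sums over the exponents of z_p and z_q, and \<open>expansion_unique\<close>
  identifies these with \<open>h v d\<close>.\<close>

lemma coefficient_sums:
  assumes pe: "partial_expansion p q W sm \<phi> h" and te: "total_expansion p q sm \<phi> A"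
    and sA: "supp A \<subseteq> expos ({p, q} \<union> W)"
  shows "\<exists>\<delta>>0. \<forall>v. v 1 \<noteq> 0 \<and> v 2 \<noteq> 0 \<and> norm (v 2) < \<delta> * norm (v 1) \<longrightarrow>
    (\<forall>d\<in>expos W. ((\<lambda>e. A (expo_add (emb p q e) d) * mon v e) has_sum h v d) (expos {1, 2}))"
proof -
  from te[unfolded total_expansion_def]
  obtain \<delta> where \<delta>: "\<delta> > 0" "\<forall>v :: nat \<Rightarrow> complex. v 1 \<noteq> 0 \<and> v 2 \<noteq> 0 \<and> norm (v 2) < \<delta> * norm (v 1) \<longrightarrow>
     (\<exists>\<rho>>0. \<forall>z. z p = v 1 \<and> z q = v 2 \<and> sm \<rho> z \<longrightarrow> ((\<lambda>e. A e * mon z e) has_sum \<phi> z) UNIV)"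
    by (elim exE conjE) (rule that; assumption)
  note sh = partial_expansionD(1)[OF pe] and ch = partial_expansionD(2)[OF pe]
    and eh = partial_expansionD(4)[OF pe]
  have main: "((\<lambda>e. A (expo_add (emb p q e) d0) * mon v e) has_sum h v d0) (expos {1, 2})"
    if v: "v 1 \<noteq> 0" "v 2 \<noteq> 0" "norm (v 2) < min \<delta> 1 * norm (v 1)" and d0: "d0 \<in> expos W" for v d0
  proof -
    \<comment> \<open>The bound 1 ensures v 1 \<noteq> v 2, so that v lies in
      \<open>Y2f\<close>.\<close>
    have "min \<delta> 1 * norm (v 1) \<le> \<delta> * norm (v 1)" "min \<delta> 1 * norm (v 1) \<le> 1 * norm (v 1)"
      by (rule mult_right_mono; simp)+
    then have v3: "norm (v 2) < \<delta> * norm (v 1)" "norm (v 2) < norm (v 1)" using v(3) by linarith+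
    have "v 1 \<noteq> v 2" using v3(2) by force
    then have vY: "v \<in> Y2f" using v by (simp add: Y2f_def)
    have "v 1 \<noteq> 0 \<and> v 2 \<noteq> 0 \<and> norm (v 2) < \<delta> * norm (v 1)" using v v3 by simp
    from mp[OF spec[OF \<delta>(2)] this]
    obtain r1 where r1: "r1 > 0" "\<forall>z. z p = v 1 \<and> z q = v 2 \<and> sm r1 z \<longrightarrow> ((\<lambda>e. A e * mon z e) has_sum \<phi> z) UNIV"
      by (elim exE conjE) (rule that; assumption)
    from eh[OF vY]
    obtain r2 where r2: "r2 > 0" "\<forall>z. norm (z p - v 1) < r2 \<and> norm (z q - v 2) < r2 \<and> sm r2 z \<longrightarrow>
        ((\<lambda>e. h (prj p q z) e * mon z e) has_sum \<phi> z) UNIV"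
      by (elim exE conjE) (rule that; assumption)
    define \<rho> where "\<rho> = min r1 r2"
    have \<rho>: "\<rho> > 0" "\<rho> \<le> r1" "\<rho> \<le> r2" using r1(1) r2(1) by (auto simp: \<rho>_def)
    obtain \<zeta> \<eta> where box: "0 < \<eta>" "\<forall>i\<in>W. \<zeta> i \<noteq> 0"
       "\<forall>z. (\<forall>i\<in>W. \<exists>t \<theta>. \<bar>t\<bar> < \<eta> \<and> z i = \<zeta> i * exp (complex_of_real t + \<i> * complex_of_real \<theta>)) \<and>
         (\<forall>i. i \<notin> W \<and> i \<noteq> p \<and> i \<noteq> q \<longrightarrow> z i = 0) \<longrightarrow> sm \<rho> z"
      using sm_box[OF \<rho>(1)] by (elim exE conjE) (rule that; assumption)
    define z0 where "z0 = (\<lambda>i. if i = p then v 1 else if i = q then v 2 else if i \<in> W then \<zeta> i else 0)"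
    define zt where "zt = (\<lambda>(t :: nat \<Rightarrow> real) (\<theta> :: nat \<Rightarrow> real) i.
       if i \<in> W then z0 i * exp (complex_of_real (t i) + \<i> * complex_of_real (\<theta> i)) else z0 i)"
    have ztpq: "zt t \<theta> p = v 1" "zt t \<theta> q = v 2" for t \<theta>
      using pq by (auto simp: zt_def z0_def)
    have z0W: "z0 i = \<zeta> i" if "i \<in> W" for i using that pq by (auto simp: z0_def)
    have smt: "sm \<rho> (zt t \<theta>)" if "\<And>i. i \<in> W \<Longrightarrow> \<bar>t i\<bar> < \<eta>" for t \<theta>
    proof (rule mp[OF spec[OF box(3)]], intro conjI ballI allI impI)
      fix i assume "i \<in> W"
      then show "\<exists>t' \<theta>'. \<bar>t'\<bar> < \<eta> \<and> zt t \<theta> i = \<zeta> i * exp (complex_of_real t' + \<i> * complex_of_real \<theta>')"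
        using that z0W by (intro exI[of _ "t i"] exI[of _ "\<theta> i"]) (simp add: zt_def)
    qed (simp add: zt_def z0_def)
    have hA: "((\<lambda>e. A e * mon (zt t \<theta>) e) has_sum \<phi> (zt t \<theta>)) UNIV"
      and hh: "((\<lambda>e. h v e * mon (zt t \<theta>) e) has_sum \<phi> (zt t \<theta>)) UNIV"
      if t: "\<And>i. i \<in> W \<Longrightarrow> \<bar>t i\<bar> < \<eta>" for t \<theta>
    proof -
      have s: "sm r1 (zt t \<theta>)" by (rule sm_mono[OF \<rho>(1) \<rho>(2)]) (rule smt[OF t])
      have s2: "sm r2 (zt t \<theta>)" by (rule sm_mono[OF \<rho>(1) \<rho>(3)]) (rule smt[OF t])
      show "((\<lambda>e. A e * mon (zt t \<theta>) e) has_sum \<phi> (zt t \<theta>)) UNIV"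
        by (rule mp[OF spec[OF r1(2)]]) (simp only: ztpq s simp_thms)
      have "h (prj p q (zt t \<theta>)) = h v" by (rule ch) (simp_all add: prj_def ztpq)
      moreover have "((\<lambda>e. h (prj p q (zt t \<theta>)) e * mon (zt t \<theta>) e) has_sum \<phi> (zt t \<theta>)) UNIV"
        by (rule mp[OF spec[OF r2(2)]]) (simp add: ztpq s2 r2(1))
      ultimately show "((\<lambda>e. h v e * mon (zt t \<theta>) e) has_sum \<phi> (zt t \<theta>)) UNIV" by (simp only:)
    qed
    have monv: "mon v e = mon (zt t \<theta>) (emb p q e)" if "e \<in> expos {1, 2}" for e t \<theta>
      using mon_emb[of p q "zt t \<theta>" e] mon_emb[of 1 2 v e] v pq emb_12[OF that] by (simp add: ztpq)
    have double: "((\<lambda>(d, e). (A (expo_add (emb p q e) d) * mon v e) * mon (zt t \<theta>) d) has_sum \<phi> (zt t \<theta>))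
        (expos W \<times> expos {1, 2})"
      if t: "\<And>i. i \<in> W \<Longrightarrow> \<bar>t i\<bar> < \<eta>" for t \<theta>
    proof -
      have "((\<lambda>e. A e * mon (zt t \<theta>) e) has_sum \<phi> (zt t \<theta>)) (expos ({p, q} \<union> W))"
        using hA[OF t] by (rule has_sum_cong_neutral[THEN iffD1, rotated -1]) (use sA in \<open>auto simp: supp_def\<close>)
      also have "?this \<longleftrightarrow> ?thesis"
      proof (rule has_sum_reindex_bij_witness[where
            j = "\<lambda>e'. ((\<lambda>i. if i \<in> W then e' i else 0), (\<lambda>i. if i = 1 then e' p else if i = 2 then e' q else 0))"
            and i = "\<lambda>(d, e). expo_add (emb p q e) d"])
        fix e' assume e': "e' \<in> expos ({p, q} \<union> W)"
        let ?d = "\<lambda>i. if i \<in> W then e' i else 0" and ?e = "\<lambda>i. if i = 1 then e' p else if i = 2 then e' q else 0"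
        show "(case (?d, ?e) of (d, e) \<Rightarrow> expo_add (emb p q e) d) = e'"
        proof
          fix i
          have "e' i = 0" if "i \<noteq> p" "i \<noteq> q" "i \<notin> W" using e' that by (simp add: expos_def)
          then show "(case (?d, ?e) of (d, e) \<Rightarrow> expo_add (emb p q e) d) i = e' i"
            using pq by (cases "i = p"; cases "i = q"; cases "i \<in> W") (simp_all add: expo_add_def emb_def)
        qed
        then have eq: "expo_add (emb p q ?e) ?d = e'" by simp
        show mem: "(?d, ?e) \<in> expos W \<times> expos {1, 2}" using e' by (auto simp: expos_def)
        have em: "emb p q ?e \<in> expos {p, q}" using mem by (intro emb_expos) simp
        have e12: "?e \<in> expos {1, 2}" and dW: "?d \<in> expos W" using mem by (simp_all only: mem_Sigma_iff)
        have "mon (zt t \<theta>) e' = mon v ?e * mon (zt t \<theta>) ?d"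
          using mon_add[OF em dW, of "zt t \<theta>"] by (simp only: eq monv[OF e12, of t \<theta>])
        then show "(case (?d, ?e) of (d, e) \<Rightarrow> A (expo_add (emb p q e) d) * mon v e * mon (zt t \<theta>) d) = A e' * mon (zt t \<theta>) e'"
          by (simp only: prod.case eq mult.assoc)
      next
        fix x assume x: "x \<in> expos W \<times> expos {1, 2}"
        obtain d e where de: "x = (d, e)" by force
        have d: "d \<in> expos W" and e: "e \<in> expos {1, 2}" using x by (auto simp: de)
        have d0: "d i = 0" if "i \<notin> W" for i using d that by (simp add: expos_def)
        have e0: "e i = 0" if "i \<noteq> 1" "i \<noteq> 2" for i using e that by (simp add: expos_def)
        have "(\<lambda>i. if i \<in> W then expo_add (emb p q e) d i else 0) = d"
        proof
          fix i
          have "i \<in> W \<Longrightarrow> i \<noteq> p \<and> i \<noteq> q" using pq by blast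
          then show "(if i \<in> W then expo_add (emb p q e) d i else 0) = d i"
            by (cases "i \<in> W") (simp_all add: d0 expo_add_def emb_def)
        qed
        moreover have "(\<lambda>i. if i = 1 then expo_add (emb p q e) d p else if i = 2 then expo_add (emb p q e) d q else 0) = e"
        proof
          fix i
          show "(if i = 1 then expo_add (emb p q e) d p else if i = 2 then expo_add (emb p q e) d q else 0) = e i"
            using pq by (cases "i = 1"; cases "i = 2") (simp_all add: d0 e0[simplified] expo_add_def emb_def)
        qed
        ultimately show "((\<lambda>i. if i \<in> W then (case x of (d, e) \<Rightarrow> expo_add (emb p q e) d) i else 0),
           (\<lambda>i. if i = 1 then (case x of (d, e) \<Rightarrow> expo_add (emb p q e) d) p
              else if i = 2 then (case x of (d, e) \<Rightarrow> expo_add (emb p q e) d) q else 0)) = x"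
          by (simp only: de prod.case)
        show "(case x of (d, e) \<Rightarrow> expo_add (emb p q e) d) \<in> expos ({p, q} \<union> W)"
          unfolding de prod.case
          by (rule expos_add; rule subsetD[OF expos_mono]) (use emb_expos[OF e, of p q] d in auto)
      qed (rule refl)
      finally show ?thesis .
    qed
    define G where "G = (\<lambda>d. infsum (\<lambda>e. A (expo_add (emb p q e) d) * mon v e) (expos {1, 2}))"
    \<comment> \<open>A single point of the box suffices for summability of a slice, since the
      monomial in the W-variables is nonzero there and can be cancelled.\<close>
    have slice: "((\<lambda>e. A (expo_add (emb p q e) d) * mon v e) has_sum G d) (expos {1, 2})" if d: "d \<in> expos W" for d
    proof -
      let ?z = "zt (\<lambda>_. 0) (\<lambda>_. 0)"
      have "(\<lambda>e. (A (expo_add (emb p q e) d) * mon v e) * mon ?z d) summable_on (expos {1, 2})"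
        using summable_on_SigmaD1[OF has_sum_imp_summable[OF double[of "\<lambda>_. 0" "\<lambda>_. 0"]] d] box(1) by simp
      then have "(\<lambda>e. A (expo_add (emb p q e) d) * mon v e) summable_on (expos {1, 2})"
        by (subst (asm) summable_on_cmult_left') (use mon_nonzero in auto)
      then show ?thesis unfolding G_def by (rule has_sum_infsum)
    qed
    define C where "C = (\<lambda>d. if d \<in> expos W then G d - h v d else 0)"
    have "C = (\<lambda>_. 0)"
    proof (rule expansion_unique[where W = W and z = z0 and \<eta> = \<eta>])
      show "supp C \<subseteq> expos W" by (auto simp: supp_def C_def)
      show "z0 i \<noteq> 0" if "i \<in> W" for i using bspec[OF box(2) that] z0W[OF that] by simp
      fix t \<theta> :: "nat \<Rightarrow> real" assume t: "\<And>i. i \<in> W \<Longrightarrow> \<bar>t i\<bar> < \<eta>"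
      have "((\<lambda>d. G d * mon (zt t \<theta>) d) has_sum \<phi> (zt t \<theta>)) (expos W)"
      proof (rule has_sum_SigmaD[OF double[OF t]])
        fix d assume "d \<in> expos W"
        from has_sum_cmult_left[OF slice[OF this], of "mon (zt t \<theta>) d"]
        show "((\<lambda>e. (\<lambda>(d, e). (A (expo_add (emb p q e) d) * mon v e) * mon (zt t \<theta>) d) (d, e)) has_sum
            G d * mon (zt t \<theta>) d) (expos {1, 2})" by simp
      qed
      moreover have "((\<lambda>d. h v d * mon (zt t \<theta>) d) has_sum \<phi> (zt t \<theta>)) (expos W)"
        using hh[OF t] by (rule has_sum_cong_neutral[THEN iffD1, rotated -1]) (use sh[of v] in \<open>auto simp: supp_def\<close>)
      ultimately have "((\<lambda>d. G d * mon (zt t \<theta>) d - h v d * mon (zt t \<theta>) d) has_sum (\<phi> (zt t \<theta>) - \<phi> (zt t \<theta>))) (expos W)"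
        by (rule has_sum_diff)
      then have "((\<lambda>d. C d * mon (zt t \<theta>) d) has_sum 0) UNIV"
        unfolding diff_self by (rule has_sum_cong_neutral[THEN iffD1, rotated -1]) (auto simp: C_def algebra_simps)
      then show "((\<lambda>e. C e * mon (\<lambda>i. if i \<in> W then z0 i * exp (complex_of_real (t i) + \<i> * complex_of_real (\<theta> i)) else z0 i) e)
          has_sum 0) UNIV"
        by (simp only: zt_def)
    qed (use box(1) W in auto)
    then have "C d0 = 0" by simp
    then have "G d0 = h v d0" using d0 by (simp add: C_def)
    then show ?thesis using slice[OF d0] by simp
  qed
  show ?thesis
  proof (intro exI[of _ "min \<delta> 1"] conjI allI impI ballI)
    show "min \<delta> 1 > 0" using \<delta>(1) by simp
    fix v :: "nat \<Rightarrow> complex" and d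
    assume "v 1 \<noteq> 0 \<and> v 2 \<noteq> 0 \<and> norm (v 2) < min \<delta> 1 * norm (v 1)" "d \<in> expos W"
    then show "((\<lambda>e. A (expo_add (emb p q e) d) * mon v e) has_sum h v d) (expos {1, 2})"
      using main by blast
  qed
qed

text \<open>The sums are only compared where |v 2| is small against |v 1|. Both sides are analytic
  wherever the two points and 0 are distinct, so the identity theorem carries the equality beyond
  the region of expansion.\<close>

lemma coefficient_eq:
  assumes pe: "partial_expansion p q W sm \<phi> h" and te: "total_expansion p q sm \<phi> A"
    and sA: "supp A \<subseteq> expos ({p, q} \<union> W)" and d: "d \<in> expos W"
    and g: "\<And>v. v \<in> Y2f \<Longrightarrow> la g v"
    and val: "\<exists>\<delta>>0. \<forall>v. v 1 \<noteq> 0 \<and> v 2 \<noteq> 0 \<and> norm (v 2) < \<delta> * norm (v 1) \<longrightarrow>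
       ((\<lambda>e. A (expo_add (emb p q e) d) * mon v e) has_sum g v) (expos {1, 2})"
    and v: "v \<in> Y2f"
  shows "h v d = g v"
proof -
  obtain \<delta>1 where d1: "\<delta>1 > 0" "\<And>v. v 1 \<noteq> 0 \<and> v 2 \<noteq> 0 \<and> norm (v 2) < \<delta>1 * norm (v 1) \<Longrightarrow>
    ((\<lambda>e. A (expo_add (emb p q e) d) * mon v e) has_sum h v d) (expos {1, 2})"
    using coefficient_sums[OF pe te sA] d by blast
  obtain \<delta>2 where d2: "\<delta>2 > 0" "\<And>v. v 1 \<noteq> 0 \<and> v 2 \<noteq> 0 \<and> norm (v 2) < \<delta>2 * norm (v 1) \<Longrightarrow>
    ((\<lambda>e. A (expo_add (emb p q e) d) * mon v e) has_sum g v) (expos {1, 2})"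
    using val by blast
  define \<delta> where "\<delta> = min 1 (min \<delta>1 \<delta>2)"
  have \<delta>: "\<delta> > 0" "\<delta> \<le> 1" "\<delta> \<le> \<delta>1" "\<delta> \<le> \<delta>2" using d1(1) d2(1) by (auto simp: \<delta>_def)
  define x0 :: "nat \<Rightarrow> complex" where "x0 = (\<lambda>i. if i = 1 then 1 else of_real (\<delta> / 2))"
  have x0: "x0 1 \<noteq> 0" "x0 2 \<noteq> 0" "norm (x0 2) < \<delta> * norm (x0 1)" using \<delta> by (auto simp: x0_def)
  have "h v d - g v = 0"
  proof (rule Y2f_identity[where g = "\<lambda>v. h v d - g v" and ?x0.0 = x0])
    show "la (\<lambda>v. h v d - g v) v" if "v \<in> Y2f" for v
      by (intro la_diff partial_expansionD(3)[OF pe] g that)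
    have "x0 1 \<noteq> x0 2"
    proof
      assume "x0 1 = x0 2"
      then have "complex_of_real 1 = of_real (\<delta> / 2)" by (simp add: x0_def)
      then show False using \<delta>(2) by (simp only: of_real_eq_iff)
    qed
    then show "x0 \<in> Y2f" using x0 by (simp add: Y2f_def)
    fix dd :: "nat \<Rightarrow> complex"
    obtain \<epsilon> where e: "\<epsilon> > 0" "\<And>l. norm l < \<epsilon> \<Longrightarrow> x0 1 + l * dd 1 \<noteq> 0 \<and> x0 2 + l * dd 2 \<noteq> 0 \<and>
     norm (x0 2 + l * dd 2) < \<delta> * norm (x0 1 + l * dd 1)" using near_region[OF x0] by blast
    have "h (\<lambda>i. x0 i + l * dd i) d - g (\<lambda>i. x0 i + l * dd i) = 0" if "norm l < \<epsilon>" for l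
    proof -
      let ?v = "\<lambda>i. x0 i + l * dd i"
      have r: "?v 1 \<noteq> 0" "?v 2 \<noteq> 0" "norm (?v 2) < \<delta> * norm (?v 1)" using e(2)[OF that] by auto
      have "\<delta> * norm (?v 1) \<le> \<delta>1 * norm (?v 1)" "\<delta> * norm (?v 1) \<le> \<delta>2 * norm (?v 1)"
        by (rule mult_right_mono; use \<delta> in simp)+
      then have "norm (?v 2) < \<delta>1 * norm (?v 1)" "norm (?v 2) < \<delta>2 * norm (?v 1)" using r(3) by linarith+
      then show ?thesis
        using has_sum_unique[OF d1(2)[of ?v] d2(2)[of ?v]] r by simp
    qed
    then show "\<exists>\<epsilon>>0. \<forall>l. norm l < \<epsilon> \<longrightarrow> h (\<lambda>i. x0 i + l * dd i) d - g (\<lambda>i. x0 i + l * dd i) = 0"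
      using e(1) by blast
  qed (rule v)
  then show ?thesis by simp
qed

lemma coefficient_eq_12:
  assumes "partial_expansion p q W sm \<phi> h" "total_expansion p q sm \<phi> A"
    and "supp A \<subseteq> expos ({p, q} \<union> W)" "d \<in> expos W"
    and mu: "\<mu> \<in> GCor2" "expand_12 \<mu> P"
    and P: "\<And>e. e \<in> expos {1, 2} \<Longrightarrow> A (expo_add (emb p q e) d) = P e"
    and "v \<in> Y2f"
  shows "h v d = \<mu> (v 1, v 2)"
proof (rule coefficient_eq[OF assms(1-4) _ _ assms(8)])
  show "la (\<lambda>v. \<mu> (v 1, v 2)) v" if "v \<in> Y2f" for v by (rule la_GCor2[OF mu(1) that])
  obtain \<delta> where s: "supp P \<subseteq> expos {1, 2}" and \<delta>: "\<delta> > 0"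
    "\<And>v. v 1 \<noteq> 0 \<and> v 2 \<noteq> 0 \<and> norm (v 2) < \<delta> * norm (v 1) \<Longrightarrow>
     ((\<lambda>e. P e * mon v e) has_sum \<mu> (v 1, v 2)) UNIV"
    using expand_12_eval[OF mu(2)] by blast
  have "((\<lambda>e. A (expo_add (emb p q e) d) * mon v e) has_sum \<mu> (v 1, v 2)) (expos {1, 2})"
    if "v 1 \<noteq> 0 \<and> v 2 \<noteq> 0 \<and> norm (v 2) < \<delta> * norm (v 1)" for v
    using \<delta>(2)[OF that]
    by (rule has_sum_cong_neutral[THEN iffD1, rotated -1]) (use s P in \<open>auto simp: supp_def\<close>)
  then show "\<exists>\<delta>>0. \<forall>v. v 1 \<noteq> 0 \<and> v 2 \<noteq> 0 \<and> norm (v 2) < \<delta> * norm (v 1) \<longrightarrow>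
       ((\<lambda>e. A (expo_add (emb p q e) d) * mon v e) has_sum \<mu> (v 1, v 2)) (expos {1, 2})"
    using \<delta>(1) by blast
qed

text \<open>After the exchange the first retained point is the second variable of \<mu>, so that |v
  1| > |v 2| is precisely the region in which \<mu> is expanded for |z2| > |z1|.\<close>

lemma coefficient_eq_21:
  assumes "partial_expansion p q W sm \<phi> h" "total_expansion p q sm \<phi> A"
    and "supp A \<subseteq> expos ({p, q} \<union> W)" "d \<in> expos W"
    and mu: "\<mu> \<in> GCor2" "expand_21 \<mu> P"
    and P: "\<And>e. e \<in> expos {1, 2} \<Longrightarrow> A (expo_add (emb p q e) d) = P (emb 2 1 e)"
    and "v \<in> Y2f"
  shows "h v d = \<mu> (v 2, v 1)"
proof (rule coefficient_eq[OF assms(1-4) _ _ assms(8)])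
  show "la (\<lambda>v. \<mu> (v 2, v 1)) v" if "v \<in> Y2f" for v
  proof -
    have Y: "emb 2 1 v \<in> Y2f" using that by (auto simp: Y2f_def emb_def)
    have "la (\<lambda>v. (\<lambda>v. \<mu> (v 1, v 2)) (emb 2 1 v)) v"
      by (rule la_linear[where T = "emb 2 1" and L = "emb 2 1" and g = "\<lambda>v. \<mu> (v 1, v 2)", OF la_GCor2[OF mu(1) Y]]) (auto simp: emb_def)
    then show ?thesis by (simp add: emb_def)
  qed
  obtain \<delta> where s: "supp P \<subseteq> expos {1, 2}" and \<delta>: "\<delta> > 0"
    "\<And>v. v 1 \<noteq> 0 \<and> v 2 \<noteq> 0 \<and> norm (v 1) < \<delta> * norm (v 2) \<Longrightarrow>
     ((\<lambda>e. P e * mon v e) has_sum \<mu> (v 1, v 2)) UNIV"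
    using expand_21_eval[OF mu(2)] by blast
  have "((\<lambda>e. A (expo_add (emb p q e) d) * mon v e) has_sum \<mu> (v 2, v 1)) (expos {1, 2})"
    if v: "v 1 \<noteq> 0 \<and> v 2 \<noteq> 0 \<and> norm (v 2) < \<delta> * norm (v 1)" for v
  proof -
    let ?u = "emb 2 1 v"
    have "((\<lambda>e. P e * mon ?u e) has_sum \<mu> (v 2, v 1)) UNIV"
      using \<delta>(2)[of ?u] v by (simp add: emb_def)
    then have "((\<lambda>e. P e * mon ?u e) has_sum \<mu> (v 2, v 1)) (expos {1, 2})"
      by (rule has_sum_cong_neutral[THEN iffD1, rotated -1]) (use s in \<open>auto simp: supp_def\<close>)
    also have "?this \<longleftrightarrow> ((\<lambda>e. A (expo_add (emb p q e) d) * mon v e) has_sum \<mu> (v 2, v 1)) (expos {1, 2})"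
    proof (rule has_sum_reindex_bij_witness[where i = "emb 2 1" and j = "emb 2 1"])
      fix e :: expo assume e: "e \<in> expos {1, 2}"
      show ee: "emb 2 1 (emb 2 1 e) = e" using e by (auto simp: emb_def expos_def fun_eq_iff)
      show e': "emb 2 1 e \<in> expos {1, 2}" using emb_expos[OF e, of 2 1] by (simp add: insert_commute)
      have "mon ?u e = mon v (emb 2 1 e)"
        using mon_emb[of 1 2 ?u e] mon_emb[of 2 1 v e] v emb_12[OF e] by (simp add: emb_def mult.commute)
      then show "A (expo_add (emb p q (emb 2 1 e)) d) * mon v (emb 2 1 e) = P e * mon ?u e"
        using P[OF e'] ee by simp
    next
      fix e :: expo assume e: "e \<in> expos {1, 2}"
      show "emb 2 1 (emb 2 1 e) = e" using e by (auto simp: emb_def expos_def fun_eq_iff)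
      show "emb 2 1 e \<in> expos {1, 2}" using emb_expos[OF e, of 2 1] by (simp add: insert_commute)
    qed (rule refl)
    finally show ?thesis .
  qed
  then show "\<exists>\<delta>>0. \<forall>v. v 1 \<noteq> 0 \<and> v 2 \<noteq> 0 \<and> norm (v 2) < \<delta> * norm (v 1) \<longrightarrow>
       ((\<lambda>e. A (expo_add (emb p q e) d) * mon v e) has_sum \<mu> (v 2, v 1)) (expos {1, 2})"
    using \<delta>(1) by blast
qed

text \<open>The W-monomials do not involve z_p and z_q, so the transposition acts on the
  coefficients alone. Equal coefficients then give equal sums wherever both expansions
  converge.\<close>

lemma local_symmetry:
  assumes pe: "partial_expansion p q W sm \<phi> h" "partial_expansion p q W sm \<phi>' h'"
    and eq: "\<And>v d. v \<in> Y2f \<Longrightarrow> d \<in> expos W \<Longrightarrow> h v d = h' (emb 2 1 v) d"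
    and v: "v \<in> Y2f"
  shows "\<exists>\<epsilon>>0. \<forall>z. norm (z p - v 1) < \<epsilon> \<and> norm (z q - v 2) < \<epsilon> \<and> sm \<epsilon> z \<and> prj p q z \<in> Y2f \<longrightarrow>
     \<phi> z = \<phi>' (z \<circ> Transposition.transpose p q)"
proof -
  note sh = partial_expansionD(1)[OF pe(1)] and sh' = partial_expansionD(1)[OF pe(2)]
    and ch = partial_expansionD(2)[OF pe(2)]
  have v': "emb 2 1 v \<in> Y2f" using v by (auto simp: Y2f_def emb_def)
  obtain e1 where e1: "e1 > 0" "\<And>z. norm (z p - v 1) < e1 \<and> norm (z q - v 2) < e1 \<and> sm e1 z \<Longrightarrow>
        ((\<lambda>e. h (prj p q z) e * mon z e) has_sum \<phi> z) UNIV"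
    using partial_expansionD(4)[OF pe(1) v] by blast
  obtain e2 where e2: "e2 > 0" "\<And>z. norm (z p - emb 2 1 v 1) < e2 \<and> norm (z q - emb 2 1 v 2) < e2 \<and> sm e2 z \<Longrightarrow>
        ((\<lambda>e. h' (prj p q z) e * mon z e) has_sum \<phi>' z) UNIV"
    using partial_expansionD(4)[OF pe(2) v'] by blast
  have "\<phi> z = \<phi>' (z \<circ> Transposition.transpose p q)"
    if z: "norm (z p - v 1) < min e1 e2" "norm (z q - v 2) < min e1 e2" "sm (min e1 e2) z" "prj p q z \<in> Y2f" for z
  proof -
    let ?z = "z \<circ> Transposition.transpose p q"
    have zz: "?z p = z q" "?z q = z p" "\<And>i. i \<noteq> p \<Longrightarrow> i \<noteq> q \<Longrightarrow> ?z i = z i"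
      by (simp_all add: Transposition.transpose_def)
    have m: "0 < min e1 e2" using e1(1) e2(1) by simp
    have s: "sm e1 z" "sm e2 z" by (rule sm_mono[OF m _ z(3)], simp)+
    have s': "sm e2 ?z" by (rule sm_cong[OF s(2)]) (rule zz(3)[symmetric])
    have 1: "((\<lambda>e. h (prj p q z) e * mon z e) has_sum \<phi> z) UNIV"
      by (rule e1(2)) (use z(1,2) s(1) in simp)
    have 2: "((\<lambda>e. h' (prj p q ?z) e * mon ?z e) has_sum \<phi>' ?z) UNIV"
      by (rule e2(2), unfold zz(1,2)) (use z(1,2) s' in \<open>simp add: emb_def\<close>)
    have hh: "h' (prj p q ?z) = h' (emb 2 1 (prj p q z))"
      by (rule ch) (simp_all add: prj_def emb_def zz)
    have "h (prj p q z) e * mon z e = h' (prj p q ?z) e * mon ?z e" for e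
    proof (cases "e \<in> expos W")
      case True
      have "mon z e = mon ?z e"
        unfolding mon_restrict[OF True W]
      proof (rule prod.cong)
        have "?z i = z i" if "i \<in> W" for i by (rule zz(3)) (use that pq in blast)+
        then show "{i. i \<in> W \<and> z i \<noteq> 0} = {i. i \<in> W \<and> ?z i \<noteq> 0}" by auto
        fix i assume "i \<in> {i. i \<in> W \<and> ?z i \<noteq> 0}"
        then have "?z i = z i" by (intro zz(3)) (use pq in blast)+
        then show "cpow (z i) (fst (e i)) (snd (e i)) = cpow (?z i) (fst (e i)) (snd (e i))" by simp
      qed
      then show ?thesis using eq[OF z(4) True] hh by simp
    next
      case False
      then have "h (prj p q z) e = 0" "h' (prj p q ?z) e = 0"
        using sh[of "prj p q z"] sh'[of "prj p q ?z"] by (auto simp: supp_def)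
      then show ?thesis by simp
    qed
    then have "(\<lambda>e. h (prj p q z) e * mon z e) = (\<lambda>e. h' (prj p q ?z) e * mon ?z e)" by (rule ext)
    with 1 have "((\<lambda>e. h' (prj p q ?z) e * mon ?z e) has_sum \<phi> z) UNIV" by (simp only:)
    then show ?thesis using 2 by (rule has_sum_unique)
  qed
  moreover have "0 < min e1 e2" using e1(1) e2(1) by simp
  ultimately show ?thesis by blast
qed

end

section \<open>The three limiting regions\<close>

text \<open>In all three regions a smaller \<rho> means a smaller region. The conditions with the
  factor 2 order the formal variables among themselves and leave the two retained points
  free.\<close>

definition sm12 :: "real \<Rightarrow> (nat \<Rightarrow> complex) \<Rightarrow> bool" where
  "sm12 \<rho> z \<longleftrightarrow> 0 < norm (z 3) \<and> norm (z 3) < \<rho> \<and> 0 < norm (z 4) \<and> 2 * norm (z 4) < norm (z 3)"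

definition sm34 :: "real \<Rightarrow> (nat \<Rightarrow> complex) \<Rightarrow> bool" where
  "sm34 \<rho> z \<longleftrightarrow> 1 / \<rho> < norm (z 2) \<and> 2 * norm (z 2) < norm (z 1)"

definition sm23 :: "real \<Rightarrow> (nat \<Rightarrow> complex) \<Rightarrow> bool" where
  "sm23 \<rho> z \<longleftrightarrow> z 4 = 0 \<and> 1 / \<rho> < norm (z 1)"

text \<open>Logarithms of moduli varying by less than 1/2 change the moduli by less than a factor 2,
  which is the tolerance built into the boxes below.\<close>

lemma exp_half: "\<bar>t\<bar> < 1 / 2 \<Longrightarrow> 1 / 2 < exp t \<and> exp t < (2 :: real)"
proof -
  assume t: "\<bar>t\<bar> < 1 / 2"
  have 1: "1 / 2 < exp s" if "\<bar>s\<bar> < 1 / 2" for s :: real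
    using exp_ge_add_one_self[of s] that by linarith
  have "1 / 2 < exp (- t)" using t by (intro 1) simp
  then have "1 / 2 < inverse (exp t)" by (simp add: exp_minus)
  then have "inverse (inverse (exp t)) < inverse (1 / 2)" by (intro less_imp_inverse_less) auto
  then show ?thesis using 1[OF t] by simp
qed

lemma norm_box:
  assumes "\<bar>t\<bar> < 1 / 2" "z = of_real c * exp (complex_of_real t + \<i> * complex_of_real \<theta>)" "c > 0"
  shows "c / 2 < norm z" "norm z < 2 * c"
proof -
  have n: "norm z = c * exp t" using assms(2,3) by (simp add: norm_mult)
  have "c * (1 / 2) < c * exp t" "c * exp t < c * 2"
    using exp_half[OF assms(1)] assms(3) by (intro mult_strict_left_mono; simp)+
  then show "c / 2 < norm z" "norm z < 2 * c" by (simp_all add: n mult.commute)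
qed

lemma inverse_mono_bound: "0 < \<rho> \<Longrightarrow> \<rho> \<le> \<rho>' \<Longrightarrow> 1 / \<rho> < x \<Longrightarrow> 1 / \<rho>' < (x :: real)"
  using frac_le[of 1 1 \<rho> \<rho>'] by linarith

lemma extreme_12: "extreme_region 1 2 {3, 4} sm12"
proof
  fix \<rho> :: real assume \<rho>: "0 < \<rho>"
  \<comment> \<open>A factor 8 apart: with tolerance 2 on either side, |z4| < \<rho> / 16 and \<rho>
    / 8 < |z3| < \<rho> / 2.\<close>
  let ?\<zeta> = "\<lambda>i :: nat. complex_of_real (if i = 3 then \<rho> / 4 else \<rho> / 32)"
  have "sm12 \<rho> z" if z: "\<forall>i\<in>{3, 4}. \<exists>t \<theta>. \<bar>t\<bar> < 1 / 2 \<and> z i = ?\<zeta> i * exp (complex_of_real t + \<i> * complex_of_real \<theta>)" for z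
  proof -
    obtain t \<theta> where 3: "\<bar>t\<bar> < 1 / 2" "z 3 = ?\<zeta> 3 * exp (complex_of_real t + \<i> * complex_of_real \<theta>)" using z by blast
    have z3: "z 3 = complex_of_real (\<rho> / 4) * exp (complex_of_real t + \<i> * complex_of_real \<theta>)" using 3(2) by simp
    obtain t' \<theta>' where 4: "\<bar>t'\<bar> < 1 / 2" "z 4 = ?\<zeta> 4 * exp (complex_of_real t' + \<i> * complex_of_real \<theta>')" using z by blast
    have z4: "z 4 = complex_of_real (\<rho> / 32) * exp (complex_of_real t' + \<i> * complex_of_real \<theta>')" using 4(2) by simp
    have "\<rho> / 8 < norm (z 3)" "norm (z 3) < \<rho> / 2"
      using norm_box[OF 3(1) z3] \<rho> by simp_all
    moreover have "\<rho> / 64 < norm (z 4)" "norm (z 4) < \<rho> / 16"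
      using norm_box[OF 4(1) z4] \<rho> by simp_all
    ultimately show ?thesis using \<rho> unfolding sm12_def by linarith
  qed
  moreover have "\<forall>i\<in>{3, 4}. ?\<zeta> i \<noteq> 0" using \<rho> by simp
  ultimately show "\<exists>\<zeta> \<eta>. 0 < \<eta> \<and> (\<forall>i\<in>{3, 4}. \<zeta> i \<noteq> 0) \<and>
       (\<forall>z. (\<forall>i\<in>{3, 4}. \<exists>t \<theta>. \<bar>t\<bar> < \<eta> \<and> z i = \<zeta> i * exp (complex_of_real t + \<i> * complex_of_real \<theta>)) \<and>
         (\<forall>i. i \<notin> {3, 4} \<and> i \<noteq> 1 \<and> i \<noteq> 2 \<longrightarrow> z i = 0) \<longrightarrow> sm12 \<rho> z)"
    by (intro exI[of _ ?\<zeta>] exI[of _ "1 / 2"]) simp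
qed (auto simp: sm12_def)

lemma extreme_34: "extreme_region 3 4 {1, 2} sm34"
proof
  fix \<rho> :: real assume \<rho>: "0 < \<rho>"
  define r where "r = 1 / \<rho>"
  have r: "r > 0" using \<rho> by (simp add: r_def)
  \<comment> \<open>A factor 16 apart: |z1| > 32 r, while |z2| lies between 2 r and 8 r.\<close>
  let ?\<zeta> = "\<lambda>i :: nat. complex_of_real (if i = 1 then 64 * r else 4 * r)"
  have "sm34 \<rho> z" if z: "\<forall>i\<in>{1, 2}. \<exists>t \<theta>. \<bar>t\<bar> < 1 / 2 \<and> z i = ?\<zeta> i * exp (complex_of_real t + \<i> * complex_of_real \<theta>)" for z
  proof -
    obtain t \<theta> where 3: "\<bar>t\<bar> < 1 / 2" "z 1 = ?\<zeta> 1 * exp (complex_of_real t + \<i> * complex_of_real \<theta>)" using z by blast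
    have z3: "z 1 = complex_of_real (64 * r) * exp (complex_of_real t + \<i> * complex_of_real \<theta>)" using 3(2) by simp
    obtain t' \<theta>' where 4: "\<bar>t'\<bar> < 1 / 2" "z 2 = ?\<zeta> 2 * exp (complex_of_real t' + \<i> * complex_of_real \<theta>')" using z by blast
    have z4: "z 2 = complex_of_real (4 * r) * exp (complex_of_real t' + \<i> * complex_of_real \<theta>')" using 4(2) by simp
    have "32 * r < norm (z 1)"
      using norm_box[OF 3(1) z3] r by simp
    moreover have "2 * r < norm (z 2)" "norm (z 2) < 8 * r"
      using norm_box[OF 4(1) z4] r by simp_all
    ultimately show ?thesis using r unfolding sm34_def r_def[symmetric] by linarith
  qed
  moreover have "\<forall>i\<in>{1, 2}. ?\<zeta> i \<noteq> 0" using r by simp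
  ultimately show "\<exists>\<zeta> \<eta>. 0 < \<eta> \<and> (\<forall>i\<in>{1, 2}. \<zeta> i \<noteq> 0) \<and>
       (\<forall>z. (\<forall>i\<in>{1, 2}. \<exists>t \<theta>. \<bar>t\<bar> < \<eta> \<and> z i = \<zeta> i * exp (complex_of_real t + \<i> * complex_of_real \<theta>)) \<and>
         (\<forall>i. i \<notin> {1, 2} \<and> i \<noteq> 3 \<and> i \<noteq> 4 \<longrightarrow> z i = 0) \<longrightarrow> sm34 \<rho> z)"
    by (intro exI[of _ ?\<zeta>] exI[of _ "1 / 2"]) simp
qed (auto simp: sm34_def intro: inverse_mono_bound)

lemma extreme_23: "extreme_region 2 3 {1} sm23"
proof
  fix \<rho> :: real assume \<rho>: "0 < \<rho>"
  define r where "r = 1 / \<rho>"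
  have r: "r > 0" using \<rho> by (simp add: r_def)
  let ?\<zeta> = "\<lambda>i :: nat. complex_of_real (4 * r)"
  have "sm23 \<rho> z" if z: "\<forall>i\<in>{1}. \<exists>t \<theta>. \<bar>t\<bar> < 1 / 2 \<and> z i = ?\<zeta> i * exp (complex_of_real t + \<i> * complex_of_real \<theta>)"
     "\<forall>i. i \<notin> {1} \<and> i \<noteq> 2 \<and> i \<noteq> 3 \<longrightarrow> z i = 0" for z
  proof -
    obtain t \<theta> where 3: "\<bar>t\<bar> < 1 / 2" "z 1 = ?\<zeta> 1 * exp (complex_of_real t + \<i> * complex_of_real \<theta>)" using z(1) by blast
    have z3: "z 1 = complex_of_real (4 * r) * exp (complex_of_real t + \<i> * complex_of_real \<theta>)" using 3(2) by simp
    have "2 * r < norm (z 1)"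
      using norm_box[OF 3(1) z3] r by simp
    then show ?thesis using r z(2) unfolding sm23_def r_def[symmetric] by simp
  qed
  moreover have "\<forall>i\<in>{1}. ?\<zeta> i \<noteq> 0" using r by simp
  ultimately show "\<exists>\<zeta> \<eta>. 0 < \<eta> \<and> (\<forall>i\<in>{1}. \<zeta> i \<noteq> 0) \<and>
       (\<forall>z. (\<forall>i\<in>{1}. \<exists>t \<theta>. \<bar>t\<bar> < \<eta> \<and> z i = \<zeta> i * exp (complex_of_real t + \<i> * complex_of_real \<theta>)) \<and>
         (\<forall>i. i \<notin> {1} \<and> i \<noteq> 2 \<and> i \<noteq> 3 \<longrightarrow> z i = 0) \<longrightarrow> sm23 \<rho> z)"
    by (intro exI[of _ ?\<zeta>] exI[of _ "1 / 2"]) simp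
qed (auto simp: sm23_def intro: inverse_mono_bound)

lemma emb_prj_linear:
  "emb p q (\<lambda>i. v i + complex_of_real t * d i) = (\<lambda>i. emb p q v i + complex_of_real t * emb p q d i)"
  by (auto simp: emb_def)

lemma norm_near:
  fixes x y :: complex
  assumes "norm (x - y) < \<epsilon>"
  shows "norm y - \<epsilon> < norm x" "norm x < norm y + \<epsilon>"
  using norm_triangle_ineq2[of x y] norm_triangle_ineq3[of x y] assms by linarith+

lemma norm_diff_near:
  fixes x y x' y' :: complex
  assumes "norm (x - x') < \<epsilon>" "norm (y - y') < \<epsilon>"
  shows "norm (x' - y') - 2 * \<epsilon> < norm (x - y)" "norm (x - y) < norm (x' - y') + 2 * \<epsilon>"
proof -
  have "norm ((x - y) - (x' - y')) \<le> norm (x - x') + norm (y - y')"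
    using norm_triangle_ineq4[of "x - x'" "y - y'"] by (simp add: algebra_simps)
  then have "norm ((x - y) - (x' - y')) < 2 * \<epsilon>" using assms by linarith
  from norm_near[OF this] show "norm (x' - y') - 2 * \<epsilon> < norm (x - y)" "norm (x - y) < norm (x' - y') + 2 * \<epsilon>" .
qed

section \<open>Partial expansions for the three pairs\<close>

lemma partial_expansion_12:
  assumes "expand_1234 \<phi> A"
  shows "\<exists>h. partial_expansion 1 2 {3, 4} sm12 \<phi> h"
proof -
  from phi_expansion[OF xi_ok_12 assms]
  obtain N where N: "\<forall>z. supp (N z) \<subseteq> expos ({1..4} - {1, 2})" "\<forall>z z'. (\<forall>i\<in>{1, 2}. z i = z' i) \<longrightarrow> N z = N z'"
     "\<forall>z e. (\<forall>i j. (i, j) \<in> set pairs4 \<longrightarrow> i \<in> {1, 2} \<longrightarrow> (if j \<in> {1, 2} then z i \<noteq> z j else z i \<noteq> 0)) \<longrightarrow> la (\<lambda>z. N z e) z"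
     "\<exists>\<epsilon>>0. \<forall>z. reg4 {1, 2} z \<longrightarrow> 16 * leadL {1, 2} z < \<epsilon> \<longrightarrow> ((\<lambda>e. N z e * mon z e) has_sum \<phi> z) UNIV"
    by (elim exE conjE) (rule that; (assumption | (rule exI, rule conjI; assumption)))
  from N(4) obtain \<epsilon>0 where e0: "\<epsilon>0 > 0" "\<forall>z. reg4 {1, 2} z \<longrightarrow> 16 * leadL {1, 2} z < \<epsilon>0 \<longrightarrow> ((\<lambda>e. N z e * mon z e) has_sum \<phi> z) UNIV"
    by (elim exE conjE) (rule that; assumption)
  define h where "h = (\<lambda>v. N (emb 1 2 v))"
  have s: "{1..4} - {1, 2} = {3, 4 :: nat}" by auto
  have "partial_expansion 1 2 {3, 4} sm12 \<phi> h"
    unfolding partial_expansion_def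
  proof (intro conjI allI ballI impI)
    show "supp (h v) \<subseteq> expos {3, 4}" for v using spec[OF N(1), of "emb 1 2 v"] unfolding h_def s .
    show "h v = h v'" if "v 1 = v' 1 \<and> v 2 = v' 2" for v v'
      unfolding h_def by (rule mp[OF spec[OF spec[OF N(2)]]]) (use that in \<open>simp add: emb_def\<close>)
    show "la (\<lambda>v. h v e) v" if "v \<in> Y2f" for v e
      unfolding h_def
    proof (rule la_linear[where T = "emb 1 2" and g = "\<lambda>z. N z e" and L = "emb 1 2"])
      show "la (\<lambda>z. N z e) (emb 1 2 v)"
        by (rule mp[OF spec[OF spec[OF N(3)]]]) (use that in \<open>auto simp: pairs4_def emb_def Y2f_def\<close>)
    qed (rule emb_prj_linear)
  next
    fix v assume v: "v \<in> Y2f"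
    define a where "a = norm (v 1)"
    define b where "b = norm (v 2)"
    define D where "D = norm (v 1 - v 2)"
    have abD: "a > 0" "b > 0" "D > 0" using v by (auto simp: a_def b_def D_def Y2f_def)
    \<comment> \<open>The leading size of the cross ratio is |z1 - z2| |z3| / (|z1| |z2|), which
      near v is below 2 D K / (a b / 4); K makes 16 times this bound equal to \<epsilon>0.\<close>
    define K where "K = \<epsilon>0 * (a * b) / (128 * D)"
    have K: "K > 0" using abD e0(1) by (simp add: K_def)
    define \<epsilon> where "\<epsilon> = min (min (a / 4) (b / 4)) (min (D / 4) K)"
    have e: "\<epsilon> > 0" "\<epsilon> \<le> a / 4" "\<epsilon> \<le> b / 4" "\<epsilon> \<le> D / 4" "\<epsilon> \<le> K" using abD K by (simp_all add: \<epsilon>_def)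
    have "((\<lambda>e. h (prj 1 2 z) e * mon z e) has_sum \<phi> z) UNIV"
      if z: "norm (z 1 - v 1) < \<epsilon>" "norm (z 2 - v 2) < \<epsilon>" "sm12 \<epsilon> z" for z
    proof -
      have z34: "0 < norm (z 3)" "norm (z 3) < \<epsilon>" "0 < norm (z 4)" "2 * norm (z 4) < norm (z 3)"
        using z(3) by (simp_all add: sm12_def)
      have n1: "a / 2 < norm (z 1)" using norm_near(1)[OF z(1)] e(2) abD(1) unfolding a_def[symmetric] by linarith
      have n2: "b / 2 < norm (z 2)" using norm_near(1)[OF z(2)] e(3) abD(2) unfolding b_def[symmetric] by linarith
      have n12: "0 < norm (z 1 - z 2)" using norm_diff_near(1)[OF z(1,2)] e(4) abD(3) unfolding D_def[symmetric] by linarith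
      have n12': "norm (z 1 - z 2) \<le> 2 * D" using norm_diff_near(2)[OF z(1,2)] e(4) abD(3) unfolding D_def[symmetric] by linarith
      have le: "2 * norm (z 3) \<le> norm (z 1)" "2 * norm (z 3) \<le> norm (z 2)"
         "2 * norm (z 4) \<le> norm (z 1)" "2 * norm (z 4) \<le> norm (z 2)" "2 * norm (z 4) \<le> norm (z 3)"
        using z34 n1 n2 e abD by simp_all
      have pos: "norm (z 1) > 0" "norm (z 2) > 0" using n1 n2 abD by linarith+
      have ne: "z 1 \<noteq> 0" "z 2 \<noteq> 0" "z 3 \<noteq> 0" "z 4 \<noteq> 0" "z 1 \<noteq> z 2" using pos z34 n12 by auto
      have reg: "reg4 {1, 2} z" using le ne by (simp add: reg4_def pairs4_def reg_pair_def)
      have "16 * (norm (z 1 - z 2) * norm (z 3)) \<le> 16 * ((2 * D) * K)"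
        using n12' z34(2) e(5) abD(3) by (intro mult_left_mono mult_mono) auto
      also have "\<dots> = \<epsilon>0 * ((a / 2) * (b / 2))" using abD by (simp add: K_def)
      also have "\<dots> < \<epsilon>0 * (norm (z 1) * norm (z 2))"
        using n1 n2 abD e0(1) by (intro mult_strict_left_mono mult_strict_mono) auto
      finally have "16 * (norm (z 1 - z 2) * norm (z 3)) / (norm (z 1) * norm (z 2)) < \<epsilon>0"
        using pos by (simp add: pos_divide_less_eq)
      then have "16 * leadL {1, 2} z < \<epsilon>0" by (simp add: leadL_def lead_def)
      with reg e0(2) have "((\<lambda>e. N z e * mon z e) has_sum \<phi> z) UNIV" by simp
      moreover have "N z = h (prj 1 2 z)"
        unfolding h_def by (rule mp[OF spec[OF spec[OF N(2)]]]) (simp add: emb_def prj_def)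
      ultimately show ?thesis by simp
    qed
    then show "\<exists>\<epsilon>>0. \<forall>z. norm (z 1 - v 1) < \<epsilon> \<and> norm (z 2 - v 2) < \<epsilon> \<and> sm12 \<epsilon> z \<longrightarrow>
        ((\<lambda>e. h (prj 1 2 z) e * mon z e) has_sum \<phi> z) UNIV"
      using e(1) by (intro exI[of _ \<epsilon>]) simp
  qed
  then show ?thesis by (intro exI[of _ h])
qed

lemma partial_expansion_34:
  assumes "expand_1234 \<phi> A"
  shows "\<exists>h. partial_expansion 3 4 {1, 2} sm34 \<phi> h"
proof -
  from phi_expansion[OF xi_ok_34 assms]
  obtain N where N: "\<forall>z. supp (N z) \<subseteq> expos ({1..4} - {3, 4})" "\<forall>z z'. (\<forall>i\<in>{3, 4}. z i = z' i) \<longrightarrow> N z = N z'"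
     "\<forall>z e. (\<forall>i j. (i, j) \<in> set pairs4 \<longrightarrow> i \<in> {3, 4} \<longrightarrow> (if j \<in> {3, 4} then z i \<noteq> z j else z i \<noteq> 0)) \<longrightarrow> la (\<lambda>z. N z e) z"
     "\<exists>\<epsilon>>0. \<forall>z. reg4 {3, 4} z \<longrightarrow> 16 * leadL {3, 4} z < \<epsilon> \<longrightarrow> ((\<lambda>e. N z e * mon z e) has_sum \<phi> z) UNIV"
    by (elim exE conjE) (rule that; (assumption | (rule exI, rule conjI; assumption)))
  from N(4) obtain \<epsilon>0 where e0: "\<epsilon>0 > 0" "\<forall>z. reg4 {3, 4} z \<longrightarrow> 16 * leadL {3, 4} z < \<epsilon>0 \<longrightarrow> ((\<lambda>e. N z e * mon z e) has_sum \<phi> z) UNIV"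
    by (elim exE conjE) (rule that; assumption)
  define h where "h = (\<lambda>v. N (emb 3 4 v))"
  have s: "{1..4} - {3, 4} = {1, 2 :: nat}" by auto
  have "partial_expansion 3 4 {1, 2} sm34 \<phi> h"
    unfolding partial_expansion_def
  proof (intro conjI allI ballI impI)
    show "supp (h v) \<subseteq> expos {1, 2}" for v using spec[OF N(1), of "emb 3 4 v"] unfolding h_def s .
    show "h v = h v'" if "v 1 = v' 1 \<and> v 2 = v' 2" for v v'
      unfolding h_def by (rule mp[OF spec[OF spec[OF N(2)]]]) (use that in \<open>simp add: emb_def\<close>)
    show "la (\<lambda>v. h v e) v" if "v \<in> Y2f" for v e
      unfolding h_def
    proof (rule la_linear[where T = "emb 3 4" and g = "\<lambda>z. N z e" and L = "emb 3 4"])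
      show "la (\<lambda>z. N z e) (emb 3 4 v)"
        by (rule mp[OF spec[OF spec[OF N(3)]]]) (use that in \<open>auto simp: pairs4_def emb_def Y2f_def\<close>)
    qed (rule emb_prj_linear)
  next
    fix v assume v: "v \<in> Y2f"
    define a where "a = norm (v 1)"
    define b where "b = norm (v 2)"
    define D where "D = norm (v 1 - v 2)"
    have abD: "a > 0" "b > 0" "D > 0" using v by (auto simp: a_def b_def D_def Y2f_def)
    \<comment> \<open>Here the leading size is |z3 - z4| / |z2| \<le> 2 D / |z2|, so |z2| > K pushes
      16 times it below \<epsilon>0.\<close>
    define K where "K = 32 * D / \<epsilon>0"
    have K: "K > 0" using abD e0(1) by (simp add: K_def)
    define C where "C = 4 * a + 4 * b + K"
    have C: "C > 0" "4 * a \<le> C" "4 * b \<le> C" "K \<le> C" using abD K by (simp_all add: C_def)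
    define \<epsilon> where "\<epsilon> = min (min a b) (min (D / 4) (1 / C))"
    have e: "\<epsilon> > 0" "\<epsilon> \<le> a" "\<epsilon> \<le> b" "\<epsilon> \<le> D / 4" "\<epsilon> \<le> 1 / C" using abD C by (simp_all add: \<epsilon>_def)
    have Ce: "C \<le> 1 / \<epsilon>" using e(1,5) C(1) by (simp add: field_simps)
    have "((\<lambda>e. h (prj 3 4 z) e * mon z e) has_sum \<phi> z) UNIV"
      if z: "norm (z 3 - v 1) < \<epsilon>" "norm (z 4 - v 2) < \<epsilon>" "sm34 \<epsilon> z" for z
    proof -
      have z12: "C < norm (z 2)" "2 * norm (z 2) < norm (z 1)" using z(3) Ce by (simp_all add: sm34_def)
      have n3: "norm (z 3) < 2 * a" using norm_near(2)[OF z(1)] e(2) unfolding a_def[symmetric] by linarith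
      have n4: "norm (z 4) < 2 * b" using norm_near(2)[OF z(2)] e(3) unfolding b_def[symmetric] by linarith
      have n34: "0 < norm (z 3 - z 4)" using norm_diff_near(1)[OF z(1,2)] e(4) abD(3) unfolding D_def[symmetric] by linarith
      have n34': "norm (z 3 - z 4) \<le> 2 * D" using norm_diff_near(2)[OF z(1,2)] e(4) abD(3) unfolding D_def[symmetric] by linarith
      have pos: "norm (z 2) > 0" "norm (z 1) > 0" using z12 C(1) by linarith+
      have le: "2 * norm (z 3) \<le> norm (z 1)" "2 * norm (z 3) \<le> norm (z 2)"
         "2 * norm (z 4) \<le> norm (z 1)" "2 * norm (z 4) \<le> norm (z 2)" "2 * norm (z 2) \<le> norm (z 1)"
        using z12 n3 n4 C(2,3) pos by linarith+
      have ne: "z 1 \<noteq> 0" "z 2 \<noteq> 0" "z 3 \<noteq> z 4" using pos n34 by auto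
      have reg: "reg4 {3, 4} z" using le ne by (simp add: reg4_def pairs4_def reg_pair_def)
      have "K < norm (z 2)" using C(4) z12(1) by linarith
      then have "32 * D < \<epsilon>0 * norm (z 2)" using e0(1) by (simp add: K_def pos_divide_less_eq mult.commute)
      then have "16 * norm (z 3 - z 4) < \<epsilon>0 * norm (z 2)" using n34' by linarith
      then have "16 * norm (z 3 - z 4) / norm (z 2) < \<epsilon>0" using pos by (simp add: pos_divide_less_eq)
      then have "16 * leadL {3, 4} z < \<epsilon>0" using ne by (simp add: leadL_def lead_def)
      with reg e0(2) have "((\<lambda>e. N z e * mon z e) has_sum \<phi> z) UNIV" by simp
      moreover have "N z = h (prj 3 4 z)"
        unfolding h_def by (rule mp[OF spec[OF spec[OF N(2)]]]) (simp add: emb_def prj_def)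
      ultimately show ?thesis by simp
    qed
    then show "\<exists>\<epsilon>>0. \<forall>z. norm (z 3 - v 1) < \<epsilon> \<and> norm (z 4 - v 2) < \<epsilon> \<and> sm34 \<epsilon> z \<longrightarrow>
        ((\<lambda>e. h (prj 3 4 z) e * mon z e) has_sum \<phi> z) UNIV"
      using e(1) by (intro exI[of _ \<epsilon>]) simp
  qed
  then show ?thesis by (intro exI[of _ h])
qed

lemma partial_expansion_23:
  assumes "expand_1234 \<phi> A"
  shows "\<exists>h. partial_expansion 2 3 {1} sm23 \<phi> h"
proof -
  from phi_expansion_23[OF assms]
  obtain N where N: "\<forall>z. supp (N z) \<subseteq> expos {1}" "\<forall>z z'. (\<forall>i\<in>{2, 3, 4}. z i = z' i) \<longrightarrow> N z = N z'"
     "\<forall>z e. z 2 \<noteq> 0 \<and> z 3 \<noteq> 0 \<and> z 2 \<noteq> z 3 \<and> z 4 = 0 \<longrightarrow> la (\<lambda>z. N z e) z"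
     "\<forall>x y. x \<noteq> 0 \<and> y \<noteq> 0 \<and> x \<noteq> y \<longrightarrow> (\<exists>\<epsilon>>0. \<forall>z. norm (z 2 - x) < \<epsilon> \<longrightarrow> norm (z 3 - y) < \<epsilon> \<longrightarrow> z 4 = 0 \<longrightarrow>
       1 / \<epsilon> < norm (z 1) \<longrightarrow> ((\<lambda>e. N z e * mon z e) has_sum \<phi> z) UNIV)"
    by (elim exE conjE) (rule that; (assumption | (rule exI, rule conjI; assumption)))
  define h where "h = (\<lambda>v. N (emb 2 3 v))"
  have "partial_expansion 2 3 {1} sm23 \<phi> h"
    unfolding partial_expansion_def
  proof (intro conjI allI ballI impI)
    show "supp (h v) \<subseteq> expos {1}" for v unfolding h_def by (rule spec[OF N(1)])
    show "h v = h v'" if "v 1 = v' 1 \<and> v 2 = v' 2" for v v'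
      unfolding h_def by (rule mp[OF spec[OF spec[OF N(2)]]]) (use that in \<open>simp add: emb_def\<close>)
    show "la (\<lambda>v. h v e) v" if "v \<in> Y2f" for v e
      unfolding h_def
    proof (rule la_linear[where T = "emb 2 3" and g = "\<lambda>z. N z e" and L = "emb 2 3"])
      show "la (\<lambda>z. N z e) (emb 2 3 v)"
        by (rule mp[OF spec[OF spec[OF N(3)]]]) (use that in \<open>auto simp: emb_def Y2f_def\<close>)
    qed (rule emb_prj_linear)
  next
    fix v assume v: "v \<in> Y2f"
    then have "v 1 \<noteq> 0 \<and> v 2 \<noteq> 0 \<and> v 1 \<noteq> v 2" by (simp add: Y2f_def)
    from mp[OF spec[OF spec[OF N(4)]] this]
    obtain \<epsilon> where e: "\<epsilon> > 0" "\<forall>z. norm (z 2 - v 1) < \<epsilon> \<longrightarrow> norm (z 3 - v 2) < \<epsilon> \<longrightarrow> z 4 = 0 \<longrightarrow>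
       1 / \<epsilon> < norm (z 1) \<longrightarrow> ((\<lambda>e. N z e * mon z e) has_sum \<phi> z) UNIV"
      by (elim exE conjE) (rule that; assumption)
    have "((\<lambda>e. h (prj 2 3 z) e * mon z e) has_sum \<phi> z) UNIV"
      if z: "norm (z 2 - v 1) < \<epsilon>" "norm (z 3 - v 2) < \<epsilon>" "sm23 \<epsilon> z" for z
    proof -
      have "z 4 = 0" "1 / \<epsilon> < norm (z 1)" using z(3) by (simp_all add: sm23_def)
      then have "((\<lambda>e. N z e * mon z e) has_sum \<phi> z) UNIV" using e(2) z(1,2) by simp
      moreover have "N z = h (prj 2 3 z)"
        unfolding h_def by (rule mp[OF spec[OF spec[OF N(2)]]]) (simp add: emb_def prj_def \<open>z 4 = 0\<close>)
      ultimately show ?thesis by simp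
    qed
    then show "\<exists>\<epsilon>>0. \<forall>z. norm (z 2 - v 1) < \<epsilon> \<and> norm (z 3 - v 2) < \<epsilon> \<and> sm23 \<epsilon> z \<longrightarrow>
        ((\<lambda>e. h (prj 2 3 z) e * mon z e) has_sum \<phi> z) UNIV"
      using e(1) by (intro exI[of _ \<epsilon>]) simp
  qed
  then show ?thesis by (intro exI[of _ h])
qed

section \<open>Complete expansions for the three pairs\<close>

text \<open>For X = {} the leading size of the cross ratio is |z3| / |z2|. This is the origin of the
  convergence condition that comes on top of the nesting of moduli.\<close>

lemma full_expansion:
  assumes "expand_1234 \<phi> A"
  obtains \<epsilon> where "\<epsilon> > 0" "\<And>z. reg4 {} z \<Longrightarrow> 16 * norm (z 3) < \<epsilon> * norm (z 2) \<Longrightarrow> ((\<lambda>e. A e * mon z e) has_sum \<phi> z) UNIV"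
    and "supp A \<subseteq> expos {1..4}"
proof -
  from phi_expansion[OF xi_ok_empty assms]
  obtain N where N: "\<forall>z. supp (N z) \<subseteq> expos ({1..4} - {})"
     "\<exists>\<epsilon>>0. \<forall>z. reg4 {} z \<longrightarrow> 16 * leadL {} z < \<epsilon> \<longrightarrow> ((\<lambda>e. N z e * mon z e) has_sum \<phi> z) UNIV"
     "{} = ({} :: nat set) \<longrightarrow> (\<forall>z. N z = A)"
    by (elim exE conjE) (rule that; (assumption | (rule exI, rule conjI; assumption)))
  have NA: "N z = A" for z using N(3) by simp
  from N(2) obtain \<epsilon> where e: "\<epsilon> > 0" "\<forall>z. reg4 {} z \<longrightarrow> 16 * leadL {} z < \<epsilon> \<longrightarrow> ((\<lambda>e. N z e * mon z e) has_sum \<phi> z) UNIV"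
    by (elim exE conjE) (rule that; assumption)
  show ?thesis
  proof (rule that[OF e(1)])
    fix z assume reg: "reg4 {} z" and s: "16 * norm (z 3) < \<epsilon> * norm (z 2)"
    have ne: "z 1 \<noteq> 0" "z 2 \<noteq> 0" using reg by (simp_all add: reg4_def pairs4_def reg_pair_def)
    have "16 * leadL {} z = 16 * norm (z 3) / norm (z 2)" using ne by (simp add: leadL_def lead_def)
    also have "\<dots> < \<epsilon>" using s ne by (simp add: pos_divide_less_eq)
    finally show "((\<lambda>e. A e * mon z e) has_sum \<phi> z) UNIV" using e(2) reg by (simp add: NA)
  qed (use N(1) in \<open>simp add: NA\<close>)
qed

lemma reg4_empty:
  assumes "0 < norm (z 4)" "2 * norm (z 4) \<le> norm (z 3)" "2 * norm (z 3) \<le> norm (z 2)" "2 * norm (z 2) \<le> norm (z 1)"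
  shows "reg4 {} z"
proof -
  have "0 < norm (z 3)" "0 < norm (z 2)" "0 < norm (z 1)" "2 * norm (z 4) \<le> norm (z 2)" "2 * norm (z 4) \<le> norm (z 1)"
    "2 * norm (z 3) \<le> norm (z 1)" using assms by linarith+
  then show ?thesis using assms by (simp add: reg4_def pairs4_def reg_pair_def, linarith)
qed

lemma total_expansion_12:
  assumes "expand_1234 \<phi> A"
  shows "total_expansion 1 2 sm12 \<phi> A"
  unfolding total_expansion_def
proof (rule exI[of _ "1 / 2"], intro conjI allI impI)
  obtain \<epsilon> where e: "\<epsilon> > 0" "\<And>z. reg4 {} z \<Longrightarrow> 16 * norm (z 3) < \<epsilon> * norm (z 2) \<Longrightarrow> ((\<lambda>e. A e * mon z e) has_sum \<phi> z) UNIV"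
    by (rule full_expansion[OF assms]) (rule that; assumption)
  fix v :: "nat \<Rightarrow> complex" assume v: "v 1 \<noteq> 0 \<and> v 2 \<noteq> 0 \<and> norm (v 2) < 1 / 2 * norm (v 1)"
  define b where "b = norm (v 2)"
  have b: "b > 0" using v by (simp add: b_def)
  show "\<exists>\<rho>>0. \<forall>z. z 1 = v 1 \<and> z 2 = v 2 \<and> sm12 \<rho> z \<longrightarrow> ((\<lambda>e. A e * mon z e) has_sum \<phi> z) UNIV"
  \<comment> \<open>The bound b / 2 nests z3 inside z2, and \<epsilon> b / 16 makes the cross ratio
    small.\<close>
  proof (rule exI[of _ "min (b / 2) (\<epsilon> * b / 16)"], intro conjI allI impI)
    show "min (b / 2) (\<epsilon> * b / 16) > 0" using b e(1) by simp
    fix z assume z: "z 1 = v 1 \<and> z 2 = v 2 \<and> sm12 (min (b / 2) (\<epsilon> * b / 16)) z"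
    then have z34: "norm (z 3) < b / 2" "16 * norm (z 3) < \<epsilon> * b" "0 < norm (z 4)" "2 * norm (z 4) < norm (z 3)"
      by (simp_all add: sm12_def)
    show "((\<lambda>e. A e * mon z e) has_sum \<phi> z) UNIV"
    proof (rule e(2))
      show "reg4 {} z" by (rule reg4_empty) (use z z34 v in \<open>simp_all add: b_def\<close>)
      show "16 * norm (z 3) < \<epsilon> * norm (z 2)" using z34 z by (simp add: b_def)
    qed
  qed
qed simp

lemma total_expansion_34:
  assumes "expand_1234 \<phi> A"
  shows "total_expansion 3 4 sm34 \<phi> A"
  unfolding total_expansion_def
proof (rule exI[of _ "1 / 2"], intro conjI allI impI)
  obtain \<epsilon> where e: "\<epsilon> > 0" "\<And>z. reg4 {} z \<Longrightarrow> 16 * norm (z 3) < \<epsilon> * norm (z 2) \<Longrightarrow> ((\<lambda>e. A e * mon z e) has_sum \<phi> z) UNIV"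
    by (rule full_expansion[OF assms]) (rule that; assumption)
  fix v :: "nat \<Rightarrow> complex" assume v: "v 1 \<noteq> 0 \<and> v 2 \<noteq> 0 \<and> norm (v 2) < 1 / 2 * norm (v 1)"
  define a where "a = norm (v 1)"
  define K where "K = 16 * a / \<epsilon>"
  have a: "a > 0" using v by (simp add: a_def)
  have K: "K > 0" using a e(1) by (simp add: K_def)
  show "\<exists>\<rho>>0. \<forall>z. z 3 = v 1 \<and> z 4 = v 2 \<and> sm34 \<rho> z \<longrightarrow> ((\<lambda>e. A e * mon z e) has_sum \<phi> z) UNIV"
  \<comment> \<open>In the lower bound 2 a + K for |z2|, the first summand nests z3 inside z2 and
    the second makes the cross ratio small.\<close>
  proof (rule exI[of _ "1 / (2 * a + K)"], intro conjI allI impI)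
    show "1 / (2 * a + K) > 0" using a K by simp
    fix z assume z: "z 3 = v 1 \<and> z 4 = v 2 \<and> sm34 (1 / (2 * a + K)) z"
    then have z12: "2 * a + K < norm (z 2)" "2 * norm (z 2) < norm (z 1)"
      by (simp_all add: sm34_def)
    have "K < norm (z 2)" using z12(1) a by linarith
    then have k: "16 * a < \<epsilon> * norm (z 2)" using e(1) by (simp add: K_def pos_divide_less_eq mult.commute)
    show "((\<lambda>e. A e * mon z e) has_sum \<phi> z) UNIV"
    proof (rule e(2))
      show "reg4 {} z" by (rule reg4_empty) (use z z12 v K in \<open>simp_all add: a_def\<close>)
      show "16 * norm (z 3) < \<epsilon> * norm (z 2)" using k z by (simp add: a_def)
    qed
  qed
qed simp

text \<open>The evaluation of A is available only at z4 \<noteq> 0. Letting z4 shrink to 0 along a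
  ray preserves the other conditions; of the non-negative integral powers of z4 only the constant
  one survives, and \<phi> is continuous along the ray up to z4 = 0 because it is analytic along
  lines.\<close>

lemma total_expansion_23:
  assumes ex: "expand_1234 \<phi> A" and C4: "\<phi> \<in> Cor4"
    and nat: "\<And>e. A e \<noteq> 0 \<Longrightarrow> fst (e 4) \<in> \<nat> \<and> snd (e 4) \<in> \<nat>"
  shows "total_expansion 2 3 sm23 \<phi> (\<lambda>e. if e 4 = 0 then A e else 0)"
proof -
  obtain \<epsilon> where e: "\<epsilon> > 0" "\<And>z. reg4 {} z \<Longrightarrow> 16 * norm (z 3) < \<epsilon> * norm (z 2) \<Longrightarrow> ((\<lambda>e. A e * mon z e) has_sum \<phi> z) UNIV"
    and sA: "supp A \<subseteq> expos {1..4}"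
    by (rule full_expansion[OF ex]) (rule that; assumption)
  have main: "((\<lambda>e. (if e 4 = 0 then A e else 0) * mon z e) has_sum \<phi> z) UNIV"
    if z: "z 4 = 0" "0 < norm (z 3)" "2 * norm (z 3) \<le> norm (z 2)" "2 * norm (z 2) \<le> norm (z 1)"
      "16 * norm (z 3) < \<epsilon> * norm (z 2)" for z
  proof -
    \<comment> \<open>Since |z3| = 4 c, the choice z4 = t c satisfies 2 |z4| \<le> |z3| for all t
      \<le> 1.\<close>
    define c where "c = norm (z 3) / 4"
    have c: "c > 0" using z(2) by (simp add: c_def)
    define d where "d = (\<lambda>i :: nat. if i = 4 then complex_of_real c else 0)"
    define y where "y = (\<lambda>(t :: real) i. z i + of_real t * d i)"
    have yi: "y t i = z i" if "i \<noteq> 4" for t i using that by (simp add: y_def d_def)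
    have y4: "y t 4 = of_real (t * c)" for t by (simp add: y_def d_def z(1))
    have pos: "0 < norm (z 2)" "0 < norm (z 1)" using z(2-4) by linarith+
    have zX: "z \<in> X4"
    proof -
      have "norm (z 1) \<noteq> norm (z 2)" "norm (z 1) \<noteq> norm (z 3)" "norm (z 2) \<noteq> norm (z 3)" using z(2-4) pos by linarith+
      then have "z 1 \<noteq> z 2" "z 1 \<noteq> z 3" "z 2 \<noteq> z 3" by auto
      moreover have "z 1 \<noteq> 0" "z 2 \<noteq> 0" "z 3 \<noteq> 0" using pos z(2) by auto
      ultimately show ?thesis by (simp add: X4_iff pairs4_def z(1))
    qed
    have k: "fst (e 4) + snd (e 4) = 0 \<or> 1 \<le> fst (e 4) + snd (e 4)" "fst (e 4) + snd (e 4) = 0 \<longleftrightarrow> e 4 = 0"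
      if Ae: "A e \<noteq> 0" for e
    proof -
      obtain m n where mn: "fst (e 4) = of_nat m" "snd (e 4) = of_nat n"
        using nat[OF Ae] by (auto elim!: Nats_cases)
      show "fst (e 4) + snd (e 4) = 0 \<or> 1 \<le> fst (e 4) + snd (e 4)" unfolding mn by (cases m; cases n) auto
      show "fst (e 4) + snd (e 4) = 0 \<longleftrightarrow> e 4 = 0" using mn by (auto simp: prod_eq_iff)
    qed
    have "((\<lambda>e. if fst (e 4) + snd (e 4) = 0 then A e * mon (y 1) e else 0) has_sum \<phi> z) UNIV"
    proof (rule has_sum_limit_0[where F = "\<lambda>t. \<phi> (y t)"])
      fix t :: real assume t: "0 < t" "t \<le> 1"
      have n4: "norm (y t 4) = t * c" using t c by (simp add: y4 norm_mult)
      have "t * c \<le> 1 * c" using t c by (intro mult_right_mono) auto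
      moreover have "norm (y t 3) = 4 * c" by (simp add: yi c_def)
      ultimately have "2 * norm (y t 4) \<le> norm (y t 3)" using c unfolding n4 by linarith
      moreover have "0 < norm (y t 4)" using n4 t c by simp
      ultimately have "reg4 {} (y t)" by (intro reg4_empty) (use z in \<open>simp_all add: yi\<close>)
      then have hs: "((\<lambda>e. A e * mon (y t) e) has_sum \<phi> (y t)) UNIV" by (rule e(2)) (use z(5) in \<open>simp add: yi\<close>)
      have "A e * mon (y t) e = A e * mon (y 1) e * of_real (t powr (fst (e 4) + snd (e 4)))" for e
      proof (cases "A e = 0")
        case False
        then have ee: "e \<in> expos {1..4}" using sA by (auto simp: supp_def)
        define u where "u = (\<lambda>i :: nat. if i = 4 then t else 1)"
        have y: "y t = (\<lambda>i. of_real (u i) * y 1 i)" by (auto simp: u_def y_def d_def z(1))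
        have "(\<Prod>i | i \<in> {1..4} \<and> y 1 i \<noteq> 0. u i powr (fst (e i) + snd (e i))) =
           (\<Prod>i\<in>{4}. u i powr (fst (e i) + snd (e i)))"
          by (rule prod.mono_neutral_right) (use c in \<open>auto simp: u_def y4\<close>)
        then have "mon (y t) e = mon (y 1) e * of_real (t powr (fst (e 4) + snd (e 4)))"
          unfolding y using mon_scale[OF ee, of u "y 1"] t(1) by (simp add: u_def)
        then show ?thesis by simp
      qed simp
      then have "(\<lambda>e. A e * mon (y t) e) = (\<lambda>e. A e * mon (y 1) e * of_real (t powr (fst (e 4) + snd (e 4))))"
        by (rule ext)
      then show "((\<lambda>e. A e * mon (y 1) e * of_real (t powr (fst (e 4) + snd (e 4)))) has_sum \<phi> (y t)) UNIV"
        using hs by (simp only:)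
    next
      fix e assume "A e * mon (y 1) e \<noteq> 0"
      then have "A e \<noteq> 0" by auto
      then show "fst (e 4) + snd (e 4) = 0 \<or> 1 \<le> fst (e 4) + snd (e 4)" by (rule k(1))
    next
      from Cor4_la[OF C4 zX, unfolded la_def, THEN spec, of d]
      obtain \<delta> H where H: "\<delta> > 0" "H holomorphic_on ball 0 \<delta>" "\<forall>t. \<bar>t\<bar> < \<delta> \<longrightarrow> \<phi> (\<lambda>i. z i + of_real t * d i) = H (of_real t)"
        by (elim exE conjE) (rule that; assumption)
      have H0: "\<phi> z = H 0" using H(3)[THEN spec, of 0] H(1) by (simp add: y_def)
      have "isCont H 0" using holomorphic_on_imp_continuous_on[OF H(2)] H(1)
        by (simp add: continuous_on_eq_continuous_at)
      then have "((\<lambda>t. H (of_real t)) \<longlongrightarrow> H (of_real 0)) (at_right (0 :: real))"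
        by (intro isCont_tendsto_compose[of _ H] tendsto_of_real tendsto_ident_at) simp
      moreover have "eventually (\<lambda>t. H (of_real t) = \<phi> (y t)) (at_right (0 :: real))"
        unfolding eventually_at_right_field using H(1,3) by (intro exI[of _ \<delta>]) (auto simp: y_def)
      ultimately show "((\<lambda>t. \<phi> (y t)) \<longlongrightarrow> \<phi> z) (at_right 0)"
        unfolding H0 by (simp add: tendsto_cong)
    qed
    moreover have "(if fst (e 4) + snd (e 4) = 0 then A e * mon (y 1) e else 0) = (if e 4 = 0 then A e else 0) * mon z e" for e
    proof (cases "A e \<noteq> 0 \<and> e 4 = 0")
      case True
      then have ee: "e \<in> expos {1..4}" using sA by (auto simp: supp_def)
      have "mon (y 1) e = mon z e"
      proof (rule mon_cong)
        fix i assume i: "i \<in> {1..4}" "e i \<noteq> 0"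
        then have "i \<noteq> 4" using True by auto
        then show "y 1 i = z i" by (rule yi)
        have "i = 1 \<or> i = 2 \<or> i = 3" using i(1) \<open>i \<noteq> 4\<close> by auto
        then show "y 1 i \<noteq> 0" using pos z(2) \<open>i \<noteq> 4\<close> by (auto simp: yi)
      qed
      then show ?thesis using True by simp
    next
      case False
      then show ?thesis using k(2)[of e] by auto
    qed
    ultimately show ?thesis by simp
  qed
  show ?thesis
    unfolding total_expansion_def
  proof (rule exI[of _ "min (1 / 2) (\<epsilon> / 16)"], intro conjI allI impI)
    show "min (1 / 2) (\<epsilon> / 16) > 0" using e(1) by simp
    fix v :: "nat \<Rightarrow> complex" assume v: "v 1 \<noteq> 0 \<and> v 2 \<noteq> 0 \<and> norm (v 2) < min (1 / 2) (\<epsilon> / 16) * norm (v 1)"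
    have "min (1 / 2) (\<epsilon> / 16) * norm (v 1) \<le> (1 / 2) * norm (v 1)" "min (1 / 2) (\<epsilon> / 16) * norm (v 1) \<le> (\<epsilon> / 16) * norm (v 1)"
      by (rule mult_right_mono; simp)+
    then have vv: "2 * norm (v 2) \<le> norm (v 1)" "16 * norm (v 2) < \<epsilon> * norm (v 1)" using v by linarith+
    show "\<exists>\<rho>>0. \<forall>z. z 2 = v 1 \<and> z 3 = v 2 \<and> sm23 \<rho> z \<longrightarrow> ((\<lambda>e. (if e 4 = 0 then A e else 0) * mon z e) has_sum \<phi> z) UNIV"
    proof (rule exI[of _ "1 / (2 * norm (v 1))"], intro conjI allI impI)
      show "1 / (2 * norm (v 1)) > 0" using v by simp
      fix z assume z: "z 2 = v 1 \<and> z 3 = v 2 \<and> sm23 (1 / (2 * norm (v 1))) z"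
      show "((\<lambda>e. (if e 4 = 0 then A e else 0) * mon z e) has_sum \<phi> z) UNIV"
        by (rule main) (use z v vv in \<open>simp_all add: sm23_def\<close>)
    qed
  qed
qed

section \<open>Exchanging two neighbouring points\<close>

text \<open>Both coefficients are values of the same \<mu>: the first through its expansion in |z1|
  > |z2|, the second through the one in |z2| > |z1| read in exchanged variables. The equality holds
  on all of \<open>Y2f\<close>, also where these expansions of \<mu> diverge.\<close>

lemma (in extreme_region) exchange:
  assumes pe: "partial_expansion p q W sm \<phi> h" "partial_expansion p q W sm \<phi>' h'"
    and te: "total_expansion p q sm \<phi> A" "total_expansion p q sm \<phi>' A'"
    and s: "supp A \<subseteq> expos ({p, q} \<union> W)" "supp A' \<subseteq> expos ({p, q} \<union> W)"
    and mu: "\<And>d. d \<in> expos W \<Longrightarrow> \<exists>\<mu> P P'. \<mu> \<in> GCor2 \<and> expand_12 \<mu> P \<and> expand_21 \<mu> P' \<and>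
       (\<forall>e\<in>expos {1, 2}. A (expo_add (emb p q e) d) = P e) \<and>
       (\<forall>e\<in>expos {1, 2}. A' (expo_add (emb p q e) d) = P' (emb 2 1 e))"
    and v: "v \<in> Y2f"
  shows "\<exists>\<epsilon>>0. \<forall>z. norm (z p - v 1) < \<epsilon> \<and> norm (z q - v 2) < \<epsilon> \<and> sm \<epsilon> z \<and> prj p q z \<in> Y2f \<longrightarrow>
     \<phi> z = \<phi>' (z \<circ> Transposition.transpose p q)"
proof (rule local_symmetry[OF pe _ v])
  fix v :: "nat \<Rightarrow> complex" and d assume v: "v \<in> Y2f" and d: "d \<in> expos W"
  obtain \<mu> P P' where m: "\<mu> \<in> GCor2" "expand_12 \<mu> P" "expand_21 \<mu> P'"
     "\<forall>e\<in>expos {1, 2}. A (expo_add (emb p q e) d) = P e"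
     "\<forall>e\<in>expos {1, 2}. A' (expo_add (emb p q e) d) = P' (emb 2 1 e)"
    using mu[OF d] by (elim exE conjE) (rule that; assumption)
  have v': "emb 2 1 v \<in> Y2f" using v by (auto simp: Y2f_def emb_def)
  have "h v d = \<mu> (v 1, v 2)"
    by (rule coefficient_eq_12[OF pe(1) te(1) s(1) d m(1,2) _ v]) (rule bspec[OF m(4)])
  moreover have "h' (emb 2 1 v) d = \<mu> ((emb 2 1 v) 2, (emb 2 1 v) 1)"
    by (rule coefficient_eq_21[OF pe(2) te(2) s(2) d m(1,3) _ v']) (rule bspec[OF m(5)])
  ultimately show "h v d = h' (emb 2 1 v) d" by (simp add: emb_def)
qed

section \<open>From a local identity to symmetry under a transposition\<close>

lemma X4_transpose:
  assumes "p \<in> {1..4}" "q \<in> {1..4}"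
  shows "z \<circ> Transposition.transpose p q \<in> X4 \<longleftrightarrow> z \<in> X4"
proof -
  have b: "bij_betw (Transposition.transpose p q) {1..4} {1..4}"
    using permutes_imp_bij[OF permutes_swap_id[OF assms]] .
  have "inj_on (z \<circ> Transposition.transpose p q) {1..4} \<longleftrightarrow> inj_on z (Transposition.transpose p q ` {1..4})"
    using comp_inj_on_iff[OF bij_betw_imp_inj_on[OF b]] by blast
  then show ?thesis using bij_betw_imp_surj_on[OF b] by (simp add: X4_def)
qed

text \<open>By translation invariance only directions that fix the fourth point have to be considered.\<close>
lemma transposition_identity:
  assumes C4: "\<phi> \<in> Cor4" "\<phi>' \<in> Cor4" and pq: "p \<in> {1..4}" "q \<in> {1..4}" and x0: "x0 \<in> X4"
    and near: "\<And>d. d 4 = 0 \<Longrightarrow> eventually (\<lambda>l. \<phi> (\<lambda>i. x0 i + l * d i) =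
        \<phi>' ((\<lambda>i. x0 i + l * d i) \<circ> Transposition.transpose p q)) (nhds 0)"
  shows "\<phi> z = \<phi>' (z \<circ> Transposition.transpose p q)"
proof (cases "z \<in> X4")
  case False
  then have "z \<circ> Transposition.transpose p q \<notin> X4" using X4_transpose[OF pq] by blast
  then have "\<phi>' (z \<circ> Transposition.transpose p q) = 0" by (rule Cor4_outside[OF C4(2)])
  then show ?thesis using Cor4_outside[OF C4(1) False] by (simp only:)
next
  case True
  let ?t = "Transposition.transpose p q"
  have "(\<lambda>z. \<phi> z - \<phi>' (z \<circ> ?t)) z = 0"
  proof (rule Cor4_identity[OF _ x0 True])
    fix z :: "nat \<Rightarrow> complex" assume z: "z \<in> X4"
    have "la \<phi>' (z \<circ> ?t)" by (rule Cor4_la[OF C4(2)]) (use z X4_transpose[OF pq] in blast)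
    then have "la (\<lambda>z. \<phi>' (z \<circ> ?t)) z"
      by (rule la_linear[where T = "\<lambda>z. z \<circ> ?t" and L = "\<lambda>z. z \<circ> ?t" and g = \<phi>']) (simp add: comp_def)
    then show "la (\<lambda>z. \<phi> z - \<phi>' (z \<circ> ?t)) z" by (rule la_diff[OF Cor4_la[OF C4(1) z]])
  next
    fix d :: "nat \<Rightarrow> complex"
    let ?z = "\<lambda>l i. x0 i + l * d i" and ?z' = "\<lambda>l i. x0 i + l * (d i - d 4)"
    have tr: "\<phi> (?z l) = \<phi> (?z' l)" "\<phi>' (?z l \<circ> ?t) = \<phi>' (?z' l \<circ> ?t)" for l
      using Cor4_translate[OF C4(1), of "?z' l" "l * d 4"] Cor4_translate[OF C4(2), of "?z' l \<circ> ?t" "l * d 4"]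
      by (simp_all add: algebra_simps comp_def)
    have "eventually (\<lambda>l. \<phi> (?z' l) = \<phi>' (?z' l \<circ> ?t)) (nhds 0)" by (rule near) simp
    then have "eventually (\<lambda>l. \<phi> (?z l) - \<phi>' (?z l \<circ> ?t) = 0) (nhds 0)" unfolding tr by simp
    then show "\<exists>\<epsilon>>0. \<forall>l. norm l < \<epsilon> \<longrightarrow> \<phi> (?z l) - \<phi>' (?z l \<circ> ?t) = 0"
      unfolding eventually_nhds_metric dist_norm diff_0_right .
  qed
  then show ?thesis by simp
qed

lemma eventually_less_line:
  assumes "(f \<longlongrightarrow> a) F" "(g \<longlongrightarrow> b) F" "a < (b :: real)"
  shows "eventually (\<lambda>l. f l < g l) F"
proof -
  have "((\<lambda>l. g l - f l) \<longlongrightarrow> b - a) F" by (intro tendsto_intros assms)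
  then have "eventually (\<lambda>l. 0 < g l - f l) F" by (rule order_tendstoD(1)) (use assms in simp)
  then show ?thesis by simp
qed

lemma line_tendsto:
  fixes x0 d :: "nat \<Rightarrow> complex"
  shows "((\<lambda>l. x0 i + l * d i) \<longlongrightarrow> x0 i) (nhds 0)"
proof -
  have "((\<lambda>l. x0 i + l * d i) \<longlongrightarrow> x0 i + 0 * d i) (nhds 0)"
    by (intro tendsto_intros filterlim_ident)
  then show ?thesis by simp
qed

lemma eventually_near_line:
  fixes x0 d v :: "nat \<Rightarrow> complex"
  assumes v: "v \<in> Y2f" and x: "x0 p = v 1" "x0 q = v 2" and e: "\<epsilon> > 0"
  shows "eventually (\<lambda>l. norm (x0 p + l * d p - v 1) < \<epsilon> \<and> norm (x0 q + l * d q - v 2) < \<epsilon> \<and>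
     prj p q (\<lambda>i. x0 i + l * d i) \<in> Y2f) (nhds 0)"
proof -
  note t = line_tendsto[of x0 _ d]
  have v': "v 1 \<noteq> 0" "v 2 \<noteq> 0" "v 1 \<noteq> v 2" using v by (simp_all add: Y2f_def)
  have 1: "eventually (\<lambda>l. norm (x0 i + l * d i - x0 i) < \<epsilon>) (nhds 0)" for i
    by (rule eventually_less_line[OF tendsto_norm[OF tendsto_diff[OF t tendsto_const]] tendsto_const]) (use e in simp)
  have 2: "eventually (\<lambda>l. x0 p + l * d p \<noteq> 0) (nhds 0)" "eventually (\<lambda>l. x0 q + l * d q \<noteq> 0) (nhds 0)"
    by (rule tendsto_imp_eventually_ne[OF t], use v' x in simp)+
  have 3: "eventually (\<lambda>l. (x0 p + l * d p) - (x0 q + l * d q) \<noteq> 0) (nhds 0)"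
    by (rule tendsto_imp_eventually_ne[OF tendsto_diff[OF t t]]) (use v' x in simp)
  show ?thesis
    using 1[of p] 1[of q] 2 3
    by eventually_elim (simp add: Y2f_def prj_def x)
qed

lemma X4_I:
  assumes "z 1 \<noteq> z 2" "z 1 \<noteq> z 3" "z 1 \<noteq> z 4" "z 2 \<noteq> z 3" "z 2 \<noteq> z 4" "z 3 \<noteq> z 4"
  shows "z \<in> X4"
  using assms by (simp add: X4_iff pairs4_def)

text \<open>Any point of \<open>Y2f\<close> would do, even this one with |v 1| < |v 2|, because the
  coefficients are identified on all of \<open>Y2f\<close>.\<close>

definition test_point :: "nat \<Rightarrow> complex" where
  "test_point = (\<lambda>i. if i = 1 then 1 else if i = 2 then 2 else 0)"

lemma test_point: "test_point \<in> Y2f" "test_point 1 = 1" "test_point 2 = 2"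
  by (simp_all add: test_point_def Y2f_def)

lemma symmetry_12:
  assumes C4: "\<phi> \<in> Cor4" "\<phi>' \<in> Cor4"
    and loc: "\<exists>\<epsilon>>0. \<forall>z. norm (z 1 - test_point 1) < \<epsilon> \<and> norm (z 2 - test_point 2) < \<epsilon> \<and> sm12 \<epsilon> z \<and> prj 1 2 z \<in> Y2f \<longrightarrow>
     \<phi> z = \<phi>' (z \<circ> Transposition.transpose 1 2)"
  shows "\<phi> z = \<phi>' (z \<circ> Transposition.transpose 1 2)"
proof -
  obtain \<epsilon> where e: "\<epsilon> > 0" "\<forall>z. norm (z 1 - test_point 1) < \<epsilon> \<and> norm (z 2 - test_point 2) < \<epsilon> \<and> sm12 \<epsilon> z \<and> prj 1 2 z \<in> Y2f \<longrightarrow>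
     \<phi> z = \<phi>' (z \<circ> Transposition.transpose 1 2)" using loc by (elim exE conjE) (rule that; assumption)
  \<comment> \<open>\<eta> < 1 keeps z3 and z4 away from the points 1 and 2. \<eta> < \<epsilon>
    places the base point strictly inside the region, so that all conditions persist for nearby
    points of every line.\<close>
  define \<eta> where "\<eta> = min (\<epsilon> / 2) (1 / 2)"
  have eta: "\<eta> > 0" "\<eta> < \<epsilon>" "\<eta> < 1" using e(1) by (auto simp: \<eta>_def)
  define x0 where "x0 = (\<lambda>i :: nat. if i = 1 then 1 else if i = 2 then 2 else if i = 3 then complex_of_real \<eta> else complex_of_real (\<eta> / 4))"
  have x: "x0 1 = 1" "x0 2 = 2" "x0 3 = complex_of_real \<eta>" "x0 4 = complex_of_real (\<eta> / 4)" by (simp_all add: x0_def)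
  have n: "norm (x0 3) = \<eta>" "norm (x0 4) = \<eta> / 4" unfolding x norm_of_real using eta by auto
  note t = line_tendsto[of x0]
  show ?thesis
  proof (rule transposition_identity[OF C4, where ?x0.0 = x0])
    have r: "complex_of_real a = complex_of_real b \<longleftrightarrow> a = b" for a b by (rule of_real_eq_iff)
    have o: "(1 :: complex) = of_real 1" "(2 :: complex) = of_real 2" by simp_all
    show "x0 \<in> X4" by (rule X4_I; unfold x o r) (use eta in auto)
    fix d :: "nat \<Rightarrow> complex" assume "d 4 = 0"
    have 1: "eventually (\<lambda>l. 0 < norm (x0 3 + l * d 3)) (nhds 0)"
      by (rule eventually_less_line[OF tendsto_const tendsto_norm[OF t]]) (use n eta in linarith)
    have 2: "eventually (\<lambda>l. 0 < norm (x0 4 + l * d 4)) (nhds 0)"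
      by (rule eventually_less_line[OF tendsto_const tendsto_norm[OF t]]) (use n eta in linarith)
    have 3: "eventually (\<lambda>l. norm (x0 3 + l * d 3) < \<epsilon>) (nhds 0)"
      by (rule eventually_less_line[OF tendsto_norm[OF t] tendsto_const]) (use n eta in linarith)
    have 4: "eventually (\<lambda>l. 2 * norm (x0 4 + l * d 4) < norm (x0 3 + l * d 3)) (nhds 0)"
      by (rule eventually_less_line[OF tendsto_mult[OF tendsto_const tendsto_norm[OF t]] tendsto_norm[OF t]]) (use n eta in linarith)
    have 5: "eventually (\<lambda>l. norm (x0 1 + l * d 1 - test_point 1) < \<epsilon> \<and> norm (x0 2 + l * d 2 - test_point 2) < \<epsilon> \<and>
       prj 1 2 (\<lambda>i. x0 i + l * d i) \<in> Y2f) (nhds 0)"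
      by (rule eventually_near_line[OF test_point(1) _ _ e(1)]) (simp_all only: x test_point)
    show "eventually (\<lambda>l. \<phi> (\<lambda>i. x0 i + l * d i) = \<phi>' ((\<lambda>i. x0 i + l * d i) \<circ> Transposition.transpose 1 2)) (nhds 0)"
      using 1 2 3 4 5
    proof eventually_elim
      case (elim l)
      show ?case by (rule mp[OF spec[OF e(2)]]) (use elim in \<open>simp add: sm12_def\<close>)
    qed
  qed simp_all
qed

lemma symmetry_34:
  assumes C4: "\<phi> \<in> Cor4" "\<phi>' \<in> Cor4"
    and loc: "\<exists>\<epsilon>>0. \<forall>z. norm (z 3 - test_point 1) < \<epsilon> \<and> norm (z 4 - test_point 2) < \<epsilon> \<and> sm34 \<epsilon> z \<and> prj 3 4 z \<in> Y2f \<longrightarrow>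
     \<phi> z = \<phi>' (z \<circ> Transposition.transpose 3 4)"
  shows "\<phi> z = \<phi>' (z \<circ> Transposition.transpose 3 4)"
proof -
  obtain \<epsilon> where e: "\<epsilon> > 0" "\<forall>z. norm (z 3 - test_point 1) < \<epsilon> \<and> norm (z 4 - test_point 2) < \<epsilon> \<and> sm34 \<epsilon> z \<and> prj 3 4 z \<in> Y2f \<longrightarrow>
     \<phi> z = \<phi>' (z \<circ> Transposition.transpose 3 4)" using loc by (elim exE conjE) (rule that; assumption)
  \<comment> \<open>M exceeds 1 / \<epsilon>, and being larger than 3 it also keeps z2 = M and z1 =
    4 M away from the points 1 and 2.\<close>
  define M where "M = 1 / \<epsilon> + 3"
  have "1 / \<epsilon> > 0" using e(1) by simp
  then have M: "M > 3" "1 / \<epsilon> < M" unfolding M_def by linarith+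
  define x0 where "x0 = (\<lambda>i :: nat. if i = 1 then complex_of_real (4 * M) else if i = 2 then complex_of_real M else if i = 3 then 1 else 2)"
  have x: "x0 1 = complex_of_real (4 * M)" "x0 2 = complex_of_real M" "x0 3 = 1" "x0 4 = 2" by (simp_all add: x0_def)
  have n: "norm (x0 1) = 4 * M" "norm (x0 2) = M" unfolding x norm_of_real using M by auto
  note t = line_tendsto[of x0]
  show ?thesis
  proof (rule transposition_identity[OF C4, where ?x0.0 = x0])
    have r: "complex_of_real a = complex_of_real b \<longleftrightarrow> a = b" for a b by (rule of_real_eq_iff)
    have o: "(1 :: complex) = of_real 1" "(2 :: complex) = of_real 2" by simp_all
    show "x0 \<in> X4" by (rule X4_I; unfold x o r) (use M in auto)
    fix d :: "nat \<Rightarrow> complex" assume "d 4 = 0"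
    have 1: "eventually (\<lambda>l. 1 / \<epsilon> < norm (x0 2 + l * d 2)) (nhds 0)"
      by (rule eventually_less_line[OF tendsto_const tendsto_norm[OF t]]) (use n M in linarith)
    have 2: "eventually (\<lambda>l. 2 * norm (x0 2 + l * d 2) < norm (x0 1 + l * d 1)) (nhds 0)"
      by (rule eventually_less_line[OF tendsto_mult[OF tendsto_const tendsto_norm[OF t]] tendsto_norm[OF t]]) (use n M in linarith)
    have 5: "eventually (\<lambda>l. norm (x0 3 + l * d 3 - test_point 1) < \<epsilon> \<and> norm (x0 4 + l * d 4 - test_point 2) < \<epsilon> \<and>
       prj 3 4 (\<lambda>i. x0 i + l * d i) \<in> Y2f) (nhds 0)"
      by (rule eventually_near_line[OF test_point(1) _ _ e(1)]) (simp_all only: x test_point)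
    show "eventually (\<lambda>l. \<phi> (\<lambda>i. x0 i + l * d i) = \<phi>' ((\<lambda>i. x0 i + l * d i) \<circ> Transposition.transpose 3 4)) (nhds 0)"
      using 1 2 5
    proof eventually_elim
      case (elim l)
      show ?case by (rule mp[OF spec[OF e(2)]]) (use elim in \<open>simp add: sm34_def\<close>)
    qed
  qed simp_all
qed

lemma symmetry_23:
  assumes C4: "\<phi> \<in> Cor4" "\<phi>' \<in> Cor4"
    and loc: "\<exists>\<epsilon>>0. \<forall>z. norm (z 2 - test_point 1) < \<epsilon> \<and> norm (z 3 - test_point 2) < \<epsilon> \<and> sm23 \<epsilon> z \<and> prj 2 3 z \<in> Y2f \<longrightarrow>
     \<phi> z = \<phi>' (z \<circ> Transposition.transpose 2 3)"
  shows "\<phi> z = \<phi>' (z \<circ> Transposition.transpose 2 3)"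
proof -
  obtain \<epsilon> where e: "\<epsilon> > 0" "\<forall>z. norm (z 2 - test_point 1) < \<epsilon> \<and> norm (z 3 - test_point 2) < \<epsilon> \<and> sm23 \<epsilon> z \<and> prj 2 3 z \<in> Y2f \<longrightarrow>
     \<phi> z = \<phi>' (z \<circ> Transposition.transpose 2 3)" using loc by (elim exE conjE) (rule that; assumption)
  define M where "M = 1 / \<epsilon> + 3"
  have "1 / \<epsilon> > 0" using e(1) by simp
  then have M: "M > 3" "1 / \<epsilon> < M" unfolding M_def by linarith+
  define x0 where "x0 = (\<lambda>i :: nat. if i = 1 then complex_of_real M else if i = 2 then 1 else if i = 3 then 2 else 0)"
  have x: "x0 1 = complex_of_real M" "x0 2 = 1" "x0 3 = 2" "x0 4 = 0" by (simp_all add: x0_def)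
  have n: "norm (x0 1) = M" unfolding x norm_of_real using M by auto
  note t = line_tendsto[of x0]
  show ?thesis
  proof (rule transposition_identity[OF C4, where ?x0.0 = x0])
    have r: "complex_of_real a = complex_of_real b \<longleftrightarrow> a = b" for a b by (rule of_real_eq_iff)
    have o: "(1 :: complex) = of_real 1" "(2 :: complex) = of_real 2" "(0 :: complex) = of_real 0" by simp_all
    show "x0 \<in> X4" by (rule X4_I; unfold x o r) (use M in auto)
    \<comment> \<open>The region prescribes z4 = 0 exactly and is not open; the reduction to
      directions with d 4 = 0 is made for this case.\<close>
    fix d :: "nat \<Rightarrow> complex" assume d4: "d 4 = 0"
    have 1: "eventually (\<lambda>l. 1 / \<epsilon> < norm (x0 1 + l * d 1)) (nhds 0)"
      by (rule eventually_less_line[OF tendsto_const tendsto_norm[OF t]]) (use n M in linarith)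
    have 5: "eventually (\<lambda>l. norm (x0 2 + l * d 2 - test_point 1) < \<epsilon> \<and> norm (x0 3 + l * d 3 - test_point 2) < \<epsilon> \<and>
       prj 2 3 (\<lambda>i. x0 i + l * d i) \<in> Y2f) (nhds 0)"
      by (rule eventually_near_line[OF test_point(1) _ _ e(1)]) (simp_all only: x test_point)
    show "eventually (\<lambda>l. \<phi> (\<lambda>i. x0 i + l * d i) = \<phi>' ((\<lambda>i. x0 i + l * d i) \<circ> Transposition.transpose 2 3)) (nhds 0)"
      using 1 5
    proof eventually_elim
      case (elim l)
      show ?case by (rule mp[OF spec[OF e(2)]]) (use elim d4 x(4) in \<open>simp add: sm23_def\<close>)
    qed
  qed simp_all
qed

section \<open>Total degrees of four-point expansions\<close>

definition total_degree :: "expo \<Rightarrow> real \<times> real" where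
  "total_degree e = (\<Sum>i\<in>{1..4}. e i)"

lemma total_expand: "total_degree e = e 1 + e 2 + e 3 + e 4"
proof -
  have "{1..4 :: nat} = {1, 2, 3, 4}" by auto
  then show ?thesis by (simp add: total_degree_def add.assoc)
qed

lemma binom_series_total:
  assumes "i \<in> {1..4}" "j \<in> {1..4}"
  shows "supp (binom_series i j \<epsilon> \<alpha> \<beta>) \<subseteq> {e. total_degree e = (\<alpha>, \<beta>)}"
proof -
  have t: "total_degree (pw i r s) = (r, s)" if "i \<in> {1..4}" for i r s
    unfolding total_degree_def pw_def zero_prod_def[symmetric] using that by simp
  have "total_degree (expo_add (pw i (\<alpha> - real m) (\<beta> - real n)) (pw j (real m) (real n))) = (\<alpha>, \<beta>)" for m n
    using t[OF assms(1)] t[OF assms(2)] by (simp add: total_degree_def expo_add_def sum.distrib)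
  then show ?thesis
    unfolding binom_series_def by (intro order.trans[OF formal_sum_supp]) auto
qed

lemma mult_total:
  assumes "supp A \<subseteq> {e. total_degree e = x}" "supp B \<subseteq> {e. total_degree e = y}"
  shows "supp (A \<odot> B) \<subseteq> {e. total_degree e = x + y}"
  using supp_mult[OF assms] by (auto simp: expo_plus_def total_degree_def expo_add_def sum.distrib)

lemma pairs_series_total:
  "\<exists>t. supp (pairs_series \<alpha> \<beta>) \<subseteq> {e. total_degree e = t} \<and>
     t = (\<alpha> 1 2 + \<alpha> 1 3 + \<alpha> 1 4 + \<alpha> 2 3 + \<alpha> 2 4 + \<alpha> 3 4, \<beta> 1 2 + \<beta> 1 3 + \<beta> 1 4 + \<beta> 2 3 + \<beta> 2 4 + \<beta> 3 4)"
proof -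
  have "supp (monomial (\<lambda>_. (0, 0))) \<subseteq> {e. total_degree e = 0}"
    unfolding supp_def monomial_def total_degree_def zero_prod_def[symmetric] by (auto split: if_splits)
  then have "supp (pairs_series \<alpha> \<beta>) \<subseteq> {e. total_degree e = (\<alpha> 1 2, \<beta> 1 2) + ((\<alpha> 1 3, \<beta> 1 3) + ((\<alpha> 1 4, \<beta> 1 4) +
      ((\<alpha> 2 3, \<beta> 2 3) + ((\<alpha> 2 4, \<beta> 2 4) + ((\<alpha> 3 4, \<beta> 3 4) + 0)))))}"
    unfolding pairs_series_def pairs4_def list.map prod.case foldr.simps comp_def id_def
    by (intro mult_total binom_series_total) simp_all
  then show ?thesis by (simp add: add.assoc)
qed

text \<open>The exponents in the cross ratio cancel, 1 + 1 - 1 - 1 = 0, so its powers have total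
  degree 0, and each generator is homogeneous of the degree of its prefactor. A finite combination
  thus involves finitely many total degrees.\<close>

lemma expand_1234_total:
  assumes "expand_1234 \<phi> A"
  obtains T where "finite T" "\<And>e. A e \<noteq> 0 \<Longrightarrow> total_degree e \<in> T"
proof -
  obtain n :: nat and c \<alpha> \<beta> J where d:
    "A = (\<lambda>e. \<Sum>k<n. c k * (pairs_series (\<alpha> k) (\<beta> k) \<odot> xi_subst_series (J k)) e)"
    by (rule expand_1234E[OF assms]) (rule that; assumption)
  have xi: "supp (xi_subst_series K) \<subseteq> {e. total_degree e = 0}" for K
  proof
    fix e assume "e \<in> supp (xi_subst_series K)"
    then have "(\<Sum>k | (case k of (r, s, e) \<Rightarrow> e) = e \<and> (case k of (r, s, e) \<Rightarrow> K r s * xi_pow_series r s e) \<noteq> 0.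
       case k of (r, s, e) \<Rightarrow> K r s * xi_pow_series r s e) \<noteq> 0"
      by (simp add: supp_def xi_subst_series_def formal_sum_def)
    then obtain r s where "xi_pow_series r s e \<noteq> 0" by (auto elim!: sum.not_neutral_contains_not_neutral)
    moreover have "supp (xi_pow_series r s) \<subseteq> {e. total_degree e = 0}"
      using pairs_series_total[of "\<lambda>i j. r * xi_exponent i j" "\<lambda>i j. s * xi_exponent i j"]
      by (simp add: xi_pow_series_def xi_exponent_def zero_prod_def)
    ultimately show "e \<in> {e. total_degree e = 0}" by (auto simp: supp_def)
  qed
  have "\<exists>t. supp (pairs_series (\<alpha> k) (\<beta> k) \<odot> xi_subst_series (J k)) \<subseteq> {e. total_degree e = t}" for k
  proof -
    obtain t where "supp (pairs_series (\<alpha> k) (\<beta> k)) \<subseteq> {e. total_degree e = t}"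
      using pairs_series_total[of "\<alpha> k" "\<beta> k"] by (elim exE conjE) (rule that; assumption)
    from mult_total[OF this xi[of "J k"]] show ?thesis by (rule exI)
  qed
  then obtain t where t: "\<And>k. supp (pairs_series (\<alpha> k) (\<beta> k) \<odot> xi_subst_series (J k)) \<subseteq> {e. total_degree e = t k}" by metis
  show ?thesis
  proof (rule that)
    show "finite (t ` {..<n})" by simp
    fix e assume "A e \<noteq> 0"
    then obtain k where "k < n" "(pairs_series (\<alpha> k) (\<beta> k) \<odot> xi_subst_series (J k)) e \<noteq> 0"
      unfolding d by (auto elim!: sum.not_neutral_contains_not_neutral)
    then show "total_degree e \<in> t ` {..<n}" using t[of k] by (auto simp: supp_def)
  qed
qed

section \<open>Homogeneous components\<close>

lemma vector_space_complex: "vector_space ((*) :: complex \<Rightarrow> complex \<Rightarrow> complex)"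
  by unfold_locales (simp_all add: algebra_simps)

context full_vertex_algebra
begin

definition components :: "'a \<Rightarrow> real \<times> real \<Rightarrow> 'a" where
  "components v = (THE x. (\<forall>h k. x (h, k) \<in> V h k) \<and> finite {i. x i \<noteq> 0} \<and> v = (\<Sum>i | x i \<noteq> 0. x i))"

lemma components:
  "components v (h, k) \<in> V h k" "finite {i. components v i \<noteq> 0}" "v = (\<Sum>i | components v i \<noteq> 0. components v i)"
  using theI'[OF direct_sum_V[of v]] unfolding components_def by blast+

lemma components_unique:
  assumes "\<And>h k. x (h, k) \<in> V h k" "finite I" "\<And>i. i \<notin> I \<Longrightarrow> x i = 0" "v = (\<Sum>i\<in>I. x i)"
  shows "components v = x"
proof -
  have "{i. x i \<noteq> 0} \<subseteq> I" using assms(3) by blast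
  moreover from this have "v = (\<Sum>i | x i \<noteq> 0. x i)"
    unfolding assms(4) by (intro sum.mono_neutral_right) (use assms(2) in auto)
  ultimately have "(\<forall>h k. x (h, k) \<in> V h k) \<and> finite {i. x i \<noteq> 0} \<and> v = (\<Sum>i | x i \<noteq> 0. x i)"
    using assms(1,2) finite_subset by blast
  then show ?thesis unfolding components_def by (rule the1_equality[OF direct_sum_V])
qed

lemma components_add: "components (v + w) = (\<lambda>i. components v i + components w i)"
proof (rule components_unique)
  let ?I = "{i. components v i \<noteq> 0} \<union> {i. components w i \<noteq> 0}"
  show "components v (h, k) + components w (h, k) \<in> V h k" for h k
    by (rule subspace_add[OF subspace_V components(1) components(1)])
  show fin: "finite ?I" using components(2)[of v] components(2)[of w] by simp
  show "components v i + components w i = 0" if "i \<notin> ?I" for i using that by simp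
  have "v = (\<Sum>i\<in>?I. components v i)" "w = (\<Sum>i\<in>?I. components w i)"
    by (subst components(3), rule sum.mono_neutral_left[OF fin]; auto)+
  then show "v + w = (\<Sum>i\<in>?I. components v i + components w i)" by (simp add: sum.distrib)
qed

lemma components_scale: "components (scl c v) = (\<lambda>i. scl c (components v i))"
proof (rule components_unique[OF _ components(2)[of v]])
  show "scl c (components v (h, k)) \<in> V h k" for h k
    by (rule subspace_scale[OF subspace_V components(1)])
  show "scl c v = (\<Sum>i | components v i \<noteq> 0. scl c (components v i))"
    by (subst components(3)[of v]) (rule scale_sum_right)
qed simp

lemma components_homogeneous:
  assumes "v \<in> V h k"
  shows "components v = (\<lambda>i. if i = (h, k) then v else 0)"
  by (rule components_unique[where I = "{(h, k)}"]) (use assms subspace_0[OF subspace_V] in auto)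

lemma linear_eq_on_homogeneous:
  assumes f: "Vector_Spaces.linear scl (*) (f :: 'a \<Rightarrow> complex)" and g: "Vector_Spaces.linear scl (*) g"
    and eq: "\<And>h k v. v \<in> V h k \<Longrightarrow> f v = g v"
  shows "f v = g v"
proof -
  interpret f: Vector_Spaces.linear scl "(*)" f by (rule f)
  interpret g: Vector_Spaces.linear scl "(*)" g by (rule g)
  have "f v = (\<Sum>i | components v i \<noteq> 0. f (components v i))"
    by (subst components(3)[of v]) (rule f.sum)
  also have "\<dots> = (\<Sum>i | components v i \<noteq> 0. g (components v i))"
    by (rule sum.cong[OF refl]) (metis eq components(1) surj_pair)
  also have "\<dots> = g v"
    by (subst (3) components(3)[of v]) (rule g.sum[symmetric])
  finally show ?thesis .
qed

text \<open>Projecting to finitely many bidegrees first puts an arbitrary linear functional into the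
  graded dual, to which (FV5) applies.\<close>

lemma truncated_functional:
  assumes L: "Vector_Spaces.linear scl (*) L" and T: "finite T"
  obtains u where "u \<in> graded_dual scl V" "\<And>h k v. v \<in> V h k \<Longrightarrow> u v = (if (h, k) \<in> T then L v else 0)"
proof -
  interpret L: Vector_Spaces.linear scl "(*)" L by (rule L)
  define u where "u = (\<lambda>v. \<Sum>i\<in>T. L (components v i))"
  have hom: "u v = (if (h, k) \<in> T then L v else 0)" if "v \<in> V h k" for h k v
  proof -
    have "u v = (\<Sum>i\<in>T. if i = (h, k) then L v else 0)"
      unfolding u_def components_homogeneous[OF that] by (rule sum.cong) (auto simp: L.zero)
    then show ?thesis using T by (simp add: sum.delta)
  qed
  have "Vector_Spaces.linear scl (*) u"
    unfolding Vector_Spaces.linear_iff u_def components_add components_scale L.add L.scale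
    using vector_space_axioms vector_space_complex by (simp add: sum.distrib sum_distrib_left)
  moreover have "finite {(h, k). \<exists>v\<in>V h k. u v \<noteq> 0}"
    by (rule finite_subset[OF _ T]) (auto simp: hom split: if_splits)
  ultimately have "u \<in> graded_dual scl V" by (simp add: graded_dual_def)
  then show ?thesis using hom by (rule that)
qed

lemma Ycoeff_degree:
  "a \<in> V h k \<Longrightarrow> b \<in> V h' k' \<Longrightarrow> Ycoeff Y a e b \<in> V (h + h' + fst e) (k + k' + snd e)"
  using FV6[of a h k b h' k' "- fst e - 1" "- snd e - 1"] by (simp add: Ycoeff_def add.assoc)

text \<open>A coefficient of Y(a, z) with homogeneous a shifts bidegrees by a fixed amount, so
  finiteness survives. In this way operators to the left of the exchanged pair are absorbed into the
  functional.\<close>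

lemma graded_dual_comp:
  assumes u: "u \<in> graded_dual scl V" and a: "a \<in> V h k"
  shows "(\<lambda>v. u (Ycoeff Y a e v)) \<in> graded_dual scl V"
proof -
  have lin: "Vector_Spaces.linear scl (*) (\<lambda>v. u (Ycoeff Y a e v))"
    using Vector_Spaces.linear_compose[OF linear_Y_right, of "(*)" u a] u
    by (simp add: graded_dual_def Ycoeff_def comp_def)
  have fin: "finite {(h', k'). \<exists>v\<in>V h' k'. u v \<noteq> 0}" using u by (simp add: graded_dual_def)
  have "{(h', k'). \<exists>v\<in>V h' k'. u (Ycoeff Y a e v) \<noteq> 0} \<subseteq>
      (\<lambda>(h', k'). (h' - h - fst e, k' - k - snd e)) ` {(h', k'). \<exists>v\<in>V h' k'. u v \<noteq> 0}"
  proof (rule subsetI, clarify)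
    fix h' k' v assume v: "v \<in> V h' k'" "u (Ycoeff Y a e v) \<noteq> 0"
    then have "(h + h' + fst e, k + k' + snd e) \<in> {(h', k'). \<exists>v\<in>V h' k'. u v \<noteq> 0}"
      using Ycoeff_degree[OF a v(1)] by blast
    then show "(h', k') \<in> (\<lambda>(h', k'). (h' - h - fst e, k' - k - snd e)) ` {(h', k'). \<exists>v\<in>V h' k'. u v \<noteq> 0}"
      by (rule rev_image_eqI) simp
  qed
  from finite_subset[OF this finite_imageI[OF fin]] lin show ?thesis by (simp add: graded_dual_def)
qed

section \<open>Locality of the vacuum expectation values\<close>

definition vacuum_vector :: "(nat \<Rightarrow> 'a) \<Rightarrow> expo \<Rightarrow> 'a" where
  "vacuum_vector b e =
     Ycoeff Y (b 1) (e 1) (Ycoeff Y (b 2) (e 2) (Ycoeff Y (b 3) (e 3) (Ycoeff Y (b 4) (e 4) vac)))"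

lemma vacuum_vector_degree:
  fixes b :: "nat \<Rightarrow> 'a"
  assumes "\<And>i. i \<in> {1..4} \<Longrightarrow> b i \<in> V (fst (w i)) (snd (w i))"
  shows "vacuum_vector b e \<in> V (fst (total_degree w + total_degree e)) (snd (total_degree w + total_degree e))"
proof -
  have b: "b 1 \<in> V (fst (w 1)) (snd (w 1))" "b 2 \<in> V (fst (w 2)) (snd (w 2))"
    "b 3 \<in> V (fst (w 3)) (snd (w 3))" "b 4 \<in> V (fst (w 4)) (snd (w 4))" by (rule assms; simp)+
  note Ycoeff_degree[OF b(1) Ycoeff_degree[OF b(2) Ycoeff_degree[OF b(3) Ycoeff_degree[OF b(4) vac_degree]]]]
  from this[of "e 1" "e 2" "e 3" "e 4"] show ?thesis
    unfolding vacuum_vector_def total_expand by (simp add: algebra_simps)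
qed

lemma vacuum_series_eq:
  fixes b :: "nat \<Rightarrow> 'a"
  shows
  "vacuum_series Y vac B (b 1) (b 2) (b 3) (b 4) e =
     (if \<forall>k. k \<notin> {1..4} \<longrightarrow> e k = (0, 0) then B vac (vacuum_vector b e) else 0)"
  unfolding vacuum_series_def vacuum_vector_def by (rule refl)

text \<open>A single u has to serve both series, since (FV5) provides one \<mu> for both orders. The
  bidegree of the vector is the total weight plus the total degree of the exponent, and the total
  weight does not change when the vectors are permuted. So truncation at the union of the two sets
  of degrees suits both series.\<close>

lemma vacuum_functional:
  fixes b :: "nat \<Rightarrow> 'a" and \<tau> :: "nat \<Rightarrow> nat"
  assumes B: "Vector_Spaces.linear scl (*) (B vac)"
    and b: "\<And>i. i \<in> {1..4} \<Longrightarrow> b i \<in> V (fst (w i)) (snd (w i))" and tau: "\<tau> permutes {1..4}"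
    and ex: "expand_1234 \<phi> (vacuum_series Y vac B (b 1) (b 2) (b 3) (b 4))"
      "expand_1234 \<phi>' (vacuum_series Y vac B (b (\<tau> 1)) (b (\<tau> 2)) (b (\<tau> 3)) (b (\<tau> 4)))"
  obtains u where "u \<in> graded_dual scl V"
    "\<And>e. e \<in> expos {1..4} \<Longrightarrow> vacuum_series Y vac B (b 1) (b 2) (b 3) (b 4) e = u (vacuum_vector b e)"
    "\<And>e. e \<in> expos {1..4} \<Longrightarrow>
       vacuum_series Y vac B (b (\<tau> 1)) (b (\<tau> 2)) (b (\<tau> 3)) (b (\<tau> 4)) e = u (vacuum_vector (b \<circ> \<tau>) e)"
proof -
  define A where "A = vacuum_series Y vac B (b 1) (b 2) (b 3) (b 4)"
  define A' where "A' = vacuum_series Y vac B (b (\<tau> 1)) (b (\<tau> 2)) (b (\<tau> 3)) (b (\<tau> 4))"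
  obtain T where T: "finite T" "\<And>e. A e \<noteq> 0 \<Longrightarrow> total_degree e \<in> T"
    using expand_1234_total[OF ex(1)] unfolding A_def by blast
  obtain T' where T': "finite T'" "\<And>e. A' e \<noteq> 0 \<Longrightarrow> total_degree e \<in> T'"
    using expand_1234_total[OF ex(2)] unfolding A'_def by blast
  obtain u where u: "u \<in> graded_dual scl V"
    "\<And>h k v. v \<in> V h k \<Longrightarrow> u v = (if (h, k) \<in> (+) (total_degree w) ` (T \<union> T') then B vac v else 0)"
    by (rule truncated_functional[OF B, of "(+) (total_degree w) ` (T \<union> T')"]) (use T T' in auto)
  have uv: "u (vacuum_vector c e) = (if total_degree e \<in> T \<union> T' then B vac (vacuum_vector c e) else 0)"
    if "\<And>i. i \<in> {1..4} \<Longrightarrow> c i \<in> V (fst (w' i)) (snd (w' i))" "total_degree w' = total_degree w" for c w' e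
  proof -
    have "(total_degree w + total_degree e \<in> (+) (total_degree w) ` (T \<union> T')) \<longleftrightarrow> total_degree e \<in> T \<union> T'" by auto
    then show ?thesis using u(2)[OF vacuum_vector_degree[where b = c and w = w' and e = e, OF that(1)]]
      unfolding that(2) prod.collapse by (simp only:)
  qed
  have tw: "total_degree (w \<circ> \<tau>) = total_degree w"
    unfolding total_degree_def using sum.permute[OF tau, of w] by (simp add: comp_def)
  have bt: "(b \<circ> \<tau>) i \<in> V (fst ((w \<circ> \<tau>) i)) (snd ((w \<circ> \<tau>) i))" if "i \<in> {1..4}" for i
    using b[of "\<tau> i"] permutes_in_image[OF tau, of i] that by simp
  have A'eq: "A' e = (if \<forall>k. k \<notin> {1..4} \<longrightarrow> e k = (0, 0) then B vac (vacuum_vector (b \<circ> \<tau>) e) else 0)" for e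
    using vacuum_series_eq[where b = "b \<circ> \<tau>"] by (simp add: A'_def)
  have e0: "\<forall>k. k \<notin> {1..4} \<longrightarrow> e k = (0, 0)" if "e \<in> expos {1..4}" for e
    using that by (simp add: expos_def zero_prod_def)
  show ?thesis
  proof (rule that[OF u(1)], fold A_def A'_def)
    fix e assume e: "e \<in> expos {1..4}"
    have "A e = B vac (vacuum_vector b e)" using e0[OF e] unfolding A_def vacuum_series_eq by simp
    \<comment> \<open>Where the truncation makes u vanish, the coefficient of the series vanishes
      too, so the two always agree.\<close>
    moreover have "total_degree e \<in> T" if "A e \<noteq> 0" using T(2)[OF that] .
    ultimately show "A e = u (vacuum_vector b e)" using uv[where c = b and w' = w, OF b refl, of e] by auto
    have "A' e = B vac (vacuum_vector (b \<circ> \<tau>) e)" using e0[OF e] unfolding A'eq by simp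
    moreover have "total_degree e \<in> T'" if "A' e \<noteq> 0" using T'(2)[OF that] .
    ultimately show "A' e = u (vacuum_vector (b \<circ> \<tau>) e)" using uv[where c = "b \<circ> \<tau>" and w' = "w \<circ> \<tau>", OF bt tw, of e] by auto
  qed
qed

lemma emb_add_expos:
  assumes "e \<in> expos {1, 2}" "d \<in> expos W" "p \<in> {1..4}" "q \<in> {1..4}" "W \<subseteq> {1..4}"
  shows "expo_add (emb p q e) d \<in> expos {1..4}"
  by (rule expos_add; rule subsetD[OF expos_mono]) (use emb_expos[OF assms(1), of p q] assms in auto)

lemma product_series_eval:
  assumes "e \<in> expos {1, 2}"
  shows "product_series Y u 1 a 2 b c e = u (Ycoeff Y a (e 1) (Ycoeff Y b (e 2) c))"
    and "product_series Y u 2 b 1 a c e = u (Ycoeff Y b (e 2) (Ycoeff Y a (e 1) c))"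
  using assms by (auto simp: product_series_def expos_def zero_prod_def)

lemma transpositions_permute:
  "Transposition.transpose 1 2 permutes {1..4 :: nat}" "Transposition.transpose 2 3 permutes {1..4 :: nat}"
  "Transposition.transpose 3 4 permutes {1..4 :: nat}"
  by (rule permutes_swap_id; simp)+

lemma locality:
  assumes "u \<in> graded_dual scl V"
  obtains \<mu> where "\<mu> \<in> GCor2" "expand_12 \<mu> (product_series Y u 1 a 2 b c)"
    "expand_21 \<mu> (product_series Y u 2 b 1 a c)"
  using FV5[OF assms, of a b c] by blast

text \<open>For fixed exponents d the two inner operators applied to the vacuum supply the vector c
  of (FV5).\<close>

lemma homogeneous_symmetry_12:
  fixes b :: "nat \<Rightarrow> 'a"
  assumes B: "Vector_Spaces.linear scl (*) (B vac)"
    and b: "\<And>i. i \<in> {1..4} \<Longrightarrow> b i \<in> V (fst (w i)) (snd (w i))"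
    and C4: "\<phi> \<in> Cor4" "\<phi>' \<in> Cor4"
    and ex: "expand_1234 \<phi> (vacuum_series Y vac B (b 1) (b 2) (b 3) (b 4))"
      "expand_1234 \<phi>' (vacuum_series Y vac B (b 2) (b 1) (b 3) (b 4))"
  shows "\<phi> z = \<phi>' (z \<circ> Transposition.transpose 1 2)"
proof (rule symmetry_12[OF C4])
  let ?t = "Transposition.transpose 1 2 :: nat \<Rightarrow> nat"
  interpret extreme_region 1 2 "{3, 4}" sm12 by (rule extreme_12)
  have ex': "expand_1234 \<phi>' (vacuum_series Y vac B (b (?t 1)) (b (?t 2)) (b (?t 3)) (b (?t 4)))"
    using ex(2) by (simp add: Transposition.transpose_def)
  obtain h h' where h: "partial_expansion 1 2 {3, 4} sm12 \<phi> h" "partial_expansion 1 2 {3, 4} sm12 \<phi>' h'"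
    using partial_expansion_12[OF ex(1)] partial_expansion_12[OF ex(2)] by blast
  obtain u where u: "u \<in> graded_dual scl V"
    "\<And>e. e \<in> expos {1..4} \<Longrightarrow> vacuum_series Y vac B (b 1) (b 2) (b 3) (b 4) e = u (vacuum_vector b e)"
    "\<And>e. e \<in> expos {1..4} \<Longrightarrow> vacuum_series Y vac B (b (?t 1)) (b (?t 2)) (b (?t 3)) (b (?t 4)) e = u (vacuum_vector (b \<circ> ?t) e)"
    by (rule vacuum_functional[where B = B and b = b and w = w and \<tau> = ?t, OF B b transpositions_permute(1) ex(1) ex']) blast+
  note W' = W
  have W: "{1, 2} \<union> {3, 4} = {1..4 :: nat}" by auto
  have s: "supp A \<subseteq> expos ({1, 2} \<union> {3, 4})" if "expand_1234 \<psi> A" for \<psi> A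
    unfolding W using full_expansion[OF that] by blast
  show "\<exists>\<epsilon>>0. \<forall>z. norm (z 1 - test_point 1) < \<epsilon> \<and> norm (z 2 - test_point 2) < \<epsilon> \<and> sm12 \<epsilon> z \<and> prj 1 2 z \<in> Y2f \<longrightarrow>
     \<phi> z = \<phi>' (z \<circ> ?t)"
  proof (rule exchange[OF h total_expansion_12[OF ex(1)] total_expansion_12[OF ex'] s[OF ex(1)] s[OF ex'] _ test_point(1)])
    fix d :: expo assume d: "d \<in> expos {3, 4}"
    let ?c = "Ycoeff Y (b 3) (d 3) (Ycoeff Y (b 4) (d 4) vac)"
    obtain \<mu> where m: "\<mu> \<in> GCor2" "expand_12 \<mu> (product_series Y u 1 (b 1) 2 (b 2) ?c)"
      "expand_21 \<mu> (product_series Y u 2 (b 2) 1 (b 1) ?c)" by (rule locality[OF u(1)])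
    have d0: "d 1 = 0" "d 2 = 0" using d by (simp_all add: expos_def)
    have 1: "vacuum_series Y vac B (b 1) (b 2) (b 3) (b 4) (expo_add (emb 1 2 e) d) = product_series Y u 1 (b 1) 2 (b 2) ?c e"
      if e: "e \<in> expos {1, 2}" for e
      unfolding u(2)[OF emb_add_expos[OF e d pq(1,2) W']] product_series_eval[OF e] vacuum_vector_def
      by (simp add: expo_add_def emb_def d0[simplified])
    have 2: "vacuum_series Y vac B (b (?t 1)) (b (?t 2)) (b (?t 3)) (b (?t 4)) (expo_add (emb 1 2 e) d) =
        product_series Y u 2 (b 2) 1 (b 1) ?c (emb 2 1 e)"
      if e: "e \<in> expos {1, 2}" for e
    proof -
      have e': "emb 2 1 e \<in> expos {1, 2}" using emb_expos[OF e, of 2 1] by (simp add: insert_commute)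
      show ?thesis
        unfolding u(3)[OF emb_add_expos[OF e d pq(1,2) W']] product_series_eval[OF e'] vacuum_vector_def
        by (simp add: expo_add_def emb_def d0[simplified] Transposition.transpose_def)
    qed
    show "\<exists>\<mu> P P'. \<mu> \<in> GCor2 \<and> expand_12 \<mu> P \<and> expand_21 \<mu> P' \<and>
       (\<forall>e\<in>expos {1, 2}. vacuum_series Y vac B (b 1) (b 2) (b 3) (b 4) (expo_add (emb 1 2 e) d) = P e) \<and>
       (\<forall>e\<in>expos {1, 2}. vacuum_series Y vac B (b (?t 1)) (b (?t 2)) (b (?t 3)) (b (?t 4)) (expo_add (emb 1 2 e) d) = P' (emb 2 1 e))"
      by (intro exI conjI ballI; (rule m | rule 1 | rule 2); assumption?)
  qed
qed

text \<open>For fixed exponents d the two outer operators are absorbed into the functional, and the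
  vector c of (FV5) is the vacuum.\<close>

lemma homogeneous_symmetry_34:
  fixes b :: "nat \<Rightarrow> 'a"
  assumes B: "Vector_Spaces.linear scl (*) (B vac)"
    and b: "\<And>i. i \<in> {1..4} \<Longrightarrow> b i \<in> V (fst (w i)) (snd (w i))"
    and C4: "\<phi> \<in> Cor4" "\<phi>' \<in> Cor4"
    and ex: "expand_1234 \<phi> (vacuum_series Y vac B (b 1) (b 2) (b 3) (b 4))"
      "expand_1234 \<phi>' (vacuum_series Y vac B (b 1) (b 2) (b 4) (b 3))"
  shows "\<phi> z = \<phi>' (z \<circ> Transposition.transpose 3 4)"
proof (rule symmetry_34[OF C4])
  let ?t = "Transposition.transpose 3 4 :: nat \<Rightarrow> nat"
  interpret extreme_region 3 4 "{1, 2}" sm34 by (rule extreme_34)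
  have ex': "expand_1234 \<phi>' (vacuum_series Y vac B (b (?t 1)) (b (?t 2)) (b (?t 3)) (b (?t 4)))"
    using ex(2) by (simp add: Transposition.transpose_def)
  obtain h h' where h: "partial_expansion 3 4 {1, 2} sm34 \<phi> h" "partial_expansion 3 4 {1, 2} sm34 \<phi>' h'"
    using partial_expansion_34[OF ex(1)] partial_expansion_34[OF ex(2)] by blast
  obtain u where u: "u \<in> graded_dual scl V"
    "\<And>e. e \<in> expos {1..4} \<Longrightarrow> vacuum_series Y vac B (b 1) (b 2) (b 3) (b 4) e = u (vacuum_vector b e)"
    "\<And>e. e \<in> expos {1..4} \<Longrightarrow> vacuum_series Y vac B (b (?t 1)) (b (?t 2)) (b (?t 3)) (b (?t 4)) e = u (vacuum_vector (b \<circ> ?t) e)"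
    by (rule vacuum_functional[where B = B and b = b and w = w and \<tau> = ?t, OF B b transpositions_permute(3) ex(1) ex']) blast+
  note W' = W
  have W: "{3, 4} \<union> {1, 2} = {1..4 :: nat}" by auto
  have s: "supp A \<subseteq> expos ({3, 4} \<union> {1, 2})" if "expand_1234 \<psi> A" for \<psi> A
    unfolding W using full_expansion[OF that] by blast
  have b12: "b 1 \<in> V (fst (w 1)) (snd (w 1))" "b 2 \<in> V (fst (w 2)) (snd (w 2))" by (rule b; simp)+
  show "\<exists>\<epsilon>>0. \<forall>z. norm (z 3 - test_point 1) < \<epsilon> \<and> norm (z 4 - test_point 2) < \<epsilon> \<and> sm34 \<epsilon> z \<and> prj 3 4 z \<in> Y2f \<longrightarrow>
     \<phi> z = \<phi>' (z \<circ> ?t)"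
  proof (rule exchange[OF h total_expansion_34[OF ex(1)] total_expansion_34[OF ex'] s[OF ex(1)] s[OF ex'] _ test_point(1)])
    fix d :: expo assume d: "d \<in> expos {1, 2}"
    let ?u = "\<lambda>v. u (Ycoeff Y (b 1) (d 1) (Ycoeff Y (b 2) (d 2) v))"
    have u': "?u \<in> graded_dual scl V"
      by (rule graded_dual_comp[OF graded_dual_comp[OF u(1) b12(1)] b12(2)])
    obtain \<mu> where m: "\<mu> \<in> GCor2" "expand_12 \<mu> (product_series Y ?u 1 (b 3) 2 (b 4) vac)"
      "expand_21 \<mu> (product_series Y ?u 2 (b 4) 1 (b 3) vac)" by (rule locality[OF u'])
    have d0: "d 3 = 0" "d 4 = 0" using d by (simp_all add: expos_def)
    have 1: "vacuum_series Y vac B (b 1) (b 2) (b 3) (b 4) (expo_add (emb 3 4 e) d) = product_series Y ?u 1 (b 3) 2 (b 4) vac e"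
      if e: "e \<in> expos {1, 2}" for e
      unfolding u(2)[OF emb_add_expos[OF e d pq(1,2) W']] product_series_eval[OF e] vacuum_vector_def
      by (simp add: expo_add_def emb_def d0)
    have 2: "vacuum_series Y vac B (b (?t 1)) (b (?t 2)) (b (?t 3)) (b (?t 4)) (expo_add (emb 3 4 e) d) =
        product_series Y ?u 2 (b 4) 1 (b 3) vac (emb 2 1 e)"
      if e: "e \<in> expos {1, 2}" for e
    proof -
      have e': "emb 2 1 e \<in> expos {1, 2}" using emb_expos[OF e, of 2 1] by (simp add: insert_commute)
      show ?thesis
        unfolding u(3)[OF emb_add_expos[OF e d pq(1,2) W']] product_series_eval[OF e'] vacuum_vector_def
        by (simp add: expo_add_def emb_def d0 Transposition.transpose_def)
    qed
    show "\<exists>\<mu> P P'. \<mu> \<in> GCor2 \<and> expand_12 \<mu> P \<and> expand_21 \<mu> P' \<and>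
       (\<forall>e\<in>expos {1, 2}. vacuum_series Y vac B (b 1) (b 2) (b 3) (b 4) (expo_add (emb 3 4 e) d) = P e) \<and>
       (\<forall>e\<in>expos {1, 2}. vacuum_series Y vac B (b (?t 1)) (b (?t 2)) (b (?t 3)) (b (?t 4)) (expo_add (emb 3 4 e) d) = P' (emb 2 1 e))"
      by (intro exI conjI ballI; (rule m | rule 1 | rule 2); assumption?)
  qed
qed

text \<open>By linearity a nonzero coefficient needs a nonzero innermost vector, and by (FV3) the
  innermost field applied to the vacuum is a power series.\<close>

lemma vacuum_series_nat:
  assumes B: "Vector_Spaces.linear scl (*) (B vac)" and ne: "vacuum_series Y vac B a1 a2 a3 a4 e \<noteq> 0"
  shows "fst (e 4) \<in> \<nat> \<and> snd (e 4) \<in> \<nat>"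
proof -
  interpret B: Vector_Spaces.linear scl "(*)" "B vac" by (rule B)
  have z: "Ycoeff Y a e' 0 = 0" for a e'
  proof -
    interpret y: Vector_Spaces.linear scl scl "\<lambda>b. Y a (- fst e' - 1) (- snd e' - 1) b" by (rule linear_Y_right)
    show ?thesis unfolding Ycoeff_def by (rule y.zero)
  qed
  have "Ycoeff Y a4 (fst (e 4), snd (e 4)) vac \<noteq> 0"
    using ne by (auto simp: vacuum_series_def z B.zero split: if_splits)
  then show ?thesis by (rule FV3_power_series)
qed

text \<open>At z4 = 0 only the constant term of the innermost field on the vacuum survives, and by
  (FV3) this is \<open>b 4\<close>. It becomes the vector c of (FV5), while the operator of
  \<open>b 1\<close> goes into the functional.\<close>

lemma homogeneous_symmetry_23:
  fixes b :: "nat \<Rightarrow> 'a"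
  assumes B: "Vector_Spaces.linear scl (*) (B vac)"
    and b: "\<And>i. i \<in> {1..4} \<Longrightarrow> b i \<in> V (fst (w i)) (snd (w i))"
    and C4: "\<phi> \<in> Cor4" "\<phi>' \<in> Cor4"
    and ex: "expand_1234 \<phi> (vacuum_series Y vac B (b 1) (b 2) (b 3) (b 4))"
      "expand_1234 \<phi>' (vacuum_series Y vac B (b 1) (b 3) (b 2) (b 4))"
  shows "\<phi> z = \<phi>' (z \<circ> Transposition.transpose 2 3)"
proof (rule symmetry_23[OF C4])
  let ?t = "Transposition.transpose 2 3 :: nat \<Rightarrow> nat"
  interpret extreme_region 2 3 "{1}" sm23 by (rule extreme_23)
  have ex': "expand_1234 \<phi>' (vacuum_series Y vac B (b (?t 1)) (b (?t 2)) (b (?t 3)) (b (?t 4)))"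
    using ex(2) by (simp add: Transposition.transpose_def)
  obtain h h' where h: "partial_expansion 2 3 {1} sm23 \<phi> h" "partial_expansion 2 3 {1} sm23 \<phi>' h'"
    using partial_expansion_23[OF ex(1)] partial_expansion_23[OF ex(2)] by blast
  define A where "A = vacuum_series Y vac B (b 1) (b 2) (b 3) (b 4)"
  define A' where "A' = vacuum_series Y vac B (b (?t 1)) (b (?t 2)) (b (?t 3)) (b (?t 4))"
  obtain u where u: "u \<in> graded_dual scl V"
    "\<And>e. e \<in> expos {1..4} \<Longrightarrow> A e = u (vacuum_vector b e)"
    "\<And>e. e \<in> expos {1..4} \<Longrightarrow> A' e = u (vacuum_vector (b \<circ> ?t) e)"
    unfolding A_def A'_def
    by (rule vacuum_functional[where B = B and b = b and w = w and \<tau> = ?t, OF B b transpositions_permute(2) ex(1) ex']) blast+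
  have s: "supp (\<lambda>e. if e 4 = 0 then D e else 0) \<subseteq> expos ({2, 3} \<union> {1})" if "expand_1234 \<psi> D" for \<psi> D
  proof -
    have "supp D \<subseteq> expos {1..4}" using full_expansion[OF that] by blast
    then have D: "e \<in> expos {1..4}" if "D e \<noteq> 0" for e using that by (auto simp: supp_def)
    have "e \<in> expos ({2, 3} \<union> {1})" if e: "D e \<noteq> 0" "e 4 = 0" for e
    proof -
      have "e i = 0" if "i \<notin> {2, 3} \<union> {1}" for i
      proof (cases "i = 4")
        case False
        then have "i \<notin> {1..4}" using that by auto
        then show ?thesis using D[OF e(1)] by (simp add: expos_def)
      qed (simp add: e(2))
      then show ?thesis using D[OF e(1)] by (simp add: expos_def)
    qed
    then show ?thesis by (auto simp: supp_def split: if_splits)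
  qed
  have te: "total_expansion 2 3 sm23 \<phi> (\<lambda>e. if e 4 = 0 then A e else 0)"
    "total_expansion 2 3 sm23 \<phi>' (\<lambda>e. if e 4 = 0 then A' e else 0)"
    unfolding A_def A'_def
    by (rule total_expansion_23[OF ex(1) C4(1)], rule vacuum_series_nat[where B = B, OF B], assumption)
       (rule total_expansion_23[OF ex' C4(2)], rule vacuum_series_nat[where B = B, OF B], assumption)
  note W' = W
  have b1: "b 1 \<in> V (fst (w 1)) (snd (w 1))" by (rule b) simp
  show "\<exists>\<epsilon>>0. \<forall>z. norm (z 2 - test_point 1) < \<epsilon> \<and> norm (z 3 - test_point 2) < \<epsilon> \<and> sm23 \<epsilon> z \<and> prj 2 3 z \<in> Y2f \<longrightarrow>
     \<phi> z = \<phi>' (z \<circ> ?t)"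
  proof (rule exchange[OF h te s[OF ex(1)[folded A_def]] s[OF ex'[folded A'_def]] _ test_point(1)])
    fix d :: expo assume d: "d \<in> expos {1}"
    let ?u = "\<lambda>v. u (Ycoeff Y (b 1) (d 1) v)"
    obtain \<mu> where m: "\<mu> \<in> GCor2" "expand_12 \<mu> (product_series Y ?u 1 (b 2) 2 (b 3) (b 4))"
      "expand_21 \<mu> (product_series Y ?u 2 (b 3) 1 (b 2) (b 4))" by (rule locality[OF graded_dual_comp[OF u(1) b1]])
    have d0: "d 2 = 0" "d 3 = 0" "d 4 = 0" using d by (simp_all add: expos_def)
    have v4: "Ycoeff Y a 0 vac = a" for a using FV3_constant_term[of a] by (simp add: zero_prod_def)
    have 1: "(if expo_add (emb 2 3 e) d 4 = 0 then A (expo_add (emb 2 3 e) d) else 0) = product_series Y ?u 1 (b 2) 2 (b 3) (b 4) e"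
      if e: "e \<in> expos {1, 2}" for e
      unfolding u(2)[OF emb_add_expos[OF e d pq(1,2) W']] product_series_eval[OF e] vacuum_vector_def
      by (simp add: expo_add_def emb_def d0 v4)
    have 2: "(if expo_add (emb 2 3 e) d 4 = 0 then A' (expo_add (emb 2 3 e) d) else 0) =
        product_series Y ?u 2 (b 3) 1 (b 2) (b 4) (emb 2 1 e)"
      if e: "e \<in> expos {1, 2}" for e
    proof -
      have e': "emb 2 1 e \<in> expos {1, 2}" using emb_expos[OF e, of 2 1] by (simp add: insert_commute)
      show ?thesis
        unfolding u(3)[OF emb_add_expos[OF e d pq(1,2) W']] product_series_eval[OF e'] vacuum_vector_def
        by (simp add: expo_add_def emb_def d0 v4 Transposition.transpose_def)
    qed
    show "\<exists>\<mu> P P'. \<mu> \<in> GCor2 \<and> expand_12 \<mu> P \<and> expand_21 \<mu> P' \<and>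
       (\<forall>e\<in>expos {1, 2}. (if expo_add (emb 2 3 e) d 4 = 0 then A (expo_add (emb 2 3 e) d) else 0) = P e) \<and>
       (\<forall>e\<in>expos {1, 2}. (if expo_add (emb 2 3 e) d 4 = 0 then A' (expo_add (emb 2 3 e) d) else 0) = P' (emb 2 1 e))"
      by (intro exI conjI ballI; (rule m | rule 1 | rule 2); assumption?)
  qed
qed

lemma multilinear_eq_on_homogeneous:
  fixes F G :: "'a \<Rightarrow> 'a \<Rightarrow> 'a \<Rightarrow> 'a \<Rightarrow> complex"
  assumes F: "\<And>a b c. Vector_Spaces.linear scl (*) (\<lambda>v. F v a b c)" "\<And>a b c. Vector_Spaces.linear scl (*) (\<lambda>v. F a v b c)"
      "\<And>a b c. Vector_Spaces.linear scl (*) (\<lambda>v. F a b v c)" "\<And>a b c. Vector_Spaces.linear scl (*) (\<lambda>v. F a b c v)"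
    and G: "\<And>a b c. Vector_Spaces.linear scl (*) (\<lambda>v. G v a b c)" "\<And>a b c. Vector_Spaces.linear scl (*) (\<lambda>v. G a v b c)"
      "\<And>a b c. Vector_Spaces.linear scl (*) (\<lambda>v. G a b v c)" "\<And>a b c. Vector_Spaces.linear scl (*) (\<lambda>v. G a b c v)"
    and eq: "\<And>b w. (\<And>i. i \<in> {1..4 :: nat} \<Longrightarrow> b i \<in> V (fst (w i)) (snd (w i))) \<Longrightarrow> F (b 1) (b 2) (b 3) (b 4) = G (b 1) (b 2) (b 3) (b 4)"
  shows "F a1 a2 a3 a4 = G a1 a2 a3 a4"
proof -
  have 0: "F v1 v2 v3 v4 = G v1 v2 v3 v4"
    if v: "v1 \<in> V h1 k1" "v2 \<in> V h2 k2" "v3 \<in> V h3 k3" "v4 \<in> V h4 k4" for v1 v2 v3 v4 h1 k1 h2 k2 h3 k3 h4 k4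
  proof -
    let ?b = "\<lambda>i :: nat. if i = 1 then v1 else if i = 2 then v2 else if i = 3 then v3 else v4"
    let ?w = "\<lambda>i :: nat. if i = 1 then (h1, k1) else if i = 2 then (h2, k2) else if i = 3 then (h3, k3) else (h4, k4)"
    have "F (?b 1) (?b 2) (?b 3) (?b 4) = G (?b 1) (?b 2) (?b 3) (?b 4)" by (rule eq[of ?b ?w]) (use v in auto)
    then show ?thesis by simp
  qed
  have 1: "F a1 v2 v3 v4 = G a1 v2 v3 v4" if "v2 \<in> V h2 k2" "v3 \<in> V h3 k3" "v4 \<in> V h4 k4" for a1 v2 v3 v4 h2 k2 h3 k3 h4 k4
    by (rule linear_eq_on_homogeneous[OF F(1) G(1)]) (rule 0[OF _ that])
  have 2: "F a1 a2 v3 v4 = G a1 a2 v3 v4" if "v3 \<in> V h3 k3" "v4 \<in> V h4 k4" for a1 a2 v3 v4 h3 k3 h4 k4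
    by (rule linear_eq_on_homogeneous[OF F(2) G(2)]) (rule 1[OF _ that])
  have 3: "F a1 a2 a3 v4 = G a1 a2 a3 v4" if "v4 \<in> V h4 k4" for a1 a2 a3 v4 h4 k4
    by (rule linear_eq_on_homogeneous[OF F(3) G(3)]) (rule 2[OF _ that])
  show ?thesis by (rule linear_eq_on_homogeneous[OF F(4) G(4)]) (rule 3)
qed

lemma adjacent_symmetry:
  assumes B: "Vector_Spaces.linear scl (*) (B vac)" and ml: "multilinear4 scl S"
    and S: "\<And>a1 a2 a3 a4. S a1 a2 a3 a4 \<in> Cor4 \<and> expand_1234 (S a1 a2 a3 a4) (vacuum_series Y vac B a1 a2 a3 a4)"
  shows "S a1 a2 a3 a4 z = S a2 a1 a3 a4 (z \<circ> Transposition.transpose 1 2)"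
    and "S a1 a2 a3 a4 z = S a1 a3 a2 a4 (z \<circ> Transposition.transpose 2 3)"
    and "S a1 a2 a3 a4 z = S a1 a2 a4 a3 (z \<circ> Transposition.transpose 3 4)"
proof -
  have lin: "Vector_Spaces.linear scl (*) (\<lambda>v. S v a b c x)" "Vector_Spaces.linear scl (*) (\<lambda>v. S a v b c x)"
     "Vector_Spaces.linear scl (*) (\<lambda>v. S a b v c x)" "Vector_Spaces.linear scl (*) (\<lambda>v. S a b c v x)" for a b c x
    using ml unfolding multilinear4_def by blast+
  note C = S[THEN conjunct1] and E = S[THEN conjunct2]
  show "S a1 a2 a3 a4 z = S a2 a1 a3 a4 (z \<circ> Transposition.transpose 1 2)"
    by (rule multilinear_eq_on_homogeneous[where F = "\<lambda>a b c d. S a b c d z" and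
         G = "\<lambda>a b c d. S b a c d (z \<circ> Transposition.transpose 1 2)"])
       (rule lin homogeneous_symmetry_12[OF B _ C C E E]; assumption)+
  show "S a1 a2 a3 a4 z = S a1 a3 a2 a4 (z \<circ> Transposition.transpose 2 3)"
    by (rule multilinear_eq_on_homogeneous[where F = "\<lambda>a b c d. S a b c d z" and
         G = "\<lambda>a b c d. S a c b d (z \<circ> Transposition.transpose 2 3)"])
       (rule lin homogeneous_symmetry_23[OF B _ C C E E]; assumption)+
  show "S a1 a2 a3 a4 z = S a1 a2 a4 a3 (z \<circ> Transposition.transpose 3 4)"
    by (rule multilinear_eq_on_homogeneous[where F = "\<lambda>a b c d. S a b c d z" and
         G = "\<lambda>a b c d. S a b d c (z \<circ> Transposition.transpose 3 4)"])
       (rule lin homogeneous_symmetry_34[OF B _ C C E E]; assumption)+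
qed

end

section \<open>All permutations\<close>

text \<open>Vectors and points are precomposed with the same map, which makes the property closed
  under composition and free of inverses. The inverse in the group action is restored only at the
  end.\<close>

definition equivariant ::
  "('a \<Rightarrow> 'a \<Rightarrow> 'a \<Rightarrow> 'a \<Rightarrow> (nat \<Rightarrow> complex) \<Rightarrow> complex) \<Rightarrow> (nat \<Rightarrow> nat) \<Rightarrow> bool" where
  "equivariant S \<tau> \<longleftrightarrow> (\<forall>a z. S (a (\<tau> 1)) (a (\<tau> 2)) (a (\<tau> 3)) (a (\<tau> 4)) (z \<circ> \<tau>) = S (a 1) (a 2) (a 3) (a 4) z)"

lemma equivariant_comp:
  assumes "equivariant S \<tau>" "equivariant S \<rho>"
  shows "equivariant S (\<tau> \<circ> \<rho>)"
  unfolding equivariant_def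
proof (intro allI)
  fix a :: "nat \<Rightarrow> 'a" and z :: "nat \<Rightarrow> complex"
  have "S ((a \<circ> \<tau>) (\<rho> 1)) ((a \<circ> \<tau>) (\<rho> 2)) ((a \<circ> \<tau>) (\<rho> 3)) ((a \<circ> \<tau>) (\<rho> 4)) ((z \<circ> \<tau>) \<circ> \<rho>) =
      S ((a \<circ> \<tau>) 1) ((a \<circ> \<tau>) 2) ((a \<circ> \<tau>) 3) ((a \<circ> \<tau>) 4) (z \<circ> \<tau>)"
    by (rule assms(2)[unfolded equivariant_def, THEN spec, THEN spec])
  also have "\<dots> = S (a 1) (a 2) (a 3) (a 4) z"
    using assms(1)[unfolded equivariant_def, THEN spec[of _ a], THEN spec[of _ z]] by (simp add: comp_def)
  finally show "S (a ((\<tau> \<circ> \<rho>) 1)) (a ((\<tau> \<circ> \<rho>) 2)) (a ((\<tau> \<circ> \<rho>) 3)) (a ((\<tau> \<circ> \<rho>) 4)) (z \<circ> (\<tau> \<circ> \<rho>)) =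
      S (a 1) (a 2) (a 3) (a 4) z"
    by (simp add: comp_def)
qed

text \<open>Conjugating one transposition by another, t a c = t a b \<circ> t b c \<circ> t a b,
  yields the three transpositions of non-neighbouring points; the induction over permutations asks
  for all six.\<close>

lemma equivariant_permutation:
  assumes adj: "equivariant S (Transposition.transpose 1 2)" "equivariant S (Transposition.transpose 2 3)"
    "equivariant S (Transposition.transpose 3 4)" and tau: "\<tau> permutes {1..4}"
  shows "equivariant S \<tau>"
proof -
  let ?t = "Transposition.transpose :: nat \<Rightarrow> nat \<Rightarrow> nat \<Rightarrow> nat"
  have conj: "equivariant S (?t a c)" if "equivariant S (?t a b)" "equivariant S (?t b c)" "a \<noteq> b" "b \<noteq> c" "a \<noteq> c" for a b c
  proof -
    have "?t a c = ?t a b \<circ> (?t b c \<circ> ?t a b)"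
      using that(3-5) by (auto simp: fun_eq_iff Transposition.transpose_def)
    then show ?thesis using equivariant_comp[OF that(1) equivariant_comp[OF that(2,1)]] by simp
  qed
  have t13: "equivariant S (?t 1 3)" by (rule conj[OF adj(1,2)]) simp_all
  have t24: "equivariant S (?t 2 4)" by (rule conj[OF adj(2,3)]) simp_all
  have t14: "equivariant S (?t 1 4)" by (rule conj[OF t13 adj(3)]) simp_all
  have less: "equivariant S (?t a b)" if "a \<in> {1..4}" "b \<in> {1..4}" "a < b" for a b
  proof -
    have "(a, b) \<in> {(1, 2), (1, 3), (1, 4), (2, 3), (2, 4), (3, 4)}" using that by auto
    then show ?thesis using adj t13 t24 t14 by fastforce
  qed
  have all: "equivariant S (?t a b)" if "a \<in> {1..4}" "b \<in> {1..4}" "a \<noteq> b" for a b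
  proof (cases "a < b")
    case True
    then show ?thesis using less that by blast
  next
    case False
    then have "equivariant S (?t b a)" using less that by simp
    then show ?thesis by (simp only: Transposition.transpose_commute)
  qed
  show ?thesis using tau finite_atLeastAtMost
  proof (induction rule: permutes_induct)
    case id
    show ?case by (simp add: equivariant_def comp_def)
  next
    case (swap a b p)
    then show ?case using equivariant_comp all by blast
  qed
qed

theorem theorem3p1:
  fixes scl :: "complex \<Rightarrow> 'a::ab_group_add \<Rightarrow> 'a"
    and V :: "real \<Rightarrow> real \<Rightarrow> 'a set"
    and Y :: "'a \<Rightarrow> real \<Rightarrow> real \<Rightarrow> 'a \<Rightarrow> 'a"
    and vac \<omega> \<omega>b :: 'a
    and B :: "'a \<Rightarrow> 'a \<Rightarrow> complex"
    and S :: "'a \<Rightarrow> 'a \<Rightarrow> 'a \<Rightarrow> 'a \<Rightarrow> (nat \<Rightarrow> complex) \<Rightarrow> complex"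
    and a :: "nat \<Rightarrow> 'a"
    and \<sigma> :: "nat \<Rightarrow> nat"
  assumes "full_vertex_operator_algebra scl V Y vac \<omega> \<omega>b"
    and "invariant_form scl V Y \<omega> \<omega>b B" and "nondegenerate B"
    and "full_vertex_operator_algebra.QP_generated scl V Y \<omega> \<omega>b"
    and "multilinear4 scl S"
    and "\<And>a1 a2 a3 a4. S a1 a2 a3 a4 \<in> Cor4 \<and>
           expand_1234 (S a1 a2 a3 a4) (vacuum_series Y vac B a1 a2 a3 a4)"
    and "\<sigma> permutes {1..4}"
  shows "act_fun \<sigma> (S (a 1) (a 2) (a 3) (a 4)) =
         S (a (inv \<sigma> 1)) (a (inv \<sigma> 2)) (a (inv \<sigma> 3)) (a (inv \<sigma> 4))"
proof -
  interpret full_vertex_operator_algebra scl V Y vac \<omega> \<omega>b by (rule assms(1))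
  have "Vector_Spaces.linear scl (*) (B vac)" using assms(2) unfolding invariant_form_def by blast
  note adj = adjacent_symmetry[where B = B, OF this assms(5,6)]
  \<comment> \<open>Acting by \<sigma> evaluates at x \<circ> \<sigma>, and equivariance under the
    inverse of \<sigma>, applied at that point, brings the argument back to x.\<close>
  have "equivariant S (inv \<sigma>)"
  proof (rule equivariant_permutation)
    show "equivariant S (Transposition.transpose 1 2)" "equivariant S (Transposition.transpose 2 3)"
      "equivariant S (Transposition.transpose 3 4)"
      unfolding equivariant_def using adj[symmetric] by (simp_all add: Transposition.transpose_def)
    show "inv \<sigma> permutes {1..4}" by (rule permutes_inv[OF assms(7)])
  qed
  then have "S (a (inv \<sigma> 1)) (a (inv \<sigma> 2)) (a (inv \<sigma> 3)) (a (inv \<sigma> 4)) ((x \<circ> \<sigma>) \<circ> inv \<sigma>) =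
      S (a 1) (a 2) (a 3) (a 4) (x \<circ> \<sigma>)" for x
    unfolding equivariant_def by blast
  moreover have "(x \<circ> \<sigma>) \<circ> inv \<sigma> = x" "act_points (inv \<sigma>) x = x \<circ> \<sigma>" for x :: "nat \<Rightarrow> complex"
    by (simp_all only: comp_assoc permutes_inv_o(1)[OF assms(7)] comp_id)
       (simp add: act_points_def permutes_inv_inv[OF assms(7)] comp_def)
  ultimately show ?thesis unfolding act_fun_def by (intro ext) (simp only:)
qed

end
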